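(* For every $u\in\mathscr S'(\mathbb R^d)$, $$WF(u)=WF'(u)=WF_G(u).$$
   Context: Notation: $\langle z\rangle=(1+|z|^2)^{1/2}$; $\mathscr S$ and $\mathscr S'$ are the Schwartz space and the tempered distributions; $(\cdot,\cdot)$ is the action of $\mathscr S'$ on $\mathscr S$, conjugate linear in the second argument and consistent with the $L^2$ inner product. For $z=(x,\xi)\in\mathbb R^{2d}$, $\Pi(z)=M_\xi T_x$ with $T_xf(y)=f(y-x)$, $M_\xi f(y)=e^{i\langle y,\xi\rangle}f(y)$. For $\varphi\in\mathscr S(\mathbb R^d)\setminus\{0\}$ and $u\in\mathscr S'(\mathbb R^d)$, the short-time Fourier transform is $V_\varphi u(z)=(u,\Pi(z)\varphi)$, $z\in\mathbb R^{2d}$. A set is conic if it is invariant under multiplication by all positive reals. $T^*(\mathbb R^d)$ is identified with $\mathbb R^{2d}$. Shubin classes: for $m\in\mathbb R$, $G^m$ is the set of $a\in C^\infty(\mathbb R^{2d})$ such that for all $\alpha,\beta\in\mathbb N^d$ there is $C_{\alpha,\beta}>0$ with $|\partial_x^\alpha\partial_\xi^\beta a(x,\xi)|\le C_{\alpha,\beta}\langle(x,\xi)\rangle^{m-|\alpha|-|\beta|}$ for all $(x,\xi)\in\mathbb R^{2d}$. Weyl quantization: $a^w(x,D)f(x)=(2\pi)^{-d}\iint e^{i\langle x-y,\xi\rangle}a\left(\frac{x+y}{2},\xi\right)f(y)\,dy\,d\xi$, interpreted for general $a\in\mathscr S'(\mathbb R^{2d})$ through $(a^w(x,D)f,g)=(2\pi)^{-d}(a,W(g,f))$,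 $f,g\in\mathscr S(\mathbb R^d)$, where $W(g,f)(x,\xi)=\int g(x+\tau/2)\overline{f(x-\tau/2)}e^{-i\langle\tau,\xi\rangle}d\tau$. For $a\in G^m$, $a^w(x,D)$ is continuous on $\mathscr S(\mathbb R^d)$ and extends to a continuous operator on $\mathscr S'(\mathbb R^d)$ by duality: $(a^w(x,D)u,g)=(u,\overline a^{\,w}(x,D)g)$. Characteristic set: for $a\in G^m$, a point $z_0\in\mathbb R^{2d}\setminus\{0\}$ is non-characteristic for $a$ if there are $A,\varepsilon>0$ and an open conic set $\Gamma\subseteq\mathbb R^{2d}\setminus\{0\}$ containing $z_0$ with $|a(z)|\ge\varepsilon\langle z\rangle^m$ for $z\in\Gamma$, $|z|\ge A$. $\operatorname{char}(a)$ is the set of points of $\mathbb R^{2d}\setminus\{0\}$ that are not non-characteristic for $a$. Global wave front set of Hörmander, $WF(u)$: the set of all $z\in\mathbb R^{2d}\setminus\{0\}$ such that whenever $m\in\mathbb R$, $a\in G^m$ and $a^w(x,D)u\in\mathscr S$, one has $z\in\operatorname{char}(a)$. $WF'(u)$: let $\varphi\in\mathscr S(\mathbb R^d)\setminus\{0\}$; a point $z_0\in\mathbb R^{2d}\setminus\{0\}$ satisfies $z_0\notin WF'(u)$ if there is an open conic set $\Gamma\subseteq\mathbb R^{2d}\setminus\{0\}$ containing $z_0$ with $\sup_{z\in\Gamma}\langle z\rangle^N|V_\varphi u(z)|<\infty$ for all $N\ge0$. (This set does not depend on the choice of $\varphi$.) $WF_G(u)$ (Gabor wave front set): let $\varphi\in\mathscr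 S(\mathbb R^d)\setminus\{0\}$ and $\Lambda=\alpha\mathbb Z^d\times\beta\mathbb Z^d$ with $\alpha,\beta>0$ sufficiently small that $\{\Pi(\lambda)\varphi\}_{\lambda\in\Lambda}$ is a Gabor frame for $L^2(\mathbb R^d)$, i.e. there are $A,B>0$ with $A\|f\|_{L^2}^2\le\sum_{\lambda\in\Lambda}|(f,\Pi(\lambda)\varphi)|^2\le B\|f\|_{L^2}^2$ for all $f\in L^2(\mathbb R^d)$. A point $z_0\in\mathbb R^{2d}\setminus\{0\}$ satisfies $z_0\notin WF_G(u)$ if there is an open conic set $\Gamma\subseteq\mathbb R^{2d}\setminus\{0\}$ containing $z_0$ with $\sup_{\lambda\in\Lambda\cap\Gamma}\langle\lambda\rangle^N|V_\varphi u(\lambda)|<\infty$ for all $N\ge0$. (This set does not depend on the choice of such a pair $(\varphi,\Lambda)$.) *)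

theory Defs
  imports "HOL-Analysis.Analysis"
begin

definition bracket :: "'a::real_normed_vector \<Rightarrow> real" where
  "bracket z = sqrt (1 + (norm z)\<^sup>2)"

text \<open>
  A multi-index \<open>\<alpha>\<close> is represented by a list of coordinate directions (elements of \<open>Basis\<close>)
  in which the direction \<open>b\<close> occurs \<open>\<alpha>\<^sub>b\<close> times; its order \<open>|\<alpha>|\<close> is the length of the list.
  Partial derivatives of a smooth function commute, so different orderings of the list
  give the same derivative.
\<close>

fun partial_derivs :: "'a::euclidean_space list \<Rightarrow> ('a \<Rightarrow> complex) \<Rightarrow> 'a \<Rightarrow> complex" where
  "partial_derivs [] f = f"
| "partial_derivs (b # bs) f = (\<lambda>x. frechet_derivative (partial_derivs bs f) (at x) b)"

definition smooth :: "('a::euclidean_space \<Rightarrow> complex) \<Rightarrow> bool" where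
  "smooth f \<longleftrightarrow> (\<forall>bs. set bs \<subseteq> Basis \<longrightarrow> partial_derivs bs f differentiable_on UNIV)"


subsection \<open>Schwartz functions and tempered distributions\<close>

definition schwartz :: "('a::euclidean_space \<Rightarrow> complex) set" where
  "schwartz = {f. smooth f \<and>
     (\<forall>(N::nat) bs. set bs \<subseteq> Basis \<longrightarrow>
        bdd_above (range (\<lambda>x. bracket x ^ N * cmod (partial_derivs bs f x))))}"

definition schwartz_seminorm :: "nat \<Rightarrow> 'a::euclidean_space list \<Rightarrow> ('a \<Rightarrow> complex) \<Rightarrow> real" where
  "schwartz_seminorm N bs f = (SUP x. bracket x ^ N * cmod (partial_derivs bs f x))"

definition schwartz_topology :: "('a::euclidean_space \<Rightarrow> complex) topology" where
  "schwartz_topology = topology_generated_by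
     {{g \<in> schwartz. schwartz_seminorm N bs (\<lambda>x. g x - f x) < e} | N bs f e.
        set bs \<subseteq> Basis \<and> f \<in> schwartz \<and> e > 0}"

text \<open>
  A distribution \<open>u\<close> is identified with its action \<open>f \<mapsto> (u, f)\<close>, which is
  conjugate linear in the test function. Only the values on \<open>schwartz\<close> are meaningful.
\<close>

definition tempered_distribution :: "(('a::euclidean_space \<Rightarrow> complex) \<Rightarrow> complex) \<Rightarrow> bool" where
  "tempered_distribution u \<longleftrightarrow>
     (\<forall>f\<in>schwartz. \<forall>g\<in>schwartz. u (\<lambda>x. f x + g x) = u f + u g) \<and>
     (\<forall>c. \<forall>f\<in>schwartz. u (\<lambda>x. c * f x) = cnj c * u f) \<and>
     continuous_map schwartz_topology euclidean u"

definition L2_inner :: "('a::euclidean_space \<Rightarrow> complex) \<Rightarrow> ('a \<Rightarrow> complex) \<Rightarrow> complex" where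
  "L2_inner f g = (LINT x|lborel. f x * cnj (g x))"

text \<open>
  \<open>L2_inner f\<close> is thus the distribution given by a function \<open>f\<close> of at most polynomial growth,
  and the following says that the distribution \<open>v\<close> is (given by) a Schwartz function.
\<close>

definition is_schwartz :: "(('a::euclidean_space \<Rightarrow> complex) \<Rightarrow> complex) \<Rightarrow> bool" where
  "is_schwartz v \<longleftrightarrow> (\<exists>h\<in>schwartz. \<forall>g\<in>schwartz. v g = L2_inner h g)"


subsection \<open>Shubin symbols and Weyl quantization\<close>

text \<open>A list of \<open>Basis\<close> directions in the phase space \<open>'a \<times> 'a\<close> encodes the pair \<open>(\<alpha>, \<beta>)\<close>, with
  length \<open>|\<alpha>| + |\<beta>|\<close>.\<close>

definition shubin :: "real \<Rightarrow> ('a::euclidean_space \<times> 'a \<Rightarrow> complex) set" where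
  "shubin m = {a. smooth a \<and>
     (\<forall>bs. set bs \<subseteq> Basis \<longrightarrow>
        (\<exists>C>0. \<forall>z. cmod (partial_derivs bs a z) \<le> C * bracket z powr (m - real (length bs))))}"

definition wigner ::
  "('a::euclidean_space \<Rightarrow> complex) \<Rightarrow> ('a \<Rightarrow> complex) \<Rightarrow> 'a \<times> 'a \<Rightarrow> complex" where
  "wigner g f = (\<lambda>(x, \<xi>).
     LINT \<tau>|lborel. g (x + \<tau> /\<^sub>R 2) * cnj (f (x - \<tau> /\<^sub>R 2)) * exp (- \<i> * of_real (\<tau> \<bullet> \<xi>)))"

text \<open>The distribution \<open>a\<^sup>w(x,D) f\<close> for a distribution \<open>a\<close> on phase space and a Schwartz
  function \<open>f\<close>.\<close>

definition weyl_distr ::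
  "(('a::euclidean_space \<times> 'a \<Rightarrow> complex) \<Rightarrow> complex)
     \<Rightarrow> ('a \<Rightarrow> complex) \<Rightarrow> ('a \<Rightarrow> complex) \<Rightarrow> complex" where
  "weyl_distr a f = (\<lambda>g. of_real ((2 * pi) powr - real DIM('a)) * a (wigner g f))"

text \<open>For a Shubin symbol \<open>a\<close> and a Schwartz function \<open>f\<close>, the distribution \<open>a\<^sup>w(x,D) f\<close> is a
  Schwartz function; \<open>weyl\<close> is this function and \<open>weyl_ext\<close> the extension to
  tempered distributions by duality.\<close>

definition weyl ::
  "('a::euclidean_space \<times> 'a \<Rightarrow> complex) \<Rightarrow> ('a \<Rightarrow> complex) \<Rightarrow> 'a \<Rightarrow> complex" where
  "weyl a f = (THE h. h \<in> schwartz \<and> (\<forall>g\<in>schwartz. L2_inner h g = weyl_distr (L2_inner a) f g))"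

definition weyl_ext ::
  "('a::euclidean_space \<times> 'a \<Rightarrow> complex)
     \<Rightarrow> (('a \<Rightarrow> complex) \<Rightarrow> complex) \<Rightarrow> ('a \<Rightarrow> complex) \<Rightarrow> complex" where
  "weyl_ext a u = (\<lambda>g. u (weyl (\<lambda>z. cnj (a z)) g))"


subsection \<open>The three wave front sets\<close>

text \<open>The predicate \<open>conic\<close> of the library also allows the factor \<open>0\<close>, so that it cannot be used
  for subsets of the complement of the origin.\<close>

definition open_cone :: "'a::real_normed_vector set \<Rightarrow> bool" where
  "open_cone \<Gamma> \<longleftrightarrow> open \<Gamma> \<and> 0 \<notin> \<Gamma> \<and> (\<forall>z\<in>\<Gamma>. \<forall>t>0. t *\<^sub>R z \<in> \<Gamma>)"

definition noncharacteristic ::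
  "real \<Rightarrow> ('a::euclidean_space \<times> 'a \<Rightarrow> complex) \<Rightarrow> 'a \<times> 'a \<Rightarrow> bool" where
  "noncharacteristic m a z0 \<longleftrightarrow>
     (\<exists>A>0. \<exists>\<epsilon>>0. \<exists>\<Gamma>. open_cone \<Gamma> \<and> z0 \<in> \<Gamma> \<and>
        (\<forall>z\<in>\<Gamma>. norm z \<ge> A \<longrightarrow> cmod (a z) \<ge> \<epsilon> * bracket z powr m))"

definition char_set :: "real \<Rightarrow> ('a::euclidean_space \<times> 'a \<Rightarrow> complex) \<Rightarrow> ('a \<times> 'a) set" where
  "char_set m a = {z. z \<noteq> 0 \<and> \<not> noncharacteristic m a z}"

definition WF :: "(('a::euclidean_space \<Rightarrow> complex) \<Rightarrow> complex) \<Rightarrow> ('a \<times> 'a) set" where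
  "WF u = {z. z \<noteq> 0 \<and>
     (\<forall>m. \<forall>a\<in>shubin m. is_schwartz (weyl_ext a u) \<longrightarrow> z \<in> char_set m a)}"

definition tf_shift ::
  "'a::euclidean_space \<times> 'a \<Rightarrow> ('a \<Rightarrow> complex) \<Rightarrow> 'a \<Rightarrow> complex" where
  "tf_shift = (\<lambda>(x, \<xi>) f y. exp (\<i> * of_real (y \<bullet> \<xi>)) * f (y - x))"

definition stft ::
  "('a::euclidean_space \<Rightarrow> complex) \<Rightarrow> (('a \<Rightarrow> complex) \<Rightarrow> complex) \<Rightarrow> 'a \<times> 'a \<Rightarrow> complex" where
  "stft \<phi> u z = u (tf_shift z \<phi>)"

definition WF' ::
  "('a::euclidean_space \<Rightarrow> complex) \<Rightarrow> (('a \<Rightarrow> complex) \<Rightarrow> complex) \<Rightarrow> ('a \<times> 'a) set" where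
  "WF' \<phi> u = {z0. z0 \<noteq> 0 \<and>
     \<not> (\<exists>\<Gamma>. open_cone \<Gamma> \<and> z0 \<in> \<Gamma> \<and>
          (\<forall>N\<ge>0::real. bdd_above ((\<lambda>z. bracket z powr N * cmod (stft \<phi> u z)) ` \<Gamma>)))}"

definition tf_lattice :: "real \<Rightarrow> real \<Rightarrow> ('a::euclidean_space \<times> 'a) set" where
  "tf_lattice \<alpha> \<beta> = {(\<alpha> *\<^sub>R j, \<beta> *\<^sub>R k) | j k. \<forall>b\<in>Basis. j \<bullet> b \<in> \<int> \<and> k \<bullet> b \<in> \<int>}"

definition gabor_frame ::
  "('a::euclidean_space \<Rightarrow> complex) \<Rightarrow> ('a \<times> 'a) set \<Rightarrow> bool" where
  "gabor_frame \<phi> \<Lambda> \<longleftrightarrow>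
     (\<exists>A>0. \<exists>B>0. \<forall>f. f \<in> borel_measurable lborel \<and> integrable lborel (\<lambda>x. (cmod (f x))\<^sup>2) \<longrightarrow>
        (\<lambda>l. (cmod (L2_inner f (tf_shift l \<phi>)))\<^sup>2) summable_on \<Lambda> \<and>
        A * (LINT x|lborel. (cmod (f x))\<^sup>2)
          \<le> (\<Sum>\<^sub>\<infinity>l\<in>\<Lambda>. (cmod (L2_inner f (tf_shift l \<phi>)))\<^sup>2) \<and>
        (\<Sum>\<^sub>\<infinity>l\<in>\<Lambda>. (cmod (L2_inner f (tf_shift l \<phi>)))\<^sup>2)
          \<le> B * (LINT x|lborel. (cmod (f x))\<^sup>2))"

definition WF_G ::
  "('a::euclidean_space \<Rightarrow> complex) \<Rightarrow> ('a \<times> 'a) set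
     \<Rightarrow> (('a \<Rightarrow> complex) \<Rightarrow> complex) \<Rightarrow> ('a \<times> 'a) set" where
  "WF_G \<phi> \<Lambda> u = {z0. z0 \<noteq> 0 \<and>
     \<not> (\<exists>\<Gamma>. open_cone \<Gamma> \<and> z0 \<in> \<Gamma> \<and>
          (\<forall>N\<ge>0::real. bdd_above ((\<lambda>l. bracket l powr N * cmod (stft \<phi> u l)) ` (\<Lambda> \<inter> \<Gamma>))))}"

end

theory Submission
  imports Defs "HOL-Probability.Characteristic_Functions" "HOL-Probability.Sinc_Integral"
begin

text \<open>
  With \<open>V = stft \<phi> u\<close> and \<open>\<Pi>(z)\<phi> = tf_shift z \<phi>\<close>, everything is read off from the reproducing formula
  \<open>u = c \<integral> V(z) \<Pi>(z)\<phi> dz\<close>, \<open>c = (2\<pi>)\<^sup>-\<^sup>d \<parallel>\<phi>\<parallel>\<^sup>-\<^sup>2\<close>. It turns \<open>a\<^sup>w(x,D)\<close> into an integral operator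
  on phase space. Integration by parts in the Wigner distribution shows that, for a symbol \<open>a\<close> of order \<open>m\<close>,
  the kernel \<open>(a\<^sup>w \<Pi>(w)\<phi>, \<Pi>(z)\<phi>)\<close> is \<open>O(\<langle>w\<rangle>\<^sup>m \<langle>z - w\<rangle>\<^sup>-\<^sup>N)\<close> for every \<open>N\<close> and differs from
  \<open>a(w) (\<Pi>(w)\<phi>, \<Pi>(z)\<phi>)\<close> by a kernel of the same type with \<open>m - 1\<close> in place of \<open>m\<close>.

  If \<open>V\<close> decays rapidly in an open cone around \<open>z\<^sub>0\<close>, then a conic cutoff \<open>a\<close> of order \<open>0\<close> supported there
  maps \<open>u\<close> to a Schwartz function, so \<open>z\<^sub>0 \<notin> WF u\<close>. Conversely, let \<open>a\<^sup>w u\<close> be a Schwartz function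
  with \<open>a\<close> elliptic in a cone. There \<open>V\<close> is rapidly decreasing up to a term of relative order \<open>-1\<close>, and in the
  supremum of \<open>\<langle>w - w\<^sub>0\<rangle>\<^sup>-\<^sup>L |V(w)|\<close> this term is absorbed; hence \<open>V(w\<^sub>0)\<close> decays rapidly as \<open>w\<^sub>0\<close> moves in a
  smaller cone.

  For the Gabor wave front set, the frame inequality is applied to the synthesis of \<open>V\<close> damped by
  \<open>(1 + |z - w\<^sub>0|/R)\<^sup>-\<^sup>n\<close>. The commutators of this weight with analysis and synthesis are \<open>O(1/R)\<close>, so for large
  \<open>R\<close> they are absorbed, and the \<open>L\<^sup>2\<close> norm of the damped \<open>V\<close> is bounded by its values on the lattice.
\<close>

text \<open>Two obstacles shape the estimates. First, the kernel of a conic cutoff is not confined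
  to the cone: the support of the symbol restricts only the variable of the Wigner distribution,
  which sits near the midpoint of \<open>w\<close> and \<open>z\<close>. This yields decay in
  \<open>w\<close> at the price of growth in \<open>z - w\<close>; integration by parts yields decay
  in \<open>z - w\<close> without decay in \<open>w\<close>; the geometric mean of the two bounds
  decays in both. Second, a term may be absorbed into a supremum or a norm only if that quantity is
  known to be finite. This is where the polynomial growth of the transform enters. A growth of order
  \<open>P\<close> is beaten by a weight of order \<open>N + P\<close> around \<open>w0\<close>, and
  by the damping, which also makes the synthesis an L2 function, so that the frame inequality can be
  applied although \<open>u\<close> is only a distribution. Relative order -1 is worth a factor 1/2
  far from the origin. Decay is transported between points by Peetre's inequality, whose losses are
  weights in \<open>z - w\<close>; they are affordable because every kernel decays faster off the
  diagonal, and outside a slightly larger cone \<open>z - w\<close> dominates both points.\<close>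

section \<open>Brackets and Peetre's inequality\<close>

lemma bracket_ge_1: "1 \<le> bracket z"
  by (simp add: bracket_def)

lemma bracket_pos [simp]: "0 < bracket z"
  using bracket_ge_1[of z] by linarith

lemma bracket_nonneg [simp]: "0 \<le> bracket z"
  using bracket_pos[of z] by linarith

lemma bracket_neq_0 [simp]: "bracket z \<noteq> 0"
  using bracket_pos[of z] by linarith

lemma norm_le_bracket: "norm z \<le> bracket z"
  by (simp add: bracket_def real_le_rsqrt)

lemma bracket_le_one_plus_norm: "bracket z \<le> 1 + norm z"
  unfolding bracket_def by (rule real_le_lsqrt) (auto simp: power2_eq_square algebra_simps)

lemma bracket_minus [simp]: "bracket (- z) = bracket z"
  by (simp add: bracket_def)

lemma bracket_diff_commute: "bracket (z - w) = bracket (w - z)"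
  by (simp add: bracket_def norm_minus_commute)

lemma bracket_mono: "norm x \<le> norm y \<Longrightarrow> bracket x \<le> bracket y"
  by (simp add: bracket_def power_mono)

lemma continuous_on_bracket [continuous_intros]:
  "continuous_on S f \<Longrightarrow> continuous_on S (\<lambda>x. bracket (f x))"
  unfolding bracket_def by (intro continuous_intros)

lemma measurable_bracket [measurable]: "bracket \<in> borel_measurable borel"
  by (intro borel_measurable_continuous_onI continuous_intros)

lemma bracket_add_le: "bracket (x + y) \<le> 2 * bracket x * bracket y"
proof -
  have "(bracket (x + y))\<^sup>2 \<le> 1 + (norm x + norm y)\<^sup>2"
    unfolding bracket_def by (simp add: norm_triangle_ineq power_mono)
  also have "\<dots> \<le> 4 * ((1 + (norm x)\<^sup>2) * (1 + (norm y)\<^sup>2))"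
  proof -
    \<comment> \<open>The last parenthesis is 3 plus a sum of squares, so dropping it leaves the
      desired inequality.\<close>
    have "4 * ((1 + a\<^sup>2) * (1 + b\<^sup>2))
        = 1 + (a + b)\<^sup>2 + (3 + 2 * a\<^sup>2 + 2 * b\<^sup>2 + (a - b)\<^sup>2 + 4 * (a * b)\<^sup>2)" for a b :: real
      by (simp add: power2_eq_square algebra_simps)
    then show ?thesis by simp
  qed
  also have "\<dots> = (2 * bracket x * bracket y)\<^sup>2"
    unfolding bracket_def by (simp add: power_mult_distrib)
  finally show ?thesis
    by (rule power2_le_imp_le) simp
qed

abbreviation wt :: "real \<Rightarrow> 'a::real_normed_vector \<Rightarrow> real" where
  "wt s z \<equiv> bracket z powr s"

lemma wt_mono: "s \<le> t \<Longrightarrow> wt s z \<le> wt t z"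
  by (simp add: powr_mono bracket_ge_1)

lemma wt_nat: "wt (real n) z = bracket z ^ n"
  by (simp add: powr_realpow)

lemma wt_ge_1: "0 \<le> s \<Longrightarrow> 1 \<le> wt s z"
  using wt_mono[of 0 s z] by simp

lemma wt_le_1: "s \<le> 0 \<Longrightarrow> wt s z \<le> 1"
  using wt_mono[of s 0 z] by simp

lemma norm_mult_wt_le: "norm z * wt s z \<le> wt (s + 1) z"
  using mult_right_mono[OF norm_le_bracket, of "wt s z" z] by (simp add: powr_add mult.commute)

text \<open>Peetre's inequality, the only means below of moving a weight from one point to another.
  The exponent of the second factor is \<bar>s\<bar> because for negative \<open>s\<close> the bound
  is inverted.\<close>

lemma wt_add_le: "wt s (x + y) \<le> 2 powr \<bar>s\<bar> * wt s x * wt \<bar>s\<bar> y"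
proof (cases "0 \<le> s")
  case True
  have "wt s (x + y) \<le> (2 * bracket x * bracket y) powr s"
    using True bracket_add_le[of x y] by (intro powr_mono2) auto
  then show ?thesis using True by (simp add: powr_mult)
next
  case False
  \<comment> \<open>Here \<open>x\<close> is regarded as \<open>(x + y) - y\<close>. Multiplying by
    \<open>wt s x * wt s (x + y)\<close> afterwards cancels both weights of opposite
    exponent.\<close>
  have "bracket x \<le> 2 * bracket (x + y) * bracket y"
    using bracket_add_le[of "x + y" "- y"] by simp
  then have "wt (-s) x \<le> (2 * bracket (x + y) * bracket y) powr (-s)"
    using False by (intro powr_mono2) auto
  then have "(wt s x * wt s (x + y)) * wt (-s) x
      \<le> (wt s x * wt s (x + y)) * (2 powr (-s) * wt (-s) (x + y) * wt (-s) y)"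
    by (intro mult_left_mono) (auto simp: powr_mult)
  also have "\<dots> = (2 powr (-s) * wt s x * wt (-s) y) * (wt s (x + y) * wt (-s) (x + y))"
    by (simp only: mult_ac)
  also have "wt s (x + y) * wt (-s) (x + y) = 1"
    by (simp flip: powr_add)
  also have "(wt s x * wt s (x + y)) * wt (-s) x = wt s (x + y) * (wt s x * wt (-s) x)"
    by (simp only: mult_ac)
  also have "wt s x * wt (-s) x = 1"
    by (simp flip: powr_add)
  finally show ?thesis using False by simp
qed

lemma wt_diff_le: "wt s x \<le> 2 powr \<bar>s\<bar> * wt s y * wt \<bar>s\<bar> (x - y)"
  using wt_add_le[of y "x - y" s] by simp

section \<open>Lebesgue integration on Euclidean spaces\<close>

lemma integrable_inverse_one_plus_square:
  "integrable lborel (\<lambda>x::real. 1 / (1 + x\<^sup>2))"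
  using integrable_inverse_1_plus_square
  by (simp add: set_integrable_def inverse_eq_divide)

lemma lborel_prod_integral:
  fixes f :: "'a::euclidean_space \<Rightarrow> real \<Rightarrow> complex"
  assumes "\<And>b. b \<in> Basis \<Longrightarrow> integrable lborel (f b)"
  shows "integrable lborel (\<lambda>x. \<Prod>b\<in>Basis. f b (x \<bullet> b))"
    and "(LINT x|lborel. (\<Prod>b\<in>Basis. f b (x \<bullet> b))) = (\<Prod>b\<in>Basis. LINT t|lborel. f b t)"
proof -
  interpret product_sigma_finite "\<lambda>b::'a. lborel :: real measure" ..
  define T :: "('a \<Rightarrow> real) \<Rightarrow> 'a" where "T = (\<lambda>f. \<Sum>b\<in>Basis. f b *\<^sub>R b)"
  have T [measurable]: "T \<in> measurable (\<Pi>\<^sub>M b\<in>Basis. lborel) borel"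
    unfolding T_def by measurable
  have [measurable]: "\<And>b. b \<in> Basis \<Longrightarrow> f b \<in> borel_measurable borel"
    using assms by (simp add: borel_measurable_integrable)
  have M [measurable]: "(\<lambda>x. \<Prod>b\<in>Basis. f b (x \<bullet> b)) \<in> borel_measurable borel"
    by (intro borel_measurable_prod) (auto intro!: measurable_compose[of _ _ borel])
  have TB: "T g \<bullet> b = g b" if "b \<in> Basis" for g b
    using that by (simp add: T_def)
  have eq: "(\<Prod>b\<in>Basis. f b (T g \<bullet> b)) = (\<Prod>b\<in>Basis. f b (g b))" for g
    by (intro prod.cong) (auto simp: TB)
  have L: "lborel = distr (\<Pi>\<^sub>M b\<in>Basis. lborel) borel T"
    unfolding T_def by (rule lborel_eq)
  show "integrable lborel (\<lambda>x. \<Prod>b\<in>Basis. f b (x \<bullet> b))"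
    unfolding L by (subst integrable_distr_eq[OF T]) 
      (use assms in \<open>auto simp: eq intro!: product_integrable_prod\<close>)
  show "(LINT x|lborel. (\<Prod>b\<in>Basis. f b (x \<bullet> b))) = (\<Prod>b\<in>Basis. LINT t|lborel. f b t)"
    unfolding L using assms
    by (subst integral_distr[OF T M]) (auto simp: eq intro!: product_integral_prod)
qed

text \<open>Comparison with a product of one-dimensional functions 1 / (1 + t^2): each of its
  factors is at least the inverse square of the bracket, which explains the threshold of twice the
  dimension.\<close>

lemma integrable_wt:
  assumes "2 * real DIM('a) \<le> s"
  shows "integrable lborel (\<lambda>z::'a::euclidean_space. wt (- s) z)"
proof (rule Bochner_Integration.integrable_bound)
  have "integrable lborel (\<lambda>t::real. complex_of_real (1 / (1 + t\<^sup>2)))"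
    using integrable_inverse_one_plus_square by (rule integrable_of_real)
  then show "integrable lborel (\<lambda>x::'a. \<Prod>b\<in>Basis. complex_of_real (1 / (1 + (x \<bullet> b)\<^sup>2)))"
    by (intro lborel_prod_integral)
  have "wt (- s) x \<le> (\<Prod>b\<in>Basis. 1 / (1 + (x \<bullet> b)\<^sup>2))" for x :: 'a
  proof -
    have "(1 + (x \<bullet> b)\<^sup>2) \<le> (bracket x)\<^sup>2" if "b \<in> Basis" for b
    proof -
      have "\<bar>x \<bullet> b\<bar> \<le> norm x"
        using Basis_le_norm[OF that] .
      then have "(x \<bullet> b)\<^sup>2 \<le> (norm x)\<^sup>2"
        by (rule abs_le_square_iff[THEN iffD1, of "x \<bullet> b" "norm x", simplified])
      then show ?thesis by (simp add: bracket_def)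
    qed
    then have "(\<Prod>b\<in>(Basis::'a set). 1 / (bracket x)\<^sup>2) \<le> (\<Prod>b\<in>Basis. 1 / (1 + (x \<bullet> b)\<^sup>2))"
      by - (rule prod_mono, auto intro!: divide_left_mono mult_pos_pos simp: add_pos_nonneg)
    moreover have "(\<Prod>b\<in>(Basis::'a set). 1 / (bracket x)\<^sup>2) = wt (- (2 * real DIM('a))) x"
    proof -
      have "wt (real (2 * DIM('a))) x = ((bracket x)\<^sup>2) ^ DIM('a)"
        by (simp only: wt_nat power_mult)
      then show ?thesis
        by (simp add: powr_minus power_one_over inverse_eq_divide)
    qed
    moreover have "wt (- s) x \<le> wt (- (2 * real DIM('a))) x"
      using assms by (intro wt_mono) simp
    ultimately show ?thesis by linarith
  qed
  then show "AE x in lborel. norm (wt (- s) x)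
      \<le> norm (\<Prod>b\<in>(Basis::'a set). complex_of_real (1 / (1 + (x \<bullet> b)\<^sup>2)))"
    by (simp only: prod_norm[symmetric] norm_of_real) (simp add: abs_of_nonneg)
qed measurable

lemma integrable_wt_bound:
  fixes F :: "'a::euclidean_space \<Rightarrow> 'b::{banach, second_countable_topology}"
  assumes "F \<in> borel_measurable borel" and "\<And>x. norm (F x) \<le> C * wt (- s) x"
    and "2 * real DIM('a) \<le> s"
  shows "integrable lborel F"
proof (rule Bochner_Integration.integrable_bound)
  show "integrable lborel (\<lambda>x::'a. C * wt (- s) x)"
    using integrable_wt[OF assms(3)] by simp
qed (use assms in \<open>auto intro: order_trans[OF assms(2)] abs_ge_self\<close>)

text \<open>The equation of the integrals is unconditional: integrability passes through the
  translation in both directions, and both sides are 0 by convention when it fails.\<close>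

lemma lborel_translate:
  fixes f :: "'a::euclidean_space \<Rightarrow> 'b::{banach, second_countable_topology}"
  shows "integrable lborel (\<lambda>x. f (x + c)) \<longleftrightarrow> integrable lborel f"
    and "(LINT x|lborel. f (x + c)) = (LINT x|lborel. f x)"
proof -
  have *: "integrable lborel (\<lambda>x. f (c + x))" if "integrable lborel f"
      for c and f :: "'a \<Rightarrow> 'b"
  proof -
    have "integrable (distr lborel borel ((+) c)) f"
      using that by (simp add: lborel_distr_plus)
    then show ?thesis
      by (subst (asm) integrable_distr_eq) (use that in auto)
  qed
  have "integrable lborel f" if "integrable lborel (\<lambda>x. f (c + x))"
    using *[OF that, of "- c"] by simp
  with *[of f c] show i: "integrable lborel (\<lambda>x. f (x + c)) \<longleftrightarrow> integrable lborel f"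
    unfolding add.commute[of _ c] by blast
  show "(LINT x|lborel. f (x + c)) = (LINT x|lborel. f x)"
  proof (cases "integrable lborel f")
    case True
    then have "(LINT x|distr lborel borel ((+) c). f x) = (LINT x|lborel. f (c + x))"
      by (subst integral_distr) auto
    then show ?thesis by (simp add: lborel_distr_plus add.commute)
  next
    case False
    then show ?thesis using i by (simp add: not_integrable_integral_eq)
  qed
qed

lemma lborel_scale:
  fixes f :: "'a::euclidean_space \<Rightarrow> 'b::{banach, second_countable_topology}"
  assumes "c \<noteq> 0"
  shows "integrable lborel (\<lambda>x. f (c *\<^sub>R x)) \<longleftrightarrow> integrable lborel f"
    and "\<bar>c\<bar> ^ DIM('a) *\<^sub>R (LINT x|lborel. f (c *\<^sub>R x)) = (LINT x|lborel. f x)"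
proof -
  have L: "lborel = density (distr lborel borel (\<lambda>x::'a. 0 + c *\<^sub>R x)) (\<lambda>_. ennreal (\<bar>c\<bar>^DIM('a)))"
    if "c \<noteq> 0" for c :: real
    using lborel_affine[OF that, of "0::'a"] by (simp add: ennreal_power)
  have *: "integrable lborel (\<lambda>x. f (c *\<^sub>R x))" if "integrable lborel f" "c \<noteq> 0"
      for c and f :: "'a \<Rightarrow> 'b"
  proof -
    have "integrable (density (distr lborel borel (\<lambda>x. 0 + c *\<^sub>R x)) (\<lambda>_. ennreal (\<bar>c\<bar>^DIM('a)))) f"
      using that L[OF that(2)] by simp
    then have "integrable lborel (\<lambda>x. \<bar>c\<bar>^DIM('a) *\<^sub>R f (c *\<^sub>R x))"
      using that by (subst (asm) integrable_density) (auto simp: integrable_distr_eq)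
    then have "integrable lborel (\<lambda>x. (1 / \<bar>c\<bar>^DIM('a)) *\<^sub>R (\<bar>c\<bar>^DIM('a) *\<^sub>R f (c *\<^sub>R x)))"
      by - (rule integrable_scaleR_right)
    moreover have "(\<lambda>x. (1 / \<bar>c\<bar>^DIM('a)) *\<^sub>R (\<bar>c\<bar>^DIM('a) *\<^sub>R f (c *\<^sub>R x))) = (\<lambda>x. f (c *\<^sub>R x))"
      using that by simp
    ultimately show ?thesis by (simp only:)
  qed
  have "integrable lborel f" if "integrable lborel (\<lambda>x. f (c *\<^sub>R x))"
    using *[OF that, of "inverse c"] assms by simp
  with * assms show i: "integrable lborel (\<lambda>x. f (c *\<^sub>R x)) \<longleftrightarrow> integrable lborel f"
    by blast
  show "\<bar>c\<bar> ^ DIM('a) *\<^sub>R (LINT x|lborel. f (c *\<^sub>R x)) = (LINT x|lborel. f x)"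
  proof (cases "integrable lborel f")
    case True
    have "(LINT x|lborel. f x)
        = (LINT x|density (distr lborel borel (\<lambda>x. 0 + c *\<^sub>R x)) (\<lambda>_. ennreal (\<bar>c\<bar>^DIM('a))). f x)"
      using L[OF assms] by simp
    also have "\<dots> = (LINT x|distr lborel borel (\<lambda>x. 0 + c *\<^sub>R x). \<bar>c\<bar>^DIM('a) *\<^sub>R f x)"
      using True by (intro integral_density) auto
    also have "\<dots> = (LINT x|lborel. \<bar>c\<bar>^DIM('a) *\<^sub>R f (0 + c *\<^sub>R x))"
      using True by (intro integral_distr) auto
    finally show ?thesis by simp
  next
    case False
    then show ?thesis using i by (simp add: not_integrable_integral_eq)
  qed
qed

lemma lborel_reflect:
  fixes f :: "'a::euclidean_space \<Rightarrow> 'b::{banach, second_countable_topology}"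
  shows "integrable lborel (\<lambda>x. f (c - x)) \<longleftrightarrow> integrable lborel f"
    and "(LINT x|lborel. f (c - x)) = (LINT x|lborel. f x)"
proof -
  have "integrable lborel (\<lambda>x. f (c - x)) \<longleftrightarrow> integrable lborel (\<lambda>x. f (c + x))"
    using lborel_scale(1)[of "-1" "\<lambda>x. f (c + x)"] by simp
  then show "integrable lborel (\<lambda>x. f (c - x)) \<longleftrightarrow> integrable lborel f"
    using lborel_translate(1)[of f c] by (simp add: add.commute)
  have "(LINT x|lborel. f (c - x)) = (LINT x|lborel. f (c + x))"
    using lborel_scale(2)[of "-1" "\<lambda>x. f (c + x)"] by simp
  then show "(LINT x|lborel. f (c - x)) = (LINT x|lborel. f x)"
    using lborel_translate(2)[of f c] by (simp add: add.commute)
qed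

text \<open>Limits within a set are tested along sequences, for which dominated convergence is
  available. The domination is asked only on \<open>S\<close>, so a neighbourhood of the limit point
  can be prescribed through \<open>S\<close>.\<close>

lemma dominated_tendsto_at:
  fixes f :: "'a::first_countable_topology \<Rightarrow> 'b \<Rightarrow> 'c::{banach, second_countable_topology}"
  assumes "\<And>x. x \<in> S \<Longrightarrow> f x \<in> borel_measurable M" and "g \<in> borel_measurable M"
    and w: "integrable M w" and b: "\<And>x y. x \<in> S \<Longrightarrow> y \<in> space M \<Longrightarrow> norm (f x y) \<le> w y"
    and l: "\<And>y. y \<in> space M \<Longrightarrow> ((\<lambda>x. f x y) \<longlongrightarrow> g y) (at a within S)"
  shows "((\<lambda>x. integral\<^sup>L M (f x)) \<longlongrightarrow> integral\<^sup>L M g) (at a within S)"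
  unfolding tendsto_at_iff_sequentially
proof (intro allI impI, unfold o_def)
  fix X :: "nat \<Rightarrow> 'a"
  assume X: "\<forall>i. X i \<in> S - {a}" "X \<longlonglongrightarrow> a"
  show "(\<lambda>i. integral\<^sup>L M (f (X i))) \<longlonglongrightarrow> integral\<^sup>L M g"
  proof (rule integral_dominated_convergence[OF assms(2) _ w])
    show "f (X i) \<in> borel_measurable M" for i
      using X(1) assms(1) by blast
    show "AE y in M. norm (f (X i) y) \<le> w y" for i
      using X(1) b by (intro AE_I2) blast
    show "AE y in M. (\<lambda>i. f (X i) y) \<longlonglongrightarrow> g y"
      using l X unfolding tendsto_at_iff_sequentially o_def by (intro AE_I2) blast
  qed
qed

text \<open>Differentiation under the integral sign. By the mean value inequality the remainder
  quotient is at most \<open>2 * w\<close>, and dominated convergence applies. The derivative at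
  \<open>x0\<close> has its own name \<open>G'\<close> because integrability is asked at this point
  alone.\<close>

lemma has_derivative_lebesgue_integral:
  fixes G :: "'a::euclidean_space \<Rightarrow> 'b \<Rightarrow> complex"
  assumes G: "\<And>x. integrable M (G x)"
    and G': "\<And>h. integrable M (\<lambda>y. G' h y)"
    and d: "\<And>x y. y \<in> space M \<Longrightarrow> ((\<lambda>x. G x y) has_derivative (\<lambda>h. D x h y)) (at x)"
    and D0: "\<And>h y. D x0 h y = G' h y"
    and w: "integrable M w"
    and b: "\<And>x h y. y \<in> space M \<Longrightarrow> cmod (D x h y) \<le> w y * norm h"
  shows "((\<lambda>x. LINT y|M. G x y) has_derivative (\<lambda>h. LINT y|M. G' h y)) (at x0)"
proof -
  have lin: "linear (\<lambda>h. D x0 h y)" if "y \<in> space M" for y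
    using d[OF that] has_derivative_linear by blast
  have "linear (\<lambda>h. LINT y|M. G' h y)"
  proof (rule linearI)
    have "(LINT y|M. G' (h + k) y) = (LINT y|M. G' h y + G' k y)" for h k
      by (intro Bochner_Integration.integral_cong) (auto simp flip: D0 simp: linear_add[OF lin])
    then show "(LINT y|M. G' (h + k) y) = (LINT y|M. G' h y) + (LINT y|M. G' k y)" for h k
      using G' by simp
    have "(LINT y|M. G' (r *\<^sub>R h) y) = (LINT y|M. r *\<^sub>R G' h y)" for r h
      by (intro Bochner_Integration.integral_cong) (auto simp flip: D0 simp: linear_scale[OF lin])
    then show "(LINT y|M. G' (r *\<^sub>R h) y) = r *\<^sub>R (LINT y|M. G' h y)" for r h
      by simp
  qed
  then have bl: "bounded_linear (\<lambda>h. LINT y|M. G' h y)"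
    by (simp add: linear_conv_bounded_linear)
  let ?q = "\<lambda>x y. (1 / norm (x - x0)) *\<^sub>R (G x y - (G x0 y + D x0 (x - x0) y))"
  have "((\<lambda>x. LINT y|M. ?q x y) \<longlongrightarrow> (LINT y|M. 0)) (at x0 within UNIV)"
  proof (rule dominated_tendsto_at[where w = "\<lambda>y. 2 * w y"])
    show "integrable M (\<lambda>y. 2 * w y)" using w by simp
    show "?q x \<in> borel_measurable M" for x
      using G[of x] G[of x0] G'[of "x - x0"] unfolding D0
      by (auto intro!: borel_measurable_integrable)
    show "((\<lambda>x. ?q x y) \<longlongrightarrow> 0) (at x0 within UNIV)" if "y \<in> space M" for y
      using d[OF that, of x0] unfolding has_derivative_within by blast
    show "norm (?q x y) \<le> 2 * w y" if y: "y \<in> space M" for x y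
    proof (cases "x = x0")
      case True
      \<comment> \<open>A basis vector has norm 1, so the bound for this increment shows that the
        dominating function is nonnegative.\<close>
      have "0 \<le> w y * norm (SOME b::'a. b \<in> Basis)"
        using b[OF y] norm_ge_zero order_trans by blast
      then have "0 \<le> w y" by (simp add: norm_some_Basis)
      then show ?thesis using True by simp
    next
      case False
      have "norm (G x y - G x0 y) \<le> w y * norm (x - x0)"
      proof (rule differentiable_bound[where S = UNIV])
        show "((\<lambda>x. G x y) has_derivative (\<lambda>h. D z h y)) (at z within UNIV)" for z
          using d[OF y] by simp
        show "onorm (\<lambda>h. D z h y) \<le> w y" for z
          by (rule onorm_bound) 
            (use b[OF y, of z] order_trans[OF norm_ge_zero b[OF y, of z "SOME b::'a. b \<in> Basis"]]
             in \<open>auto simp: norm_some_Basis\<close>)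
      qed auto
      then have "norm (G x y - (G x0 y + D x0 (x - x0) y)) \<le> 2 * w y * norm (x - x0)"
        using b[OF y, of x0 "x - x0"] norm_triangle_ineq4[of "G x y - G x0 y" "D x0 (x - x0) y"]
        by (simp add: algebra_simps)
      then show ?thesis using False unfolding norm_scaleR by (simp add: field_simps)
    qed
  qed auto
  moreover have "(LINT y|M. ?q x y)
      = (1 / norm (x - x0)) *\<^sub>R ((LINT y|M. G x y) - ((LINT y|M. G x0 y) + (LINT y|M. G' (x - x0) y)))" for x
    using G G' by (simp add: D0)
  ultimately show ?thesis
    unfolding has_derivative_within using bl by (simp only: Bochner_Integration.integral_zero simp_thms)
qed

text \<open>The integral of a translate of \<open>F\<close> does not depend on the translation.\<close>

lemma integral_directional_derivative_eq_0:
  fixes F :: "'a::euclidean_space \<Rightarrow> complex"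
  assumes d: "\<And>x. (F has_derivative F' x) (at x)"
    and m: "(\<lambda>x. F' x e) \<in> borel_measurable borel"
    and s: "2 * real DIM('a) \<le> s"
    and F: "\<And>x. cmod (F x) \<le> C * wt (- s) x"
    and F': "\<And>x. cmod (F' x e) \<le> C * wt (- s) x"
  shows "(LINT x|lborel. F' x e) = 0"
proof -
  have [measurable]: "F \<in> borel_measurable borel"
    using d by (intro borel_measurable_continuous_onI)
      (metis continuous_at_imp_continuous_on has_derivative_continuous)
  have C: "0 \<le> C"
    using order_trans[OF norm_ge_zero F[of 0]] by (simp add: zero_le_mult_iff bracket_def)
  have iF: "integrable lborel F"
    by (rule integrable_wt_bound[OF _ F s]) measurable
  have der: "((\<lambda>t. F (x + t *\<^sub>R e)) has_derivative (\<lambda>h. h *\<^sub>R F' (x + t *\<^sub>R e) e)) (at t)" for x t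
  proof -
    have "((\<lambda>t. x + t *\<^sub>R e) has_derivative (\<lambda>h. h *\<^sub>R e)) (at t)"
      by (auto intro!: derivative_eq_intros)
    from has_derivative_compose[OF this d]
    have "((\<lambda>t. F (x + t *\<^sub>R e)) has_derivative (\<lambda>h. F' (x + t *\<^sub>R e) (h *\<^sub>R e))) (at t)" .
    then show ?thesis
      using linear_scale[OF has_derivative_linear[OF d]] by simp
  qed
  \<comment> \<open>The Peetre factor of a translation by at most one step in the direction
    \<open>e\<close>, uniform in \<open>t\<close> with \<bar>t\<bar> \<le> 1.\<close>
  define k where "k = (2::real) powr \<bar>s\<bar> * wt \<bar>s\<bar> e"
  have shift: "wt (- s) (x + t *\<^sub>R e) \<le> k * wt (- s) x" if "\<bar>t\<bar> \<le> 1" for x t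
  proof -
    have "bracket (t *\<^sub>R e) \<le> bracket e"
      using that by (intro bracket_mono) (simp add: mult_left_le_one_le)
    then have "wt \<bar>s\<bar> (t *\<^sub>R e) \<le> wt \<bar>s\<bar> e"
      by (intro powr_mono2) auto
    then have "2 powr \<bar>s\<bar> * wt (- s) x * wt \<bar>s\<bar> (t *\<^sub>R e) \<le> 2 powr \<bar>s\<bar> * wt (- s) x * wt \<bar>s\<bar> e"
      by (intro mult_left_mono) auto
    with wt_add_le[of x "t *\<^sub>R e" "-s"] show ?thesis
      unfolding k_def abs_minus_cancel mult.assoc mult.left_commute[of _ "2 powr \<bar>s\<bar>"]
        mult.commute[of "wt \<bar>s\<bar> e"] by linarith
  qed
  let ?q = "\<lambda>t x. (F (x + t *\<^sub>R e) - F x) /\<^sub>R t"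
  \<comment> \<open>The limit is taken within [-1, 1], where \<open>shift\<close> gives one
    dominating function for all difference quotients; 0 is still a limit point of this interval, so
    the limit is unique.\<close>
  have "((\<lambda>t. LINT x|lborel. ?q t x) \<longlongrightarrow> (LINT x|lborel. F' x e)) (at 0 within {-1..1})"
  proof (rule dominated_tendsto_at[where w = "\<lambda>x. C * k * wt (- s) x"])
    show "integrable lborel (\<lambda>x::'a. C * k * wt (- s) x)"
      using integrable_wt[OF s] by simp
    show "((\<lambda>t. ?q t x) \<longlongrightarrow> F' x e) (at 0 within {-1..1})" for x
    proof -
      have "((\<lambda>t. (1 / norm (t - 0)) *\<^sub>R (F (x + t *\<^sub>R e) - (F (x + 0 *\<^sub>R e)
          + (t - 0) *\<^sub>R F' (x + 0 *\<^sub>R e) e))) \<longlongrightarrow> 0) (at 0 within {-1..1})"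
        using has_derivative_at_withinI[OF der[of x 0]] unfolding has_derivative_within by blast
      then have "((\<lambda>t. norm (?q t x - F' x e)) \<longlongrightarrow> 0) (at 0 within {-1..1})"
      proof (rule tendsto_norm_zero[THEN tendsto_cong[THEN iffD1, rotated]])
        have "norm ((1 / norm (t - 0)) *\<^sub>R (F (x + t *\<^sub>R e) - (F (x + 0 *\<^sub>R e)
          + (t - 0) *\<^sub>R F' (x + 0 *\<^sub>R e) e))) = norm (?q t x - F' x e)" if "t \<noteq> 0" for t
        proof -
          have "?q t x - F' x e = (1 / t) *\<^sub>R (F (x + t *\<^sub>R e) - (F (x + 0 *\<^sub>R e)
            + (t - 0) *\<^sub>R F' (x + 0 *\<^sub>R e) e))"
            using that by (simp add: scaleR_right_diff_distrib scaleR_add_right divide_inverse)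
          then show ?thesis by (simp only: norm_scaleR) simp
        qed
        then show "\<forall>\<^sub>F t in at 0 within {-1..1}. norm ((1 / norm (t - 0)) *\<^sub>R (F (x + t *\<^sub>R e) -
          (F (x + 0 *\<^sub>R e) + (t - 0) *\<^sub>R F' (x + 0 *\<^sub>R e) e))) = norm (?q t x - F' x e)"
          by (simp add: eventually_at_filter)
      qed
      then show ?thesis
        using tendsto_norm_zero_iff Lim_null by blast
    qed
    show "norm (?q t x) \<le> C * k * wt (- s) x" if "t \<in> {-1..1}" for t x
    proof -
      have "norm (F (x + t *\<^sub>R e) - F (x + 0 *\<^sub>R e)) \<le> (C * k * wt (- s) x) * norm (t - 0)"
      proof (rule differentiable_bound[where S = "{-1..1}"])
        show "((\<lambda>t. F (x + t *\<^sub>R e)) has_derivative (\<lambda>h. h *\<^sub>R F' (x + t *\<^sub>R e) e)) (at t within {-1..1})" for t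
          using der by (rule has_derivative_at_withinI)
        show "onorm (\<lambda>h. h *\<^sub>R F' (x + t *\<^sub>R e) e) \<le> C * k * wt (- s) x" if "t \<in> {-1..1}" for t
        proof (rule onorm_le)
          fix h :: real
          have "cmod (F' (x + t *\<^sub>R e) e) \<le> C * (k * wt (- s) x)"
            using order_trans[OF F'[of "x + t *\<^sub>R e"] mult_left_mono[OF shift[of t x] C]] that by auto
          then show "norm (h *\<^sub>R F' (x + t *\<^sub>R e) e) \<le> C * k * wt (- s) x * norm h"
            by (simp add: mult.commute mult_left_mono mult.assoc)
        qed
      qed (use that in auto)
      then have "norm (F (x + t *\<^sub>R e) - F x) \<le> (C * k * wt (- s) x) * \<bar>t\<bar>"
        by simp
      moreover have "0 \<le> C * k * wt (- s) x"
        using C by (simp add: k_def)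
      ultimately show ?thesis
        unfolding norm_scaleR by (cases "t = 0") (auto simp: field_simps)
    qed
  qed (use m in auto)
  moreover have "(LINT x|lborel. ?q t x) = 0" for t
    using iF lborel_translate[of F "t *\<^sub>R e"] by (simp)
  ultimately have "((\<lambda>t::real. 0) \<longlongrightarrow> (LINT x|lborel. F' x e)) (at 0 within {-1..1})"
    by (simp only:)
  moreover have "at (0::real) within {-1..1} \<noteq> bot"
    by (simp add: trivial_limit_within islimpt_Icc)
  ultimately show ?thesis
    using tendsto_const tendsto_unique by (metis)
qed

section \<open>Partial derivatives and smooth functions\<close>

abbreviation dpart :: "'a::euclidean_space \<Rightarrow> ('a \<Rightarrow> complex) \<Rightarrow> 'a \<Rightarrow> complex" where
  "dpart b f \<equiv> (\<lambda>x. frechet_derivative f (at x) b)"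

lemma partial_derivs_append: "partial_derivs (xs @ ys) f = partial_derivs xs (partial_derivs ys f)"
  by (induction xs) auto

text \<open>The last entry of the list is the derivative that is taken first. Induction from the end
  therefore replaces the function by one of its first derivatives, which suits statements about
  classes of functions closed under \<open>dpart\<close>.\<close>

lemma partial_derivs_snoc: "partial_derivs (bs @ [b]) f = partial_derivs bs (dpart b f)"
  by (simp add: partial_derivs_append)

lemma smoothD:
  assumes "smooth f"
  shows "f differentiable (at x)"
  using assms[unfolded smooth_def, rule_format, of "[]"] by (simp add: differentiable_on_def)

lemma smooth_dpart:
  assumes "smooth f" "b \<in> Basis"
  shows "smooth (dpart b f)"
  using assms unfolding smooth_def by (auto simp flip: partial_derivs_snoc)

text \<open>Reduces every claim about all higher derivatives to finding a class of functions that is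
  stable under one derivative; smoothness and membership in \<open>schwartz\<close> are checked this
  way.\<close>

lemma partial_derivs_coinduct:
  assumes "f \<in> F" "\<And>f b. f \<in> F \<Longrightarrow> b \<in> Basis \<Longrightarrow> dpart b f \<in> F" "set bs \<subseteq> Basis"
  shows "partial_derivs bs f \<in> F"
  using assms(3) by (induction bs) (auto simp: assms)

lemma smooth_coinduct:
  assumes "f \<in> F" "\<And>f b. f \<in> F \<Longrightarrow> b \<in> Basis \<Longrightarrow> dpart b f \<in> F"
    and "\<And>f x. f \<in> F \<Longrightarrow> f differentiable (at x)"
  shows "smooth f"
  unfolding smooth_def differentiable_on_def
  using partial_derivs_coinduct[OF assms(1,2)] assms(3) by auto

lemma smooth_has_derivative:
  "smooth f \<Longrightarrow> (f has_derivative frechet_derivative f (at x)) (at x)"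
  using smoothD frechet_derivative_works by blast

lemma dpart_eq: "(f has_derivative f') (at x) \<Longrightarrow> frechet_derivative f (at x) b = f' b"
  using frechet_derivative_at by metis

lemma frechet_derivative_basis:
  assumes "f differentiable (at x)"
  shows "frechet_derivative f (at x) h = (\<Sum>b\<in>Basis. (h \<bullet> b) *\<^sub>R frechet_derivative f (at x) b)"
proof -
  have l: "linear (frechet_derivative f (at x))"
    using assms frechet_derivative_works has_derivative_linear by blast
  have "frechet_derivative f (at x) (\<Sum>b\<in>Basis. (h \<bullet> b) *\<^sub>R b)
      = (\<Sum>b\<in>Basis. (h \<bullet> b) *\<^sub>R frechet_derivative f (at x) b)"
    by (simp add: linear_sum[OF l] linear_scale[OF l])
  then show ?thesis by (simp add: euclidean_representation)
qed

lemma cmod_frechet_derivative_le: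
  assumes "f differentiable (at x)"
  shows "cmod (frechet_derivative f (at x) h)
    \<le> (\<Sum>b\<in>Basis. cmod (frechet_derivative f (at x) b)) * norm h"
  unfolding frechet_derivative_basis[OF assms, of h] sum_distrib_right
  by (intro sum_norm_le)
    (auto simp: mult.commute[of _ "norm h"] intro!: mult_right_mono Basis_le_norm)

lemma continuous_on_smooth: "smooth f \<Longrightarrow> continuous_on S f"
  by (meson smoothD continuous_at_imp_continuous_on differentiable_imp_continuous_within)

lemma measurable_smooth: "smooth f \<Longrightarrow> f \<in> borel_measurable borel"
  by (intro borel_measurable_continuous_onI continuous_on_smooth)

lemma smooth_partial_derivs: "smooth f \<Longrightarrow> set bs \<subseteq> Basis \<Longrightarrow> smooth (partial_derivs bs f)"
  by (induction bs) (auto intro: smooth_dpart)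

lemma dpart_add:
  assumes "f differentiable (at x)" "g differentiable (at x)"
  shows "frechet_derivative (\<lambda>x. f x + g x) (at x) b
    = frechet_derivative f (at x) b + frechet_derivative g (at x) b"
  by (rule dpart_eq[OF has_derivative_add]) (use assms frechet_derivative_works in blast)+

lemma dpart_cmult:
  fixes f :: "'a::euclidean_space \<Rightarrow> complex"
  assumes "f differentiable (at x)"
  shows "frechet_derivative (\<lambda>x. c * f x) (at x) b = c * frechet_derivative f (at x) b"
proof -
  have "(f has_derivative frechet_derivative f (at x)) (at x)"
    using assms frechet_derivative_works by blast
  from bounded_linear.has_derivative[OF bounded_linear_mult_right this]
  show ?thesis by (rule dpart_eq)
qed

lemma partial_derivs_add:
  assumes "smooth f" "smooth g" "set bs \<subseteq> Basis"
  shows "partial_derivs bs (\<lambda>x. f x + g x) = (\<lambda>x. partial_derivs bs f x + partial_derivs bs g x)"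
  using assms(3)
  by (induction bs) (auto simp: dpart_add smoothD smooth_partial_derivs assms)

lemma partial_derivs_cmult:
  assumes "smooth f" "set bs \<subseteq> Basis"
  shows "partial_derivs bs (\<lambda>x. c * f x) = (\<lambda>x. c * partial_derivs bs f x)"
  using assms(2)
  by (induction bs) (auto simp: dpart_cmult smoothD smooth_partial_derivs assms)

lemma smooth_add:
  assumes "smooth f" "smooth g"
  shows "smooth (\<lambda>x. f x + g x)"
  unfolding smooth_def using assms
  by (auto simp: partial_derivs_add differentiable_on_def smoothD smooth_partial_derivs)

lemma smooth_cmult:
  assumes "smooth f"
  shows "smooth (\<lambda>x. c * f x)"
  unfolding smooth_def using assms
  by (auto simp: partial_derivs_cmult differentiable_on_def smoothD smooth_partial_derivs)

section \<open>Schwartz functions\<close>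

lemma schwartz_smooth: "f \<in> schwartz \<Longrightarrow> smooth f"
  by (simp add: schwartz_def)

lemma schwartz_dpart: "f \<in> schwartz \<Longrightarrow> b \<in> Basis \<Longrightarrow> dpart b f \<in> schwartz"
  unfolding schwartz_def by (auto simp: smooth_dpart simp flip: partial_derivs_snoc)

lemma schwartz_measurable [measurable_dest]: "f \<in> schwartz \<Longrightarrow> f \<in> borel_measurable borel"
  by (simp add: measurable_smooth schwartz_smooth)

text \<open>The definition controls natural powers of the bracket. A real exponent \<open>s\<close>
  of either sign is reached through a natural number that is at least \<open>- s\<close>.\<close>

lemma schwartz_bound:
  assumes "f \<in> schwartz" "set bs \<subseteq> Basis"
  obtains C where "C \<ge> 0" "\<And>x. cmod (partial_derivs bs f x) \<le> C * wt s x"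
proof -
  obtain n :: nat where n: "- s \<le> n"
    using real_arch_simple by blast
  obtain C where C: "\<And>x. bracket x ^ n * cmod (partial_derivs bs f x) \<le> C"
    using assms unfolding schwartz_def bdd_above_def by fastforce
  have "cmod (partial_derivs bs f x) \<le> max C 0 * wt s x" for x
  proof -
    have "wt (- s) x * cmod (partial_derivs bs f x) \<le> bracket x ^ n * cmod (partial_derivs bs f x)"
      using wt_mono[OF n, of x] by (intro mult_right_mono) (auto simp: wt_nat)
    also have "\<dots> \<le> max C 0" using C[of x] by simp
    finally show ?thesis
      by (simp add: powr_minus field_simps)
  qed
  then show ?thesis using that[of "max C 0"] by auto
qed

lemma schwartz_bound0:
  assumes "f \<in> schwartz"
  obtains C where "C \<ge> 0" "\<And>x. cmod (f x) \<le> C * wt s x"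
  using schwartz_bound[OF assms, of "[]" s] by auto

text \<open>Since \<open>F\<close> is stable under derivatives, the decay has to be checked only for
  the members of \<open>F\<close> themselves. The class has to be chosen large enough to be
  stable.\<close>

lemma schwartz_coinduct:
  assumes "f \<in> F" "\<And>f b. f \<in> F \<Longrightarrow> b \<in> Basis \<Longrightarrow> dpart b f \<in> F"
    and "\<And>f x. f \<in> F \<Longrightarrow> f differentiable (at x)"
    and "\<And>f s. f \<in> F \<Longrightarrow> \<exists>C. \<forall>x. cmod (f x) \<le> C * wt (- s) x"
  shows "f \<in> schwartz"
  unfolding schwartz_def bdd_above_def
proof (safe)
  show "smooth f" using smooth_coinduct[OF assms(1-3)] by blast
  fix N :: nat and bs :: "'a list"
  assume bs: "set bs \<subseteq> Basis"
  then obtain C where C: "\<And>x. cmod (partial_derivs bs f x) \<le> C * wt (- real N) x"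
    using assms(4)[OF partial_derivs_coinduct[OF assms(1,2) bs], of "real N"] by auto
  have "bracket x ^ N * cmod (partial_derivs bs f x) \<le> C" for x
    using C[of x] by (simp add: powr_minus wt_nat field_simps)
  then show "\<exists>M. \<forall>x\<in>range (\<lambda>x. bracket x ^ N * cmod (partial_derivs bs f x)). x \<le> M"
    by auto
qed

lemma schwartz_add:
  assumes "f \<in> schwartz" "g \<in> schwartz"
  shows "(\<lambda>x. f x + g x) \<in> schwartz"
proof (rule schwartz_coinduct[where F = "{\<lambda>x. f x + g x | f g. f \<in> schwartz \<and> g \<in> schwartz}"])
  show "(\<lambda>x. f x + g x) \<in> {\<lambda>x. f x + g x | f g. f \<in> schwartz \<and> g \<in> schwartz}"
    using assms by blast
next
  fix h :: "'a \<Rightarrow> complex" assume "h \<in> {\<lambda>x. f x + g x | f g. f \<in> schwartz \<and> g \<in> schwartz}"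
  then obtain f g where fg: "f \<in> schwartz" "g \<in> schwartz" and h: "h = (\<lambda>x. f x + g x)" by blast
  show "h differentiable (at x)" for x
    unfolding h using fg by (simp add: schwartz_smooth smoothD)
  show "dpart b h \<in> {\<lambda>x. f x + g x | f g. f \<in> schwartz \<and> g \<in> schwartz}" if "b \<in> Basis" for b
  proof -
    have "dpart b h = (\<lambda>x. dpart b f x + dpart b g x)"
      unfolding h using fg by (simp add: dpart_add schwartz_smooth smoothD)
    then show ?thesis
      using schwartz_dpart[OF fg(1) that] schwartz_dpart[OF fg(2) that]
      by (intro CollectI exI[of _ "dpart b f"] exI[of _ "dpart b g"]) simp
  qed
  show "\<exists>C. \<forall>x. cmod (h x) \<le> C * wt (- s) x" for s
  proof -
    obtain C where C: "\<And>x. cmod (f x) \<le> C * wt (- s) x" using schwartz_bound0[OF fg(1)] by blast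
    obtain D where D: "\<And>x. cmod (g x) \<le> D * wt (- s) x" using schwartz_bound0[OF fg(2)] by blast
    have "cmod (h x) \<le> (C + D) * wt (- s) x" for x
      unfolding h using norm_triangle_ineq[of "f x" "g x"] C[of x] D[of x] by (simp add: distrib_right)
    then show ?thesis by blast
  qed
qed

lemma schwartz_cmult:
  assumes "f \<in> schwartz"
  shows "(\<lambda>x. c * f x) \<in> schwartz"
proof (rule schwartz_coinduct[where F = "{\<lambda>x. c * f x | f. f \<in> schwartz}"])
  show "(\<lambda>x. c * f x) \<in> {\<lambda>x. c * f x | f. f \<in> schwartz}"
    using assms by blast
next
  fix h :: "'a \<Rightarrow> complex" assume "h \<in> {\<lambda>x. c * f x | f. f \<in> schwartz}"
  then obtain f where f: "f \<in> schwartz" and h: "h = (\<lambda>x. c * f x)" by blast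
  show "h differentiable (at x)" for x
    unfolding h using f by (simp add: schwartz_smooth smoothD)
  show "dpart b h \<in> {\<lambda>x. c * f x | f. f \<in> schwartz}" if "b \<in> Basis" for b
  proof -
    have "dpart b h = (\<lambda>x. c * dpart b f x)"
      unfolding h using f by (simp add: dpart_cmult schwartz_smooth smoothD)
    then show ?thesis
      using schwartz_dpart[OF f that] by (intro CollectI exI[of _ "dpart b f"]) simp
  qed
  show "\<exists>C. \<forall>x. cmod (h x) \<le> C * wt (- s) x" for s
  proof -
    obtain C where C: "\<And>x. cmod (f x) \<le> C * wt (- s) x" using schwartz_bound0[OF f] by blast
    have "cmod (h x) \<le> (cmod c * C) * wt (- s) x" for x
      unfolding h using mult_left_mono[OF C[of x], of "cmod c"] by (simp add: norm_mult mult_ac)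
    then show ?thesis by blast
  qed
qed

lemma schwartz_zero: "(\<lambda>x. 0) \<in> schwartz"
proof (rule schwartz_coinduct[where F = "{\<lambda>x. 0}"])
  show "\<exists>C. \<forall>x. cmod (f x) \<le> C * wt (- s) x" if "f \<in> {\<lambda>x::'a. 0}" for f s
    using that by (intro exI[of _ 0]) auto
qed auto

lemma schwartz_diff:
  assumes "f \<in> schwartz" "g \<in> schwartz"
  shows "(\<lambda>x. f x - g x) \<in> schwartz"
  using schwartz_add[OF assms(1) schwartz_cmult[OF assms(2), of "-1"]] by simp

lemma schwartz_sum:
  assumes "finite I" "\<And>i. i \<in> I \<Longrightarrow> f i \<in> schwartz"
  shows "(\<lambda>x. \<Sum>i\<in>I. f i x) \<in> schwartz"
  using assms by (induction I rule: finite_induct) (auto intro: schwartz_zero schwartz_add)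

lemma partial_derivs_zero: "partial_derivs bs (\<lambda>x. 0) = (\<lambda>x. 0)"
  by (induction bs) auto

lemma partial_derivs_sum:
  assumes "finite I" "\<And>i. i \<in> I \<Longrightarrow> f i \<in> schwartz" "set bs \<subseteq> Basis"
  shows "partial_derivs bs (\<lambda>x. \<Sum>i\<in>I. f i x) = (\<lambda>x. \<Sum>i\<in>I. partial_derivs bs (f i) x)"
  using assms(1,2)
proof (induction I rule: finite_induct)
  case empty
  then show ?case by (simp add: partial_derivs_zero)
next
  case (insert i I)
  then have "smooth (f i)" "smooth (\<lambda>x. \<Sum>i\<in>I. f i x)"
    by (auto intro!: schwartz_smooth schwartz_sum)
  then show ?case using insert by (simp add: partial_derivs_add assms(3))
qed

lemma partial_derivs_diff:
  assumes "smooth f" "smooth g" "set bs \<subseteq> Basis"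
  shows "partial_derivs bs (\<lambda>x. f x - g x) = (\<lambda>x. partial_derivs bs f x - partial_derivs bs g x)"
  using partial_derivs_add[OF assms(1) smooth_cmult[OF assms(2), of "-1"] assms(3)]
    partial_derivs_cmult[OF assms(2,3), of "-1"] by simp

lemma has_derivative_of_real_inner:
  "((\<lambda>x. complex_of_real (x \<bullet> c)) has_derivative (\<lambda>h. of_real (h \<bullet> c))) (at x within S)"
  by (intro bounded_linear_imp_has_derivative bounded_linear_compose[OF bounded_linear_of_real]
      bounded_linear_inner_left)

text \<open>The product rule leaves a summand without the coordinate factor, so the stable class
  consists of the functions of the form \<open>x f + g\<close>.\<close>

lemma schwartz_coord_mult:
  assumes "f \<in> schwartz"
  shows "(\<lambda>x. of_real (x \<bullet> c) * f x) \<in> schwartz"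
proof (rule schwartz_coinduct[where
      F = "{\<lambda>x. of_real (x \<bullet> c) * f x + g x | f g. f \<in> schwartz \<and> g \<in> schwartz}"])
  show "(\<lambda>x. of_real (x \<bullet> c) * f x) \<in> {\<lambda>x. of_real (x \<bullet> c) * f x + g x | f g. f \<in> schwartz \<and> g \<in> schwartz}"
    using assms schwartz_zero by force
next
  fix h :: "'a \<Rightarrow> complex"
  assume "h \<in> {\<lambda>x. of_real (x \<bullet> c) * f x + g x | f g. f \<in> schwartz \<and> g \<in> schwartz}"
  then obtain f g where fg: "f \<in> schwartz" "g \<in> schwartz"
    and h: "h = (\<lambda>x. of_real (x \<bullet> c) * f x + g x)" by blast
  have der: "(h has_derivative (\<lambda>k. of_real (x \<bullet> c) * frechet_derivative f (at x) k
      + of_real (k \<bullet> c) * f x + frechet_derivative g (at x) k)) (at x)" for x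
    unfolding h using fg
    by (intro has_derivative_add has_derivative_mult has_derivative_of_real_inner
        smooth_has_derivative schwartz_smooth)
  show "h differentiable (at x)" for x
    using der unfolding differentiable_def by blast
  show "dpart b h \<in> {\<lambda>x. of_real (x \<bullet> c) * f x + g x | f g. f \<in> schwartz \<and> g \<in> schwartz}"
    if b: "b \<in> Basis" for b
  proof -
    have "dpart b h = (\<lambda>x. of_real (x \<bullet> c) * dpart b f x + (of_real (b \<bullet> c) * f x + dpart b g x))"
      using dpart_eq[OF der] by (simp add: add.assoc)
    moreover have "(\<lambda>x. of_real (b \<bullet> c) * f x + dpart b g x) \<in> schwartz"
      by (intro schwartz_add schwartz_cmult fg schwartz_dpart b)
    ultimately show ?thesis
      using schwartz_dpart[OF fg(1) b]
      by (intro CollectI exI[of _ "dpart b f"]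
          exI[of _ "\<lambda>x. of_real (b \<bullet> c) * f x + dpart b g x"]) simp
  qed
  show "\<exists>C. \<forall>x. cmod (h x) \<le> C * wt (- s) x" for s
  proof -
    obtain C where C: "\<And>x. cmod (f x) \<le> C * wt (- (s + 1)) x" "C \<ge> 0"
      using schwartz_bound0[OF fg(1)] by blast
    obtain D where D: "\<And>x. cmod (g x) \<le> D * wt (- s) x" using schwartz_bound0[OF fg(2)] by blast
    have "cmod (h x) \<le> (norm c * C + D) * wt (- s) x" for x
    proof -
      have "cmod (of_real (x \<bullet> c) * f x) \<le> (norm x * norm c) * (C * wt (- (s + 1)) x)"
        unfolding norm_mult norm_of_real
        by (intro mult_mono C Cauchy_Schwarz_ineq2) auto
      also have "\<dots> = norm c * C * (norm x * wt (- (s + 1)) x)" by simp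
      also have "\<dots> \<le> norm c * C * wt (- s) x"
        using norm_mult_wt_le[of x "-(s+1)"] C(2) by (intro mult_left_mono) auto
      finally show ?thesis
        unfolding h using norm_triangle_ineq[of "of_real (x \<bullet> c) * f x" "g x"] D[of x]
        by (simp add: distrib_right)
    qed
    then show ?thesis by blast
  qed
qed

lemma schwartz_reflect:
  assumes "f \<in> schwartz"
  shows "(\<lambda>x. f (- x)) \<in> schwartz"
proof (rule schwartz_coinduct[where F = "{\<lambda>x. f (- x) | f. f \<in> schwartz}"])
  show "(\<lambda>x. f (- x)) \<in> {\<lambda>x. f (- x) | f. f \<in> schwartz}"
    using assms by blast
next
  fix h :: "'a \<Rightarrow> complex" assume "h \<in> {\<lambda>x. f (- x) | f. f \<in> schwartz}"
  then obtain f where f: "f \<in> schwartz" and h: "h = (\<lambda>x. f (- x))" by blast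
  have der: "(h has_derivative (\<lambda>k. frechet_derivative f (at (- x)) (- k))) (at x)" for x
  proof -
    have "((\<lambda>x. - x) has_derivative (\<lambda>k. - k)) (at x)" by (auto intro!: derivative_eq_intros)
    from has_derivative_compose[OF this smooth_has_derivative[OF schwartz_smooth[OF f]]]
    show ?thesis unfolding h .
  qed
  show "h differentiable (at x)" for x
    using der unfolding differentiable_def by blast
  show "dpart b h \<in> {\<lambda>x. f (- x) | f. f \<in> schwartz}" if b: "b \<in> Basis" for b
  proof -
    have "dpart b h = (\<lambda>x. (-1) * dpart b f (- x))"
      using linear_neg[OF has_derivative_linear[OF smooth_has_derivative[OF schwartz_smooth[OF f]]]]
      by (simp add: dpart_eq[OF der])
    then show ?thesis
      using schwartz_cmult[OF schwartz_dpart[OF f b], of "-1"]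
      by (intro CollectI exI[of _ "\<lambda>x. (-1) * dpart b f x"]) simp
  qed
  show "\<exists>C. \<forall>x. cmod (h x) \<le> C * wt (- s) x" for s
  proof -
    obtain C where "\<And>x. cmod (f x) \<le> C * wt (- s) x" using schwartz_bound0[OF f] by blast
    then have "cmod (h x) \<le> C * wt (- s) x" for x
      unfolding h by (metis bracket_minus)
    then show ?thesis by blast
  qed
qed

section \<open>Time-frequency shifts\<close>

lemma measurable_fst_borel [measurable]:
    "(fst :: 'a::euclidean_space \<times> 'b::euclidean_space \<Rightarrow> 'a) \<in> borel_measurable borel"
  and measurable_snd_borel [measurable]:
    "(snd :: 'a \<times> 'b \<Rightarrow> 'b) \<in> borel_measurable borel"
  by (intro borel_measurable_continuous_onI continuous_intros)+

lemma tf_shift_apply: "tf_shift z f y = exp (\<i> * of_real (y \<bullet> snd z)) * f (y - fst z)"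
  by (simp add: tf_shift_def split_beta)

lemma cmod_tf_shift [simp]: "cmod (tf_shift z f y) = cmod (f (y - fst z))"
  by (simp add: tf_shift_apply norm_mult)

lemma tf_shift_has_derivative:
  assumes "\<And>x. f differentiable (at x)"
  shows "(tf_shift z f has_derivative (\<lambda>h. \<i> * of_real (h \<bullet> snd z) * tf_shift z f y
     + exp (\<i> * of_real (y \<bullet> snd z)) * frechet_derivative f (at (y - fst z)) h)) (at y)"
proof -
  have 1: "((\<lambda>y. exp (\<i> * of_real (y \<bullet> snd z))) has_derivative
      (\<lambda>h. (\<i> * of_real (h \<bullet> snd z)) * exp (\<i> * of_real (y \<bullet> snd z)))) (at y)"
    by (rule has_derivative_eq_rhs, rule has_derivative_compose[OF 
        has_derivative_mult_right[OF has_derivative_of_real_inner]])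
      (rule DERIV_exp[unfolded has_field_derivative_def], simp add: mult_ac fun_eq_iff)
  have "((\<lambda>y. y - fst z) has_derivative (\<lambda>h. h)) (at y)"
    by (auto intro!: derivative_eq_intros)
  moreover have "(f has_derivative frechet_derivative f (at (y - fst z))) (at (y - fst z))"
    using assms frechet_derivative_works by blast
  ultimately have 2: "((\<lambda>y. f (y - fst z)) has_derivative (\<lambda>h. frechet_derivative f (at (y - fst z)) h)) (at y)"
    by (rule has_derivative_compose)
  show ?thesis
    unfolding tf_shift_apply[abs_def]
    by (rule has_derivative_eq_rhs[OF has_derivative_mult[OF 1 2]])
      (simp add: algebra_simps fun_eq_iff)
qed

lemma dpart_tf_shift:
  assumes "\<And>x. f differentiable (at x)"
  shows "dpart b (tf_shift z f) = (\<lambda>y. \<i> * of_real (b \<bullet> snd z) * tf_shift z f y + tf_shift z (dpart b f) y)"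
  using dpart_eq[OF tf_shift_has_derivative[OF assms]] by (simp add: tf_shift_apply fun_eq_iff)

text \<open>For fixed \<open>z\<close>, the derivative of a shift is the same shift of another
  Schwartz function: the modulation only contributes a constant multiple of
  \<open>f\<close>.\<close>

lemma schwartz_tf_shift:
  assumes "f \<in> schwartz"
  shows "tf_shift z f \<in> schwartz"
proof (rule schwartz_coinduct[where F = "{tf_shift z f | f. f \<in> schwartz}"])
  show "tf_shift z f \<in> {tf_shift z f | f. f \<in> schwartz}"
    using assms by blast
next
  fix h :: "'a \<Rightarrow> complex" assume "h \<in> {tf_shift z f | f. f \<in> schwartz}"
  then obtain f where f: "f \<in> schwartz" and h: "h = tf_shift z f" by blast
  have df: "f differentiable (at x)" for x
    using f by (simp add: schwartz_smooth smoothD)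
  show "h differentiable (at x)" for x
    unfolding h using tf_shift_has_derivative[OF df] unfolding differentiable_def by blast
  show "dpart b h \<in> {tf_shift z f | f. f \<in> schwartz}" if b: "b \<in> Basis" for b
  proof -
    have "dpart b h = tf_shift z (\<lambda>y. \<i> * of_real (b \<bullet> snd z) * f y + dpart b f y)"
      unfolding h dpart_tf_shift[OF df] by (simp add: tf_shift_apply algebra_simps fun_eq_iff)
    moreover have "(\<lambda>y. \<i> * of_real (b \<bullet> snd z) * f y + dpart b f y) \<in> schwartz"
      by (intro schwartz_add schwartz_cmult schwartz_dpart f b)
    ultimately show ?thesis by blast
  qed
  show "\<exists>C. \<forall>x. cmod (h x) \<le> C * wt (- s) x" for s
  proof -
    obtain C where C: "C \<ge> 0" "\<And>x. cmod (f x) \<le> C * wt (- s) x" using schwartz_bound0[OF f] by blast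
    have "cmod (h x) \<le> (C * (2 powr \<bar>s\<bar> * wt \<bar>s\<bar> (fst z))) * wt (- s) x" for x
    proof -
      have "cmod (h x) \<le> C * wt (- s) (x - fst z)" unfolding h using C by simp
      also have "\<dots> \<le> C * (2 powr \<bar>-s\<bar> * wt (-s) x * wt \<bar>-s\<bar> (x - fst z - x))"
        using C(1) by (intro mult_left_mono wt_diff_le)
      finally show ?thesis by (simp add: mult_ac)
    qed
    then show ?thesis by blast
  qed
qed

section \<open>Synthesis of Schwartz functions from coefficients on phase space\<close>

text \<open>The condition on coefficient functions: the synthesis is differentiated in the position
  variable, so the coefficients must decay like Schwartz functions but may be merely
  measurable.\<close>

definition rapid :: "('a::euclidean_space \<Rightarrow> complex) \<Rightarrow> bool" where
  "rapid H \<longleftrightarrow> H \<in> borel_measurable borel \<and> (\<forall>s. \<exists>C. \<forall>z. cmod (H z) \<le> C * wt (- s) z)"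

lemma rapid_bound:
  assumes "rapid H"
  obtains C where "C \<ge> 0" "\<And>z. cmod (H z) \<le> C * wt s z"
proof -
  obtain C where C: "\<And>z. cmod (H z) \<le> C * wt s z"
    using assms unfolding rapid_def by (metis minus_minus)
  have "cmod (H z) \<le> max C 0 * wt s z" for z
    using C[of z] mult_right_mono[of C "max C 0" "wt s z"] by (auto intro: order_trans)
  then show ?thesis using that[of "max C 0"] by auto
qed

lemma schwartz_rapid: "f \<in> schwartz \<Longrightarrow> rapid f"
  unfolding rapid_def using schwartz_bound0 schwartz_measurable by metis

lemma rapid_integrable: "rapid H \<Longrightarrow> integrable lborel H"
  using integrable_wt_bound[of H _ "2 * real DIM('a)"] unfolding rapid_def by blast

text \<open>Decay in \<open>z\<close> lets derivatives pass under the integral over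
  \<open>z\<close>; the simultaneous decay in \<open>y\<close> survives the integration. Stability
  under \<open>dpart\<close> is built in through the lists \<open>bs\<close>.\<close>

definition schwartz_family :: "('b::euclidean_space \<Rightarrow> 'a::euclidean_space \<Rightarrow> complex) \<Rightarrow> bool" where
  "schwartz_family K \<longleftrightarrow> (\<forall>z. K z \<in> schwartz) \<and>
    (\<forall>bs. set bs \<subseteq> Basis \<longrightarrow>
      (\<forall>y. (\<lambda>z. partial_derivs bs (K z) y) \<in> borel_measurable borel) \<and>
      (\<forall>s t. \<exists>C\<ge>0. \<forall>z y. cmod (partial_derivs bs (K z) y) \<le> C * wt (- s) z * wt (- t) y))"

lemma schwartz_family_dpart:
  assumes "schwartz_family K" "b \<in> Basis"
  shows "schwartz_family (\<lambda>z. dpart b (K z))"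
  using assms unfolding schwartz_family_def
  by (auto simp: schwartz_dpart simp flip: partial_derivs_snoc)

lemma schwartz_family_bound:
  assumes "schwartz_family K" "set bs \<subseteq> Basis"
  obtains C where "C \<ge> 0" "\<And>z y. cmod (partial_derivs bs (K z) y) \<le> C * wt (- s) z * wt (- t) y"
  using assms unfolding schwartz_family_def by metis

lemma schwartz_family_bound0:
  assumes "schwartz_family K"
  obtains C where "C \<ge> 0" "\<And>z y. cmod (K z y) \<le> C * wt (- s) z * wt (- t) y"
  using schwartz_family_bound[OF assms, of "[]" s t] unfolding partial_derivs.simps(1) by auto

lemma schwartz_family_integrable:
  fixes K :: "'b::euclidean_space \<Rightarrow> 'a::euclidean_space \<Rightarrow> complex"
  assumes "schwartz_family K"
  shows "integrable lborel (\<lambda>z. K z y)"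
proof -
  obtain C where "\<And>z y. cmod (K z y) \<le> C * wt (- (2 * real DIM('b))) z * wt (- 0) y"
    using schwartz_family_bound0[OF assms] by blast
  moreover have "(\<lambda>z. partial_derivs [] (K z) y) \<in> borel_measurable borel"
    using assms[unfolded schwartz_family_def, THEN conjunct2, rule_format, of "[]"] by simp
  ultimately show ?thesis
    by (intro integrable_wt_bound) auto
qed

lemma schwartz_family_has_derivative:
  fixes K :: "'b::euclidean_space \<Rightarrow> 'a::euclidean_space \<Rightarrow> complex"
  assumes K: "schwartz_family K"
  shows "((\<lambda>y. LINT z|lborel. K z y) has_derivative
    (\<lambda>h. LINT z|lborel. frechet_derivative (K z) (at y) h)) (at y)"
proof -
  have dif: "K z differentiable (at y)" for z y
    using K by (auto simp: schwartz_family_def intro: smoothD schwartz_smooth)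
  have "\<exists>C\<ge>0. \<forall>z y. cmod (dpart b (K z) y) \<le> C * wt (- (2 * real DIM('b))) z" if b: "b \<in> Basis" for b
  proof -
    obtain D where "D \<ge> 0" "\<And>z y. cmod (dpart b (K z) y) \<le> D * wt (- (2 * real DIM('b))) z * wt (- 0) y"
      using schwartz_family_bound0[OF schwartz_family_dpart[OF K b]] by blast
    then show ?thesis by auto
  qed
  then have "\<forall>b\<in>Basis. \<exists>C\<ge>0. \<forall>z y. cmod (dpart b (K z) y) \<le> C * wt (- (2 * real DIM('b))) z"
    by blast
  then obtain C where C: "\<And>b z y. b \<in> Basis \<Longrightarrow> cmod (dpart b (K z) y) \<le> C b * wt (- (2 * real DIM('b))) z"
    by metis
  show ?thesis
  proof (rule has_derivative_lebesgue_integral[where 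
        D = "\<lambda>x h z. frechet_derivative (K z) (at x) h"
        and w = "\<lambda>z. (\<Sum>b\<in>Basis. C b) * wt (- (2 * real DIM('b))) z"])
    show "integrable lborel (\<lambda>z. K z x)" for x
      by (rule schwartz_family_integrable[OF K])
    show "integrable lborel (\<lambda>z. frechet_derivative (K z) (at y) h)" for h
      unfolding frechet_derivative_basis[OF dif, of _ y h]
      using schwartz_family_integrable[OF schwartz_family_dpart[OF K]] by simp
    show "(K z has_derivative frechet_derivative (K z) (at x)) (at x)" for x z
      using dif frechet_derivative_works by blast
    show "integrable lborel (\<lambda>z::'b. (\<Sum>b\<in>Basis. C b) * wt (- (2 * real DIM('b))) z)"
      using integrable_wt[where 'a='b and s = "2 * real DIM('b)"] by simp
    show "cmod (frechet_derivative (K z) (at x) h)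
        \<le> (\<Sum>b\<in>Basis. C b) * wt (- (2 * real DIM('b))) z * norm h" for x h z
    proof -
      have "(\<Sum>b\<in>Basis. cmod (frechet_derivative (K z) (at x) b)) \<le> (\<Sum>b\<in>Basis. C b) * wt (- (2 * real DIM('b))) z"
        unfolding sum_distrib_right by (intro sum_mono C)
      then show ?thesis
        using cmod_frechet_derivative_le[OF dif, of z x h] by (meson mult_right_mono norm_ge_zero order_trans)
    qed
  qed auto
qed

lemma partial_derivs_integral:
  assumes "schwartz_family K" "set bs \<subseteq> Basis"
  shows "partial_derivs bs (\<lambda>y. LINT z|lborel. K z y) = (\<lambda>y. LINT z|lborel. partial_derivs bs (K z) y)"
  using assms
proof (induction bs arbitrary: K rule: rev_induct)
  case (snoc b bs)
  have "dpart b (\<lambda>y. LINT z|lborel. K z y) = (\<lambda>y. LINT z|lborel. dpart b (K z) y)"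
    using dpart_eq[OF schwartz_family_has_derivative[OF snoc.prems(1)]] by blast
  then show ?case
    using snoc.IH[OF schwartz_family_dpart[OF snoc.prems(1), of b]] snoc.prems(2)
    by (simp add: partial_derivs_snoc)
qed simp

lemma schwartz_integral:
  fixes K :: "'b::euclidean_space \<Rightarrow> 'a::euclidean_space \<Rightarrow> complex"
  assumes "schwartz_family K"
  shows "(\<lambda>y. LINT z|lborel. K z y) \<in> schwartz"
proof (rule schwartz_coinduct[where
      F = "{\<lambda>y. LINT z|lborel. K z y | K. schwartz_family (K :: 'b \<Rightarrow> 'a \<Rightarrow> complex)}"])
  show "(\<lambda>y. LINT z|lborel. K z y) \<in> {\<lambda>y. LINT z|lborel. K z y | K. schwartz_family (K :: 'b \<Rightarrow> 'a \<Rightarrow> complex)}"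
    using assms by blast
next
  fix h :: "'a \<Rightarrow> complex"
  assume "h \<in> {\<lambda>y. LINT z|lborel. K z y | K. schwartz_family (K :: 'b \<Rightarrow> 'a \<Rightarrow> complex)}"
  then obtain K :: "'b \<Rightarrow> 'a \<Rightarrow> complex" where K: "schwartz_family K" and h: "h = (\<lambda>y. LINT z|lborel. K z y)" by blast
  note der = schwartz_family_has_derivative[OF K]
  show "h differentiable (at x)" for x
    unfolding h differentiable_def using der by blast
  show "dpart b h \<in> {\<lambda>y. LINT z|lborel. K z y | K. schwartz_family (K :: 'b \<Rightarrow> 'a \<Rightarrow> complex)}"
    if b: "b \<in> Basis" for b
    unfolding h dpart_eq[OF der] using schwartz_family_dpart[OF K b]
    by (intro CollectI exI[of _ "\<lambda>z. dpart b (K z)"]) simp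
  show "\<exists>C. \<forall>x. cmod (h x) \<le> C * wt (- s) x" for s
  proof -
    obtain C where C: "\<And>z y. cmod (K z y) \<le> C * wt (- (2 * real DIM('b))) z * wt (- s) y"
      using schwartz_family_bound0[OF K] by blast
    have "cmod (h y) \<le> (LINT z::'b|lborel. C * wt (- (2 * real DIM('b))) z * wt (- s) y)" for y
      unfolding h using C schwartz_family_integrable[OF K] integrable_wt[where 'a='b and s = "2 * real DIM('b)"]
      by (intro Bochner_Integration.integral_norm_bound_integral) auto
    then have "cmod (h y) \<le> (C * (LINT z::'b|lborel. wt (- (2 * real DIM('b))) z)) * wt (- s) y" for y
      by simp
    then show ?thesis by blast
  qed
qed

lemma tf_shift_partial_derivs_snoc:
  assumes "f \<in> schwartz" "b \<in> Basis" "set bs \<subseteq> Basis"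
  shows "partial_derivs (bs @ [b]) (tf_shift z f) y
    = \<i> * of_real (b \<bullet> snd z) * partial_derivs bs (tf_shift z f) y + partial_derivs bs (tf_shift z (dpart b f)) y"
proof -
  have "smooth (tf_shift z f)" "smooth (tf_shift z (dpart b f))"
    using assms by (auto intro!: schwartz_smooth schwartz_tf_shift schwartz_dpart)
  then show ?thesis
    using assms by (simp add: partial_derivs_snoc dpart_tf_shift smoothD schwartz_smooth
        partial_derivs_add partial_derivs_cmult smooth_cmult)
qed

lemma measurable_partial_derivs_tf_shift:
  assumes "f \<in> schwartz" "set bs \<subseteq> Basis"
  shows "(\<lambda>z. partial_derivs bs (tf_shift z f) y) \<in> borel_measurable borel"
  using assms
proof (induction bs arbitrary: f rule: rev_induct)
  case Nil
  then have [measurable]: "f \<in> borel_measurable borel" by measurable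
  then show ?case by (simp add: tf_shift_apply) 
next
  case (snoc b bs)
  then have [measurable]: "(\<lambda>z. partial_derivs bs (tf_shift z f) y) \<in> borel_measurable borel"
     "(\<lambda>z. partial_derivs bs (tf_shift z (dpart b f)) y) \<in> borel_measurable borel"
    by (auto intro: schwartz_dpart)
  show ?case using snoc.prems by (simp add: tf_shift_partial_derivs_snoc del: partial_derivs.simps)
qed

lemma norm_fst_le_norm: "norm (fst z) \<le> norm z"
  using norm_fst_le[of "fst z" "snd z"] by simp

lemma bracket_fst_le: "bracket (fst z) \<le> bracket z" and bracket_snd_le: "bracket (snd z) \<le> bracket z"
  using norm_fst_le[of "fst z" "snd z"] norm_snd_le[of "snd z" "fst z"]
  by (auto intro!: bracket_mono)

lemma inner_snd_le: "b \<in> Basis \<Longrightarrow> \<bar>b \<bullet> snd z\<bar> \<le> bracket z"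
  using Cauchy_Schwarz_ineq2[of b "snd z"] norm_le_bracket[of "snd z"] bracket_snd_le[of z] by simp

text \<open>Moving the decay of \<open>f\<close> from \<open>y - fst z\<close> to \<open>y\<close>
  costs \<bar>t\<bar> powers of the bracket of \<open>z\<close>, and each derivative that hits the
  modulation costs one more.\<close>

lemma partial_derivs_tf_shift_bound:
  fixes f :: "'a::euclidean_space \<Rightarrow> complex"
  assumes "f \<in> schwartz" "set bs \<subseteq> Basis"
  shows "\<exists>C\<ge>0. \<forall>z y. cmod (partial_derivs bs (tf_shift z f) y)
    \<le> C * wt (\<bar>t\<bar> + real (length bs)) z * wt (- t) y"
  using assms
proof (induction bs arbitrary: f rule: rev_induct)
  case Nil
  obtain C where C: "C \<ge> 0" "\<And>x. cmod (f x) \<le> C * wt (- t) x" using schwartz_bound0[OF Nil(1)] by blast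
  have "cmod (tf_shift z f y) \<le> (C * 2 powr \<bar>t\<bar>) * wt \<bar>t\<bar> z * wt (- t) y" for z y
  proof -
    have "cmod (tf_shift z f y) \<le> C * wt (- t) (y - fst z)" using C by simp
    also have "\<dots> \<le> C * (2 powr \<bar>-t\<bar> * wt (-t) y * wt \<bar>-t\<bar> (y - fst z - y))"
      using C(1) by (intro mult_left_mono wt_diff_le)
    also have "\<dots> = (C * 2 powr \<bar>t\<bar> * wt (-t) y) * wt \<bar>t\<bar> (fst z)"
      by (simp add: mult_ac)
    also have "\<dots> \<le> (C * 2 powr \<bar>t\<bar> * wt (-t) y) * wt \<bar>t\<bar> z"
      using C(1) by (intro mult_left_mono powr_mono2 bracket_fst_le) auto
    finally show ?thesis by (simp add: mult_ac)
  qed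
  then show ?case using C(1) by (intro exI[of _ "C * 2 powr \<bar>t\<bar>"]) auto
next
  case (snoc b bs)
  from snoc obtain C where C: "C \<ge> 0" "\<And>z y. cmod (partial_derivs bs (tf_shift z f) y)
    \<le> C * wt (\<bar>t\<bar> + real (length bs)) z * wt (- t) y" by force
  from snoc.IH[of "dpart b f"] snoc.prems obtain D where D: "D \<ge> 0" 
    "\<And>z y. cmod (partial_derivs bs (tf_shift z (dpart b f)) y)
    \<le> D * wt (\<bar>t\<bar> + real (length bs)) z * wt (- t) y" by (auto simp: schwartz_dpart)
  have "cmod (partial_derivs (bs @ [b]) (tf_shift z f) y) 
      \<le> (C + D) * wt (\<bar>t\<bar> + real (length (bs @ [b]))) z * wt (- t) y" for z y
  proof -
    let ?w = "wt (\<bar>t\<bar> + real (length bs)) z"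
    have w: "wt (\<bar>t\<bar> + real (length (bs @ [b]))) z = bracket z * ?w"
      by (simp add: powr_add)
    have "cmod (partial_derivs (bs @ [b]) (tf_shift z f) y) \<le> \<bar>b \<bullet> snd z\<bar> * cmod (partial_derivs bs (tf_shift z f) y)
      + cmod (partial_derivs bs (tf_shift z (dpart b f)) y)"
      using snoc.prems
        norm_triangle_ineq[of "\<i> * of_real (b \<bullet> snd z) * partial_derivs bs (tf_shift z f) y"
          "partial_derivs bs (tf_shift z (dpart b f)) y"]
      by (simp add: tf_shift_partial_derivs_snoc norm_mult del: partial_derivs.simps)
    also have "\<dots> \<le> bracket z * (C * ?w * wt (- t) y) + bracket z * (D * ?w * wt (- t) y)"
    proof (rule add_mono)
      show "\<bar>b \<bullet> snd z\<bar> * cmod (partial_derivs bs (tf_shift z f) y) \<le> bracket z * (C * ?w * wt (- t) y)"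
        using C snoc.prems by (intro mult_mono inner_snd_le) auto
      have "1 * cmod (partial_derivs bs (tf_shift z (dpart b f)) y) \<le> bracket z * (D * ?w * wt (- t) y)"
        using D bracket_ge_1[of z] by (intro mult_mono) auto
      then show "cmod (partial_derivs bs (tf_shift z (dpart b f)) y) \<le> bracket z * (D * ?w * wt (- t) y)"
        by simp
    qed
    finally show ?thesis unfolding w by (simp only: distrib_left distrib_right mult_ac)
  qed
  then show ?case using C(1) D(1) by (intro exI[of _ "C + D"]) auto
qed

text \<open>The formal adjoint of the map that takes \<open>g\<close> to its short-time Fourier
  transform with window \<open>f\<close>.\<close>

definition synth :: "('a::euclidean_space \<Rightarrow> complex) \<Rightarrow> ('a \<times> 'a \<Rightarrow> complex) \<Rightarrow> 'a \<Rightarrow> complex" where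
  "synth f H = (\<lambda>y. LINT z|lborel. H z * tf_shift z f y)"

lemma partial_derivs_cmult_tf_shift:
  assumes "f \<in> schwartz" "set bs \<subseteq> Basis"
  shows "partial_derivs bs (\<lambda>y. c * tf_shift z f y) = (\<lambda>y. c * partial_derivs bs (tf_shift z f) y)"
  using assms by (intro partial_derivs_cmult schwartz_smooth schwartz_tf_shift)

lemma schwartz_family_synth:
  assumes f: "f \<in> schwartz" and H: "rapid H"
  shows "schwartz_family (\<lambda>z y. H z * tf_shift z f y)"
  unfolding schwartz_family_def
proof (intro conjI allI impI)
  show "(\<lambda>y. H z * tf_shift z f y) \<in> schwartz" for z
    by (intro schwartz_cmult schwartz_tf_shift f)
  fix bs :: "'a list" assume bs: "set bs \<subseteq> Basis"
  show "(\<lambda>z. partial_derivs bs (\<lambda>y. H z * tf_shift z f y) y) \<in> borel_measurable borel" for y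
    using H measurable_partial_derivs_tf_shift[OF f bs]
    by (auto simp: partial_derivs_cmult_tf_shift[OF f bs] rapid_def)
  show "\<exists>C\<ge>0. \<forall>z y. cmod (partial_derivs bs (\<lambda>y. H z * tf_shift z f y) y) \<le> C * wt (- s) z * wt (- t) y" for s t
  proof -
    obtain C where C: "C \<ge> 0" "\<And>z y. cmod (partial_derivs bs (tf_shift z f) y)
      \<le> C * wt (\<bar>t\<bar> + real (length bs)) z * wt (- t) y"
      using partial_derivs_tf_shift_bound[OF f bs] by blast
    \<comment> \<open>The surplus in the decay of \<open>H\<close> pays for the growth of the
      differentiated shifts in \<open>z\<close>.\<close>
    obtain D where D: "D \<ge> 0" "\<And>z. cmod (H z) \<le> D * wt (- s - (\<bar>t\<bar> + real (length bs))) z"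
      using rapid_bound[OF H] by blast
    have "cmod (partial_derivs bs (\<lambda>y. H z * tf_shift z f y) y) \<le> (D * C) * wt (- s) z * wt (- t) y" for z y
    proof -
      have "cmod (partial_derivs bs (\<lambda>y. H z * tf_shift z f y) y) 
        \<le> (D * wt (- s - (\<bar>t\<bar> + real (length bs))) z) * (C * wt (\<bar>t\<bar> + real (length bs)) z * wt (- t) y)"
        unfolding partial_derivs_cmult_tf_shift[OF f bs] norm_mult
        using C D by (intro mult_mono) auto
      also have "\<dots> = (D * C) * (wt (- s - (\<bar>t\<bar> + real (length bs))) z * wt (\<bar>t\<bar> + real (length bs)) z) * wt (- t) y"
        by (simp only: mult_ac)
      finally show ?thesis by (simp flip: powr_add)
    qed
    then show ?thesis using C(1) D(1) by (intro exI[of _ "D * C"]) auto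
  qed
qed

lemma schwartz_synth:
  assumes "f \<in> schwartz" "rapid H"
  shows "synth f H \<in> schwartz"
  unfolding synth_def using schwartz_integral[OF schwartz_family_synth[OF assms]] .

lemma partial_derivs_synth:
  assumes "f \<in> schwartz" "rapid H" "set bs \<subseteq> Basis"
  shows "partial_derivs bs (synth f H) y = (LINT z|lborel. H z * partial_derivs bs (tf_shift z f) y)"
    and "integrable lborel (\<lambda>z. H z * partial_derivs bs (tf_shift z f) y)"
proof -
  note K = schwartz_family_synth[OF assms(1,2)]
  show "partial_derivs bs (synth f H) y = (LINT z|lborel. H z * partial_derivs bs (tf_shift z f) y)"
    unfolding synth_def partial_derivs_integral[OF K assms(3)] partial_derivs_cmult_tf_shift[OF assms(1,3)] ..
  obtain C where "\<And>z y. cmod (H z * partial_derivs bs (tf_shift z f) y) \<le> C * wt (- (2 * real DIM('a \<times> 'a))) z * wt (- 0) y"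
    using schwartz_family_bound[OF K assms(3)] unfolding partial_derivs_cmult_tf_shift[OF assms(1,3)] by blast
  then show "integrable lborel (\<lambda>z. H z * partial_derivs bs (tf_shift z f) y)"
    using assms(2) measurable_partial_derivs_tf_shift[OF assms(1,3)]
    by (intro integrable_wt_bound[where s = "2 * real DIM('a \<times> 'a)"]) (auto simp: rapid_def)
qed

text \<open>A Lipschitz bound in the phase space point, used for the continuity of the transform of
  a distribution and for approximating integrals by sums. Changing the modulation costs a factor
  \<open>norm y\<close>, hence the window bound with exponent \<open>t + 1\<close>; changing the
  translation is a mean value estimate along a segment.\<close>

lemma tf_shift_diff_bound:
  fixes f :: "'a::euclidean_space \<Rightarrow> complex"
  assumes "f \<in> schwartz"
  shows "\<exists>C\<ge>0. \<forall>z w y. cmod (tf_shift z f y - tf_shift w f y)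
    \<le> C * wt (\<bar>t\<bar> + 1) z * wt (\<bar>t\<bar> + 1) w * norm (z - w) * wt (- t) y"
proof -
  have dif: "f differentiable (at x)" for x
    using assms by (simp add: schwartz_smooth smoothD)
  obtain A where A: "A \<ge> 0" "\<And>x. cmod (f x) \<le> A * wt (- (t + 1)) x"
    using schwartz_bound0[OF assms] by blast
  have "\<forall>b\<in>Basis. \<exists>C\<ge>0. \<forall>x. cmod (dpart b f x) \<le> C * wt (- t) x"
    using schwartz_bound0[OF schwartz_dpart[OF assms]] by metis
  then obtain B where B: "\<And>b. b \<in> Basis \<Longrightarrow> B b \<ge> 0"
      "\<And>b x. b \<in> Basis \<Longrightarrow> cmod (dpart b f x) \<le> B b * wt (- t) x"
    by metis
  define D where "D = (\<Sum>b\<in>Basis. B b)"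
  have D: "D \<ge> 0" "cmod (frechet_derivative f (at x) h) \<le> D * wt (- t) x * norm h" for x h
  proof -
    show "D \<ge> 0" unfolding D_def by (intro sum_nonneg B)
    have "(\<Sum>b\<in>Basis. cmod (frechet_derivative f (at x) b)) \<le> D * wt (- t) x"
      unfolding D_def sum_distrib_right by (intro sum_mono B)
    then show "cmod (frechet_derivative f (at x) h) \<le> D * wt (- t) x * norm h"
      using cmod_frechet_derivative_le[OF dif, of x h] by (meson mult_right_mono norm_ge_zero order_trans)
  qed
  define E where "E = A * 2 powr \<bar>t + 1\<bar> + D * 2 powr \<bar>t\<bar>"
  have "cmod (tf_shift z f y - tf_shift w f y)
    \<le> E * wt (\<bar>t\<bar> + 1) z * wt (\<bar>t\<bar> + 1) w * norm (z - w) * wt (- t) y" for z w y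
  proof -
    let ?e = "\<lambda>z. exp (\<i> * of_real (y \<bullet> snd z))"
    have ww: "wt p (fst z) \<le> wt (\<bar>t\<bar> + 1) z * wt (\<bar>t\<bar> + 1) w" if "p \<le> \<bar>t\<bar> + 1" "0 \<le> p" for p
    proof -
      have "wt p (fst z) \<le> wt p z" using that by (intro powr_mono2 bracket_fst_le) auto
      also have "\<dots> \<le> wt (\<bar>t\<bar> + 1) z * 1" using wt_mono[OF that(1), of z] by simp
      also have "\<dots> \<le> wt (\<bar>t\<bar> + 1) z * wt (\<bar>t\<bar> + 1) w"
        by (intro mult_left_mono wt_ge_1) auto
      finally show ?thesis .
    qed
    have 1: "cmod ((?e z - ?e w) * f (y - fst z))
        \<le> (A * 2 powr \<bar>t + 1\<bar>) * (wt (\<bar>t\<bar> + 1) z * wt (\<bar>t\<bar> + 1) w) * norm (z - w) * wt (- t) y"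
    proof -
      have "cmod (?e z - ?e w) \<le> \<bar>y \<bullet> snd z - y \<bullet> snd w\<bar>"
      proof -
        have "?e z - ?e w = ?e w * (exp (\<i> * of_real (y \<bullet> snd z - y \<bullet> snd w)) - 1)"
          by (simp add: exp_diff right_diff_distrib mult.commute)
        then have "cmod (?e z - ?e w) = cmod (exp (\<i> * of_real (y \<bullet> snd z - y \<bullet> snd w)) - 1)"
          by (simp add: norm_mult)
        then show ?thesis using iexp_approx1[of "y \<bullet> snd z - y \<bullet> snd w" 0] by simp
      qed
      also have "\<dots> \<le> norm y * norm (z - w)"
        using Cauchy_Schwarz_ineq2[of y "snd (z - w)"]
          mult_left_mono[OF norm_snd_le[of "snd (z - w)" "fst (z - w)"] norm_ge_zero[of y]]
        by (simp add: inner_diff_right minus_prod_def)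
      finally have "cmod ((?e z - ?e w) * f (y - fst z)) \<le> (norm y * norm (z - w)) * (A * wt (- (t + 1)) (y - fst z))"
        unfolding norm_mult using A by (intro mult_mono) auto
      also have "\<dots> \<le> (norm y * norm (z - w)) * (A * (2 powr \<bar>- (t + 1)\<bar> * wt (- (t + 1)) y * wt \<bar>- (t + 1)\<bar> (y - fst z - y)))"
        using A(1) by (intro mult_left_mono wt_diff_le) auto
      also have "\<dots> = (A * 2 powr \<bar>t + 1\<bar>) * wt \<bar>t + 1\<bar> (fst z) * norm (z - w) * (norm y * wt (- (t + 1)) y)"
        by (simp add: mult_ac abs_minus_cancel[of "t + 1"] del: minus_add_distrib abs_minus_cancel)
      also have "\<dots> \<le> (A * 2 powr \<bar>t + 1\<bar>) * (wt (\<bar>t\<bar> + 1) z * wt (\<bar>t\<bar> + 1) w) * norm (z - w) * wt (- t) y"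
        using A(1) norm_mult_wt_le[of y "- (t + 1)"] by (intro mult_mono ww) auto
      finally show ?thesis .
    qed
    have 2: "cmod (?e w * (f (y - fst z) - f (y - fst w)))
        \<le> (D * 2 powr \<bar>t\<bar>) * (wt (\<bar>t\<bar> + 1) z * wt (\<bar>t\<bar> + 1) w) * norm (z - w) * wt (- t) y"
    proof -
      let ?B = "D * 2 powr \<bar>t\<bar> * (wt (\<bar>t\<bar> + 1) z * wt (\<bar>t\<bar> + 1) w) * wt (- t) y"
      have "cmod (f (y - fst z) - f (y - fst w)) \<le> ?B * norm ((y - fst z) - (y - fst w))"
      proof (rule differentiable_bound[where S = "closed_segment (y - fst w) (y - fst z)"])
        show "(f has_derivative frechet_derivative f (at x)) (at x within closed_segment (y - fst w) (y - fst z))" for x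
          using dif frechet_derivative_works has_derivative_at_withinI by blast
        show "onorm (frechet_derivative f (at x)) \<le> ?B" if x: "x \<in> closed_segment (y - fst w) (y - fst z)" for x
        proof (rule onorm_le)
          fix h
          obtain u where u: "0 \<le> u" "u \<le> 1" "x = (1 - u) *\<^sub>R (y - fst w) + u *\<^sub>R (y - fst z)"
            using x unfolding closed_segment_def by blast
          \<comment> \<open>On the segment, \<open>y - x\<close> is a convex combination of the two
            translations, so it is no longer than the larger of \<open>w\<close> and
            \<open>z\<close>.\<close>
          have yx: "y - x = (1 - u) *\<^sub>R fst w + u *\<^sub>R fst z"
            using u(3) by (simp add: algebra_simps)
          have "norm (y - x) \<le> norm ((1 - u) *\<^sub>R fst w) + norm (u *\<^sub>R fst z)"
            unfolding yx by (rule norm_triangle_ineq)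
          also have "\<dots> \<le> (1 - u) * norm w + u * norm z"
            using u by (auto intro!: add_mono mult_left_mono norm_fst_le_norm)
          also have "\<dots> \<le> max (norm w) (norm z)"
            using u convex_bound_le[of "norm w" "max (norm w) (norm z)" "norm z" "1 - u" u] by simp
          finally have "norm (y - x) \<le> norm w \<or> norm (y - x) \<le> norm z" by linarith
          then have "bracket (y - x) \<le> bracket w \<or> bracket (y - x) \<le> bracket z"
            by (auto simp: bracket_def power_mono)
          \<comment> \<open>Brackets are at least 1, so their product dominates either one and the
            bound becomes symmetric in both points.\<close>
          moreover have "bracket w \<le> bracket z * bracket w" "bracket z \<le> bracket z * bracket w"
            by (simp_all add: bracket_ge_1)
          ultimately have "bracket (y - x) \<le> bracket z * bracket w"
            by linarith
          then have "wt \<bar>t\<bar> (y - x) \<le> (bracket z * bracket w) powr \<bar>t\<bar>"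
            by (intro powr_mono2) auto
          also have "\<dots> = wt \<bar>t\<bar> z * wt \<bar>t\<bar> w" by (simp add: powr_mult)
          also have "\<dots> \<le> wt (\<bar>t\<bar> + 1) z * wt (\<bar>t\<bar> + 1) w"
            by (intro mult_mono wt_mono) auto
          finally have w: "wt \<bar>t\<bar> (y - x) \<le> wt (\<bar>t\<bar> + 1) z * wt (\<bar>t\<bar> + 1) w" .
          have "wt (- t) x \<le> 2 powr \<bar>t\<bar> * wt (- t) y * wt \<bar>t\<bar> (y - x)"
            using wt_diff_le[of x "- t" y] by (simp add: bracket_diff_commute[of x y])
          also have "\<dots> \<le> 2 powr \<bar>t\<bar> * wt (- t) y * (wt (\<bar>t\<bar> + 1) z * wt (\<bar>t\<bar> + 1) w)"
            using w by (intro mult_left_mono) auto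
          finally have "D * wt (- t) x \<le> D * (2 powr \<bar>t\<bar> * wt (- t) y * (wt (\<bar>t\<bar> + 1) z * wt (\<bar>t\<bar> + 1) w))"
            using D(1) by (rule mult_left_mono)
          then have "D * wt (- t) x \<le> ?B" by (simp only: mult_ac)
          then show "norm (frechet_derivative f (at x) h) \<le> ?B * norm h"
            using D(2)[of x h] by (meson mult_right_mono norm_ge_zero order_trans)
        qed
      qed auto
      also have "\<dots> \<le> ?B * norm (z - w)"
        using D(1) norm_fst_le_norm[of "z - w"] by (intro mult_left_mono) (auto simp: norm_minus_commute)
      finally show ?thesis by (simp add: norm_mult mult_ac)
    qed
    have eq: "tf_shift z f y - tf_shift w f y = (?e z - ?e w) * f (y - fst z) + ?e w * (f (y - fst z) - f (y - fst w))"
      by (simp add: tf_shift_apply algebra_simps)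
    have "E * wt (\<bar>t\<bar> + 1) z * wt (\<bar>t\<bar> + 1) w * norm (z - w) * wt (- t) y
      = (A * 2 powr \<bar>t + 1\<bar>) * (wt (\<bar>t\<bar> + 1) z * wt (\<bar>t\<bar> + 1) w) * norm (z - w) * wt (- t) y
      + (D * 2 powr \<bar>t\<bar>) * (wt (\<bar>t\<bar> + 1) z * wt (\<bar>t\<bar> + 1) w) * norm (z - w) * wt (- t) y"
      unfolding E_def by (simp add: algebra_simps)
    then show ?thesis
      unfolding eq using norm_triangle_mono[OF 1 2] by linarith
  qed
  moreover have "E \<ge> 0" using A D by (simp add: E_def)
  ultimately show ?thesis by blast
qed

section \<open>Fubini and the L2 pairing\<close>

text \<open>Domination by a product of two integrable functions is the form in which absolute
  convergence is established for every later exchange of integrals.\<close>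

lemma fubini_dominated:
  fixes f :: "'a::euclidean_space \<Rightarrow> 'b::euclidean_space \<Rightarrow> complex"
  assumes f [measurable]: "case_prod f \<in> borel_measurable (lborel \<Otimes>\<^sub>M lborel)"
    and u: "integrable lborel u" and v: "integrable lborel v"
    and b: "\<And>x y. cmod (f x y) \<le> u x * v y"
  shows "integrable (lborel \<Otimes>\<^sub>M lborel) (case_prod f)"
    and "(LINT x|lborel. LINT y|lborel. f x y) = (LINT y|lborel. LINT x|lborel. f x y)"
proof -
  have i: "integrable lborel (f x)" for x
    by (rule Bochner_Integration.integrable_bound[of _ "\<lambda>y. u x * v y"])
      (use v b order_trans[OF b abs_ge_self] in auto)
  have "integrable lborel (\<lambda>x. LINT y|lborel. norm (f x y))"
  proof (rule Bochner_Integration.integrable_bound[of _ "\<lambda>x. u x * (LINT y|lborel. v y)"])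
    show "AE x in lborel. norm (LINT y|lborel. norm (f x y)) \<le> norm (u x * (LINT y|lborel. v y))"
    proof (rule AE_I2)
      fix x
      have "(LINT y|lborel. norm (f x y)) \<le> (LINT y|lborel. u x * v y)"
        using i v b by (intro integral_mono) auto
      then show "norm (LINT y|lborel. norm (f x y)) \<le> norm (u x * (LINT y|lborel. v y))"
        by simp
    qed
  qed (use u in auto)
  then show "integrable (lborel \<Otimes>\<^sub>M lborel) (case_prod f)"
    using i by (intro lborel_pair.Fubini_integrable) auto
  then show "(LINT x|lborel. LINT y|lborel. f x y) = (LINT y|lborel. LINT x|lborel. f x y)"
    using lborel_pair.Fubini_integral by metis
qed

lemma integral_phase_space:
  fixes F :: "'a::euclidean_space \<times> 'b::euclidean_space \<Rightarrow> complex"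
  assumes "integrable lborel F"
  shows "(LINT z|lborel. F z) = (LINT x|lborel. LINT \<xi>|lborel. F (x, \<xi>))"
  using lborel_pair.integral_fst'[of F] assms by (simp add: lborel_prod)

lemma borel_measurable_cnj [measurable (raw)]:
  "f \<in> borel_measurable M \<Longrightarrow> (\<lambda>x. cnj (f x)) \<in> borel_measurable M"
  by (rule borel_measurable_continuous_on[OF continuous_on_cnj[OF continuous_on_id]])

lemma measurable_tf_shift [measurable (raw)]:
  assumes [measurable]: "f \<in> borel_measurable borel" "z \<in> borel_measurable M" "y \<in> borel_measurable M"
  shows "(\<lambda>x. tf_shift (z x) f (y x)) \<in> borel_measurable M"
  unfolding tf_shift_apply by measurable

lemma L2_integrable:
  assumes f: "f \<in> borel_measurable borel" "\<And>x. cmod (f x) \<le> C * wt (- s) x"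
    and g: "g \<in> borel_measurable borel" "\<And>x. cmod (g x) \<le> B" 
    and s: "2 * real DIM('a) \<le> s"
  shows "integrable lborel (\<lambda>x::'a::euclidean_space. f x * cnj (g x))"
proof (rule integrable_wt_bound[OF _ _ s])
  show "(\<lambda>x. f x * cnj (g x)) \<in> borel_measurable borel" using f(1) g(1) by measurable
  show "cmod (f x * cnj (g x)) \<le> (C * B) * wt (- s) x" for x
    using mult_mono[OF f(2)[of x] g(2)[of x] order_trans[OF norm_ge_zero f(2)] norm_ge_zero]
    by (simp add: norm_mult mult_ac)
qed

lemma schwartz_bounded:
  assumes "f \<in> schwartz"
  obtains C where "C \<ge> 0" "\<And>x. cmod (f x) \<le> C"
  using schwartz_bound0[OF assms, of 0] by auto

lemma L2_integrable_rapid: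
  assumes "rapid f" "g \<in> schwartz"
  shows "integrable lborel (\<lambda>x::'a::euclidean_space. f x * cnj (g x))"
proof -
  obtain C where "\<And>z. cmod (f z) \<le> C * wt (- (2 * real DIM('a))) z"
    using rapid_bound[OF assms(1)] by blast
  moreover obtain B where "\<And>x. cmod (g x) \<le> B" using schwartz_bounded[OF assms(2)] by blast
  ultimately show ?thesis
    using assms L2_integrable[of f C "2 * real DIM('a)" g B] by (auto simp: rapid_def)
qed

lemma L2_integrable_schwartz:
  "f \<in> schwartz \<Longrightarrow> g \<in> schwartz \<Longrightarrow> integrable lborel (\<lambda>x::'a::euclidean_space. f x * cnj (g x))"
  by (rule L2_integrable_rapid[OF schwartz_rapid])

lemma L2_inner_commute: "L2_inner g f = cnj (L2_inner f g)"
  unfolding L2_inner_def Bochner_Integration.integral_cnj[symmetric]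
  by (intro Bochner_Integration.integral_cong) (auto simp: mult.commute)

lemma L2_inner_add_right:
  "f \<in> schwartz \<Longrightarrow> g \<in> schwartz \<Longrightarrow> h \<in> schwartz \<Longrightarrow>
    L2_inner h (\<lambda>x. f x + g x) = L2_inner h f + L2_inner h g"
  unfolding L2_inner_def by (simp add: distrib_left L2_integrable_schwartz)

lemma L2_inner_cmult_left: "L2_inner (\<lambda>x. c * f x) h = c * L2_inner f h"
  unfolding L2_inner_def by (simp add: mult.assoc)

lemma L2_inner_cmult_right: "L2_inner f (\<lambda>x. c * h x) = cnj c * L2_inner f h"
  unfolding L2_inner_def by (simp add: mult.left_commute)

text \<open>Integration by parts: the derivative of \<open>f\<close> times the conjugate of
  \<open>g\<close> is a directional derivative and integrates to 0.\<close>

lemma L2_inner_dpart: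
  fixes f g :: "'a::euclidean_space \<Rightarrow> complex"
  assumes f: "f \<in> schwartz" and g: "g \<in> schwartz" and b: "b \<in> Basis"
  shows "L2_inner (dpart b f) g = - L2_inner f (dpart b g)"
proof -
  let ?F = "\<lambda>x. f x * cnj (g x)"
  let ?F' = "\<lambda>x h. f x * cnj (frechet_derivative g (at x) h) + frechet_derivative f (at x) h * cnj (g x)"
  let ?s = "2 * real DIM('a)"
  have df: "dpart b f \<in> schwartz" and dg: "dpart b g \<in> schwartz"
    using f g b by (auto intro: schwartz_dpart)
  have [measurable]: "f \<in> borel_measurable borel" "g \<in> borel_measurable borel"
      "dpart b f \<in> borel_measurable borel" "dpart b g \<in> borel_measurable borel"
    using f g df dg by (auto intro: schwartz_measurable)
  obtain A where A: "A \<ge> 0" "\<And>x. cmod (f x) \<le> A * wt (- ?s) x" using schwartz_bound0[OF f] by blast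
  obtain A' where A': "A' \<ge> 0" "\<And>x. cmod (dpart b f x) \<le> A' * wt (- ?s) x" using schwartz_bound0[OF df] by blast
  obtain B where B: "B \<ge> 0" "\<And>x. cmod (g x) \<le> B" using schwartz_bounded[OF g] by blast
  obtain B' where B': "B' \<ge> 0" "\<And>x. cmod (dpart b g x) \<le> B'" using schwartz_bounded[OF dg] by blast
  have "(LINT x|lborel. ?F' x b) = 0"
  proof (rule integral_directional_derivative_eq_0[where F = ?F and C = "A * B + A * B' + A' * B" and s = ?s])
    show "(?F has_derivative ?F' x) (at x)" for x
      by (intro has_derivative_mult bounded_linear.has_derivative[OF bounded_linear_cnj]
          smooth_has_derivative schwartz_smooth f g)
    show "cmod (?F x) \<le> (A * B + A * B' + A' * B) * wt (- ?s) x" for x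
    proof -
      have "cmod (?F x) \<le> (A * wt (- ?s) x) * B"
        unfolding norm_mult complex_mod_cnj using A B by (intro mult_mono) auto
      also have "\<dots> \<le> (A * B + A * B' + A' * B) * wt (- ?s) x"
        using A A' B B' by (simp add: algebra_simps)
      finally show ?thesis .
    qed
    show "cmod (?F' x b) \<le> (A * B + A * B' + A' * B) * wt (- ?s) x" for x
    proof -
      have "cmod (f x * cnj (dpart b g x)) \<le> (A * wt (- ?s) x) * B'"
        unfolding norm_mult complex_mod_cnj using A B' by (intro mult_mono) auto
      moreover have "cmod (dpart b f x * cnj (g x)) \<le> (A' * wt (- ?s) x) * B"
        unfolding norm_mult complex_mod_cnj using A' B by (intro mult_mono) auto
      ultimately have "cmod (?F' x b) \<le> (A * wt (- ?s) x) * B' + (A' * wt (- ?s) x) * B"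
        by (rule norm_triangle_mono)
      also have "\<dots> \<le> (A * B + A * B' + A' * B) * wt (- ?s) x"
        using A A' B B' by (simp add: algebra_simps)
      finally show ?thesis .
    qed
  qed (auto)
  then have "(LINT x|lborel. f x * cnj (dpart b g x)) + (LINT x|lborel. dpart b f x * cnj (g x)) = 0"
    using L2_integrable_schwartz[OF f dg] L2_integrable_schwartz[OF df g] by simp
  then show ?thesis
    unfolding L2_inner_def by (simp add: add_eq_0_iff)
qed

lemma tf_shift_coord:
  "of_real (fst z \<bullet> b) * tf_shift z f y
    = of_real (y \<bullet> b) * tf_shift z f y - tf_shift z (\<lambda>y. of_real (y \<bullet> b) * f y) y"
  by (simp add: tf_shift_apply inner_diff_left algebra_simps)

text \<open>The position coordinate of \<open>z\<close> equals \<open>y\<close> minus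
  \<open>y - fst z\<close>: the first part multiplies \<open>g\<close>, the second multiplies the
  window inside the shift.\<close>

lemma stft_coord:
  assumes "f \<in> schwartz" "g \<in> schwartz"
  shows "of_real (fst z \<bullet> b) * L2_inner g (tf_shift z f)
    = L2_inner (\<lambda>y. of_real (y \<bullet> b) * g y) (tf_shift z f)
      - L2_inner g (tf_shift z (\<lambda>y. of_real (y \<bullet> b) * f y))"
proof -
  have "L2_inner g (\<lambda>y. of_real (fst z \<bullet> b) * tf_shift z f y)
    = L2_inner g (\<lambda>y. of_real (y \<bullet> b) * tf_shift z f y + (-1) * tf_shift z (\<lambda>y. of_real (y \<bullet> b) * f y) y)"
    unfolding tf_shift_coord by simp
  also have "\<dots> = L2_inner g (\<lambda>y. of_real (y \<bullet> b) * tf_shift z f y)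
      - L2_inner g (tf_shift z (\<lambda>y. of_real (y \<bullet> b) * f y))"
    using assms by (subst L2_inner_add_right)
      (auto intro!: schwartz_coord_mult schwartz_tf_shift schwartz_cmult[of _ "-1", simplified]
        simp: L2_inner_cmult_right[of _ "-1", simplified])
  also have "L2_inner g (\<lambda>y. of_real (y \<bullet> b) * tf_shift z f y) = L2_inner (\<lambda>y. of_real (y \<bullet> b) * g y) (tf_shift z f)"
    by (simp add: L2_inner_def mult_ac)
  finally show ?thesis by (simp add: L2_inner_cmult_right)
qed

text \<open>The frequency coordinate appears when the modulation is differentiated; integration by
  parts moves this derivative to \<open>g\<close>, and the product rule leaves one on the
  window.\<close>

lemma stft_freq:
  assumes "f \<in> schwartz" "g \<in> schwartz" "b \<in> Basis"
  shows "\<i> * of_real (snd z \<bullet> b) * L2_inner g (tf_shift z f)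
    = L2_inner (dpart b g) (tf_shift z f) + L2_inner g (tf_shift z (dpart b f))"
proof -
  have "L2_inner (dpart b g) (tf_shift z f) = - L2_inner g (dpart b (tf_shift z f))"
    using assms by (intro L2_inner_dpart schwartz_tf_shift)
  also have "dpart b (tf_shift z f) = (\<lambda>y. \<i> * of_real (b \<bullet> snd z) * tf_shift z f y + tf_shift z (dpart b f) y)"
    using assms by (intro dpart_tf_shift) (simp add: schwartz_smooth smoothD)
  also have "L2_inner g (\<lambda>y. \<i> * of_real (b \<bullet> snd z) * tf_shift z f y + tf_shift z (dpart b f) y)
     = - \<i> * of_real (b \<bullet> snd z) * L2_inner g (tf_shift z f) + L2_inner g (tf_shift z (dpart b f))"
    using assms by (subst L2_inner_add_right)
      (auto intro!: schwartz_tf_shift schwartz_cmult schwartz_dpart simp: L2_inner_cmult_right)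
  finally show ?thesis by (simp add: inner_commute)
qed

section \<open>Decay by multiplication with coordinates\<close>

lemma bracket_le_sum_coords:
  "bracket (z :: 'a::euclidean_space \<times> 'a) \<le> 1 + ((\<Sum>b\<in>Basis. \<bar>fst z \<bullet> b\<bar>) + (\<Sum>b\<in>Basis. \<bar>snd z \<bullet> b\<bar>))"
  using bracket_le_one_plus_norm[of z] norm_le_l1[of "fst z"] norm_le_l1[of "snd z"]
    norm_Pair_le[of "fst z" "snd z"] by simp

text \<open>\<open>T\<close> singles out a class of functions that is closed, up to sums, under multiplication by coordinates.\<close>

lemma decay_by_coordinates:
  fixes A :: "'i \<Rightarrow> 'p \<Rightarrow> real" and T :: "'i \<Rightarrow> bool" and pos :: "'p \<Rightarrow> 'a::euclidean_space \<times> 'a"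
  assumes "T i"
    and nonneg: "\<And>i p. 0 \<le> A i p"
    and base: "\<And>i. T i \<Longrightarrow> \<exists>C. \<forall>p. A i p \<le> C * r p"
    and x: "\<And>i b. T i \<Longrightarrow> b \<in> Basis \<Longrightarrow>
      \<exists>J. (\<forall>j\<in>set J. T j) \<and> (\<forall>p. \<bar>fst (pos p) \<bullet> b\<bar> * A i p \<le> (\<Sum>j\<leftarrow>J. A j p))"
    and xi: "\<And>i b. T i \<Longrightarrow> b \<in> Basis \<Longrightarrow>
      \<exists>J. (\<forall>j\<in>set J. T j) \<and> (\<forall>p. \<bar>snd (pos p) \<bullet> b\<bar> * A i p \<le> (\<Sum>j\<leftarrow>J. A j p))"
  shows "\<exists>C. \<forall>p. bracket (pos p) ^ n * A i p \<le> C * r p"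
  using assms(1)
proof (induction n arbitrary: i)
  case 0
  then show ?case using base by simp
next
  case (Suc n)
  \<comment> \<open>The induction hypothesis, available for each member of the class separately, is
    added up along a finite list.\<close>
  have lst: "\<exists>C. \<forall>p. bracket (pos p) ^ n * (\<Sum>j\<leftarrow>J. A j p) \<le> C * r p" if "\<forall>j\<in>set J. T j" for J
    using that
  proof (induction J)
    case Nil
    show ?case by (intro exI[of _ 0]) simp
  next
    case (Cons j J)
    obtain C where C: "\<And>p. bracket (pos p) ^ n * A j p \<le> C * r p"
      using Suc.IH[of j] Cons.prems by auto
    obtain D where D: "\<And>p. bracket (pos p) ^ n * (\<Sum>j\<leftarrow>J. A j p) \<le> D * r p"
      using Cons by auto
    have "bracket (pos p) ^ n * (\<Sum>j\<leftarrow>j # J. A j p) \<le> (C + D) * r p" for p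
      using add_mono[OF C[of p] D[of p]] by (simp add: distrib_left distrib_right)
    then show ?case by blast
  qed
  have cmp: "\<exists>C. \<forall>p. bracket (pos p) ^ n * (B p * A i p) \<le> C * r p"
    if "\<exists>J. (\<forall>j\<in>set J. T j) \<and> (\<forall>p. B p * A i p \<le> (\<Sum>j\<leftarrow>J. A j p))" for B
  proof -
    obtain J where J: "\<forall>j\<in>set J. T j" "\<And>p. B p * A i p \<le> (\<Sum>j\<leftarrow>J. A j p)"
      using \<open>\<exists>J. _\<close> by blast
    obtain C where C: "\<And>p. bracket (pos p) ^ n * (\<Sum>j\<leftarrow>J. A j p) \<le> C * r p" using lst[OF J(1)] by blast
    have "bracket (pos p) ^ n * (B p * A i p) \<le> C * r p" for p
      by (rule order_trans[OF mult_left_mono[OF J(2)] C]) simp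
    then show ?thesis by blast
  qed
  have "\<forall>b\<in>Basis. \<exists>C. \<forall>p. bracket (pos p) ^ n * (\<bar>fst (pos p) \<bullet> b\<bar> * A i p) \<le> C * r p"
    using cmp[OF x[OF Suc.prems]] by blast
  then obtain C1 where C1: "\<And>b p. b \<in> Basis \<Longrightarrow> bracket (pos p) ^ n * (\<bar>fst (pos p) \<bullet> b\<bar> * A i p) \<le> C1 b * r p"
    by metis
  have "\<forall>b\<in>Basis. \<exists>C. \<forall>p. bracket (pos p) ^ n * (\<bar>snd (pos p) \<bullet> b\<bar> * A i p) \<le> C * r p"
    using cmp[OF xi[OF Suc.prems]] by blast
  then obtain C2 where C2: "\<And>b p. b \<in> Basis \<Longrightarrow> bracket (pos p) ^ n * (\<bar>snd (pos p) \<bullet> b\<bar> * A i p) \<le> C2 b * r p"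
    by metis
  obtain C0 where C0: "\<And>p. bracket (pos p) ^ n * A i p \<le> C0 * r p"
    using Suc.IH[OF Suc.prems] by blast
  \<comment> \<open>The additional bracket is at most 1 plus all coordinates, and each coordinate is
    traded for a list of members of the class. The comparison function \<open>r\<close> is never
    touched.\<close>
  have "bracket (pos p) ^ Suc n * A i p \<le> (C0 + ((\<Sum>b\<in>Basis. C1 b) + (\<Sum>b\<in>Basis. C2 b))) * r p" for p
  proof -
    have "bracket (pos p) ^ Suc n * A i p = (bracket (pos p) ^ n * A i p) * bracket (pos p)" by simp
    also have "\<dots> \<le> (bracket (pos p) ^ n * A i p) * (1 + ((\<Sum>b\<in>Basis. \<bar>fst (pos p) \<bullet> b\<bar>) + (\<Sum>b\<in>Basis. \<bar>snd (pos p) \<bullet> b\<bar>)))"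
      using nonneg by (intro mult_left_mono bracket_le_sum_coords) auto
    also have "\<dots> = bracket (pos p) ^ n * A i p + ((\<Sum>b\<in>Basis. bracket (pos p) ^ n * (\<bar>fst (pos p) \<bullet> b\<bar> * A i p))
        + (\<Sum>b\<in>Basis. bracket (pos p) ^ n * (\<bar>snd (pos p) \<bullet> b\<bar> * A i p)))"
      by (simp add: distrib_left sum_distrib_left mult_ac)
    also have "\<dots> \<le> C0 * r p + ((\<Sum>b\<in>Basis. C1 b * r p) + (\<Sum>b\<in>Basis. C2 b * r p))"
      by (intro add_mono sum_mono C0 C1 C2)
    finally show ?thesis by (simp add: distrib_right sum_distrib_right)
  qed
  then show ?case by blast
qed

lemma power_bound_to_wt:
  assumes "bracket z ^ nat \<lceil>s\<rceil> * a \<le> C" "0 \<le> a"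
  shows "a \<le> C * wt (- s) z"
proof -
  have "s \<le> real (nat \<lceil>s\<rceil>)" by linarith
  then have "wt s z * a \<le> wt (real (nat \<lceil>s\<rceil>)) z * a"
    using assms(2) by (intro mult_right_mono wt_mono)
  then have "wt s z * a \<le> C" using assms(1) unfolding wt_nat by linarith
  then show ?thesis by (simp add: powr_minus field_simps)
qed

text \<open>Every coordinate of \<open>z\<close> is absorbed by multiplying or differentiating one
  of the two functions, and the pairings that arise are bounded uniformly in
  \<open>z\<close>.\<close>

lemma stft_decay:
  fixes f g :: "'a::euclidean_space \<Rightarrow> complex"
  assumes "f \<in> schwartz" "g \<in> schwartz"
  obtains C where "C \<ge> 0" "\<And>z. cmod (L2_inner g (tf_shift z f)) \<le> C * wt (- s) z"
proof -
  define T where "T = (\<lambda>(f, g). f \<in> (schwartz :: ('a \<Rightarrow> complex) set) \<and> g \<in> (schwartz :: ('a \<Rightarrow> complex) set))"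
  define A where "A = (\<lambda>(f :: 'a \<Rightarrow> complex, g) z. cmod (L2_inner g (tf_shift z f)))"
  have "\<exists>C. \<forall>z. bracket z ^ nat \<lceil>s\<rceil> * A (f, g) z \<le> C * 1"
  proof (rule decay_by_coordinates[where A = A and T = T and pos = "\<lambda>z. z"])
    show "T (f, g)" using assms by (simp add: T_def)
    show "0 \<le> A i p" for i p by (cases i) (simp add: A_def)
    fix i assume "T i"
    then obtain f g :: "'a \<Rightarrow> complex" where i: "i = (f, g)" and fg: "f \<in> schwartz" "g \<in> schwartz"
      by (cases i) (auto simp: T_def)
    show "\<exists>C. \<forall>z. A i z \<le> C * 1"
    proof -
      obtain C where C: "\<And>z. cmod (f z) \<le> C" using schwartz_bounded[OF fg(1)] by blast
      have "cmod (L2_inner g (tf_shift z f)) \<le> (LINT y|lborel. cmod (g y) * C)" for z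
        unfolding L2_inner_def
        using C L2_integrable_schwartz[OF fg(2) schwartz_tf_shift[OF fg(1)], of z]
          rapid_integrable[OF schwartz_rapid[OF fg(2)]]
        by (intro Bochner_Integration.integral_norm_bound_integral) (auto simp: norm_mult intro: mult_left_mono)
      then show ?thesis unfolding i A_def by auto
    qed
    fix b :: 'a assume b: "b \<in> Basis"
    let ?x = "\<lambda>(f :: 'a \<Rightarrow> complex) y. of_real (y \<bullet> b) * f y"
    have "\<bar>fst z \<bullet> b\<bar> * A i z \<le> A (f, ?x g) z + A (?x f, g) z" for z
      using arg_cong[OF stft_coord[OF fg, of z b], of cmod]
        norm_triangle_ineq4[of "L2_inner (?x g) (tf_shift z f)" "L2_inner g (tf_shift z (?x f))"]
      by (simp add: norm_mult A_def i)
    then show "\<exists>J. (\<forall>j\<in>set J. T j) \<and> (\<forall>z. \<bar>fst z \<bullet> b\<bar> * A i z \<le> (\<Sum>j\<leftarrow>J. A j z))"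
      using fg by (intro exI[of _ "[(f, ?x g), (?x f, g)]"]) (auto simp: T_def intro: schwartz_coord_mult)
    have "\<bar>snd z \<bullet> b\<bar> * A i z \<le> A (f, dpart b g) z + A (dpart b f, g) z" for z
      using arg_cong[OF stft_freq[OF fg b, of z], of cmod]
        norm_triangle_ineq[of "L2_inner (dpart b g) (tf_shift z f)" "L2_inner g (tf_shift z (dpart b f))"]
      by (simp add: norm_mult A_def i)
    then show "\<exists>J. (\<forall>j\<in>set J. T j) \<and> (\<forall>z. \<bar>snd z \<bullet> b\<bar> * A i z \<le> (\<Sum>j\<leftarrow>J. A j z))"
      using fg b by (intro exI[of _ "[(f, dpart b g), (dpart b f, g)]"]) (auto simp: T_def intro: schwartz_dpart)
  qed
  then obtain C where C: "\<And>z. bracket z ^ nat \<lceil>s\<rceil> * cmod (L2_inner g (tf_shift z f)) \<le> C"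
    by (auto simp: A_def)
  have "0 \<le> C" using order_trans[OF _ C[of 0]] by simp
  with power_bound_to_wt[OF C] that show ?thesis by simp
qed

lemma measurable_stft [measurable]:
  assumes [measurable]: "f \<in> borel_measurable borel" "g \<in> borel_measurable borel"
  shows "(\<lambda>z. L2_inner g (tf_shift z f)) \<in> borel_measurable borel"
  unfolding L2_inner_def by measurable

lemma rapid_stft:
  assumes "f \<in> schwartz" "g \<in> schwartz"
  shows "rapid (\<lambda>z. L2_inner g (tf_shift z f))"
  unfolding rapid_def
  using assms measurable_stft[OF schwartz_measurable schwartz_measurable] stft_decay[OF assms] by metis

lemma tf_shift_tf_shift:
  "tf_shift w (tf_shift v f) = (\<lambda>y. exp (- \<i> * of_real (fst w \<bullet> snd v)) * tf_shift (w + v) f y)"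
  by (simp add: tf_shift_apply fun_eq_iff algebra_simps inner_add_right inner_diff_left flip: exp_add)

lemma L2_inner_tf_shift: "L2_inner (tf_shift w g) (tf_shift w f) = L2_inner g f"
proof -
  have "tf_shift w g y * cnj (tf_shift w f y) = g (y - fst w) * cnj (f (y - fst w))" for y
    by (simp add: tf_shift_apply exp_cnj exp_minus field_simps)
  then show ?thesis
    unfolding L2_inner_def using lborel_translate(2)[of "\<lambda>y. g y * cnj (f y)" "- fst w"] by simp
qed

text \<open>Covariance under the Heisenberg group. The phase has modulus 1, so the Gram kernel of
  the shifts has a modulus depending on \<open>z - w\<close> alone and inherits off-diagonal decay
  from a single transform.\<close>

lemma L2_inner_tf_shift2:
  "L2_inner (tf_shift w g) (tf_shift z f)
    = exp (- \<i> * of_real (fst w \<bullet> snd (z - w))) * L2_inner g (tf_shift (z - w) f)"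
proof -
  have "tf_shift z f y = exp (\<i> * of_real (fst w \<bullet> snd (z - w))) * tf_shift w (tf_shift (z - w) f) y" for y
    by (simp add: tf_shift_tf_shift exp_minus)
  then have "L2_inner (tf_shift w g) (tf_shift z f) =
      L2_inner (tf_shift w g) (\<lambda>y. exp (\<i> * of_real (fst w \<bullet> snd (z - w))) * tf_shift w (tf_shift (z - w) f) y)"
    by presburger
  also have "\<dots> = exp (- \<i> * of_real (fst w \<bullet> snd (z - w))) * L2_inner g (tf_shift (z - w) f)"
    by (simp add: L2_inner_cmult_right L2_inner_tf_shift exp_cnj)
  finally show ?thesis .
qed

lemma stft_decay2:
  fixes f g :: "'a::euclidean_space \<Rightarrow> complex"
  assumes "f \<in> schwartz" "g \<in> schwartz"
  obtains C where "C \<ge> 0" "\<And>z w. cmod (L2_inner (tf_shift w g) (tf_shift z f)) \<le> C * wt (- s) (z - w)"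
proof -
  obtain C where "C \<ge> 0" "\<And>z. cmod (L2_inner g (tf_shift z f)) \<le> C * wt (- s) z"
    using stft_decay[OF assms] by blast
  then show ?thesis using that[of C] by (simp add: L2_inner_tf_shift2 norm_mult)
qed

subsection \<open>Fourier inversion\<close>

text \<open>Normalized by its value 1 at the origin, so that the dilates
  \<open>gauss (e *\<^sub>R x)\<close> tend to 1 and serve as summation factors. It is its own
  Fourier transform up to the factor (2 pi)^(d/2).\<close>

definition gauss :: "'a::euclidean_space \<Rightarrow> real" where
  "gauss x = exp (- (norm x)\<^sup>2 / 2)"

lemma gauss_pos: "0 < gauss x" and gauss_le_1: "gauss x \<le> 1" and gauss_0 [simp]: "gauss 0 = 1"
  by (auto simp: gauss_def)

lemma abs_gauss [simp]: "\<bar>gauss x\<bar> = gauss x"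
  by (simp add: gauss_def)

lemma measurable_gauss [measurable]: "gauss \<in> borel_measurable borel"
  unfolding gauss_def by measurable

lemma gauss_prod: "complex_of_real (gauss x)
    = of_real (sqrt (2 * pi)) ^ DIM('a) * (\<Prod>b\<in>Basis. of_real (std_normal_density ((x::'a::euclidean_space) \<bullet> b)))"
proof -
  have "(\<Prod>b\<in>(Basis::'a set). complex_of_real (std_normal_density (x \<bullet> b)))
      = of_real ((1 / sqrt (2 * pi)) ^ DIM('a) * exp (\<Sum>b\<in>Basis. - (x \<bullet> b)\<^sup>2 / 2))"
    unfolding std_normal_density_def of_real_prod[symmetric] prod.distrib
    by (simp add: exp_sum)
  also have "(\<Sum>b\<in>Basis. - (x \<bullet> b)\<^sup>2 / 2) = - (norm x)\<^sup>2 / 2"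
    unfolding power2_norm_eq_inner[of x] euclidean_inner[of x x]
    by (simp add: power2_eq_square sum_divide_distrib sum_negf)
  finally show ?thesis
    by (simp add: gauss_def power_divide)
qed

text \<open>Both functions are products over the coordinates, so this is the characteristic function
  of the standard normal distribution, one coordinate at a time.\<close>

lemma gauss_fourier:
  "integrable lborel (\<lambda>x::'a::euclidean_space. exp (\<i> * of_real (x \<bullet> t)) * of_real (gauss x))"
  "(LINT x::'a|lborel. exp (\<i> * of_real (x \<bullet> t)) * of_real (gauss x))
    = of_real (sqrt (2 * pi)) ^ DIM('a) * of_real (gauss t)"
proof -
  let ?f = "\<lambda>b s. exp (\<i> * of_real (s * (t \<bullet> b))) * complex_of_real (std_normal_density s)"
  have int: "integrable lborel (?f b)" for b
    by (rule Bochner_Integration.integrable_bound[of _ std_normal_density])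
      (auto simp: norm_mult)
  have "(LINT s|lborel. ?f b s) = of_real (exp (- (t \<bullet> b)\<^sup>2 / 2))" for b
  proof -
    have "char std_normal_distribution (t \<bullet> b) = (LINT s|lborel. std_normal_density s *\<^sub>R exp (\<i> * of_real ((t \<bullet> b) * s)))"
      unfolding char_def by (subst integral_density) auto
    then show ?thesis
      by (simp add: char_std_normal_distribution scaleR_conv_of_real mult.commute)
  qed
  moreover have "exp (\<i> * of_real (x \<bullet> t)) = (\<Prod>b\<in>Basis. exp (\<i> * complex_of_real ((x \<bullet> b) * (t \<bullet> b))))" for x
    unfolding euclidean_inner[of x t] by (simp add: exp_sum sum_distrib_left)
  ultimately have eq: "exp (\<i> * of_real (x \<bullet> t)) * of_real (gauss x)
      = of_real (sqrt (2 * pi)) ^ DIM('a) * (\<Prod>b\<in>Basis. ?f b (x \<bullet> b))" for x :: 'a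
    unfolding gauss_prod prod.distrib by simp
  show "integrable lborel (\<lambda>x::'a. exp (\<i> * of_real (x \<bullet> t)) * of_real (gauss x))"
    unfolding eq using lborel_prod_integral(1)[of ?f, OF int] by simp
  have "(\<Prod>b\<in>Basis. LINT s|lborel. ?f b s) = of_real (gauss t)"
  proof -
    have "(\<Prod>b\<in>Basis. LINT s|lborel. ?f b s) = (\<Prod>b\<in>Basis. of_real (exp (- (t \<bullet> b)\<^sup>2 / 2)))"
      by (intro prod.cong) (simp_all only: \<open>\<And>b. (LINT s|lborel. ?f b s) = _\<close>)
    also have "\<dots> = of_real (exp (\<Sum>b\<in>Basis. - (t \<bullet> b)\<^sup>2 / 2))"
      by (simp only: exp_sum[OF finite_Basis] of_real_prod)
    also have "(\<Sum>b\<in>Basis. - (t \<bullet> b)\<^sup>2 / 2) = - (norm t)\<^sup>2 / 2"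
      unfolding power2_norm_eq_inner[of t] euclidean_inner[of t t]
      by (simp add: power2_eq_square sum_divide_distrib sum_negf)
    finally show ?thesis by (simp add: gauss_def)
  qed
  then show "(LINT x::'a|lborel. exp (\<i> * of_real (x \<bullet> t)) * of_real (gauss x))
    = of_real (sqrt (2 * pi)) ^ DIM('a) * of_real (gauss t)"
    unfolding eq using lborel_prod_integral(2)[of ?f, OF int] by simp
qed

lemma gauss_integrable: "integrable lborel (\<lambda>x::'a::euclidean_space. gauss x)"
  using integrable_norm[OF gauss_fourier(1)[of "0::'a"]] by (simp add: abs_of_pos gauss_pos)

text \<open>Gaussian summation: the damped integral over frequencies is an average of
  \<open>F\<close> at scale \<open>e\<close>, and both expressions converge as \<open>e\<close>
  tends to 0. Evaluation at 0 suffices, since other points are reached by translating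
  \<open>F\<close>.\<close>

lemma fourier_inversion_0:
  fixes F :: "'a::euclidean_space \<Rightarrow> complex"
  assumes c: "continuous_on UNIV F" and i: "integrable lborel F" and B: "\<And>x. cmod (F x) \<le> B"
    and h: "integrable lborel (\<lambda>\<xi>. LINT t|lborel. F t * exp (- \<i> * of_real (t \<bullet> \<xi>)))"
  shows "(LINT \<xi>|lborel. LINT t|lborel. F t * exp (- \<i> * of_real (t \<bullet> \<xi>))) = of_real ((2 * pi) ^ DIM('a)) * F 0"
proof -
  let ?Fh = "\<lambda>\<xi>. LINT t|lborel. F t * exp (- \<i> * of_real (t \<bullet> \<xi>))"
  have [measurable]: "F \<in> borel_measurable borel" using i by measurable
  let ?k = "complex_of_real (sqrt (2 * pi)) ^ DIM('a)"
  \<comment> \<open>Exchange of the integrals, then rescaling: damping by a wide Gaussian in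
    frequency becomes averaging with a narrow Gaussian in position.\<close>
  have eq: "(LINT \<xi>|lborel. ?Fh \<xi> * of_real (gauss (e *\<^sub>R \<xi>))) = ?k * (LINT s|lborel. F (e *\<^sub>R s) * of_real (gauss s))"
    if e: "e > 0" for e :: real
  proof -
    have ge: "integrable lborel (\<lambda>\<xi>::'a. gauss (e *\<^sub>R \<xi>))"
      using lborel_scale(1)[of e "gauss :: 'a \<Rightarrow> real"] e gauss_integrable by simp
    have "(LINT \<xi>|lborel. ?Fh \<xi> * of_real (gauss (e *\<^sub>R \<xi>)))
        = (LINT \<xi>|lborel. LINT t|lborel. F t * exp (- \<i> * of_real (t \<bullet> \<xi>)) * of_real (gauss (e *\<^sub>R \<xi>)))"
      by simp
    also have "\<dots> = (LINT t|lborel. LINT \<xi>|lborel. F t * exp (- \<i> * of_real (t \<bullet> \<xi>)) * of_real (gauss (e *\<^sub>R \<xi>)))"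
    proof (rule fubini_dominated(2)[where u = "\<lambda>\<xi>. gauss (e *\<^sub>R \<xi>)" and v = "\<lambda>t. cmod (F t)"])
      show "cmod (F t * exp (- \<i> * of_real (t \<bullet> \<xi>)) * of_real (gauss (e *\<^sub>R \<xi>))) \<le> gauss (e *\<^sub>R \<xi>) * cmod (F t)" for t \<xi>
        using gauss_pos[of "e *\<^sub>R \<xi>"] by (simp add: norm_mult)
    qed (use ge i in \<open>auto\<close>)
    also have "\<dots> = (LINT t|lborel. F t * (?k * (of_real (gauss (t /\<^sub>R e)) / of_real (e ^ DIM('a)))))"
    proof (intro Bochner_Integration.integral_cong refl)
      fix t :: 'a
      have "(LINT \<xi>|lborel. exp (\<i> * of_real ((e *\<^sub>R \<xi>) \<bullet> (- (t /\<^sub>R e)))) * of_real (gauss (e *\<^sub>R \<xi>)))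
          = ?k * of_real (gauss (t /\<^sub>R e)) / of_real (e ^ DIM('a))"
        using lborel_scale(2)[of e "\<lambda>\<xi>. exp (\<i> * of_real (\<xi> \<bullet> (- (t /\<^sub>R e)))) * complex_of_real (gauss \<xi>)"]
          gauss_fourier(2)[of "- (t /\<^sub>R e)"] e
        by (simp add: scaleR_conv_of_real field_simps gauss_def)
      moreover have "(e *\<^sub>R \<xi>) \<bullet> (- (t /\<^sub>R e)) = - (t \<bullet> \<xi>)" for \<xi>
        using e by (simp add: inner_commute)
      ultimately show "(LINT \<xi>|lborel. F t * exp (- \<i> * of_real (t \<bullet> \<xi>)) * of_real (gauss (e *\<^sub>R \<xi>)))
          = F t * (?k * (of_real (gauss (t /\<^sub>R e)) / of_real (e ^ DIM('a))))"
        by (simp only:) (simp add: mult.assoc)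
    qed
    also have "\<dots> = e ^ DIM('a) *\<^sub>R (LINT s|lborel. F (e *\<^sub>R s) * (?k * (of_real (gauss s) / of_real (e ^ DIM('a)))))"
      using lborel_scale(2)[of e "\<lambda>t. F t * (?k * (of_real (gauss (t /\<^sub>R e)) / of_real (e ^ DIM('a))))"] e by simp
    also have "\<dots> = (LINT s|lborel. e ^ DIM('a) *\<^sub>R (F (e *\<^sub>R s) * (?k * (of_real (gauss s) / of_real (e ^ DIM('a))))))"
      by (rule integral_scaleR_right[symmetric]) 
    also have "\<dots> = (LINT s|lborel. ?k * (F (e *\<^sub>R s) * of_real (gauss s)))"
    proof (intro Bochner_Integration.integral_cong refl)
      have "E * (a * (k * (g / E))) = k * (a * g)" if "E \<noteq> 0" for E a k g :: complex
        using that by simp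
      then show "e ^ DIM('a) *\<^sub>R (F (e *\<^sub>R s) * (?k * (of_real (gauss s) / of_real (e ^ DIM('a)))))
          = ?k * (F (e *\<^sub>R s) * of_real (gauss s))" for s
        unfolding scaleR_conv_of_real by this (use e in auto)
    qed
    also have "\<dots> = ?k * (LINT s|lborel. F (e *\<^sub>R s) * of_real (gauss s))"
      by (rule integral_mult_right_zero)
    finally show ?thesis .
  qed
  let ?e = "\<lambda>n. inverse (real (Suc n))"
  have inverse_Suc: "0 < ?e n" for n by simp
  have e0: "?e \<longlonglongrightarrow> 0" by (rule LIMSEQ_inverse_real_of_nat)
  have isg: "isCont (gauss :: 'a \<Rightarrow> real) x" for x
    unfolding gauss_def by (intro continuous_intros) simp
  have "(\<lambda>n. LINT \<xi>|lborel. ?Fh \<xi> * of_real (gauss (?e n *\<^sub>R \<xi>))) \<longlonglongrightarrow> (LINT \<xi>|lborel. ?Fh \<xi>)"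
  proof (rule integral_dominated_convergence[where w = "\<lambda>\<xi>. cmod (?Fh \<xi>)"])
    have "(\<lambda>n. ?Fh \<xi> * of_real (gauss (?e n *\<^sub>R \<xi>))) \<longlonglongrightarrow> ?Fh \<xi> * of_real (gauss (0 *\<^sub>R \<xi>))" for \<xi>
      by (intro tendsto_intros isCont_tendsto_compose[OF isg] e0)
    then show "AE \<xi> in lborel. (\<lambda>n. ?Fh \<xi> * of_real (gauss (?e n *\<^sub>R \<xi>))) \<longlonglongrightarrow> ?Fh \<xi>"
      by simp
    show "AE \<xi> in lborel. cmod (?Fh \<xi> * of_real (gauss (?e n *\<^sub>R \<xi>))) \<le> cmod (?Fh \<xi>)" for n
      by (intro AE_I2) (auto simp: norm_mult gauss_le_1 less_imp_le[OF gauss_pos] intro!: mult_right_le_one_le)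
  qed (use h in \<open>auto\<close>)
  moreover have "(\<lambda>n. LINT \<xi>|lborel. ?Fh \<xi> * of_real (gauss (?e n *\<^sub>R \<xi>))) \<longlonglongrightarrow> of_real ((2 * pi) ^ DIM('a)) * F 0"
  proof -
    have "(\<lambda>n. LINT s|lborel. F (?e n *\<^sub>R s) * of_real (gauss s)) \<longlonglongrightarrow> (LINT s::'a|lborel. F 0 * of_real (gauss s))"
    proof (rule integral_dominated_convergence[where w = "\<lambda>s. B * gauss s"])
      have "isCont F x" for x using c by (simp add: continuous_on_eq_continuous_at)
      then have "(\<lambda>n. F (?e n *\<^sub>R s) * of_real (gauss s)) \<longlonglongrightarrow> F (0 *\<^sub>R s) * of_real (gauss s)" for s
        by (intro tendsto_intros isCont_tendsto_compose[of _ F] e0)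
      then show "AE s in lborel. (\<lambda>n. F (?e n *\<^sub>R s) * of_real (gauss s)) \<longlonglongrightarrow> F 0 * of_real (gauss s)"
        by simp
      show "AE s in lborel. cmod (F (?e n *\<^sub>R s) * of_real (gauss s)) \<le> B * gauss s" for n
        using B by (intro AE_I2) (auto simp: norm_mult less_imp_le[OF gauss_pos] intro!: mult_right_mono)
    qed (use gauss_integrable in auto)
    also have "(LINT s::'a|lborel. F 0 * of_real (gauss s)) = F 0 * ?k"
      using gauss_fourier(2)[of "0::'a"] by simp
    finally have "(\<lambda>n. ?k * (LINT s|lborel. F (?e n *\<^sub>R s) * of_real (gauss s))) \<longlonglongrightarrow> ?k * (F 0 * ?k)"
      by (rule tendsto_mult_left)
    \<comment> \<open>One factor (2 pi)^(d/2) comes from transforming the Gaussian, the other from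
      its total mass.\<close>
    moreover have "?k * (F 0 * ?k) = of_real ((2 * pi) ^ DIM('a)) * F 0"
    proof -
      have "?k * ?k = of_real (sqrt (2 * pi) * sqrt (2 * pi)) ^ DIM('a)"
        by (simp only: of_real_mult power_mult_distrib)
      then have "?k * ?k = of_real ((2 * pi) ^ DIM('a))"
        by (simp only: of_real_power real_sqrt_mult_self) simp
      then show ?thesis by (metis mult.assoc mult.commute)
    qed
    ultimately show ?thesis by (simp only: eq[OF inverse_Suc])
  qed
  ultimately show ?thesis by (rule LIMSEQ_unique)
qed

subsection \<open>The reproducing formula\<close>

text \<open>For a fixed translation \<open>x\<close> the integral over frequencies is a Fourier
  inversion, moved from 0 to \<open>y\<close> by substituting \<open>t + y\<close>. It leaves
  \<open>f y\<close> times a product of windows, and the remaining integral over \<open>x\<close> is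
  their inner product.\<close>

lemma synth_stft:
  fixes f :: "'a::euclidean_space \<Rightarrow> complex"
  assumes f: "f \<in> schwartz" and p: "\<phi> \<in> schwartz" and q: "\<psi> \<in> schwartz"
  shows "synth \<psi> (\<lambda>z. L2_inner f (tf_shift z \<phi>)) y = of_real ((2 * pi) ^ DIM('a)) * L2_inner \<psi> \<phi> * f y"
proof -
  let ?c = "complex_of_real ((2 * pi) ^ DIM('a))"
  let ?F = "\<lambda>x t. f (t + y) * cnj (\<phi> (t + y - x))"
  obtain A where A: "\<And>x. cmod (f x) \<le> A" "A \<ge> 0" using schwartz_bounded[OF f] by blast
  obtain B where B: "\<And>x. cmod (\<phi> x) \<le> B" "B \<ge> 0" using schwartz_bounded[OF p] by blast
  have "synth \<psi> (\<lambda>z. L2_inner f (tf_shift z \<phi>)) y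
    = (LINT x|lborel. LINT \<xi>|lborel. L2_inner f (tf_shift (x, \<xi>) \<phi>) * tf_shift (x, \<xi>) \<psi> y)"
    unfolding synth_def
    using schwartz_family_integrable[OF schwartz_family_synth[OF q rapid_stft[OF p f]], of y]
    by (rule integral_phase_space)
  also have "\<dots> = (LINT x|lborel. ?c * f y * (\<psi> (y - x) * cnj (\<phi> (y - x))))"
  proof (intro Bochner_Integration.integral_cong refl)
    fix x
    have Fh: "L2_inner f (tf_shift (x, \<xi>) \<phi>) * exp (\<i> * of_real (y \<bullet> \<xi>)) = (LINT t|lborel. ?F x t * exp (- \<i> * of_real (t \<bullet> \<xi>)))" for \<xi>
    proof -
      have "L2_inner f (tf_shift (x, \<xi>) \<phi>) * exp (\<i> * of_real (y \<bullet> \<xi>))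
          = (LINT t|lborel. f t * cnj (\<phi> (t - x)) * exp (- \<i> * of_real ((t - y) \<bullet> \<xi>)))"
        unfolding L2_inner_def integral_mult_left_zero[symmetric]
      proof (intro Bochner_Integration.integral_cong refl)
        fix t
        have "exp (- \<i> * of_real ((t - y) \<bullet> \<xi>)) = exp (- \<i> * of_real (t \<bullet> \<xi>)) * exp (\<i> * of_real (y \<bullet> \<xi>))"
          by (simp add: inner_diff_left algebra_simps flip: exp_add)
        then show "f t * cnj (tf_shift (x, \<xi>) \<phi> t) * exp (\<i> * of_real (y \<bullet> \<xi>))
            = f t * cnj (\<phi> (t - x)) * exp (- \<i> * of_real ((t - y) \<bullet> \<xi>))"
          by (simp add: tf_shift_apply exp_cnj mult_ac)
      qed
      also have "\<dots> = (LINT t|lborel. ?F x t * exp (- \<i> * of_real (t \<bullet> \<xi>)))"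
        using lborel_translate(2)[of "\<lambda>t. f t * cnj (\<phi> (t - x)) * exp (- \<i> * of_real ((t - y) \<bullet> \<xi>))" y] by simp
      finally show ?thesis .
    qed
    have "(LINT \<xi>|lborel. LINT t|lborel. ?F x t * exp (- \<i> * of_real (t \<bullet> \<xi>))) = ?c * ?F x 0"
    proof (rule fourier_inversion_0)
      show "continuous_on UNIV (?F x)"
        by (intro continuous_intros continuous_on_compose2[OF continuous_on_smooth[OF schwartz_smooth[OF f]]]
            continuous_on_compose2[OF continuous_on_smooth[OF schwartz_smooth[OF p]]]) auto
      have "integrable lborel (\<lambda>t. f t * cnj (tf_shift (x, 0) \<phi> t))"
        by (intro L2_integrable_schwartz f schwartz_tf_shift p)
      then show "integrable lborel (?F x)"
        using lborel_translate(1)[of "\<lambda>t. f t * cnj (tf_shift (x, 0) \<phi> t)" y] by (simp add: tf_shift_apply)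
      show "cmod (?F x t) \<le> A * B" for t
        unfolding norm_mult complex_mod_cnj using A B by (intro mult_mono) auto
      \<comment> \<open>By \<open>Fh\<close> the Fourier transform of this slice is a short-time
        Fourier transform up to a phase, whose decay on phase space includes decay in the frequency
        alone.\<close>
      show "integrable lborel (\<lambda>\<xi>. LINT t|lborel. ?F x t * exp (- \<i> * of_real (t \<bullet> \<xi>)))"
      proof -
        let ?s = "2 * real DIM('a)"
        obtain C where C: "C \<ge> 0" "\<And>z. cmod (L2_inner f (tf_shift z \<phi>)) \<le> C * wt (- ?s) z"
          using stft_decay[OF p f] by blast
        have [measurable]: "f \<in> borel_measurable borel" "\<phi> \<in> borel_measurable borel"
          using f p by (auto intro: schwartz_measurable)
        have "integrable lborel (\<lambda>\<xi>. L2_inner f (tf_shift (x, \<xi>) \<phi>) * exp (\<i> * of_real (y \<bullet> \<xi>)))"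
        proof (rule integrable_wt_bound[of _ C ?s])
          show "(\<lambda>\<xi>. L2_inner f (tf_shift (x, \<xi>) \<phi>) * exp (\<i> * of_real (y \<bullet> \<xi>))) \<in> borel_measurable borel"
            unfolding L2_inner_def tf_shift_apply fst_conv snd_conv by measurable
          fix \<xi>
          have "cmod (L2_inner f (tf_shift (x, \<xi>) \<phi>) * exp (\<i> * of_real (y \<bullet> \<xi>))) \<le> C * wt (- ?s) (x, \<xi>)"
            using C(2)[of "(x, \<xi>)"] by (simp add: norm_mult)
          also have "\<dots> \<le> C * wt (- ?s) \<xi>"
            using C(1) bracket_snd_le[of "(x, \<xi>)"] by (intro mult_left_mono powr_mono2') auto
          finally show "cmod (L2_inner f (tf_shift (x, \<xi>) \<phi>) * exp (\<i> * of_real (y \<bullet> \<xi>))) \<le> C * wt (- ?s) \<xi>" .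
        qed simp
        then show ?thesis unfolding Fh .
      qed
    qed
    then have "(LINT \<xi>|lborel. L2_inner f (tf_shift (x, \<xi>) \<phi>) * exp (\<i> * of_real (y \<bullet> \<xi>))) = ?c * ?F x 0"
      unfolding Fh .
    then have "(LINT \<xi>|lborel. (L2_inner f (tf_shift (x, \<xi>) \<phi>) * exp (\<i> * of_real (y \<bullet> \<xi>))) * \<psi> (y - x)) = ?c * ?F x 0 * \<psi> (y - x)"
      by simp
    then show "(LINT \<xi>|lborel. L2_inner f (tf_shift (x, \<xi>) \<phi>) * tf_shift (x, \<xi>) \<psi> y) = ?c * f y * (\<psi> (y - x) * cnj (\<phi> (y - x)))"
      by (simp add: tf_shift_apply mult_ac)
  qed
  also have "\<dots> = ?c * f y * L2_inner \<psi> \<phi>"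
    using lborel_reflect(2)[of "\<lambda>x. \<psi> x * cnj (\<phi> x)" y] by (simp add: L2_inner_def)
  finally show ?thesis by (simp add: mult_ac)
qed

text \<open>A vanishing norm gives \<open>f = 0\<close> almost everywhere only; by continuity the
  set where \<open>f\<close> does not vanish is open, and a nonempty open set is not
  negligible.\<close>

lemma L2_inner_self_pos:
  fixes f :: "'a::euclidean_space \<Rightarrow> complex"
  assumes f: "f \<in> schwartz" and "f \<noteq> (\<lambda>_. 0)"
  obtains k where "k > 0" "L2_inner f f = of_real k"
proof -
  define k where "k = (LINT x|lborel. (cmod (f x))\<^sup>2)"
  have eq: "f x * cnj (f x) = of_real ((cmod (f x))\<^sup>2)" for x
    by (simp only: complex_norm_square)
  have L: "L2_inner f f = of_real k"
    unfolding L2_inner_def k_def eq by (simp only: integral_complex_of_real)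
  have i: "integrable lborel (\<lambda>x. (cmod (f x))\<^sup>2)"
    using L2_integrable_schwartz[OF f f] unfolding eq complex_of_real_integrable_eq .
  have "k \<noteq> 0"
  proof
    assume "k = 0"
    then have ae: "AE x in lborel. (cmod (f x))\<^sup>2 = 0"
      unfolding k_def using integral_nonneg_eq_0_iff_AE[OF i] by simp
    obtain x0 where x0: "f x0 \<noteq> 0" using assms(2) by blast
    have "open {x. f x \<noteq> 0}"
      using continuous_on_smooth[OF schwartz_smooth[OF f]] by (intro open_Collect_neq continuous_on_const) auto
    then have "\<not> negligible {x. f x \<noteq> 0}"
      using x0 open_not_negligible by blast
    moreover have "negligible {x. f x \<noteq> 0}"
    proof -
      have "AE x in lebesgue. x \<notin> {x. f x \<noteq> 0}"
        using AE_completion[OF ae] by simp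
      moreover have "{x. f x \<noteq> 0} \<in> sets lebesgue"
        using borel_open[OF \<open>open {x. f x \<noteq> 0}\<close>] by simp
      ultimately show ?thesis
        unfolding negligible_iff_null_sets using AE_iff_null_sets by blast
    qed
    ultimately show False by blast
  qed
  moreover have "k \<ge> 0" unfolding k_def by simp
  ultimately show ?thesis using that L by simp
qed

subsection \<open>Tempered distributions\<close>

context
  fixes u :: "('a::euclidean_space \<Rightarrow> complex) \<Rightarrow> complex"
  assumes u: "tempered_distribution u"
begin

lemma tempered_add: "f \<in> schwartz \<Longrightarrow> g \<in> schwartz \<Longrightarrow> u (\<lambda>x. f x + g x) = u f + u g"
  using u unfolding tempered_distribution_def by blast

lemma tempered_cmult: "f \<in> schwartz \<Longrightarrow> u (\<lambda>x. c * f x) = cnj c * u f"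
  using u unfolding tempered_distribution_def by blast

lemma tempered_zero: "u (\<lambda>x. 0) = 0"
  using tempered_cmult[OF schwartz_zero, of 0] by simp

lemma tempered_diff: "f \<in> schwartz \<Longrightarrow> g \<in> schwartz \<Longrightarrow> u (\<lambda>x. f x - g x) = u f - u g"
  using tempered_add[of f "\<lambda>x. -1 * g x"] tempered_cmult[of g "-1"] schwartz_cmult[of g "-1"] by simp

lemma tempered_sum:
  assumes "finite I" "\<And>i. i \<in> I \<Longrightarrow> f i \<in> schwartz"
  shows "u (\<lambda>x. \<Sum>i\<in>I. c i * f i x) = (\<Sum>i\<in>I. cnj (c i) * u (f i))"
  using assms
proof (induction I rule: finite_induct)
  case (insert i I)
  then have "(\<lambda>x. \<Sum>i\<in>I. c i * f i x) \<in> schwartz"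
    by (intro schwartz_sum schwartz_cmult) auto
  then show ?case
    using insert by (simp add: tempered_add tempered_cmult schwartz_cmult)
qed (simp add: tempered_zero)

lemma schwartz_seminorm_upper:
  assumes "f \<in> schwartz" "set bs \<subseteq> Basis"
  shows "bracket x ^ N * cmod (partial_derivs bs f x) \<le> schwartz_seminorm N bs f"
  unfolding schwartz_seminorm_def using assms
  by (intro cSUP_upper) (auto simp: schwartz_def)

lemma schwartz_seminorm_least:
  assumes "\<And>x. bracket x ^ N * cmod (partial_derivs bs f x) \<le> B"
  shows "schwartz_seminorm N bs f \<le> B"
  unfolding schwartz_seminorm_def using assms by (intro cSUP_least) auto

text \<open>Induction on the generation of the open set: an intersection unites the finite sets of
  seminorms and takes the smaller radius, a union needs only the member that contains 0.\<close>

lemma schwartz_neighbourhood: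
  fixes U :: "('a \<Rightarrow> complex) set"
  assumes "openin schwartz_topology U" "(\<lambda>x. 0) \<in> U"
  shows "\<exists>J \<delta>. finite J \<and> (\<forall>(N, bs)\<in>J. set bs \<subseteq> Basis) \<and> \<delta> > 0 \<and>
    (\<forall>g\<in>schwartz. (\<forall>(N, bs)\<in>J. schwartz_seminorm N bs g < \<delta>) \<longrightarrow> g \<in> U)"
  using assms unfolding schwartz_topology_def openin_topology_generated_by_iff
proof (induction U rule: generate_topology_on.induct)
  case Empty
  then show ?case by simp
next
  case (Int A B)
  obtain J d where J: "finite J" "\<forall>(N, bs)\<in>J. set bs \<subseteq> Basis" "d > 0"
    "\<forall>g\<in>schwartz. (\<forall>(N, bs)\<in>J. schwartz_seminorm N bs g < d) \<longrightarrow> g \<in> A" using Int by auto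
  obtain K e where K: "finite K" "\<forall>(N, bs)\<in>K. set bs \<subseteq> Basis" "e > 0"
    "\<forall>g\<in>schwartz. (\<forall>(N, bs)\<in>K. schwartz_seminorm N bs g < e) \<longrightarrow> g \<in> B" using Int by auto
  show ?case
  proof (intro exI[of _ "J \<union> K"] exI[of _ "min d e"] conjI ballI impI)
    fix g :: "'a \<Rightarrow> complex"
    assume g: "g \<in> schwartz" "\<forall>(N, bs)\<in>J \<union> K. schwartz_seminorm N bs g < min d e"
    then have "\<forall>(N, bs)\<in>J. schwartz_seminorm N bs g < d" "\<forall>(N, bs)\<in>K. schwartz_seminorm N bs g < e"
      by fastforce+
    then show "g \<in> A \<inter> B" using J(4) K(4) g(1) by blast
  qed (use J K in auto)
next
  case (UN K)
  then obtain k where "k \<in> K" "(\<lambda>x. 0) \<in> k" by blast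
  with UN.IH[of k] obtain J d where "finite J" "\<forall>(N, bs)\<in>J. set bs \<subseteq> Basis" "d > 0"
    "\<forall>g\<in>schwartz. (\<forall>(N, bs)\<in>J. schwartz_seminorm N bs g < d) \<longrightarrow> g \<in> k" by blast
  then show ?case using \<open>k \<in> K\<close> by (intro exI[of _ J] exI[of _ d]) blast
next
  case (Basis s)
  then obtain N bs f e where s: "s = {g \<in> schwartz. schwartz_seminorm N bs (\<lambda>x. g x - f x) < e}"
    and bs: "set bs \<subseteq> Basis" and f: "f \<in> schwartz" and e: "e > 0" by blast
  let ?f = "\<lambda>x. 0 - f x"
  have f': "?f \<in> schwartz" by (intro schwartz_diff schwartz_zero f)
  have p: "schwartz_seminorm N bs ?f < e" using Basis.prems s by simp
  show ?case
  \<comment> \<open>The subbasic set is centred at \<open>f\<close>, not at 0; by the triangle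
    inequality a ball around 0 fits in once the seminorm of \<open>f\<close> is subtracted from the
    radius.\<close>
  proof (intro exI[of _ "{(N, bs)}"] exI[of _ "e - schwartz_seminorm N bs ?f"] conjI ballI impI)
    fix g :: "'a \<Rightarrow> complex"
    assume g: "g \<in> schwartz"
      "\<forall>(M, cs)\<in>{(N, bs)}. schwartz_seminorm M cs g < e - schwartz_seminorm N bs ?f"
    have "schwartz_seminorm N bs (\<lambda>x. g x - f x) \<le> schwartz_seminorm N bs g + schwartz_seminorm N bs ?f"
    proof (rule schwartz_seminorm_least)
      fix x
      have "partial_derivs bs (\<lambda>x. g x - f x) x = partial_derivs bs g x + partial_derivs bs ?f x"
        using partial_derivs_add[OF schwartz_smooth[OF g(1)] schwartz_smooth[OF f'] bs] by simp
      then have "bracket x ^ N * cmod (partial_derivs bs (\<lambda>x. g x - f x) x)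
        \<le> bracket x ^ N * (cmod (partial_derivs bs g x) + cmod (partial_derivs bs ?f x))"
        by (metis norm_triangle_ineq mult_left_mono bracket_nonneg zero_le_power)
      also have "\<dots> \<le> schwartz_seminorm N bs g + schwartz_seminorm N bs ?f"
        unfolding distrib_left by (intro add_mono schwartz_seminorm_upper g f' bs)
      finally show "bracket x ^ N * cmod (partial_derivs bs (\<lambda>x. g x - f x) x)
        \<le> schwartz_seminorm N bs g + schwartz_seminorm N bs ?f" .
    qed
    then show "g \<in> s" using g unfolding s by auto
  qed (use bs p in auto)
qed

text \<open>Continuity at 0 provides a neighbourhood mapped into the unit ball, and homogeneity
  turns it into an estimate by finitely many seminorms. It is phrased with a common positive bound
  \<open>B\<close>, which can be checked pointwise and by which one can divide.\<close>

lemma tempered_bound: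
  "\<exists>(J :: (nat \<times> 'a list) set) C. finite J \<and> (\<forall>N bs. (N, bs) \<in> J \<longrightarrow> set bs \<subseteq> Basis) \<and> C \<ge> 0 \<and>
    (\<forall>f\<in>schwartz. \<forall>B>0. (\<forall>N bs y. (N, bs) \<in> J \<longrightarrow> bracket y ^ N * cmod (partial_derivs bs f y) \<le> B)
      \<longrightarrow> cmod (u f) \<le> C * B)"
proof -
  let ?U = "{f \<in> topspace schwartz_topology. u f \<in> ball 0 1}"
  have "openin schwartz_topology ?U"
    using u unfolding tempered_distribution_def by (intro openin_continuous_map_preimage) auto
  moreover have "(\<lambda>x. 0) \<in> ?U"
  proof -
    have "(\<lambda>x::'a. 0::complex) \<in> {g \<in> schwartz. schwartz_seminorm 0 [] (\<lambda>x. g x - 0) < 1}"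
      using schwartz_zero by (simp add: schwartz_seminorm_def)
    moreover have "{g \<in> schwartz. schwartz_seminorm 0 [] (\<lambda>x. g x - 0) < 1}
      \<in> {{g \<in> schwartz. schwartz_seminorm N bs (\<lambda>x. g x - f x) < e} | N bs f e.
        set bs \<subseteq> Basis \<and> f \<in> (schwartz :: ('a \<Rightarrow> complex) set) \<and> e > 0}"
      using schwartz_zero by (intro CollectI exI[of _ 0] exI[of _ "[]"] exI[of _ "\<lambda>x. 0"] exI[of _ 1]) auto
    ultimately have "(\<lambda>x::'a. 0::complex) \<in> topspace schwartz_topology"
      unfolding schwartz_topology_def topology_generated_by_topspace by blast
    then show ?thesis by (simp add: tempered_zero)
  qed
  ultimately have "\<exists>J \<delta>. finite J \<and> (\<forall>(N, bs)\<in>J. set bs \<subseteq> Basis) \<and> \<delta> > 0 \<and>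
    (\<forall>g\<in>schwartz. (\<forall>(N, bs)\<in>J. schwartz_seminorm N bs g < \<delta>) \<longrightarrow> g \<in> ?U)"
    by (rule schwartz_neighbourhood)
  then obtain J \<delta> where J: "finite J" "\<forall>(N, bs)\<in>J. set bs \<subseteq> Basis" "\<delta> > 0"
    "\<forall>g\<in>schwartz. (\<forall>(N, bs)\<in>J. schwartz_seminorm N bs g < \<delta>) \<longrightarrow> g \<in> ?U"
    by (elim exE conjE)
  have "cmod (u f) \<le> (2 / \<delta>) * B"
    if f: "f \<in> schwartz" and B: "B > 0" and
      b: "\<forall>N bs y. (N, bs) \<in> J \<longrightarrow> bracket y ^ N * cmod (partial_derivs bs f y) \<le> B" for f B
  proof -
    \<comment> \<open>Chosen so that the seminorms of the scaled function are at most \<delta> / 2,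
      which is strictly below \<delta>.\<close>
    define c where "c = \<delta> / (2 * B)"
    have c: "c > 0" using J(3) B by (simp add: c_def)
    have "schwartz_seminorm N bs (\<lambda>x. of_real c * f x) < \<delta>" if "(N, bs) \<in> J" for N bs
    proof -
      have "schwartz_seminorm N bs (\<lambda>x. of_real c * f x) \<le> \<delta> / 2"
      proof (rule schwartz_seminorm_least)
        fix x
        have "set bs \<subseteq> Basis" using J(2) that by auto
        then have "bracket x ^ N * cmod (partial_derivs bs (\<lambda>x. of_real c * f x) x)
          = c * (bracket x ^ N * cmod (partial_derivs bs f x))"
          using c by (simp add: partial_derivs_cmult schwartz_smooth f norm_mult)
        also have "\<dots> \<le> c * B" using b that c by (intro mult_left_mono) auto
        finally show "bracket x ^ N * cmod (partial_derivs bs (\<lambda>x. of_real c * f x) x) \<le> \<delta> / 2"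
          using B by (simp add: c_def)
      qed
      then show ?thesis using J(3) by simp
    qed
    then have "(\<lambda>x. of_real c * f x) \<in> ?U"
      using J(4) schwartz_cmult[OF f] by blast
    then have "c * cmod (u f) < 1"
      using c by (simp add: tempered_cmult f norm_mult)
    then show ?thesis
      using J(3) B by (simp add: c_def field_simps)
  qed
  note bound = this
  have "\<forall>N bs. (N, bs) \<in> J \<longrightarrow> set bs \<subseteq> Basis" "0 \<le> 2 / \<delta>"
    using J(2,3) by auto
  with J(1) show ?thesis
    by (intro exI[of _ J] exI[of _ "2 / \<delta>"] conjI ballI allI impI bound)
      (simp_all add: Ball_def)
qed

end

text \<open>Each derivative splits the difference in three: the frequency factor changes, the shift
  changes under a fixed frequency factor, or the derivative falls on the window. The middle term
  costs one more power of the bracket.\<close>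

lemma partial_derivs_tf_shift_diff_bound:
  fixes f :: "'a::euclidean_space \<Rightarrow> complex"
  assumes "f \<in> schwartz" "set bs \<subseteq> Basis"
  shows "\<exists>C\<ge>0. \<forall>z w y. cmod (partial_derivs bs (tf_shift z f) y - partial_derivs bs (tf_shift w f) y)
    \<le> C * (wt (\<bar>t\<bar> + 1 + real (length bs)) z * wt (\<bar>t\<bar> + 1 + real (length bs)) w * norm (z - w) * wt (- t) y)"
  using assms
proof (induction bs arbitrary: f rule: rev_induct)
  case Nil
  show ?case using tf_shift_diff_bound[OF Nil(1), of t] by (simp add: mult.assoc)
next
  case (snoc b bs)
  let ?p = "\<bar>t\<bar> + 1 + real (length bs)" 
  have b: "b \<in> Basis" and bs: "set bs \<subseteq> Basis" using snoc.prems by auto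
  obtain A where A: "A \<ge> 0" "\<And>z y. cmod (partial_derivs bs (tf_shift z f) y)
    \<le> A * wt (\<bar>t\<bar> + real (length bs)) z * wt (- t) y"
    using partial_derivs_tf_shift_bound[OF snoc.prems(1) bs] by blast
  obtain C where C: "C \<ge> 0" "\<And>z w y. cmod (partial_derivs bs (tf_shift z f) y - partial_derivs bs (tf_shift w f) y)
    \<le> C * (wt ?p z * wt ?p w * norm (z - w) * wt (- t) y)"
    using snoc.IH[OF snoc.prems(1) bs] by blast
  obtain D where D: "D \<ge> 0" "\<And>z w y. cmod (partial_derivs bs (tf_shift z (dpart b f)) y - partial_derivs bs (tf_shift w (dpart b f)) y)
    \<le> D * (wt ?p z * wt ?p w * norm (z - w) * wt (- t) y)"
    using snoc.IH[OF schwartz_dpart[OF snoc.prems(1) b] bs] by blast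
  have "cmod (partial_derivs (bs @ [b]) (tf_shift z f) y - partial_derivs (bs @ [b]) (tf_shift w f) y)
      \<le> (A + C + D) * (wt (?p + 1) z * wt (?p + 1) w * norm (z - w) * wt (- t) y)" for z w y
  proof -
    let ?X = "wt (?p + 1) z * wt (?p + 1) w * norm (z - w) * wt (- t) y"
    let ?d = "\<lambda>g z. partial_derivs bs (tf_shift z g) y"
    have "\<bar>b \<bullet> snd z - b \<bullet> snd w\<bar> \<le> norm (z - w)"
      using Cauchy_Schwarz_ineq2[of b "snd (z - w)"] norm_snd_le[of "snd (z - w)" "fst (z - w)"] b
      by (simp add: inner_diff_right minus_prod_def)
    then have "cmod (of_real (b \<bullet> snd z - b \<bullet> snd w) * ?d f z) \<le> norm (z - w) * (A * wt (\<bar>t\<bar> + real (length bs)) z * wt (- t) y)"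
      unfolding norm_mult norm_of_real by (intro mult_mono A) auto
    also have "\<dots> = A * (wt (\<bar>t\<bar> + real (length bs)) z * 1 * norm (z - w) * wt (- t) y)"
      by (simp only: mult_ac mult_1_right mult_1_left)
    also have "\<dots> \<le> A * ?X"
      using A(1) by (intro mult_left_mono mult_mono wt_mono wt_ge_1) auto
    finally have 1: "cmod (of_real (b \<bullet> snd z - b \<bullet> snd w) * ?d f z) \<le> A * ?X" .
    have "cmod (of_real (b \<bullet> snd w) * (?d f z - ?d f w)) \<le> bracket w * (C * (wt ?p z * wt ?p w * norm (z - w) * wt (- t) y))"
      unfolding norm_mult norm_of_real using inner_snd_le[OF b, of w] by (intro mult_mono C) auto
    also have "\<dots> = C * (wt ?p z * wt (?p + 1) w * norm (z - w) * wt (- t) y)"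
      by (simp add: powr_add mult_ac power2_eq_square)
    also have "\<dots> \<le> C * ?X"
      using C(1) by (intro mult_left_mono mult_right_mono mult_mono wt_mono) auto
    finally have 2: "cmod (of_real (b \<bullet> snd w) * (?d f z - ?d f w)) \<le> C * ?X" .
    have "cmod (?d (dpart b f) z - ?d (dpart b f) w) \<le> D * (wt ?p z * wt ?p w * norm (z - w) * wt (- t) y)"
      by (rule D)
    also have "\<dots> \<le> D * ?X"
      using D(1) by (intro mult_left_mono mult_right_mono mult_mono wt_mono) auto
    finally have 3: "cmod (?d (dpart b f) z - ?d (dpart b f) w) \<le> D * ?X" .
    have "partial_derivs (bs @ [b]) (tf_shift z f) y - partial_derivs (bs @ [b]) (tf_shift w f) y
      = \<i> * (of_real (b \<bullet> snd z - b \<bullet> snd w) * ?d f z) + \<i> * (of_real (b \<bullet> snd w) * (?d f z - ?d f w))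
        + (?d (dpart b f) z - ?d (dpart b f) w)"
      unfolding tf_shift_partial_derivs_snoc[OF snoc.prems(1) b bs] by (simp add: algebra_simps)
    moreover have "cmod (\<i> * (of_real (b \<bullet> snd z - b \<bullet> snd w) * ?d f z) + \<i> * (of_real (b \<bullet> snd w) * (?d f z - ?d f w))
        + (?d (dpart b f) z - ?d (dpart b f) w)) \<le> A * ?X + C * ?X + D * ?X"
      by (intro norm_triangle_mono 3) (use 1 2 in \<open>simp_all add: norm_mult\<close>)
    ultimately show ?thesis by (simp only: distrib_right)
  qed
  then show ?case using A(1) C(1) D(1) by (intro exI[of _ "A + C + D"]) (auto simp: add.assoc)
qed

text \<open>Supplies the bounds for the finite set \<open>J\<close> of seminorms that
  \<open>tempered_bound\<close> returns, with one constant and one exponent for all of them.\<close>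

lemma finite_tf_shift_bounds:
  fixes f :: "'a::euclidean_space \<Rightarrow> complex"
  assumes "finite J" "\<forall>N bs. (N::nat, bs) \<in> J \<longrightarrow> set bs \<subseteq> Basis" "f \<in> schwartz"
  shows "\<exists>C>0. \<exists>P\<ge>0. \<forall>N bs y z w. (N, bs) \<in> J \<longrightarrow>
      bracket y ^ N * cmod (partial_derivs bs (tf_shift z f) y) \<le> C * wt P z \<and>
      bracket y ^ N * cmod (partial_derivs bs (tf_shift z f) y - partial_derivs bs (tf_shift w f) y)
        \<le> C * (wt P z * wt P w * norm (z - w))"
  using assms(1,2)
proof (induction J rule: finite_induct)
  case empty
  then show ?case by (intro exI[of _ 1] conjI exI[of _ 0]) auto
next
  case (insert j J)
  obtain M cs where j: "j = (M, cs)" by (cases j)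
  have cs: "set cs \<subseteq> Basis" using insert.prems j by auto
  obtain C P where C: "C > 0" "P \<ge> 0" and CP: "\<And>N bs y z w. (N, bs) \<in> J \<Longrightarrow>
      bracket y ^ N * cmod (partial_derivs bs (tf_shift z f) y) \<le> C * wt P z \<and>
      bracket y ^ N * cmod (partial_derivs bs (tf_shift z f) y - partial_derivs bs (tf_shift w f) y)
        \<le> C * (wt P z * wt P w * norm (z - w))"
    using insert.IH insert.prems by blast
  obtain A where A: "A \<ge> 0" "\<And>z y. cmod (partial_derivs cs (tf_shift z f) y)
      \<le> A * wt (\<bar>real M\<bar> + real (length cs)) z * wt (- real M) y"
    using partial_derivs_tf_shift_bound[OF assms(3) cs] by blast
  obtain B where B: "B \<ge> 0" "\<And>z w y. cmod (partial_derivs cs (tf_shift z f) y - partial_derivs cs (tf_shift w f) y)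
    \<le> B * (wt (\<bar>real M\<bar> + 1 + real (length cs)) z * wt (\<bar>real M\<bar> + 1 + real (length cs)) w * norm (z - w) * wt (- real M) y)"
    using partial_derivs_tf_shift_diff_bound[OF assms(3) cs] by blast
  define Q where "Q = P + (\<bar>real M\<bar> + 1 + real (length cs))"
  have Q: "P \<le> Q" "\<bar>real M\<bar> + real (length cs) \<le> Q" "\<bar>real M\<bar> + 1 + real (length cs) \<le> Q" "0 \<le> Q"
    using C by (auto simp: Q_def)
  have wM: "bracket y ^ M * wt (- real M) y = 1" for y :: 'a
    by (simp add: powr_minus powr_realpow)
  have "bracket y ^ N * cmod (partial_derivs bs (tf_shift z f) y) \<le> (C + A + B) * wt Q z \<and>
      bracket y ^ N * cmod (partial_derivs bs (tf_shift z f) y - partial_derivs bs (tf_shift w f) y)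
        \<le> (C + A + B) * (wt Q z * wt Q w * norm (z - w))" if "(N, bs) \<in> insert j J" for N bs y z w
  proof (cases "(N, bs) = j")
    case True
    then have Nb: "N = M" "bs = cs" using j by auto
    have "bracket y ^ M * cmod (partial_derivs cs (tf_shift z f) y)
        \<le> bracket y ^ M * (A * wt (\<bar>real M\<bar> + real (length cs)) z * wt (- real M) y)"
      by (intro mult_left_mono A) auto
    also have "\<dots> = A * wt (\<bar>real M\<bar> + real (length cs)) z * (bracket y ^ M * wt (- real M) y)"
      by (simp only: mult_ac)
    also have "\<dots> \<le> (C + A + B) * wt Q z"
      unfolding wM mult_1_right using A(1) B(1) C(1) Q by (intro mult_mono wt_mono) auto
    finally have 1: "bracket y ^ M * cmod (partial_derivs cs (tf_shift z f) y) \<le> (C + A + B) * wt Q z" .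
    have "bracket y ^ M * cmod (partial_derivs cs (tf_shift z f) y - partial_derivs cs (tf_shift w f) y)
        \<le> bracket y ^ M * (B * (wt (\<bar>real M\<bar> + 1 + real (length cs)) z * wt (\<bar>real M\<bar> + 1 + real (length cs)) w * norm (z - w) * wt (- real M) y))"
      by (intro mult_left_mono B) auto
    also have "\<dots> = B * (wt (\<bar>real M\<bar> + 1 + real (length cs)) z * wt (\<bar>real M\<bar> + 1 + real (length cs)) w * norm (z - w)) * (bracket y ^ M * wt (- real M) y)"
      by (simp only: mult_ac)
    also have "\<dots> \<le> (C + A + B) * (wt Q z * wt Q w * norm (z - w))"
      unfolding wM mult_1_right using A(1) B(1) C(1) Q by (intro mult_mono mult_right_mono wt_mono) auto
    finally show ?thesis using 1 Nb by blast
  next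
    case False
    then have "(N, bs) \<in> J" using that by auto
    from CP[OF this, of y z w]
    have "bracket y ^ N * cmod (partial_derivs bs (tf_shift z f) y) \<le> C * wt P z"
      "bracket y ^ N * cmod (partial_derivs bs (tf_shift z f) y - partial_derivs bs (tf_shift w f) y)
        \<le> C * (wt P z * wt P w * norm (z - w))" by auto
    moreover have "C * wt P z \<le> (C + A + B) * wt Q z"
      using A(1) B(1) C(1) Q by (intro mult_mono wt_mono) auto
    moreover have "C * (wt P z * wt P w * norm (z - w)) \<le> (C + A + B) * (wt Q z * wt Q w * norm (z - w))"
      using A(1) B(1) C(1) Q by (intro mult_mono mult_right_mono wt_mono) auto
    ultimately show ?thesis by linarith
  qed
  note bound = this
  have pos: "0 < C + A + B" using A(1) B(1) C(1) by simp
  show ?case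
    by (rule exI[of _ "C + A + B"], rule conjI[OF pos], rule exI[of _ Q], rule conjI[OF Q(4)],
        intro allI impI, rule bound)
qed

context
  fixes u :: "('a::euclidean_space \<Rightarrow> complex) \<Rightarrow> complex" and \<phi> :: "'a \<Rightarrow> complex"
  assumes u: "tempered_distribution u" and p: "\<phi> \<in> schwartz"
begin

lemma stft_growth_lipschitz:
  obtains C P where "C > 0" "P \<ge> 0" "\<And>z. cmod (stft \<phi> u z) \<le> C * wt P z"
    "\<And>z w. cmod (stft \<phi> u z - stft \<phi> u w) \<le> C * (wt P z * wt P w * norm (z - w))"
proof -
  from tempered_bound[OF u] obtain J :: "(nat \<times> 'a list) set" and D
    where J: "finite J" "\<forall>N bs. (N, bs) \<in> J \<longrightarrow> set bs \<subseteq> Basis" "D \<ge> 0"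
    and b: "\<forall>f\<in>schwartz. \<forall>B>0. (\<forall>N bs y. (N, bs) \<in> J \<longrightarrow> bracket y ^ N * cmod (partial_derivs bs f y) \<le> B)
      \<longrightarrow> cmod (u f) \<le> D * B"
    by (elim exE conjE) (rule that)
  obtain C P where C: "C > 0" "P \<ge> 0" and CP: "\<And>N bs y z w. (N, bs) \<in> J \<Longrightarrow>
      bracket y ^ N * cmod (partial_derivs bs (tf_shift z \<phi>) y) \<le> C * wt P z \<and>
      bracket y ^ N * cmod (partial_derivs bs (tf_shift z \<phi>) y - partial_derivs bs (tf_shift w \<phi>) y)
        \<le> C * (wt P z * wt P w * norm (z - w))"
    using finite_tf_shift_bounds[OF J(1,2) p] by blast
  \<comment> \<open>The summand 1 makes the constant positive even when \<open>D\<close> is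
    0.\<close>
  have "cmod (stft \<phi> u z) \<le> (D * C + 1) * wt P z" for z
  proof -
    have "cmod (stft \<phi> u z) \<le> D * (C * wt P z)"
      unfolding stft_def using C CP by (intro b[rule_format] schwartz_tf_shift p) auto
    also have "\<dots> \<le> (D * C + 1) * wt P z" by (simp add: algebra_simps)
    finally show ?thesis .
  qed
  moreover have "cmod (stft \<phi> u z - stft \<phi> u w) \<le> (D * C + 1) * (wt P z * wt P w * norm (z - w))" for z w
  proof (cases "z = w")
    case False
    have "cmod (u (\<lambda>x. tf_shift z \<phi> x - tf_shift w \<phi> x)) \<le> D * (C * (wt P z * wt P w * norm (z - w)))"
      using C CP False J(2)
      by (intro b[rule_format] schwartz_diff schwartz_tf_shift p)
        (auto simp: partial_derivs_diff schwartz_smooth schwartz_tf_shift p)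
    also have "\<dots> \<le> (D * C + 1) * (wt P z * wt P w * norm (z - w))" by (simp add: algebra_simps)
    finally show ?thesis by (simp add: stft_def tempered_diff[OF u] schwartz_tf_shift p)
  qed simp
  ultimately show ?thesis using that[of "D * C + 1" P] C J(3) by (simp add: add_nonneg_pos)
qed

lemma continuous_stft: "continuous_on UNIV (stft \<phi> u)"
proof -
  obtain C P where C: "C > 0" "P \<ge> 0" 
    and L: "\<And>z w. cmod (stft \<phi> u z - stft \<phi> u w) \<le> C * (wt P z * wt P w * norm (z - w))"
    using stft_growth_lipschitz by metis
  have "((\<lambda>z. stft \<phi> u z - stft \<phi> u w) \<longlongrightarrow> 0) (at w)" for w
  proof (rule Lim_null_comparison)
    show "\<forall>\<^sub>F z in at w. cmod (stft \<phi> u z - stft \<phi> u w) \<le> C * (wt P z * wt P w * norm (z - w))"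
      using L by simp
    have "continuous_on UNIV (\<lambda>z::'a \<times> 'a. C * (wt P z * wt P w * norm (z - w)))"
      by (intro continuous_intros) auto
    then have "isCont (\<lambda>z::'a \<times> 'a. C * (wt P z * wt P w * norm (z - w))) w"
      using continuous_on_eq_continuous_at[OF open_UNIV] by blast
    then have "((\<lambda>z. C * (wt P z * wt P w * norm (z - w))) \<longlongrightarrow> C * (wt P w * wt P w * norm (w - w))) (at w)"
      unfolding isCont_def .
    then show "((\<lambda>z. C * (wt P z * wt P w * norm (z - w))) \<longlongrightarrow> 0) (at w)" by simp
  qed
  then show ?thesis
    unfolding continuous_on_eq_continuous_at[OF open_UNIV] isCont_def
    using LIM_zero_cancel by blast
qed

lemma measurable_stft_distr [measurable]: "stft \<phi> u \<in> borel_measurable borel"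
  by (intro borel_measurable_continuous_onI continuous_stft)

lemma integrable_rapid_stft:
  assumes "rapid H"
  shows "integrable lborel (\<lambda>z. cnj (H z) * stft \<phi> u z)"
proof -
  obtain C P where C: "C > 0" "P \<ge> 0" and g: "\<And>z. cmod (stft \<phi> u z) \<le> C * wt P z"
    using stft_growth_lipschitz by metis
  let ?s = "2 * real DIM('a \<times> 'a)"
  obtain D where D: "D \<ge> 0" "\<And>z. cmod (H z) \<le> D * wt (- ?s - P) z" using rapid_bound[OF assms] by blast
  show ?thesis
  proof (rule integrable_wt_bound[where C = "D * C" and s = ?s])
    have [measurable]: "H \<in> borel_measurable borel" using assms by (simp add: rapid_def)
    show "(\<lambda>z. cnj (H z) * stft \<phi> u z) \<in> borel_measurable borel" by measurable
    fix z
    have "cmod (cnj (H z) * stft \<phi> u z) \<le> (D * wt (- ?s - P) z) * (C * wt P z)"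
      unfolding norm_mult complex_mod_cnj using C D g by (intro mult_mono) auto
    also have "\<dots> = D * C * (wt (- ?s - P) z * wt P z)" by (simp only: mult_ac)
    also have "\<dots> = D * C * wt (- ?s) z" by (simp flip: powr_add)
    finally show "cmod (cnj (H z) * stft \<phi> u z) \<le> D * C * wt (- ?s) z" .
  qed simp
qed

text \<open>The proof approximates the variable of integration by simple functions, for which the integral
  is a finite sum.\<close>

lemma tempered_synth:
  assumes H: "rapid H"
  shows "u (synth \<phi> H) = (LINT z|lborel. cnj (H z) * stft \<phi> u z)"
proof -
  have [measurable]: "H \<in> borel_measurable borel" using H by (simp add: rapid_def)
  from tempered_bound[OF u] obtain J :: "(nat \<times> 'a list) set" and D
    where J: "finite J" "\<forall>N bs. (N, bs) \<in> J \<longrightarrow> set bs \<subseteq> Basis" "D \<ge> 0"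
    and b: "\<forall>f\<in>schwartz. \<forall>B>0. (\<forall>N bs y. (N, bs) \<in> J \<longrightarrow> bracket y ^ N * cmod (partial_derivs bs f y) \<le> B)
      \<longrightarrow> cmod (u f) \<le> D * B"
    by (elim exE conjE) (rule that)
  obtain C P where C: "C > 0" "P \<ge> 0" and CP: "\<And>N bs y z w. (N, bs) \<in> J \<Longrightarrow>
      bracket y ^ N * cmod (partial_derivs bs (tf_shift z \<phi>) y) \<le> C * wt P z \<and>
      bracket y ^ N * cmod (partial_derivs bs (tf_shift z \<phi>) y - partial_derivs bs (tf_shift w \<phi>) y)
        \<le> C * (wt P z * wt P w * norm (z - w))"
    using finite_tf_shift_bounds[OF J(1,2) p] by blast
  obtain G Q where G: "G > 0" "Q \<ge> 0" and gr: "\<And>z. cmod (stft \<phi> u z) \<le> G * wt Q z"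
    using stft_growth_lipschitz by metis
  \<comment> \<open>The points \<open>s i z\<close> are simple approximations of the point
    \<open>z\<close> itself, and they stay within twice its norm, so all weights at
    \<open>s i z\<close> are controlled by weights at \<open>z\<close>.\<close>
  obtain s :: "nat \<Rightarrow> 'a \<times> 'a \<Rightarrow> 'a \<times> 'a" where s: "\<And>i. simple_function borel (s i)"
    and lim: "\<And>z. (\<lambda>i. s i z) \<longlonglongrightarrow> z" and dist: "\<And>i z. dist (s i z) 0 \<le> 2 * dist z 0"
    using borel_measurable_implies_sequence_metric[of "\<lambda>z::'a \<times> 'a. z" borel 0] by auto
  have [measurable]: "s i \<in> borel_measurable borel" for i
    using s by (rule borel_measurable_simple_function)
  have fin: "finite (range (s i))" for i
    using s[of i] by (simp add: simple_function_def)
  have bs2: "bracket (s i z) \<le> 2 * bracket z" for i z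
  proof (rule power2_le_imp_le)
    have "(norm (s i z))\<^sup>2 \<le> (2 * norm z)\<^sup>2"
      using dist[of i z] by (intro power_mono) auto
    then show "(bracket (s i z))\<^sup>2 \<le> (2 * bracket z)\<^sup>2"
      by (simp add: bracket_def power_mult_distrib)
  qed simp
  define T where "T = (\<lambda>i l. {z. s i z = l})"
  have [measurable]: "T i l \<in> sets borel" for i l unfolding T_def by measurable
  \<comment> \<open>The mass of \<open>H\<close> on the cell of phase space that is replaced by the
    point \<open>l\<close>.\<close>
  define c where "c = (\<lambda>i l. LINT z|lborel. H z * indicator (T i l) z)"
  have iH: "integrable lborel H" by (rule rapid_integrable[OF H])
  have iHT: "integrable lborel (\<lambda>z. H z * indicator (T i l) z)" for i l
    by (rule Bochner_Integration.integrable_bound[OF iH]) (auto simp: norm_mult indicator_def)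
  have step: "(LINT z|lborel. H z * a (s i z)) = (\<Sum>l\<in>range (s i). c i l * a l)" for a :: "'a \<times> 'a \<Rightarrow> complex" and i
  proof -
    have "H z * a (s i z) = (\<Sum>l\<in>range (s i). H z * indicator (T i l) z * a l)" for z
    proof -
      have "(\<Sum>l\<in>range (s i). H z * indicator (T i l) z * a l) = (\<Sum>l\<in>range (s i). if s i z = l then H z * a l else 0)"
        by (intro sum.cong) (auto simp: T_def indicator_def)
      then show ?thesis using fin by simp
    qed
    then have "(LINT z|lborel. H z * a (s i z)) = (LINT z|lborel. (\<Sum>l\<in>range (s i). H z * indicator (T i l) z * a l))"
      by presburger
    also have "\<dots> = (\<Sum>l\<in>range (s i). c i l * a l)"
      unfolding c_def using iHT by (subst Bochner_Integration.integral_sum) auto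
    finally show ?thesis .
  qed
  have iHa: "integrable lborel (\<lambda>z. H z * a (s i z))" for a :: "'a \<times> 'a \<Rightarrow> complex" and i
  proof -
    have eq: "(\<lambda>z. H z * a (s i z)) = (\<lambda>z. \<Sum>l\<in>range (s i). H z * indicator (T i l) z * a l)"
    proof
      fix z
      have "(\<Sum>l\<in>range (s i). H z * indicator (T i l) z * a l) = (\<Sum>l\<in>range (s i). if s i z = l then H z * a l else 0)"
        by (intro sum.cong) (auto simp: T_def indicator_def)
      then show "H z * a (s i z) = (\<Sum>l\<in>range (s i). H z * indicator (T i l) z * a l)" using fin by simp
    qed
    show ?thesis unfolding eq using iHT by (intro Bochner_Integration.integrable_sum) auto
  qed
  \<comment> \<open>A finite combination of shifts, to which \<open>u\<close> applies by linearity.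
    Its pairing with \<open>u\<close> is the integral with \<open>stft \<phi> u\<close> evaluated at
    the approximating points.\<close>
  define h where "h = (\<lambda>i y. \<Sum>l\<in>range (s i). c i l * tf_shift l \<phi> y)"
  have hS: "h i \<in> schwartz" for i
    unfolding h_def by (intro schwartz_sum schwartz_cmult schwartz_tf_shift p fin)
  have uh: "u (h i) = (LINT z|lborel. cnj (H z) * stft \<phi> u (s i z))" for i
  proof -
    have "u (h i) = (\<Sum>l\<in>range (s i). cnj (c i l) * stft \<phi> u l)"
      unfolding h_def stft_def by (intro tempered_sum[OF u] schwartz_tf_shift p fin)
    also have "\<dots> = cnj (\<Sum>l\<in>range (s i). c i l * cnj (stft \<phi> u l))" by simp
    also have "\<dots> = cnj (LINT z|lborel. H z * cnj (stft \<phi> u (s i z)))"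
      using step[of "\<lambda>z. cnj (stft \<phi> u z)" i] by simp
    also have "\<dots> = (LINT z|lborel. cnj (H z) * stft \<phi> u (s i z))"
      unfolding Bochner_Integration.integral_cnj[symmetric] by simp
    finally show ?thesis .
  qed
  have ph: "partial_derivs bs (h i) y = (LINT z|lborel. H z * partial_derivs bs (tf_shift (s i z) \<phi>) y)"
    if "set bs \<subseteq> Basis" for bs i y
    unfolding h_def step[of "\<lambda>l. partial_derivs bs (tf_shift l \<phi>) y" i]
    using that by (subst partial_derivs_sum)
      (auto simp: fin partial_derivs_cmult_tf_shift p intro!: schwartz_cmult schwartz_tf_shift)
  \<comment> \<open>Up to a constant, \<open>e i\<close> bounds the integrand of every relevant
    seminorm of the difference between the synthesis and \<open>h i\<close>. The function
    \<open>W\<close> below dominates it independently of \<open>i\<close>.\<close>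
  define e where "e = (\<lambda>i z. cmod (H z) * (wt P z * wt P (s i z) * norm (z - s i z)))"
  define W where "W = (\<lambda>z::'a \<times> 'a. cmod (H z) * (wt P z * (2 powr P * wt P z) * (3 * bracket z)))"
  have iW: "integrable lborel W"
  proof -
    let ?s = "2 * real DIM('a \<times> 'a)"
    obtain A where A: "A \<ge> 0" "\<And>z. cmod (H z) \<le> A * wt (- ?s - (P + P + 1)) z" using rapid_bound[OF H] by blast
    show ?thesis
    proof (rule integrable_wt_bound[where C = "A * (2 powr P * 3)" and s = ?s])
      show "W \<in> borel_measurable borel" unfolding W_def by measurable
      fix z :: "'a \<times> 'a"
      have "norm (W z) = cmod (H z) * (wt P z * (2 powr P * wt P z) * (3 * bracket z))" by (simp add: W_def)
      also have "\<dots> \<le> (A * wt (- ?s - (P + P + 1)) z) * (wt P z * (2 powr P * wt P z) * (3 * bracket z))"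
        using A by (intro mult_right_mono) auto
      also have "\<dots> = A * (2 powr P * 3) * (wt (- ?s - (P + P + 1)) z * (wt P z * wt P z * wt 1 z))"
        by (simp add: mult_ac)
      also have "\<dots> = A * (2 powr P * 3) * wt (- ?s) z"
        by (simp only: powr_add[symmetric]) simp
      finally show "norm (W z) \<le> A * (2 powr P * 3) * wt (- ?s) z" .
    qed simp
  qed
  have eW: "\<bar>e i z\<bar> \<le> W z" for i z
  proof -
    have "wt P (s i z) \<le> 2 powr P * wt P z"
      using powr_mono2[OF C(2) _ bs2[of i z]] by (simp add: powr_mult)
    moreover have "norm (z - s i z) \<le> 3 * bracket z"
      using norm_triangle_ineq4[of z "s i z"] dist[of i z] norm_le_bracket[of z] by simp
    ultimately have "e i z \<le> W z"
      unfolding e_def W_def by (intro mult_left_mono mult_mono) auto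
    moreover have "0 \<le> e i z" by (simp add: e_def)
    ultimately show ?thesis by simp
  qed
  have me: "e i \<in> borel_measurable borel" for i unfolding e_def by measurable
  have ie: "integrable lborel (e i)" for i
  proof (rule Bochner_Integration.integrable_bound[OF iW])
    show "AE z in lborel. norm (e i z) \<le> norm (W z)"
      using order_trans[OF eW abs_ge_self] by (intro AE_I2) simp
  qed (use me in simp)
  have "(\<lambda>i. LINT z|lborel. e i z) \<longlonglongrightarrow> (LINT z::'a\<times>'a|lborel. 0)"
  proof (rule integral_dominated_convergence[OF _ _ iW])
    show "AE z in lborel. (\<lambda>i. e i z) \<longlonglongrightarrow> 0"
    proof (rule AE_I2)
      fix z
      have "(\<lambda>i. bracket (s i z)) \<longlonglongrightarrow> bracket z"
        by (rule continuous_on_tendsto_compose[OF continuous_on_bracket[OF continuous_on_id[of UNIV]] lim]) auto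
      then have "(\<lambda>i. e i z) \<longlonglongrightarrow> cmod (H z) * (wt P z * wt P z * norm (z - z))"
        unfolding e_def by (intro tendsto_intros lim) auto
      then show "(\<lambda>i. e i z) \<longlonglongrightarrow> 0" by simp
    qed
  qed (use me eW in auto)
  then have E0: "(\<lambda>i. LINT z|lborel. e i z) \<longlonglongrightarrow> 0" by simp
  \<comment> \<open>The additional \<open>inverse (real (Suc i))\<close> keeps the common bound
    strictly positive, as \<open>tempered_bound\<close> demands, and vanishes in the limit.\<close>
  have diff: "cmod (u (synth \<phi> H) - u (h i)) \<le> D * (C * (LINT z|lborel. e i z) + inverse (real (Suc i)))" for i
  proof -
    have syn: "synth \<phi> H \<in> schwartz" by (rule schwartz_synth[OF p H])
    have "cmod (u (\<lambda>x. synth \<phi> H x - h i x)) \<le> D * (C * (LINT z|lborel. e i z) + inverse (real (Suc i)))"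
    proof (rule b[rule_format])
      show "(\<lambda>x. synth \<phi> H x - h i x) \<in> schwartz" by (intro schwartz_diff syn hS)
      have "0 \<le> (LINT z|lborel. e i z)" by (intro Bochner_Integration.integral_nonneg) (simp add: e_def)
      then show "0 < C * (LINT z|lborel. e i z) + inverse (real (Suc i))"
        using C by (intro add_nonneg_pos) auto
      fix N bs y assume Nb: "(N, bs) \<in> J"
      then have bs: "set bs \<subseteq> Basis" using J(2) by blast
      have "partial_derivs bs (\<lambda>x. synth \<phi> H x - h i x) y
        = (LINT z|lborel. H z * (partial_derivs bs (tf_shift z \<phi>) y - partial_derivs bs (tf_shift (s i z) \<phi>) y))"
        using bs by (simp add: partial_derivs_diff schwartz_smooth syn hS partial_derivs_synth[OF p H bs] ph
          iHa[of "\<lambda>l. partial_derivs bs (tf_shift l \<phi>) y"] right_diff_distrib)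
      then have "bracket y ^ N * cmod (partial_derivs bs (\<lambda>x. synth \<phi> H x - h i x) y)
        = cmod (LINT z|lborel. bracket y ^ N *\<^sub>R (H z * (partial_derivs bs (tf_shift z \<phi>) y - partial_derivs bs (tf_shift (s i z) \<phi>) y)))"
        by (simp only: integral_scaleR_right norm_scaleR) simp
      also have "\<dots> \<le> (LINT z|lborel. C * e i z)"
      proof (rule Bochner_Integration.integral_norm_bound_integral)
        show "integrable lborel (\<lambda>z. bracket y ^ N *\<^sub>R (H z * (partial_derivs bs (tf_shift z \<phi>) y - partial_derivs bs (tf_shift (s i z) \<phi>) y)))"
          using partial_derivs_synth(2)[OF p H bs, of y] iHa[of "\<lambda>l. partial_derivs bs (tf_shift l \<phi>) y" i]
          by (simp add: right_diff_distrib)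
        show "norm (bracket y ^ N *\<^sub>R (H z * (partial_derivs bs (tf_shift z \<phi>) y - partial_derivs bs (tf_shift (s i z) \<phi>) y))) \<le> C * e i z" for z
        proof -
          have "norm (bracket y ^ N *\<^sub>R (H z * (partial_derivs bs (tf_shift z \<phi>) y - partial_derivs bs (tf_shift (s i z) \<phi>) y)))
             = cmod (H z) * (bracket y ^ N * cmod (partial_derivs bs (tf_shift z \<phi>) y - partial_derivs bs (tf_shift (s i z) \<phi>) y))"
            by (simp add: norm_mult)
          also have "\<dots> \<le> cmod (H z) * (C * (wt P z * wt P (s i z) * norm (z - s i z)))"
            using CP[OF Nb] by (intro mult_left_mono) auto
          finally show ?thesis by (simp add: e_def mult_ac)
        qed
      qed (use ie in simp)
      also have "\<dots> \<le> C * (LINT z|lborel. e i z) + inverse (real (Suc i))" by simp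
      finally show "bracket y ^ N * cmod (partial_derivs bs (\<lambda>x. synth \<phi> H x - h i x) y)
        \<le> C * (LINT z|lborel. e i z) + inverse (real (Suc i))" .
    qed
    then show ?thesis by (simp add: tempered_diff[OF u syn hS])
  qed
  have "(\<lambda>i. D * (C * (LINT z|lborel. e i z) + inverse (real (Suc i)))) \<longlonglongrightarrow> D * (C * 0 + 0)"
    by (intro tendsto_intros E0 LIMSEQ_inverse_real_of_nat)
  then have lim0: "(\<lambda>i. D * (C * (LINT z|lborel. e i z) + inverse (real (Suc i)))) \<longlonglongrightarrow> 0"
    by simp
  have "(\<lambda>i. u (synth \<phi> H) - u (h i)) \<longlonglongrightarrow> 0"
    by (rule Lim_null_comparison[OF always_eventually[OF allI[OF diff]] lim0])
  from tendsto_diff[OF tendsto_const[of "u (synth \<phi> H)"] this]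
  have 1: "(\<lambda>i. u (h i)) \<longlonglongrightarrow> u (synth \<phi> H)"
    by simp
  have "(\<lambda>i. LINT z|lborel. cnj (H z) * stft \<phi> u (s i z)) \<longlonglongrightarrow> (LINT z|lborel. cnj (H z) * stft \<phi> u z)"
  proof (rule integral_dominated_convergence[where w = "\<lambda>z. cmod (H z) * (G * (2 powr Q * wt Q z))"])
    show "integrable lborel (\<lambda>z. cmod (H z) * (G * (2 powr Q * wt Q z)))"
    proof -
      let ?s = "2 * real DIM('a \<times> 'a)"
      obtain A where A: "A \<ge> 0" "\<And>z. cmod (H z) \<le> A * wt (- ?s - Q) z" using rapid_bound[OF H] by blast
      show ?thesis
      proof (rule integrable_wt_bound[where C = "A * G * 2 powr Q" and s = ?s])
        fix z :: "'a \<times> 'a"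
        have "norm (cmod (H z) * (G * (2 powr Q * wt Q z))) \<le> (A * wt (- ?s - Q) z) * (G * (2 powr Q * wt Q z))"
          using A G by (simp add: abs_mult mult_right_mono)
        also have "\<dots> = A * G * 2 powr Q * (wt (- ?s - Q) z * wt Q z)" by (simp only: mult_ac)
        also have "\<dots> = A * G * 2 powr Q * wt (- ?s) z" by (simp flip: powr_add)
        finally show "norm (cmod (H z) * (G * (2 powr Q * wt Q z))) \<le> A * G * 2 powr Q * wt (- ?s) z" .
      qed auto
    qed
    show "AE z in lborel. (\<lambda>i. cnj (H z) * stft \<phi> u (s i z)) \<longlonglongrightarrow> cnj (H z) * stft \<phi> u z"
      by (intro AE_I2 tendsto_intros continuous_on_tendsto_compose[OF continuous_stft lim]) auto
    show "AE z in lborel. norm (cnj (H z) * stft \<phi> u (s i z)) \<le> cmod (H z) * (G * (2 powr Q * wt Q z))" for i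
    proof (rule AE_I2)
      fix z
      have "cmod (stft \<phi> u (s i z)) \<le> G * wt Q (s i z)" by (rule gr)
      also have "\<dots> \<le> G * (2 powr Q * wt Q z)"
        using G powr_mono2[OF G(2) _ bs2[of i z]] by (intro mult_left_mono) (auto simp: powr_mult)
      finally show "norm (cnj (H z) * stft \<phi> u (s i z)) \<le> cmod (H z) * (G * (2 powr Q * wt Q z))"
        by (simp add: norm_mult mult_left_mono)
    qed
  qed measurable
  then show ?thesis using 1 LIMSEQ_unique unfolding uh by blast
qed

end

definition rc :: "('a::euclidean_space \<Rightarrow> complex) \<Rightarrow> real" where
  "rc \<phi> = inverse ((2 * pi) ^ DIM('a) * Re (L2_inner \<phi> \<phi>))"

lemma rc_pos:
  assumes "\<phi> \<in> schwartz" "\<phi> \<noteq> (\<lambda>_. 0)"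
  shows "rc \<phi> > 0"
proof -
  obtain k where "k > 0" "L2_inner \<phi> \<phi> = of_real k" using L2_inner_self_pos[OF assms] by blast
  then show ?thesis by (simp add: rc_def)
qed

lemma reproducing:
  fixes f :: "'a::euclidean_space \<Rightarrow> complex"
  assumes p: "\<phi> \<in> schwartz" "\<phi> \<noteq> (\<lambda>_. 0)" and f: "f \<in> schwartz"
  shows "f = (\<lambda>y. of_real (rc \<phi>) * synth \<phi> (\<lambda>z. L2_inner f (tf_shift z \<phi>)) y)"
proof
  fix y
  obtain k where "k > 0" "L2_inner \<phi> \<phi> = of_real k" using L2_inner_self_pos[OF p] by blast
  then show "f y = of_real (rc \<phi>) * synth \<phi> (\<lambda>z. L2_inner f (tf_shift z \<phi>)) y"
    unfolding synth_stft[OF f p(1) p(1)] rc_def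
    by (simp only: Re_complex_of_real mult.assoc[symmetric] of_real_mult[symmetric])
      (simp add: field_simps)
qed

lemma tempered_reproducing:
  fixes u :: "('a::euclidean_space \<Rightarrow> complex) \<Rightarrow> complex"
  assumes u: "tempered_distribution u" and p: "\<phi> \<in> schwartz" "\<phi> \<noteq> (\<lambda>_. 0)" and f: "f \<in> schwartz"
  shows "u f = of_real (rc \<phi>) * (LINT z|lborel. cnj (L2_inner f (tf_shift z \<phi>)) * stft \<phi> u z)"
proof -
  have "u f = u (\<lambda>y. of_real (rc \<phi>) * synth \<phi> (\<lambda>z. L2_inner f (tf_shift z \<phi>)) y)"
    using reproducing[OF p f] by simp
  also have "\<dots> = of_real (rc \<phi>) * u (synth \<phi> (\<lambda>z. L2_inner f (tf_shift z \<phi>)))"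
    using tempered_cmult[OF u schwartz_synth[OF p(1) rapid_stft[OF p(1) f]], of "of_real (rc \<phi>)"] by simp
  finally show ?thesis
    using tempered_synth[OF u p(1) rapid_stft[OF p(1) f]] by simp
qed

subsection \<open>Wigner distributions and Weyl quantization\<close>

lemma wt_scale2_le: "0 \<le> s \<Longrightarrow> wt (- s) (2 *\<^sub>R v) \<le> wt (- s) v"
  by (intro powr_mono2' bracket_mono) auto

lemma tf_shift_0 [simp]: "tf_shift 0 f = f"
  by (simp add: tf_shift_apply fun_eq_iff)

lemma tf_shift_reflect: "tf_shift w f (- y) = tf_shift (- w) (\<lambda>y. f (- y)) y"
  by (simp add: tf_shift_apply)

lemma wigner_apply: "wigner g f v =
  (LINT \<tau>|lborel. g (fst v + \<tau> /\<^sub>R 2) * cnj (f (fst v - \<tau> /\<^sub>R 2)) * exp (- \<i> * of_real (\<tau> \<bullet> snd v)))"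
  by (simp add: wigner_def split_beta)

text \<open>The substitution \<tau> = 2 (s - x), with \<open>x\<close> the position part of
  \<open>v\<close>, makes one argument \<open>s\<close> and the other the reflection of
  \<open>s - 2 x\<close>. All decay of Wigner distributions is inherited from the transform through
  this identity.\<close>

lemma wigner_stft:
  fixes g f :: "'a::euclidean_space \<Rightarrow> complex"
  shows "wigner g f v = of_real (2 ^ DIM('a)) * exp (\<i> * of_real (2 * (fst v \<bullet> snd v)))
    * L2_inner g (tf_shift (2 *\<^sub>R v) (\<lambda>y. f (- y)))"
proof -
  let ?G = "\<lambda>\<tau>. g (fst v + \<tau> /\<^sub>R 2) * cnj (f (fst v - \<tau> /\<^sub>R 2)) * exp (- \<i> * of_real (\<tau> \<bullet> snd v))"
  let ?H = "\<lambda>t. g t * cnj (tf_shift (2 *\<^sub>R v) (\<lambda>y. f (- y)) t)"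
  have "wigner g f v = 2 ^ DIM('a) *\<^sub>R (LINT s|lborel. ?G (2 *\<^sub>R s))"
    using lborel_scale(2)[of 2 ?G] by (simp add: wigner_apply)
  also have "(LINT s|lborel. ?G (2 *\<^sub>R s)) = (LINT s|lborel. ?G (2 *\<^sub>R (s + - fst v)))"
    using lborel_translate(2)[of "\<lambda>s. ?G (2 *\<^sub>R s)" "- fst v"] by presburger
  also have "\<dots> = (LINT s|lborel. exp (\<i> * of_real (2 * (fst v \<bullet> snd v))) * ?H s)"
  proof (intro Bochner_Integration.integral_cong refl)
    fix s
    have "exp (- \<i> * of_real ((2 *\<^sub>R (s + - fst v)) \<bullet> snd v))
      = exp (\<i> * of_real (2 * (fst v \<bullet> snd v))) * exp (- \<i> * of_real (s \<bullet> (2 *\<^sub>R snd v)))"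
      by (simp add: inner_diff_left algebra_simps flip: exp_add)
    moreover have "fst v + (2 *\<^sub>R (s + - fst v)) /\<^sub>R 2 = s"
      "fst v - (2 *\<^sub>R (s + - fst v)) /\<^sub>R 2 = - (s - 2 *\<^sub>R fst v)"
      by (simp_all only: scaleR_scaleR) (simp_all add: algebra_simps scaleR_2)
    ultimately show "?G (2 *\<^sub>R (s + - fst v)) = exp (\<i> * of_real (2 * (fst v \<bullet> snd v))) * ?H s"
      by (simp only:) (simp add: tf_shift_apply exp_cnj mult_ac)
  qed
  finally show ?thesis by (simp add: L2_inner_def scaleR_conv_of_real)
qed

text \<open>Concentration at the midpoint of the two shifts: the transform behind the Wigner
  distribution depends on \<open>2 v - w - z\<close>, which is twice the distance vector from
  \<open>v\<close> to the midpoint.\<close>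

lemma wigner_decay:
  fixes g f :: "'a::euclidean_space \<Rightarrow> complex"
  assumes g: "g \<in> schwartz" and f: "f \<in> schwartz" and s: "0 \<le> s"
  obtains C where "C \<ge> 0"
    "\<And>z w v. cmod (wigner (tf_shift z g) (tf_shift w f) v) \<le> C * wt (- s) (v - (z + w) /\<^sub>R 2)"
proof -
  obtain C where C: "C \<ge> 0" 
    and Cb: "\<And>z w. cmod (L2_inner (tf_shift w g) (tf_shift z (\<lambda>y. f (- y)))) \<le> C * wt (- s) (z - w)"
    using stft_decay2[OF schwartz_reflect[OF f] g] by blast
  have "cmod (wigner (tf_shift z g) (tf_shift w f) v) \<le> (2 ^ DIM('a) * C) * wt (- s) (v - (z + w) /\<^sub>R 2)" for z w v
  proof -
    have "(\<lambda>y. tf_shift w f (- y)) = tf_shift (- w) (\<lambda>y. f (- y))"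
      by (simp add: tf_shift_reflect)
    then have "cmod (wigner (tf_shift z g) (tf_shift w f) v)
      = 2 ^ DIM('a) * cmod (L2_inner (tf_shift z g) (tf_shift (2 *\<^sub>R v - w) (\<lambda>y. f (- y))))"
      by (simp add: wigner_stft tf_shift_tf_shift L2_inner_cmult_right norm_mult norm_power exp_cnj)
    also have "\<dots> \<le> 2 ^ DIM('a) * (C * wt (- s) (2 *\<^sub>R v - w - z))"
      by (intro mult_left_mono Cb) simp
    also have "2 *\<^sub>R v - w - z = 2 *\<^sub>R (v - (z + w) /\<^sub>R 2)"
      by (simp add: algebra_simps)
    also have "2 ^ DIM('a) * (C * wt (- s) (2 *\<^sub>R (v - (z + w) /\<^sub>R 2))) \<le> 2 ^ DIM('a) * (C * wt (- s) (v - (z + w) /\<^sub>R 2))"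
      using C wt_scale2_le[OF s] by (intro mult_left_mono) auto
    finally show ?thesis by simp
  qed
  then show ?thesis using that[of "2 ^ DIM('a) * C"] C by simp
qed

lemma measurable_wigner [measurable (raw)]:
  fixes g f :: "'m \<Rightarrow> 'a::euclidean_space \<Rightarrow> complex"
  assumes [measurable]: "(\<lambda>(x, y). g x y) \<in> borel_measurable (M \<Otimes>\<^sub>M borel)"
    "(\<lambda>(x, y). f x y) \<in> borel_measurable (M \<Otimes>\<^sub>M borel)" "v \<in> borel_measurable M"
  shows "(\<lambda>x. wigner (g x) (f x) (v x)) \<in> borel_measurable M"
  unfolding wigner_apply by measurable

lemma measurable_wigner1:
  assumes [measurable]: "g \<in> borel_measurable borel" "f \<in> borel_measurable borel"
  shows "wigner g f \<in> borel_measurable borel"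
  unfolding wigner_apply[abs_def] by measurable

lemma wigner_commute: "wigner f g v = cnj (wigner g f v)"
proof -
  have "cnj (wigner g f v) = (LINT \<tau>|lborel.
      cnj (g (fst v + \<tau> /\<^sub>R 2)) * f (fst v - \<tau> /\<^sub>R 2) * exp (\<i> * of_real (\<tau> \<bullet> snd v)))"
    unfolding wigner_apply Bochner_Integration.integral_cnj[symmetric] by (simp add: exp_cnj)
  also have "\<dots> = (LINT \<tau>|lborel.
      cnj (g (fst v + (0 - \<tau>) /\<^sub>R 2)) * f (fst v - (0 - \<tau>) /\<^sub>R 2) * exp (\<i> * of_real ((0 - \<tau>) \<bullet> snd v)))"
    by (rule lborel_reflect(2)[symmetric])
  also have "\<dots> = wigner f g v"
    unfolding wigner_apply by (intro Bochner_Integration.integral_cong) (auto simp: mult_ac)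
  finally show ?thesis by simp
qed

text \<open>The two arguments differ by \<tau>, so they cannot both be small compared with it;
  Peetre's inequality converts their joint decay into decay in \<tau>, uniformly in
  \<open>x\<close>.\<close>

lemma wigner_integrand_bound:
  assumes "A \<ge> 0" "\<And>x. cmod (f x) \<le> A * wt (- s) x" "B \<ge> 0" "\<And>x. cmod (g x) \<le> B * wt (- s) x" "s \<ge> 0"
  shows "cmod (g (x + \<tau> /\<^sub>R 2)) * cmod (f (x - \<tau> /\<^sub>R 2)) \<le> B * A * 2 powr s * wt (- s) \<tau>"
proof -
  have "(x + \<tau> /\<^sub>R 2) + - (x - \<tau> /\<^sub>R 2) = \<tau>"
    by (simp add: algebra_simps flip: scaleR_add_left)
  then have "bracket \<tau> \<le> 2 * bracket (x + \<tau> /\<^sub>R 2) * bracket (x - \<tau> /\<^sub>R 2)"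
    using bracket_add_le[of "x + \<tau> /\<^sub>R 2" "- (x - \<tau> /\<^sub>R 2)"] by (simp only: bracket_minus)
  then have "(2 * bracket (x + \<tau> /\<^sub>R 2) * bracket (x - \<tau> /\<^sub>R 2)) powr (- s) \<le> wt (- s) \<tau>"
    using assms(5) by (intro powr_mono2') auto
  then have "2 powr s * ((2 * bracket (x + \<tau> /\<^sub>R 2) * bracket (x - \<tau> /\<^sub>R 2)) powr (- s)) \<le> 2 powr s * wt (- s) \<tau>"
    by (rule mult_left_mono) simp
  moreover have "2 powr s * ((2 * bracket (x + \<tau> /\<^sub>R 2) * bracket (x - \<tau> /\<^sub>R 2)) powr (- s))
    = (2 powr s * 2 powr (- s)) * (wt (- s) (x + \<tau> /\<^sub>R 2) * wt (- s) (x - \<tau> /\<^sub>R 2))"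
    by (simp add: powr_mult mult_ac)
  moreover have "(2::real) powr s * 2 powr (- s) = 1" by (simp flip: powr_add)
  ultimately have w: "wt (- s) (x + \<tau> /\<^sub>R 2) * wt (- s) (x - \<tau> /\<^sub>R 2) \<le> 2 powr s * wt (- s) \<tau>"
    by (simp only: mult_1_left)
  have "cmod (g (x + \<tau> /\<^sub>R 2)) * cmod (f (x - \<tau> /\<^sub>R 2))
      \<le> (B * wt (- s) (x + \<tau> /\<^sub>R 2)) * (A * wt (- s) (x - \<tau> /\<^sub>R 2))"
    using assms by (intro mult_mono) auto
  also have "\<dots> = (B * A) * (wt (- s) (x + \<tau> /\<^sub>R 2) * wt (- s) (x - \<tau> /\<^sub>R 2))" by simp
  also have "\<dots> \<le> (B * A) * (2 powr s * wt (- s) \<tau>)"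
    using assms w by (intro mult_left_mono) auto
  finally show ?thesis by (simp add: mult_ac)
qed

lemma wigner_integrable:
  fixes g f :: "'a::euclidean_space \<Rightarrow> complex"
  assumes "g \<in> schwartz" "f \<in> schwartz"
  shows "integrable lborel (\<lambda>\<tau>. g (x + \<tau> /\<^sub>R 2) * cnj (f (x - \<tau> /\<^sub>R 2)) * exp (- \<i> * of_real (\<tau> \<bullet> \<xi>)))"
proof -
  let ?s = "2 * real DIM('a)"
  obtain A where A: "A \<ge> 0" "\<And>x. cmod (f x) \<le> A * wt (- ?s) x" using schwartz_bound0[OF assms(2)] by blast
  obtain B where B: "B \<ge> 0" "\<And>x. cmod (g x) \<le> B * wt (- ?s) x" using schwartz_bound0[OF assms(1)] by blast
  have [measurable]: "f \<in> borel_measurable borel" "g \<in> borel_measurable borel"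
    using assms by (auto intro: schwartz_measurable)
  show ?thesis
    by (rule integrable_wt_bound[where C = "B * A * 2 powr ?s" and s = ?s])
      (use wigner_integrand_bound[OF A B] in \<open>simp_all add: norm_mult\<close>)
qed

lemma wigner_add_left:
  assumes "g \<in> schwartz" "h \<in> schwartz" "f \<in> schwartz"
  shows "wigner (\<lambda>x. g x + h x) f v = wigner g f v + wigner h f v"
  unfolding wigner_apply distrib_right
  by (rule Bochner_Integration.integral_add[OF wigner_integrable[OF assms(1,3)] wigner_integrable[OF assms(2,3)]])

lemma wigner_cmult_left: "wigner (\<lambda>x. c * g x) f v = c * wigner g f v"
  unfolding wigner_apply by (simp add: mult.assoc)

text \<open>A position derivative reaches both functions by the product rule. A frequency derivative
  brings down \<tau>, which is the difference of the two arguments and thus becomes a coordinate on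
  \<open>g\<close> minus a coordinate on \<open>f\<close>.\<close>

lemma wigner_has_derivative:
  fixes g f :: "'a::euclidean_space \<Rightarrow> complex"
  assumes g: "g \<in> schwartz" and f: "f \<in> schwartz"
  shows "\<exists>W'. (wigner g f has_derivative W') (at v) \<and>
    (\<forall>b\<in>Basis. W' (b, 0) = wigner (dpart b g) f v + wigner g (dpart b f) v) \<and>
    (\<forall>b\<in>Basis. W' (0, b) = - \<i> * (wigner (\<lambda>y. of_real (y \<bullet> b) * g y) f v - wigner g (\<lambda>y. of_real (y \<bullet> b) * f y) v))"
proof -
  have dg: "g differentiable (at x)" and df: "f differentiable (at x)" for x
    using f g by (auto intro: smoothD schwartz_smooth)
  have lg: "(g has_derivative frechet_derivative g (at x)) (at x)" and lf: "(f has_derivative frechet_derivative f (at x)) (at x)" for x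
    using f g by (auto intro: smooth_has_derivative schwartz_smooth)
  let ?e = "\<lambda>v \<tau>. exp (- \<i> * complex_of_real (\<tau> \<bullet> snd v))"
  let ?p = "\<lambda>v \<tau>. fst v + \<tau> /\<^sub>R 2" and ?m = "\<lambda>v \<tau>. fst v - \<tau> /\<^sub>R 2"
  let ?G = "\<lambda>v \<tau>. g (?p v \<tau>) * cnj (f (?m v \<tau>)) * ?e v \<tau>"
  let ?D = "\<lambda>v h \<tau>. frechet_derivative g (at (?p v \<tau>)) (fst h) * cnj (f (?m v \<tau>)) * ?e v \<tau>
    + g (?p v \<tau>) * cnj (frechet_derivative f (at (?m v \<tau>)) (fst h)) * ?e v \<tau>
    + g (?p v \<tau>) * cnj (f (?m v \<tau>)) * ?e v \<tau> * (- \<i> * of_real (\<tau> \<bullet> snd h))"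
  \<comment> \<open>The exponent \<open>?t\<close> exceeds \<open>?s\<close> by 1 to pay for the
    factor \<tau> that a frequency derivative produces.\<close>
  let ?s = "2 * real DIM('a)" and ?t = "2 * real DIM('a) + 1"
  have deriv: "((\<lambda>v. ?G v \<tau>) has_derivative (\<lambda>h. ?D v h \<tau>)) (at v)" for v \<tau>
  proof -
    have 1: "((\<lambda>v. g (?p v \<tau>)) has_derivative (\<lambda>h. frechet_derivative g (at (?p v \<tau>)) (fst h))) (at v)"
      by (rule has_derivative_compose[OF _ lg, of "\<lambda>v. ?p v \<tau>"]) (auto intro!: derivative_eq_intros)
    have "((\<lambda>v. f (?m v \<tau>)) has_derivative (\<lambda>h. frechet_derivative f (at (?m v \<tau>)) (fst h))) (at v)"
      by (rule has_derivative_compose[OF _ lf, of "\<lambda>v. ?m v \<tau>"]) (auto intro!: derivative_eq_intros)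
    then have 2: "((\<lambda>v. cnj (f (?m v \<tau>))) has_derivative (\<lambda>h. cnj (frechet_derivative f (at (?m v \<tau>)) (fst h)))) (at v)"
      by (rule bounded_linear.has_derivative[OF bounded_linear_cnj])
    have "((\<lambda>v. complex_of_real (\<tau> \<bullet> snd v)) has_derivative (\<lambda>h. of_real (\<tau> \<bullet> snd h))) (at v)"
      by (intro bounded_linear_imp_has_derivative bounded_linear_compose[OF bounded_linear_of_real]
        bounded_linear_compose[OF bounded_linear_inner_right] bounded_linear_snd)
    then have "((\<lambda>v. - \<i> * complex_of_real (\<tau> \<bullet> snd v)) has_derivative (\<lambda>h. - \<i> * of_real (\<tau> \<bullet> snd h))) (at v)"
      by (rule bounded_linear.has_derivative[OF bounded_linear_mult_right])
    from has_derivative_compose[OF this DERIV_exp[unfolded has_field_derivative_def]]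
    have 3: "((\<lambda>v. ?e v \<tau>) has_derivative (\<lambda>h. ?e v \<tau> * (- \<i> * of_real (\<tau> \<bullet> snd h)))) (at v)" .
    show ?thesis
      by (rule has_derivative_eq_rhs[OF has_derivative_mult[OF has_derivative_mult[OF 1 2] 3]])
        (simp add: fun_eq_iff algebra_simps)
  qed
  obtain A where A: "A \<ge> 0" "\<And>x. cmod (f x) \<le> A * wt (- ?t) x" using schwartz_bound0[OF f] by blast
  obtain B where B: "B \<ge> 0" "\<And>x. cmod (g x) \<le> B * wt (- ?t) x" using schwartz_bound0[OF g] by blast
  have bnd: "\<exists>C\<ge>0. \<forall>x h. cmod (frechet_derivative k (at x) h) \<le> C * wt (- ?t) x * norm h"
    if k: "k \<in> schwartz" for k :: "'a \<Rightarrow> complex"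
  proof -
    have "\<forall>b\<in>Basis. \<exists>C\<ge>0. \<forall>x. cmod (dpart b k x) \<le> C * wt (- ?t) x"
      using schwartz_bound0[OF schwartz_dpart[OF k]] by metis
    then obtain C where C: "\<And>b. b \<in> Basis \<Longrightarrow> C b \<ge> 0"
        "\<And>b x. b \<in> Basis \<Longrightarrow> cmod (dpart b k x) \<le> C b * wt (- ?t) x" by metis
    have "cmod (frechet_derivative k (at x) h) \<le> (\<Sum>b\<in>Basis. C b) * wt (- ?t) x * norm h" for x h
    proof -
      have "(\<Sum>b\<in>Basis. cmod (frechet_derivative k (at x) b)) \<le> (\<Sum>b\<in>Basis. C b) * wt (- ?t) x"
        unfolding sum_distrib_right by (intro sum_mono C)
      then show ?thesis
        using cmod_frechet_derivative_le[OF smoothD[OF schwartz_smooth[OF k]], of x h]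
        by (meson mult_right_mono norm_ge_zero order_trans)
    qed
    moreover have "0 \<le> (\<Sum>b\<in>Basis. C b)" by (intro sum_nonneg C)
    ultimately show ?thesis by blast
  qed
  obtain A' where A': "A' \<ge> 0" "\<And>x h. cmod (frechet_derivative f (at x) h) \<le> A' * wt (- ?t) x * norm h"
    using bnd[OF f] by blast
  obtain B' where B': "B' \<ge> 0" "\<And>x h. cmod (frechet_derivative g (at x) h) \<le> B' * wt (- ?t) x * norm h"
    using bnd[OF g] by blast
  define c where "c = 2 powr ?t"
  have c: "c \<ge> 0" by (simp add: c_def)
  have tt: "0 \<le> ?t" by simp
  have bD: "cmod (?D v h \<tau>) \<le> ((B' * A + B * A' + B * A) * c * wt (- ?s) \<tau>) * norm h" for v h \<tau>
  proof -
    have mono: "wt (- ?t) \<tau> \<le> wt (- ?s) \<tau>" by (intro wt_mono) simp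
    have hh: "norm (fst h) \<le> norm h" "norm (snd h) \<le> norm h"
      using norm_fst_le[of "fst h" "snd h"] norm_snd_le[of "snd h" "fst h"] by simp_all
    have "cmod (frechet_derivative g (at (?p v \<tau>)) (fst h)) * cmod (f (?m v \<tau>)) \<le> (B' * norm (fst h)) * A * c * wt (- ?t) \<tau>"
      unfolding c_def using B' by (intro wigner_integrand_bound[OF A _ _ tt, where g = "\<lambda>x. frechet_derivative g (at x) (fst h)"])
         (auto simp: mult_ac)
    also have "\<dots> \<le> (B' * norm h) * A * c * wt (- ?s) \<tau>"
      using A B' c hh mono by (intro mult_mono) auto
    finally have 1: "cmod (frechet_derivative g (at (?p v \<tau>)) (fst h) * cnj (f (?m v \<tau>)) * ?e v \<tau>) \<le> (B' * norm h) * A * c * wt (- ?s) \<tau>"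
      by (simp add: norm_mult)
    have "cmod (g (?p v \<tau>)) * cmod (frechet_derivative f (at (?m v \<tau>)) (fst h)) \<le> B * (A' * norm (fst h)) * c * wt (- ?t) \<tau>"
      unfolding c_def using A' by (intro wigner_integrand_bound[OF _ _ B tt, where f = "\<lambda>x. frechet_derivative f (at x) (fst h)"])
         (auto simp: mult_ac)
    also have "\<dots> \<le> B * (A' * norm h) * c * wt (- ?s) \<tau>"
      using B A' c hh mono by (intro mult_mono) auto
    finally have 2: "cmod (g (?p v \<tau>) * cnj (frechet_derivative f (at (?m v \<tau>)) (fst h)) * ?e v \<tau>) \<le> B * (A' * norm h) * c * wt (- ?s) \<tau>"
      by (simp add: norm_mult)
    have "cmod (g (?p v \<tau>) * cnj (f (?m v \<tau>)) * ?e v \<tau> * (- \<i> * of_real (\<tau> \<bullet> snd h)))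
        = (cmod (g (?p v \<tau>)) * cmod (f (?m v \<tau>))) * \<bar>\<tau> \<bullet> snd h\<bar>"
      by (simp add: norm_mult)
    also have "\<dots> \<le> (B * A * c * wt (- ?t) \<tau>) * (norm \<tau> * norm h)"
    proof (rule mult_mono)
      show "cmod (g (?p v \<tau>)) * cmod (f (?m v \<tau>)) \<le> B * A * c * wt (- ?t) \<tau>"
        unfolding c_def by (rule wigner_integrand_bound[OF A B tt])
      show "\<bar>\<tau> \<bullet> snd h\<bar> \<le> norm \<tau> * norm h"
        using hh by (intro order_trans[OF Cauchy_Schwarz_ineq2] mult_left_mono) auto
    qed (use A B c in auto)
    also have "\<dots> = (B * A * c * norm h) * (norm \<tau> * wt (- ?t) \<tau>)" by simp
    also have "\<dots> \<le> (B * A * c * norm h) * wt (- ?s) \<tau>"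
      using A B c norm_mult_wt_le[of \<tau> "- ?t"] by (intro mult_left_mono) auto
    finally have 3: "cmod (g (?p v \<tau>) * cnj (f (?m v \<tau>)) * ?e v \<tau> * (- \<i> * of_real (\<tau> \<bullet> snd h))) \<le> (B * A * c * norm h) * wt (- ?s) \<tau>" .
    have "cmod (?D v h \<tau>) \<le> (B' * norm h) * A * c * wt (- ?s) \<tau> + B * (A' * norm h) * c * wt (- ?s) \<tau> + (B * A * c * norm h) * wt (- ?s) \<tau>"
      by (intro norm_triangle_mono 1 2 3)
    then show ?thesis by (simp add: algebra_simps)
  qed
  have [measurable]: "f \<in> borel_measurable borel" "g \<in> borel_measurable borel"
      using f g by (auto intro: schwartz_measurable)
  have mfd: "(\<lambda>x. frechet_derivative k (at x) h) \<in> borel_measurable borel" if k: "k \<in> schwartz" for k :: "'a \<Rightarrow> complex" and h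
    unfolding frechet_derivative_basis[OF smoothD[OF schwartz_smooth[OF k]], of _ h]
    using schwartz_measurable[OF schwartz_dpart[OF k]] by (intro borel_measurable_sum borel_measurable_scaleR) auto
  have iD: "integrable lborel (\<lambda>\<tau>. ?D v h \<tau>)" for h
  proof (rule integrable_wt_bound[where C = "(B' * A + B * A' + B * A) * c * norm h" and s = ?s])
    have [measurable]: "(\<lambda>x. frechet_derivative g (at x) (fst h)) \<in> borel_measurable borel"
       "(\<lambda>x. frechet_derivative f (at x) (fst h)) \<in> borel_measurable borel"
      using mfd f g by auto
    have [measurable]: "(\<lambda>\<tau>. frechet_derivative g (at (?p v \<tau>)) (fst h)) \<in> borel_measurable borel"
      by (rule measurable_compose[of "\<lambda>\<tau>. ?p v \<tau>" borel borel "\<lambda>x. frechet_derivative g (at x) (fst h)"]) measurable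
    have [measurable]: "(\<lambda>\<tau>. frechet_derivative f (at (?m v \<tau>)) (fst h)) \<in> borel_measurable borel"
      by (rule measurable_compose[of "\<lambda>\<tau>. ?m v \<tau>" borel borel "\<lambda>x. frechet_derivative f (at x) (fst h)"]) measurable
    show "?D v h \<in> borel_measurable borel" by measurable
    show "cmod (?D v h \<tau>) \<le> (B' * A + B * A' + B * A) * c * norm h * wt (- ?s) \<tau>" for \<tau>
      using bD[of v \<tau> h] by (simp only: mult_ac)
  qed simp
  have "((\<lambda>v. LINT \<tau>|lborel. ?G v \<tau>) has_derivative (\<lambda>h. LINT \<tau>|lborel. ?D v h \<tau>)) (at v)"
  proof (rule has_derivative_lebesgue_integral[where D = ?D and w = "\<lambda>\<tau>. (B' * A + B * A' + B * A) * c * wt (- ?s) \<tau>"])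
    show "integrable lborel (?G v)" for v
      using wigner_integrable[OF g f] by simp
    show "integrable lborel (\<lambda>\<tau>::'a. (B' * A + B * A' + B * A) * c * wt (- ?s) \<tau>)"
      using integrable_wt[where 'a='a and s = ?s] by simp
  qed (use iD deriv bD in auto)
  moreover have "wigner g f = (\<lambda>v. LINT \<tau>|lborel. ?G v \<tau>)"
    by (rule ext) (rule wigner_apply)
  ultimately have W': "(wigner g f has_derivative (\<lambda>h. LINT \<tau>|lborel. ?D v h \<tau>)) (at v)"
    by (simp only:)
  moreover have "(LINT \<tau>|lborel. ?D v (b, 0) \<tau>) = wigner (dpart b g) f v + wigner g (dpart b f) v" if b: "b \<in> Basis" for b
    using wigner_integrable[OF schwartz_dpart[OF g b] f, of "fst v" "snd v"]
      wigner_integrable[OF g schwartz_dpart[OF f b], of "fst v" "snd v"] by (simp add: wigner_apply)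
  moreover have "(LINT \<tau>|lborel. ?D v (0, b) \<tau>)
      = - \<i> * (wigner (\<lambda>y. of_real (y \<bullet> b) * g y) f v - wigner g (\<lambda>y. of_real (y \<bullet> b) * f y) v)" if b: "b \<in> Basis" for b
  proof -
    have l0: "frechet_derivative g (at x) 0 = 0" "frechet_derivative f (at x) 0 = 0" for x
      using linear_0[OF has_derivative_linear[OF lg]] linear_0[OF has_derivative_linear[OF lf]] by auto
    have "?D v (0, b) \<tau> = - \<i> * (of_real ((?p v \<tau>) \<bullet> b) * g (?p v \<tau>) * cnj (f (?m v \<tau>)) * ?e v \<tau>
        - g (?p v \<tau>) * cnj (of_real ((?m v \<tau>) \<bullet> b) * f (?m v \<tau>)) * ?e v \<tau>)" for \<tau>
    proof -
      have "\<tau> \<bullet> b = (?p v \<tau>) \<bullet> b - (?m v \<tau>) \<bullet> b"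
        by (simp add: inner_add_left inner_diff_left)
      then have "complex_of_real (\<tau> \<bullet> b) = of_real ((?p v \<tau>) \<bullet> b) - of_real ((?m v \<tau>) \<bullet> b)"
        by (simp only: of_real_diff)
      then show ?thesis
        unfolding fst_conv snd_conv l0 by (simp only: complex_cnj_zero complex_cnj_mult complex_cnj_complex_of_real) (simp add: algebra_simps)
    qed
    then have "(LINT \<tau>|lborel. ?D v (0, b) \<tau>) = (LINT \<tau>|lborel. - \<i> * (of_real ((?p v \<tau>) \<bullet> b) * g (?p v \<tau>) * cnj (f (?m v \<tau>)) * ?e v \<tau>
        - g (?p v \<tau>) * cnj (of_real ((?m v \<tau>) \<bullet> b) * f (?m v \<tau>)) * ?e v \<tau>))" by presburger
    also have "\<dots> = - \<i> * (LINT \<tau>|lborel. of_real ((?p v \<tau>) \<bullet> b) * g (?p v \<tau>) * cnj (f (?m v \<tau>)) * ?e v \<tau>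
        - g (?p v \<tau>) * cnj (of_real ((?m v \<tau>) \<bullet> b) * f (?m v \<tau>)) * ?e v \<tau>)"
      by (rule integral_mult_right_zero)
    also have "(LINT \<tau>|lborel. of_real ((?p v \<tau>) \<bullet> b) * g (?p v \<tau>) * cnj (f (?m v \<tau>)) * ?e v \<tau>
        - g (?p v \<tau>) * cnj (of_real ((?m v \<tau>) \<bullet> b) * f (?m v \<tau>)) * ?e v \<tau>)
       = wigner (\<lambda>y. of_real (y \<bullet> b) * g y) f v - wigner g (\<lambda>y. of_real (y \<bullet> b) * f y) v"
      unfolding wigner_apply
      by (rule Bochner_Integration.integral_diff[OF wigner_integrable[OF schwartz_coord_mult[OF g] f]
          wigner_integrable[OF g schwartz_coord_mult[OF f]]])
    finally show ?thesis .
  qed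
  ultimately show ?thesis by blast
qed

lemma integrable_wt_shift:
  assumes "2 * real DIM('a) \<le> s"
  shows "integrable lborel (\<lambda>z::'a::euclidean_space. wt (- s) (z - c))"
    and "(LINT z|lborel. wt (- s) (z - c)) = (LINT z::'a|lborel. wt (- s) z)"
  using lborel_translate[of "\<lambda>z::'a. wt (- s) z" "- c"] integrable_wt[OF assms] by simp_all

text \<open>The sesquilinear form \<open>(a\<^sup>w(x,D) f, g)\<close> for a symbol that is a
  function.\<close>

definition weyl_form :: "('a::euclidean_space \<times> 'a \<Rightarrow> complex) \<Rightarrow> ('a \<Rightarrow> complex) \<Rightarrow> ('a \<Rightarrow> complex) \<Rightarrow> complex" where
  "weyl_form a f g = weyl_distr (L2_inner a) f g"

abbreviation weyl_const :: "'a::euclidean_space itself \<Rightarrow> complex" where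
  "weyl_const _ \<equiv> of_real ((2 * pi) powr - real DIM('a))"

lemma weyl_form_eq:
  "weyl_form a (f :: 'a::euclidean_space \<Rightarrow> complex) g
    = weyl_const TYPE('a) * (LINT v|lborel. a v * cnj (wigner g f v))"
  by (simp add: weyl_form_def weyl_distr_def L2_inner_def)

lemma weyl_form_commute: "weyl_form a f g = cnj (weyl_form (\<lambda>v. cnj (a v)) g f)"
  unfolding weyl_form_eq complex_cnj_mult Bochner_Integration.integral_cnj[symmetric]
  by (simp add: wigner_commute[of f g])

text \<open>The Wigner distribution lives near the midpoint, so up to Peetre factors the symbol is
  evaluated there. The constant serves all symbols at once, which enter through \<open>A\<close>
  alone.\<close>

lemma weyl_form_integrable_bound:
  fixes f g :: "'a::euclidean_space \<Rightarrow> complex"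
  assumes f: "f \<in> schwartz" and g: "g \<in> schwartz"
  shows "\<exists>C\<ge>0. \<forall>a A w z. a \<in> borel_measurable borel \<longrightarrow> A \<ge> 0 \<longrightarrow> (\<forall>v. cmod (a v) \<le> A * wt K v) \<longrightarrow>
      integrable lborel (\<lambda>v. a v * cnj (wigner (tf_shift z g) (tf_shift w f) v)) \<and>
      cmod (weyl_form a (tf_shift w f) (tf_shift z g)) \<le> C * A * wt K ((z + w) /\<^sub>R 2)"
proof -
  define s where "s = 2 * real DIM('a \<times> 'a)"
  obtain D where D: "D \<ge> 0" 
    "\<And>z w v. cmod (wigner (tf_shift z g) (tf_shift w f) v) \<le> D * wt (- (s + \<bar>K\<bar>)) (v - (z + w) /\<^sub>R 2)"
    using wigner_decay[OF g f, of "s + \<bar>K\<bar>"] by (auto simp: s_def)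
  define I where "I = (LINT v::'a\<times>'a|lborel. wt (- s) v)"
  have I: "I \<ge> 0" unfolding I_def by simp
  let ?c = "(2 * pi) powr - real DIM('a)"
  define C where "C = ?c * (2 powr \<bar>K\<bar> * D * I)"
  have main: "integrable lborel (\<lambda>v. a v * cnj (wigner (tf_shift z g) (tf_shift w f) v)) \<and>
      cmod (weyl_form a (tf_shift w f) (tf_shift z g)) \<le> C * A * wt K ((z + w) /\<^sub>R 2)"
    if am: "a \<in> borel_measurable borel" and A: "A \<ge> 0" and aA: "\<And>v. cmod (a v) \<le> A * wt K v" for a A w z
  proof -
    let ?p = "(z + w) /\<^sub>R 2"
    let ?W = "wigner (tf_shift z g) (tf_shift w f)"
    have b: "cmod (a v * cnj (?W v)) \<le> (A * 2 powr \<bar>K\<bar> * wt K ?p * D) * wt (- s) (v - ?p)" for v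
    proof -
      have "cmod (a v * cnj (?W v)) \<le> (A * wt K v) * (D * wt (- (s + \<bar>K\<bar>)) (v - ?p))"
        unfolding norm_mult complex_mod_cnj using A D(1) by (intro mult_mono aA D) auto
      also have "\<dots> \<le> (A * (2 powr \<bar>K\<bar> * wt K ?p * wt \<bar>K\<bar> (v - ?p))) * (D * wt (- (s + \<bar>K\<bar>)) (v - ?p))"
        using A D by (intro mult_right_mono mult_left_mono wt_diff_le) auto
      also have "\<dots> = (A * 2 powr \<bar>K\<bar> * wt K ?p * D) * (wt \<bar>K\<bar> (v - ?p) * wt (- (s + \<bar>K\<bar>)) (v - ?p))"
        by (simp only: mult_ac)
      also have "wt \<bar>K\<bar> (v - ?p) * wt (- (s + \<bar>K\<bar>)) (v - ?p) = wt (- s) (v - ?p)"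
        by (simp flip: powr_add)
      finally show ?thesis .
    qed
    have i: "integrable lborel (\<lambda>v. (A * 2 powr \<bar>K\<bar> * wt K ?p * D) * wt (- s) (v - ?p))"
      using integrable_wt_shift(1)[where 'a = "'a \<times> 'a" and s = s] by (simp add: s_def)
    have [measurable]: "?W \<in> borel_measurable borel"
      using f g by (intro measurable_wigner1 schwartz_measurable schwartz_tf_shift)
    have int: "integrable lborel (\<lambda>v. a v * cnj (?W v))"
    proof (rule Bochner_Integration.integrable_bound[OF i])
      show "AE v in lborel. norm (a v * cnj (?W v)) \<le> norm ((A * 2 powr \<bar>K\<bar> * wt K ?p * D) * wt (- s) (v - ?p))"
        using order_trans[OF b abs_ge_self] by (intro AE_I2) simp
    qed (use am in measurable)
    have "cmod (LINT v|lborel. a v * cnj (?W v)) \<le> (LINT v|lborel. (A * 2 powr \<bar>K\<bar> * wt K ?p * D) * wt (- s) (v - ?p))"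
      by (rule Bochner_Integration.integral_norm_bound_integral[OF int i b])
    also have "\<dots> = A * 2 powr \<bar>K\<bar> * wt K ?p * D * I"
      using integrable_wt_shift(2)[where 'a = "'a \<times> 'a" and s = s] by (simp add: s_def I_def)
    finally have "cmod (weyl_form a (tf_shift w f) (tf_shift z g)) \<le> ?c * (A * 2 powr \<bar>K\<bar> * wt K ?p * D * I)"
      unfolding weyl_form_eq norm_mult by (simp add: mult_left_mono)
    then show ?thesis using int by (simp only: C_def mult_ac)
  qed
  have "C \<ge> 0" unfolding C_def using D I by auto
  then show ?thesis
    by (intro exI[of _ C] conjI[of "0 \<le> C"]) (assumption, intro allI impI, rule main, auto)
qed

lemma wigner_covariance: "wigner (tf_shift w g) (tf_shift w f) v = wigner g f (v - w)"
proof -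
  have "tf_shift w g (fst v + \<tau> /\<^sub>R 2) * cnj (tf_shift w f (fst v - \<tau> /\<^sub>R 2)) * exp (- \<i> * of_real (\<tau> \<bullet> snd v))
    = g (fst v - fst w + \<tau> /\<^sub>R 2) * cnj (f (fst v - fst w - \<tau> /\<^sub>R 2)) * exp (- \<i> * of_real (\<tau> \<bullet> snd (v - w)))" for \<tau>
  proof -
    let ?a = "(fst v + \<tau> /\<^sub>R 2) \<bullet> snd w" and ?b = "(fst v - \<tau> /\<^sub>R 2) \<bullet> snd w" and ?c = "\<tau> \<bullet> snd v"
    have "?a - ?b - ?c = - (\<tau> \<bullet> snd (v - w))"
      by (simp add: inner_add_left inner_diff_left inner_diff_right)
    then have "\<i> * complex_of_real (?a - ?b - ?c) = - \<i> * of_real (\<tau> \<bullet> snd (v - w))"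
      by simp
    then have "\<i> * of_real ?a + - (\<i> * of_real ?b) + - (\<i> * of_real ?c) = - \<i> * complex_of_real (\<tau> \<bullet> snd (v - w))"
      unfolding of_real_diff right_diff_distrib by (simp only: add_uminus_conv_diff)
    then have "exp (\<i> * of_real ?a) * exp (- (\<i> * of_real ?b)) * exp (- (\<i> * of_real ?c))
       = exp (- \<i> * complex_of_real (\<tau> \<bullet> snd (v - w)))"
      by (simp only: exp_add[symmetric])
    moreover have "fst v + \<tau> /\<^sub>R 2 - fst w = fst v - fst w + \<tau> /\<^sub>R 2" "fst v - \<tau> /\<^sub>R 2 - fst w = fst v - fst w - \<tau> /\<^sub>R 2"
      by (simp_all add: algebra_simps)
    ultimately show ?thesis
      unfolding tf_shift_apply complex_cnj_mult exp_cnj complex_cnj_i complex_cnj_complex_of_real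
      by (simp only: mult_minus_left) (simp add: mult_ac)
  qed
  then show ?thesis unfolding wigner_apply fst_diff by presburger
qed

lemma weyl_form_cmult_right: "weyl_form a f (\<lambda>x. c * g x) = cnj c * weyl_form a f g"
  unfolding weyl_form_eq wigner_cmult_left complex_cnj_mult
  by (simp add: mult.left_commute)

text \<open>Shifting both functions by \<open>w\<close> translates the symbol. Splitting
  \<open>tf_shift z\<close> into two shifts leaves a phase, hence the modulus.\<close>

lemma weyl_form_covariance:
  "cmod (weyl_form a (tf_shift w f) (tf_shift z g)) = cmod (weyl_form (\<lambda>v. a (v + w)) f (tf_shift (z - w) g))"
proof -
  let ?c = "exp (\<i> * complex_of_real (fst w \<bullet> snd (z - w)))"
  have "tf_shift z g = (\<lambda>y. ?c * tf_shift w (tf_shift (z - w) g) y)"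
    by (simp add: tf_shift_tf_shift exp_minus fun_eq_iff)
  then have "weyl_form a (tf_shift w f) (tf_shift z g) = weyl_form a (tf_shift w f) (\<lambda>y. ?c * tf_shift w (tf_shift (z - w) g) y)"
    by (rule arg_cong)
  also have "\<dots> = cnj ?c * weyl_form a (tf_shift w f) (tf_shift w (tf_shift (z - w) g))"
    by (rule weyl_form_cmult_right)
  also have "weyl_form a (tf_shift w f) (tf_shift w (tf_shift (z - w) g)) = weyl_form (\<lambda>v. a (v + w)) f (tf_shift (z - w) g)"
    unfolding weyl_form_eq wigner_covariance
    using lborel_translate(2)[of "\<lambda>v. a v * cnj (wigner (tf_shift (z - w) g) f (v - w))" w] by simp
  finally show ?thesis by (simp add: norm_mult)
qed

section \<open>Integration by parts in Weyl forms\<close>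

text \<open>All derivatives obey one order \<open>K\<close>, uniformly in the parameter. The
  parameter will be the base point at which a symbol is recentred and normalized; uniformity is what
  makes the resulting kernel bounds independent of that point.\<close>

definition symbol_family :: "real \<Rightarrow> ('q \<Rightarrow> 'b::euclidean_space \<Rightarrow> complex) \<Rightarrow> bool" where
  "symbol_family K b \<longleftrightarrow> (\<forall>q. smooth (b q)) \<and>
    (\<forall>bs. set bs \<subseteq> Basis \<longrightarrow> (\<exists>C\<ge>0. \<forall>q v. cmod (partial_derivs bs (b q) v) \<le> C * wt K v))"

lemma symbol_family_dpart:
  assumes "symbol_family K b" "e \<in> Basis"
  shows "symbol_family K (\<lambda>q. dpart e (b q))"
  using assms unfolding symbol_family_def
  by (auto simp: smooth_dpart simp flip: partial_derivs_snoc)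

lemma symbol_family_bound:
  assumes "symbol_family K b"
  obtains C where "C \<ge> 0" "\<And>q v. cmod (b q v) \<le> C * wt K v"
  using assms unfolding symbol_family_def by (metis partial_derivs.simps(1) empty_subsetI list.set(1))

lemma symbol_family_measurable: "symbol_family K b \<Longrightarrow> b q \<in> borel_measurable borel"
  by (simp add: symbol_family_def measurable_smooth)

lemma weyl_form_integrable:
  fixes f g :: "'a::euclidean_space \<Rightarrow> complex"
  assumes "f \<in> schwartz" "g \<in> schwartz" "a \<in> borel_measurable borel" "\<And>v. cmod (a v) \<le> A * wt K v"
  shows "integrable lborel (\<lambda>v. a v * cnj (wigner g f v))"
proof -
  have A: "A \<ge> 0"
    using order_trans[OF norm_ge_zero assms(4)[of 0]] by (simp add: zero_le_mult_iff)
  from weyl_form_integrable_bound[OF assms(1,2), where K = K] obtain C where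
    "\<forall>a A w z. a \<in> borel_measurable borel \<longrightarrow> A \<ge> 0 \<longrightarrow> (\<forall>v. cmod (a v) \<le> A * wt K v) \<longrightarrow>
      integrable lborel (\<lambda>v. a v * cnj (wigner (tf_shift z g) (tf_shift w f) v)) \<and>
      cmod (weyl_form a (tf_shift w f) (tf_shift z g)) \<le> C * A * wt K ((z + w) /\<^sub>R 2)"
    by (elim exE conjE) (rule that)
  from this[rule_format, OF assms(3) A assms(4), of 0 0] show ?thesis by simp
qed

lemma weyl_form_add_right:
  fixes f g :: "'a::euclidean_space \<Rightarrow> complex"
  assumes f: "f \<in> schwartz" and g: "g \<in> schwartz" and h: "h \<in> schwartz"
    and a: "a \<in> borel_measurable borel" "\<And>v. cmod (a v) \<le> A * wt K v"
  shows "weyl_form a f (\<lambda>x. g x + h x) = weyl_form a f g + weyl_form a f h"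
  unfolding weyl_form_eq using weyl_form_integrable[OF f g a] weyl_form_integrable[OF f h a]
  by (simp add: wigner_add_left[OF g h f] distrib_left)

text \<open>The derivative \<open>V\<close> of the Wigner distribution in the direction
  \<open>e\<close> is left abstract, so that position and frequency directions are handled
  together.\<close>

lemma weyl_form_by_parts:
  fixes f g :: "'a::euclidean_space \<Rightarrow> complex"
  assumes b: "symbol_family K b" and e: "e \<in> Basis" and f: "f \<in> schwartz" and g: "g \<in> schwartz"
    and W: "\<And>v. \<exists>W'. (wigner g f has_derivative W') (at v) \<and> W' e = V v"
    and V: "V \<in> borel_measurable borel" "\<And>s. \<exists>C. \<forall>v. cmod (V v) \<le> C * wt (- s) v"
  shows "(LINT v|lborel. b q v * cnj (V v)) = - (LINT v|lborel. dpart e (b q) v * cnj (wigner g f v))"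
proof -
  let ?s = "2 * real DIM('a \<times> 'a)"
  obtain C where C: "C \<ge> 0" "\<And>q v. cmod (b q v) \<le> C * wt K v" using symbol_family_bound[OF b] by blast
  obtain C' where C': "C' \<ge> 0" "\<And>q v. cmod (dpart e (b q) v) \<le> C' * wt K v"
    using symbol_family_bound[OF symbol_family_dpart[OF b e]] by blast
  have [measurable]: "b q \<in> borel_measurable borel" "dpart e (b q) \<in> borel_measurable borel"
    using b e by (auto intro: symbol_family_measurable symbol_family_dpart[THEN symbol_family_measurable])
  have [measurable]: "wigner g f \<in> borel_measurable borel"
    using f g by (intro measurable_wigner1 schwartz_measurable)
  note [measurable] = V(1)
  obtain W' where W': "\<And>v. (wigner g f has_derivative W' v) (at v)" "\<And>v. W' v e = V v"
    using W by metis
  let ?sK = "?s + \<bar>K\<bar>"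
  obtain B where B: "B \<ge> 0" "\<And>v. cmod (wigner g f v) \<le> B * wt (- ?sK) v"
  proof -
    obtain B where B: "B \<ge> 0" "\<And>z w v. cmod (wigner (tf_shift z g) (tf_shift w f) v) \<le> B * wt (- ?sK) (v - (z + w) /\<^sub>R 2)"
      using wigner_decay[OF g f, of "?sK"] by auto
    from B(2)[of 0 0] show ?thesis using B(1) that[of B] by simp
  qed
  obtain D0 where D0: "\<And>v. cmod (V v) \<le> D0 * wt (- ?sK) v" using V(2) by blast
  define D where "D = max D0 0"
  have D: "D \<ge> 0" "\<And>v. cmod (V v) \<le> D * wt (- ?sK) v"
    unfolding D_def by (auto intro!: order_trans[OF D0] mult_right_mono)
  have wK: "wt K v * wt (- ?sK) v \<le> wt (- ?s) v" for v :: "'a \<times> 'a"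
    unfolding powr_add[symmetric] by (intro wt_mono) simp
  let ?M = "C * B + C * D + C' * B"
  have bd: "cmod x * cmod y \<le> X * Y * wt (- ?s) v" if "X \<ge> 0" "Y \<ge> 0" "cmod x \<le> X * wt K v" "cmod y \<le> Y * wt (- ?sK) v"
    for x y X Y and v :: "'a \<times> 'a"
  proof -
    have "cmod x * cmod y \<le> (X * wt K v) * (Y * wt (- ?sK) v)"
      using that by (intro mult_mono) auto
    also have "\<dots> = (X * Y) * (wt K v * wt (- ?sK) v)" by (simp only: mult_ac)
    also have "\<dots> \<le> (X * Y) * wt (- ?s) v" using that by (intro mult_left_mono wK) auto
    finally show ?thesis .
  qed
  have bdF: "cmod (b q v * cnj (wigner g f v)) \<le> C * B * wt (- ?s) v" for v
    unfolding norm_mult complex_mod_cnj by (rule bd[OF C(1) B(1) C(2) B(2)])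
  have bd1: "cmod (b q v * cnj (V v)) \<le> C * D * wt (- ?s) v" for v
    unfolding norm_mult complex_mod_cnj by (rule bd[OF C(1) D(1) C(2) D(2)])
  have bd2: "cmod (dpart e (b q) v * cnj (wigner g f v)) \<le> C' * B * wt (- ?s) v" for v
    unfolding norm_mult complex_mod_cnj by (rule bd[OF C'(1) B(1) C'(2) B(2)])
  have nn: "0 \<le> C * B" "0 \<le> C * D" "0 \<le> C' * B" using C C' B D by auto
  have "(LINT v|lborel. b q v * cnj (W' v e) + frechet_derivative (b q) (at v) e * cnj (wigner g f v)) = 0"
  proof (rule integral_directional_derivative_eq_0[where F = "\<lambda>v. b q v * cnj (wigner g f v)" and C = ?M and s = ?s])
    show "((\<lambda>v. b q v * cnj (wigner g f v)) has_derivative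
        (\<lambda>h. b q v * cnj (W' v h) + frechet_derivative (b q) (at v) h * cnj (wigner g f v))) (at v)" for v
      using b W'(1) by (intro has_derivative_mult bounded_linear.has_derivative[OF bounded_linear_cnj]
          smooth_has_derivative) (auto simp: symbol_family_def)
    show "cmod (b q v * cnj (wigner g f v)) \<le> ?M * wt (- ?s) v" for v
      using bdF[of v] nn by (elim order_trans) (intro mult_right_mono, auto)
    show "cmod (b q v * cnj (W' v e) + frechet_derivative (b q) (at v) e * cnj (wigner g f v)) \<le> ?M * wt (- ?s) v" for v
    proof -
      have "cmod (b q v * cnj (V v) + dpart e (b q) v * cnj (wigner g f v)) \<le> C * D * wt (- ?s) v + C' * B * wt (- ?s) v"
        by (intro norm_triangle_mono bd1 bd2)
      also have "\<dots> \<le> ?M * wt (- ?s) v" using nn by (simp add: distrib_right)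
      finally show ?thesis unfolding W'(2) .
    qed
  qed (simp_all add: W'(2))
  moreover have "integrable lborel (\<lambda>v. b q v * cnj (V v))"
    by (rule integrable_wt_bound[OF _ bd1]) simp_all
  moreover have "integrable lborel (\<lambda>v. dpart e (b q) v * cnj (wigner g f v))"
    by (rule integrable_wt_bound[OF _ bd2]) simp_all
  ultimately show ?thesis unfolding W'(2) by (simp add: add_eq_0_iff)
qed

lemma wigner_rapid:
  assumes "g \<in> schwartz" "f \<in> schwartz"
  shows "rapid (wigner g f)"
  unfolding rapid_def
proof (intro conjI allI)
  show "wigner g f \<in> borel_measurable borel"
    using assms by (intro measurable_wigner1 schwartz_measurable)
  fix s
  obtain C where C: "C \<ge> 0" "\<And>z w v. cmod (wigner (tf_shift z g) (tf_shift w f) v) \<le> C * wt (- \<bar>s\<bar>) (v - (z + w) /\<^sub>R 2)"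
    using wigner_decay[OF assms, of "\<bar>s\<bar>"] by auto
  have "cmod (wigner g f v) \<le> C * wt (- s) v" for v
  proof -
    have "C * wt (- \<bar>s\<bar>) v \<le> C * wt (- s) v"
      using C(1) by (intro mult_left_mono wt_mono) auto
    then show ?thesis using C(2)[of 0 0 v] by simp
  qed
  then show "\<exists>C. \<forall>v. cmod (wigner g f v) \<le> C * wt (- s) v" by blast
qed

lemma rapid_add: "rapid F \<Longrightarrow> rapid G \<Longrightarrow> rapid (\<lambda>v. F v + G v)"
  unfolding rapid_def
proof (intro conjI allI; (elim conjE)?)
  fix s
  assume "\<forall>s. \<exists>C. \<forall>z. cmod (F z) \<le> C * wt (- s) z" "\<forall>s. \<exists>C. \<forall>z. cmod (G z) \<le> C * wt (- s) z"
  then obtain C D where CD: "\<And>z. cmod (F z) \<le> C * wt (- s) z" "\<And>z. cmod (G z) \<le> D * wt (- s) z" by meson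
  have "cmod (F z + G z) \<le> (C + D) * wt (- s) z" for z
    using norm_triangle_mono[OF CD(1)[of z] CD(2)[of z]] by (simp add: distrib_right)
  then show "\<exists>C. \<forall>z. cmod (F z + G z) \<le> C * wt (- s) z" by blast
qed auto

lemma rapid_cmult: "rapid F \<Longrightarrow> rapid (\<lambda>v. c * F v)"
  unfolding rapid_def
proof (intro conjI allI; (elim conjE)?)
  fix s
  assume "\<forall>s. \<exists>C. \<forall>z. cmod (F z) \<le> C * wt (- s) z"
  then obtain C where C: "\<And>z. cmod (F z) \<le> C * wt (- s) z" by meson
  have "cmod (c * F z) \<le> (cmod c * C) * wt (- s) z" for z
    using mult_left_mono[OF C[of z], of "cmod c"] by (simp add: norm_mult mult.assoc)
  then show "\<exists>C. \<forall>z. cmod (c * F z) \<le> C * wt (- s) z" by blast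
qed auto

lemma Basis_prod_left: "b \<in> Basis \<Longrightarrow> (b, 0) \<in> Basis" and Basis_prod_right: "b \<in> Basis \<Longrightarrow> (0, b) \<in> Basis"
  by (auto simp: Basis_prod_def)

text \<open>The commutator of the operator with a derivative: the position derivative of the Wigner
  distribution is split by the product rule and then thrown onto the symbol.\<close>

lemma weyl_form_dpart:
  fixes f g :: "'a::euclidean_space \<Rightarrow> complex"
  assumes b: "symbol_family K a" and e: "e \<in> Basis" and f: "f \<in> schwartz" and g: "g \<in> schwartz"
  shows "weyl_form (a q) f (dpart e g) = - weyl_form (a q) (dpart e f) g - weyl_form (dpart (e, 0) (a q)) f g"
proof -
  obtain A where A: "\<And>q v. cmod (a q v) \<le> A * wt K v" using symbol_family_bound[OF b] by blast
  note am = symbol_family_measurable[OF b, of q]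
  have df: "dpart e f \<in> schwartz" and dg: "dpart e g \<in> schwartz" using f g e by (auto intro: schwartz_dpart)
  have "(LINT v|lborel. a q v * cnj (wigner (dpart e g) f v + wigner g (dpart e f) v))
      = - (LINT v|lborel. dpart (e, 0) (a q) v * cnj (wigner g f v))"
  proof (rule weyl_form_by_parts[OF b Basis_prod_left[OF e] f g])
    show "\<exists>W'. (wigner g f has_derivative W') (at v) \<and> W' (e, 0) = wigner (dpart e g) f v + wigner g (dpart e f) v" for v
      using wigner_has_derivative[OF g f, of v] e by blast
    have "rapid (\<lambda>v. wigner (dpart e g) f v + wigner g (dpart e f) v)"
      by (intro rapid_add wigner_rapid f g df dg)
    then show "(\<lambda>v. wigner (dpart e g) f v + wigner g (dpart e f) v) \<in> borel_measurable borel"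
       "\<And>s. \<exists>C. \<forall>v. cmod (wigner (dpart e g) f v + wigner g (dpart e f) v) \<le> C * wt (- s) v"
      by (simp_all add: rapid_def)
  qed
  then have "(LINT v|lborel. a q v * cnj (wigner (dpart e g) f v)) + (LINT v|lborel. a q v * cnj (wigner g (dpart e f) v))
      = - (LINT v|lborel. dpart (e, 0) (a q) v * cnj (wigner g f v))"
    using weyl_form_integrable[OF f dg am A] weyl_form_integrable[OF df g am A] by (simp add: distrib_left)
  then have eq: "(LINT v|lborel. a q v * cnj (wigner (dpart e g) f v))
      = - (LINT v|lborel. a q v * cnj (wigner g (dpart e f) v)) - (LINT v|lborel. dpart (e, 0) (a q) v * cnj (wigner g f v))"
    by (simp add: algebra_simps eq_neg_iff_add_eq_0)
  show ?thesis
    unfolding weyl_form_eq eq by (simp only: right_diff_distrib mult_minus_right)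
qed

text \<open>The commutator of the operator with a coordinate: the difference of the coordinates on
  both sides is a frequency derivative of the Wigner distribution, which moves onto the
  symbol.\<close>

lemma weyl_form_coord:
  fixes f g :: "'a::euclidean_space \<Rightarrow> complex"
  assumes b: "symbol_family K a" and e: "e \<in> Basis" and f: "f \<in> schwartz" and g: "g \<in> schwartz"
  shows "weyl_form (a q) f (\<lambda>y. of_real (y \<bullet> e) * g y)
    = weyl_form (a q) (\<lambda>y. of_real (y \<bullet> e) * f y) g + \<i> * weyl_form (dpart (0, e) (a q)) f g"
proof -
  obtain A where A: "\<And>q v. cmod (a q v) \<le> A * wt K v" using symbol_family_bound[OF b] by blast
  note am = symbol_family_measurable[OF b, of q]
  let ?x = "\<lambda>(f :: 'a \<Rightarrow> complex) y. of_real (y \<bullet> e) * f y"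
  have df: "?x f \<in> schwartz" and dg: "?x g \<in> schwartz" using f g by (auto intro: schwartz_coord_mult)
  let ?V = "\<lambda>v. - \<i> * (wigner (?x g) f v - wigner g (?x f) v)"
  have "(LINT v|lborel. a q v * cnj (?V v)) = - (LINT v|lborel. dpart (0, e) (a q) v * cnj (wigner g f v))"
  proof (rule weyl_form_by_parts[OF b Basis_prod_right[OF e] f g])
    show "\<exists>W'. (wigner g f has_derivative W') (at v) \<and> W' (0, e) = ?V v" for v
      using wigner_has_derivative[OF g f, of v] e by blast
    have "rapid (\<lambda>v. - \<i> * (wigner (?x g) f v + (-1) * wigner g (?x f) v))"
      by (intro rapid_add rapid_cmult wigner_rapid f g df dg)
    then show "?V \<in> borel_measurable borel" "\<And>s. \<exists>C. \<forall>v. cmod (?V v) \<le> C * wt (- s) v"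
      by (simp_all add: rapid_def)
  qed
  moreover have "(LINT v|lborel. a q v * cnj (?V v))
      = (LINT v|lborel. \<i> * (a q v * cnj (wigner (?x g) f v) - a q v * cnj (wigner g (?x f) v)))"
    by (intro Bochner_Integration.integral_cong) (auto simp: algebra_simps)
  moreover have "\<dots> = \<i> * ((LINT v|lborel. a q v * cnj (wigner (?x g) f v)) - (LINT v|lborel. a q v * cnj (wigner g (?x f) v)))"
    using weyl_form_integrable[OF f dg am A] weyl_form_integrable[OF df g am A] by simp
  ultimately have "\<i> * ((LINT v|lborel. a q v * cnj (wigner (?x g) f v)) - (LINT v|lborel. a q v * cnj (wigner g (?x f) v)))
      = - (LINT v|lborel. dpart (0, e) (a q) v * cnj (wigner g f v))" by simp
  then have "\<i> * (\<i> * ((LINT v|lborel. a q v * cnj (wigner (?x g) f v)) - (LINT v|lborel. a q v * cnj (wigner g (?x f) v))))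
      = \<i> * - (LINT v|lborel. dpart (0, e) (a q) v * cnj (wigner g f v))" by (rule arg_cong)
  then have eq: "(LINT v|lborel. a q v * cnj (wigner (?x g) f v))
      = (LINT v|lborel. a q v * cnj (wigner g (?x f) v)) + \<i> * (LINT v|lborel. dpart (0, e) (a q) v * cnj (wigner g f v))"
    by (simp add: mult.assoc[symmetric] algebra_simps)
  show ?thesis
    unfolding weyl_form_eq eq by (simp only: distrib_left mult_ac)
qed

text \<open>The coordinate argument for triples: each coordinate of the shift lands on
  \<open>f\<close>, on the window, or as a derivative on the symbol, and symbol families are closed
  under derivatives. Working with families instead of single symbols keeps the constant uniform in
  \<open>q\<close>.\<close>

lemma weyl_form_decay:
  fixes f g :: "'a::euclidean_space \<Rightarrow> complex" and a :: "'q \<Rightarrow> 'a \<times> 'a \<Rightarrow> complex"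
  assumes a: "symbol_family K a" and f: "f \<in> schwartz" and g: "g \<in> schwartz"
  obtains C where "C \<ge> 0" "\<And>q z. cmod (weyl_form (a q) f (tf_shift z g)) \<le> C * wt (- s) z"
proof -
  define T where "T = (\<lambda>(a :: 'q \<Rightarrow> 'a \<times> 'a \<Rightarrow> complex, f :: 'a \<Rightarrow> complex, g :: 'a \<Rightarrow> complex).
      symbol_family K a \<and> f \<in> schwartz \<and> g \<in> schwartz)"
  define A where "A = (\<lambda>(a :: 'q \<Rightarrow> 'a \<times> 'a \<Rightarrow> complex, f :: 'a \<Rightarrow> complex, g) p. cmod (weyl_form (a (fst p)) f (tf_shift (snd p) g)))"
  \<comment> \<open>The base estimate evaluates the symbol near \<open>z / 2\<close> and so grows
    like \<open>wt \<bar>K\<bar> z\<close>; this many additional powers cancel the growth.\<close>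
  define n where "n = nat \<lceil>s + \<bar>K\<bar>\<rceil>"
  have "\<exists>C. \<forall>p. bracket (snd p) ^ n * A (a, f, g) p \<le> C * wt \<bar>K\<bar> (snd p)"
  proof (rule decay_by_coordinates[where A = A and T = T])
    show "T (a, f, g)" using a f g by (simp add: T_def)
    show "0 \<le> A i p" for i p by (cases i) (simp add: A_def)
    fix i assume "T i"
    then obtain a f g where i: "i = (a, f, g)" and a: "symbol_family K a" and f: "f \<in> schwartz" and g: "g \<in> schwartz"
      by (cases i) (auto simp: T_def)
    obtain D where D: "D \<ge> 0" "\<And>q v. cmod (a q v) \<le> D * wt K v" using symbol_family_bound[OF a] by blast
    note am = symbol_family_measurable[OF a]
    show "\<exists>C. \<forall>p. A i p \<le> C * wt \<bar>K\<bar> (snd p)"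
    proof -
      from weyl_form_integrable_bound[OF f g, where K = K]
      obtain C where C: "C \<ge> 0" and CC: "\<forall>a A w z. a \<in> borel_measurable borel \<longrightarrow> A \<ge> 0 \<longrightarrow> (\<forall>v. cmod (a v) \<le> A * wt K v) \<longrightarrow>
        integrable lborel (\<lambda>v. a v * cnj (wigner (tf_shift z g) (tf_shift w f) v)) \<and>
        cmod (weyl_form a (tf_shift w f) (tf_shift z g)) \<le> C * A * wt K ((z + w) /\<^sub>R 2)"
        by (elim exE conjE) (rule that)
      have "A i p \<le> (C * D) * wt \<bar>K\<bar> (snd p)" for p
      proof -
        have "A i p \<le> C * D * wt K (snd p /\<^sub>R 2)"
          using CC[rule_format, OF am[of "fst p"] D(1) D(2), where w = 0 and z = "snd p"] by (simp add: A_def i)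
        also have "\<dots> \<le> C * D * wt \<bar>K\<bar> (snd p /\<^sub>R 2)"
          using C D by (intro mult_left_mono wt_mono) auto
        also have "\<dots> \<le> C * D * wt \<bar>K\<bar> (snd p)"
          using C D by (intro mult_left_mono powr_mono2 bracket_mono) auto
        finally show ?thesis .
      qed
      then show ?thesis by blast
    qed
    fix e :: 'a assume e: "e \<in> Basis"
    let ?x = "\<lambda>(f :: 'a \<Rightarrow> complex) y. of_real (y \<bullet> e) * f y"
    have "\<bar>fst (snd p) \<bullet> e\<bar> * A i p \<le> A (a, ?x f, g) p + (A (\<lambda>q. dpart (0, e) (a q), f, g) p + A (a, f, ?x g) p)" for p
    proof -
      let ?z = "snd p" and ?q = "fst p"
      have tg: "tf_shift ?z g \<in> schwartz" "tf_shift ?z (?x g) \<in> schwartz"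
        using g by (auto intro!: schwartz_tf_shift schwartz_coord_mult)
      have "(\<lambda>y. of_real (fst ?z \<bullet> e) * tf_shift ?z g y) = (\<lambda>y. ?x (tf_shift ?z g) y + (-1) * tf_shift ?z (?x g) y)"
        by (simp add: tf_shift_coord)
      then have "weyl_form (a ?q) f (\<lambda>y. of_real (fst ?z \<bullet> e) * tf_shift ?z g y)
          = weyl_form (a ?q) f (\<lambda>y. ?x (tf_shift ?z g) y + (-1) * tf_shift ?z (?x g) y)" by (rule arg_cong)
      also have "\<dots> = weyl_form (a ?q) f (?x (tf_shift ?z g)) + weyl_form (a ?q) f (\<lambda>y. (-1) * tf_shift ?z (?x g) y)"
        using tg by (intro weyl_form_add_right[OF f _ _ am D(2)] schwartz_coord_mult schwartz_cmult)
      finally have "of_real (fst ?z \<bullet> e) * weyl_form (a ?q) f (tf_shift ?z g)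
         = weyl_form (a ?q) (?x f) (tf_shift ?z g) + (\<i> * weyl_form (dpart (0, e) (a ?q)) f (tf_shift ?z g)
           + (-1) * weyl_form (a ?q) f (tf_shift ?z (?x g)))"
        unfolding weyl_form_cmult_right weyl_form_coord[OF a e f tg(1)] by (simp add: add.assoc)
      then have "cmod (of_real (fst ?z \<bullet> e) * weyl_form (a ?q) f (tf_shift ?z g))
          \<le> cmod (weyl_form (a ?q) (?x f) (tf_shift ?z g)) + (cmod (\<i> * weyl_form (dpart (0, e) (a ?q)) f (tf_shift ?z g))
           + cmod ((-1) * weyl_form (a ?q) f (tf_shift ?z (?x g))))"
        by (simp only:) (intro norm_triangle_mono order_refl)
      then show ?thesis by (simp add: norm_mult A_def i)
    qed
    then show "\<exists>J. (\<forall>j\<in>set J. T j) \<and> (\<forall>p. \<bar>fst (snd p) \<bullet> e\<bar> * A i p \<le> (\<Sum>j\<leftarrow>J. A j p))"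
      using a f g symbol_family_dpart[OF a Basis_prod_right[OF e]]
      by (intro exI[of _ "[(a, ?x f, g), (\<lambda>q. dpart (0, e) (a q), f, g), (a, f, ?x g)]"])
        (auto simp: T_def intro: schwartz_coord_mult)
    have "\<bar>snd (snd p) \<bullet> e\<bar> * A i p \<le> A (a, dpart e f, g) p + (A (\<lambda>q. dpart (e, 0) (a q), f, g) p + A (a, f, dpart e g) p)" for p
    proof -
      let ?z = "snd p" and ?q = "fst p"
      have tg: "tf_shift ?z g \<in> schwartz" "tf_shift ?z (dpart e g) \<in> schwartz"
        using g e by (auto intro!: schwartz_tf_shift schwartz_dpart)
      have "dpart e (tf_shift ?z g) = (\<lambda>y. \<i> * of_real (e \<bullet> snd ?z) * tf_shift ?z g y + tf_shift ?z (dpart e g) y)"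
        using g by (intro dpart_tf_shift) (simp add: schwartz_smooth smoothD)
      then have "weyl_form (a ?q) f (dpart e (tf_shift ?z g))
          = weyl_form (a ?q) f (\<lambda>y. \<i> * of_real (e \<bullet> snd ?z) * tf_shift ?z g y + tf_shift ?z (dpart e g) y)" by (rule arg_cong)
      also have "\<dots> = weyl_form (a ?q) f (\<lambda>y. \<i> * of_real (e \<bullet> snd ?z) * tf_shift ?z g y) + weyl_form (a ?q) f (tf_shift ?z (dpart e g))"
        using tg by (intro weyl_form_add_right[OF f _ _ am D(2)] schwartz_cmult)
      finally have "\<i> * of_real (snd ?z \<bullet> e) * weyl_form (a ?q) f (tf_shift ?z g)
         = weyl_form (a ?q) (dpart e f) (tf_shift ?z g) + (weyl_form (dpart (e, 0) (a ?q)) f (tf_shift ?z g)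
           + weyl_form (a ?q) f (tf_shift ?z (dpart e g)))"
        unfolding weyl_form_cmult_right weyl_form_dpart[OF a e f tg(1)]
        by (simp add: inner_commute algebra_simps) (simp add: algebra_simps eq_neg_iff_add_eq_0)?
      then have "cmod (\<i> * of_real (snd ?z \<bullet> e) * weyl_form (a ?q) f (tf_shift ?z g))
          \<le> cmod (weyl_form (a ?q) (dpart e f) (tf_shift ?z g)) + (cmod (weyl_form (dpart (e, 0) (a ?q)) f (tf_shift ?z g))
           + cmod (weyl_form (a ?q) f (tf_shift ?z (dpart e g))))"
        by (simp only:) (intro norm_triangle_mono order_refl)
      then show ?thesis by (simp add: norm_mult A_def i)
    qed
    then show "\<exists>J. (\<forall>j\<in>set J. T j) \<and> (\<forall>p. \<bar>snd (snd p) \<bullet> e\<bar> * A i p \<le> (\<Sum>j\<leftarrow>J. A j p))"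
      using a f g symbol_family_dpart[OF a Basis_prod_left[OF e]] e
      by (intro exI[of _ "[(a, dpart e f, g), (\<lambda>q. dpart (e, 0) (a q), f, g), (a, f, dpart e g)]"])
        (auto simp: T_def intro: schwartz_dpart)
  qed
  then obtain C where C: "\<And>p. bracket (snd p) ^ n * A (a, f, g) p \<le> C * wt \<bar>K\<bar> (snd p)" by blast
  have "cmod (weyl_form (a q) f (tf_shift z g)) \<le> max C 0 * wt (- s) z" for q z
  proof -
    let ?B = "cmod (weyl_form (a q) f (tf_shift z g))"
    have "wt (s + \<bar>K\<bar>) z * ?B \<le> wt (real n) z * ?B"
    proof (intro mult_right_mono wt_mono)
      show "s + \<bar>K\<bar> \<le> real n" unfolding n_def by linarith
    qed auto
    also have "\<dots> \<le> C * wt \<bar>K\<bar> z" using C[of "(q, z)"] by (simp add: A_def wt_nat)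
    also have "\<dots> \<le> max C 0 * wt \<bar>K\<bar> z" by (intro mult_right_mono) auto
    finally have "wt s z * ?B \<le> max C 0" by (simp add: powr_add mult_ac)
    then show ?thesis by (simp add: powr_minus field_simps)
  qed
  then show ?thesis using that[of "max C 0"] by simp
qed

section \<open>Weyl operators as integral operators on phase space\<close>

lemma wigner_expansion:
  fixes f g :: "'a::euclidean_space \<Rightarrow> complex"
  assumes p: "\<phi> \<in> schwartz" and H: "rapid H" and f: "f \<in> schwartz"
  shows "wigner (synth \<phi> H) f v = (LINT z|lborel. H z * wigner (tf_shift z \<phi>) f v)"
proof -
  have [measurable]: "f \<in> borel_measurable borel" "\<phi> \<in> borel_measurable borel" "H \<in> borel_measurable borel"
    using f p H by (auto intro: schwartz_measurable simp: rapid_def)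
  obtain B where B: "B \<ge> 0" "\<And>x. cmod (\<phi> x) \<le> B" using schwartz_bounded[OF p] by blast
  let ?e = "\<lambda>\<tau>. exp (- \<i> * complex_of_real (\<tau> \<bullet> snd v))"
  have "wigner (synth \<phi> H) f v
    = (LINT \<tau>|lborel. LINT z|lborel. H z * tf_shift z \<phi> (fst v + \<tau> /\<^sub>R 2) * cnj (f (fst v - \<tau> /\<^sub>R 2)) * ?e \<tau>)"
    by (simp add: wigner_apply synth_def)
  also have "\<dots> = (LINT z|lborel. LINT \<tau>|lborel. H z * tf_shift z \<phi> (fst v + \<tau> /\<^sub>R 2) * cnj (f (fst v - \<tau> /\<^sub>R 2)) * ?e \<tau>)"
  proof (rule fubini_dominated(2)[where u = "\<lambda>\<tau>. cmod (f (fst v - \<tau> /\<^sub>R 2))" and v = "\<lambda>z. cmod (H z) * B"])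
    have "integrable lborel (\<lambda>\<tau>. f (fst v - \<tau>))"
      using lborel_reflect(1)[of f "fst v"] rapid_integrable[OF schwartz_rapid[OF f]] by simp
    then have "integrable lborel (\<lambda>\<tau>. f (fst v - (1/2) *\<^sub>R \<tau>))"
      by (subst lborel_scale(1)[of "1/2" "\<lambda>\<tau>. f (fst v - \<tau>)"]) auto
    then show "integrable lborel (\<lambda>\<tau>. cmod (f (fst v - \<tau> /\<^sub>R 2)))"
      by (simp add: inverse_eq_divide)
    show "integrable lborel (\<lambda>z. cmod (H z) * B)"
      using rapid_integrable[OF H] by simp
    show "cmod (H z * tf_shift z \<phi> (fst v + \<tau> /\<^sub>R 2) * cnj (f (fst v - \<tau> /\<^sub>R 2)) * ?e \<tau>)
        \<le> cmod (f (fst v - \<tau> /\<^sub>R 2)) * (cmod (H z) * B)" for \<tau> z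
    proof -
      have "cmod (H z * tf_shift z \<phi> (fst v + \<tau> /\<^sub>R 2) * cnj (f (fst v - \<tau> /\<^sub>R 2)) * ?e \<tau>)
        = cmod (f (fst v - \<tau> /\<^sub>R 2)) * (cmod (H z) * cmod (\<phi> (fst v + \<tau> /\<^sub>R 2 - fst z)))"
        by (simp add: norm_mult)
      also have "\<dots> \<le> cmod (f (fst v - \<tau> /\<^sub>R 2)) * (cmod (H z) * B)"
        using B by (intro mult_left_mono) auto
      finally show ?thesis .
    qed
  qed measurable
  also have "\<dots> = (LINT z|lborel. H z * wigner (tf_shift z \<phi>) f v)"
    by (simp add: wigner_apply mult.assoc)
  finally show ?thesis .
qed

lemma weyl_form_synth_right:
  fixes f g :: "'a::euclidean_space \<Rightarrow> complex"
  assumes p: "\<phi> \<in> schwartz" and H: "rapid H" and f: "f \<in> schwartz"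
    and am: "a \<in> borel_measurable borel" and aA: "\<And>v. cmod (a v) \<le> A * wt K v"
  shows "weyl_form a f (synth \<phi> H) = (LINT z|lborel. cnj (H z) * weyl_form a f (tf_shift z \<phi>))"
proof -
  note [measurable] = am
  have [measurable]: "f \<in> borel_measurable borel" "\<phi> \<in> borel_measurable borel" "H \<in> borel_measurable borel"
    using f p H by (auto intro: schwartz_measurable simp: rapid_def)
  have A: "A \<ge> 0"
    using order_trans[OF norm_ge_zero aA[of 0]] by (simp add: zero_le_mult_iff)
  let ?d = "2 * real DIM('a \<times> 'a)"
  define s where "s = ?d + \<bar>K\<bar>"
  have s: "0 \<le> s" by (simp add: s_def)
  obtain C where C: "C \<ge> 0" "\<And>z w v. cmod (wigner (tf_shift z \<phi>) (tf_shift w f) v) \<le> C * wt (- s) (v - (z + w) /\<^sub>R 2)"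
    using wigner_decay[OF p f s] by blast
  \<comment> \<open>The additional decay of order \<open>s\<close> in \<open>H\<close> pays for
    recentring the Wigner decay from \<open>z / 2\<close> to 0, which splits the bound into a
    product of a function of \<open>v\<close> and one of \<open>z\<close>.\<close>
  obtain D where D: "D \<ge> 0" "\<And>z. cmod (H z) \<le> D * wt (- ?d - s) z" using rapid_bound[OF H] by blast
  have "(LINT v|lborel. a v * cnj (wigner (synth \<phi> H) f v))
      = (LINT v|lborel. LINT z|lborel. a v * cnj (H z) * cnj (wigner (tf_shift z \<phi>) f v))"
    unfolding wigner_expansion[OF p H f] Bochner_Integration.integral_cnj[symmetric]
    by (simp add: mult.assoc)
  also have "\<dots> = (LINT z|lborel. LINT v|lborel. a v * cnj (H z) * cnj (wigner (tf_shift z \<phi>) f v))"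
  proof (rule fubini_dominated(2)[where u = "\<lambda>v. A * 2 powr s * C * wt (- ?d) v" and v = "\<lambda>z. D * wt (- ?d) z"])
    show "(\<lambda>(v, z). a v * cnj (H z) * cnj (wigner (tf_shift z \<phi>) f v)) \<in> borel_measurable (lborel \<Otimes>\<^sub>M lborel)"
      by measurable
    show "integrable lborel (\<lambda>v::'a \<times> 'a. A * 2 powr s * C * wt (- ?d) v)" "integrable lborel (\<lambda>z::'a \<times> 'a. D * wt (- ?d) z)"
      using integrable_wt[where 'a = "'a \<times> 'a" and s = ?d] by simp_all
    show "cmod (a v * cnj (H z) * cnj (wigner (tf_shift z \<phi>) f v)) \<le> (A * 2 powr s * C * wt (- ?d) v) * (D * wt (- ?d) z)" for v z
    proof -
      have "cmod (wigner (tf_shift z \<phi>) f v) \<le> C * wt (- s) (v + - (z /\<^sub>R 2))"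
        using C(2)[of z 0 v] by simp
      also have "\<dots> \<le> C * (2 powr \<bar>- s\<bar> * wt (- s) v * wt \<bar>- s\<bar> (- (z /\<^sub>R 2)))"
        using C by (intro mult_left_mono wt_add_le)
      also have "\<dots> = C * (2 powr s * wt (- s) v) * wt s (z /\<^sub>R 2)"
        using s by (simp add: mult_ac)
      also have "\<dots> \<le> C * (2 powr s * wt (- s) v) * wt s z"
        using C s by (intro mult_left_mono powr_mono2 bracket_mono) auto
      finally have W: "cmod (wigner (tf_shift z \<phi>) f v) \<le> C * (2 powr s * wt (- s) v) * wt s z" .
      have "cmod (a v * cnj (H z) * cnj (wigner (tf_shift z \<phi>) f v))
          \<le> (A * wt K v) * (D * wt (- ?d - s) z) * (C * (2 powr s * wt (- s) v) * wt s z)"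
        unfolding norm_mult complex_mod_cnj using A C D by (intro mult_mono W aA D) auto
      also have "\<dots> = (A * 2 powr s * C * (wt K v * wt (- s) v)) * (D * (wt (- ?d - s) z * wt s z))"
        by (simp only: mult_ac)
      also have "\<dots> \<le> (A * 2 powr s * C * wt (- ?d) v) * (D * wt (- ?d) z)"
        unfolding powr_add[symmetric] using A C D
        by (intro mult_mono mult_left_mono wt_mono) (auto simp: s_def)
      finally show ?thesis .
    qed
  qed
  also have "\<dots> = (LINT z|lborel. cnj (H z) * (LINT v|lborel. a v * cnj (wigner (tf_shift z \<phi>) f v)))"
    by (subst integral_mult_right_zero[symmetric]) (simp add: mult_ac)
  finally have eq: "(LINT v|lborel. a v * cnj (wigner (synth \<phi> H) f v))
    = (LINT z|lborel. cnj (H z) * (LINT v|lborel. a v * cnj (wigner (tf_shift z \<phi>) f v)))" .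
  have "(LINT z|lborel. cnj (H z) * weyl_form a f (tf_shift z \<phi>))
    = (LINT z|lborel. weyl_const TYPE('a) * (cnj (H z) * (LINT v|lborel. a v * cnj (wigner (tf_shift z \<phi>) f v))))"
    unfolding weyl_form_eq by (intro Bochner_Integration.integral_cong refl) (rule mult.left_commute)
  then show ?thesis
    unfolding weyl_form_eq eq by simp
qed

lemma weyl_form_expansion_right:
  fixes f g :: "'a::euclidean_space \<Rightarrow> complex"
  assumes p: "\<phi> \<in> schwartz" "\<phi> \<noteq> (\<lambda>_. 0)" and f: "f \<in> schwartz" and g: "g \<in> schwartz"
    and am: "a \<in> borel_measurable borel" and aA: "\<And>v. cmod (a v) \<le> A * wt K v"
  shows "weyl_form a f g = of_real (rc \<phi>) * (LINT z|lborel. cnj (L2_inner g (tf_shift z \<phi>)) * weyl_form a f (tf_shift z \<phi>))"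
proof -
  have "weyl_form a f g = weyl_form a f (\<lambda>y. of_real (rc \<phi>) * synth \<phi> (\<lambda>z. L2_inner g (tf_shift z \<phi>)) y)"
    using reproducing[OF p g] by simp
  then show ?thesis
    unfolding weyl_form_cmult_right weyl_form_synth_right[OF p(1) rapid_stft[OF p(1) g] f am aA] by simp
qed

text \<open>Passing to the adjoint form, with the conjugate symbol, reduces the first argument to
  the second.\<close>

lemma weyl_form_expansion_left:
  fixes f g :: "'a::euclidean_space \<Rightarrow> complex"
  assumes p: "\<phi> \<in> schwartz" "\<phi> \<noteq> (\<lambda>_. 0)" and f: "f \<in> schwartz" and g: "g \<in> schwartz"
    and am: "a \<in> borel_measurable borel" and aA: "\<And>v. cmod (a v) \<le> A * wt K v"
  shows "weyl_form a f g = of_real (rc \<phi>) * (LINT z|lborel. L2_inner f (tf_shift z \<phi>) * weyl_form a (tf_shift z \<phi>) g)"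
proof -
  have m: "(\<lambda>v. cnj (a v)) \<in> borel_measurable borel" using am by measurable
  have b: "cmod (cnj (a v)) \<le> A * wt K v" for v using aA by simp
  have "weyl_form a f g = cnj (weyl_form (\<lambda>v. cnj (a v)) g f)" by (rule weyl_form_commute)
  also have "weyl_form (\<lambda>v. cnj (a v)) g f
    = of_real (rc \<phi>) * (LINT z|lborel. cnj (L2_inner f (tf_shift z \<phi>)) * weyl_form (\<lambda>v. cnj (a v)) g (tf_shift z \<phi>))"
    by (rule weyl_form_expansion_right[OF p g f m b])
  also have "cnj \<dots> = of_real (rc \<phi>) * (LINT z|lborel. L2_inner f (tf_shift z \<phi>) * cnj (weyl_form (\<lambda>v. cnj (a v)) g (tf_shift z \<phi>)))"
    unfolding complex_cnj_mult Bochner_Integration.integral_cnj[symmetric] by simp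
  finally show ?thesis unfolding weyl_form_commute[of a "tf_shift _ \<phi>" g] .
qed

text \<open>Synthesis and analysis are adjoint. Integrability of both functions is enough, so the
  identity covers rapidly decreasing coefficients as well as the damped transforms of the frame
  argument.\<close>

lemma L2_inner_synth:
  fixes g :: "'a::euclidean_space \<Rightarrow> complex"
  assumes p: "\<phi> \<in> schwartz" and H: "integrable lborel H" and g: "integrable lborel g"
  shows "L2_inner (synth \<phi> H) g = (LINT z|lborel. H z * L2_inner (tf_shift z \<phi>) g)"
proof -
  have [measurable]: "g \<in> borel_measurable borel" "\<phi> \<in> borel_measurable borel" "H \<in> borel_measurable borel"
    using schwartz_measurable[OF p] borel_measurable_integrable[OF H] borel_measurable_integrable[OF g] by simp_all
  obtain B where B: "B \<ge> 0" "\<And>x. cmod (\<phi> x) \<le> B" using schwartz_bounded[OF p] by blast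
  have "L2_inner (synth \<phi> H) g = (LINT y|lborel. LINT z|lborel. H z * tf_shift z \<phi> y * cnj (g y))"
    by (simp add: L2_inner_def synth_def)
  also have "\<dots> = (LINT z|lborel. LINT y|lborel. H z * tf_shift z \<phi> y * cnj (g y))"
  proof (rule fubini_dominated(2)[where u = "\<lambda>y. cmod (g y)" and v = "\<lambda>z. cmod (H z) * B"])
    show "integrable lborel (\<lambda>y. cmod (g y))" "integrable lborel (\<lambda>z. cmod (H z) * B)"
      using H g by simp_all
    show "cmod (H z * tf_shift z \<phi> y * cnj (g y)) \<le> cmod (g y) * (cmod (H z) * B)" for y z
    proof -
      have "cmod (H z * tf_shift z \<phi> y * cnj (g y)) = cmod (g y) * (cmod (H z) * cmod (\<phi> (y - fst z)))"
        by (simp add: norm_mult)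
      also have "\<dots> \<le> cmod (g y) * (cmod (H z) * B)"
        using B by (intro mult_left_mono) auto
      finally show ?thesis .
    qed
  qed measurable
  also have "\<dots> = (LINT z|lborel. H z * L2_inner (tf_shift z \<phi>) g)"
    by (simp add: L2_inner_def mult.assoc)
  finally show ?thesis .
qed

lemma measurable_weyl_form [measurable (raw)]:
  assumes [measurable]: "a \<in> borel_measurable borel" "(\<lambda>(x, y). g x y) \<in> borel_measurable (M \<Otimes>\<^sub>M borel)"
    "(\<lambda>(x, y). f x y) \<in> borel_measurable (M \<Otimes>\<^sub>M borel)"
  shows "(\<lambda>x. weyl_form a (f x) (g x)) \<in> borel_measurable M"
  unfolding weyl_form_eq by measurable

lemma rapid_weyl_form:
  fixes f g :: "'a::euclidean_space \<Rightarrow> complex"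
  assumes a: "symbol_family K (\<lambda>_ :: unit. a)" and f: "f \<in> schwartz" and g: "g \<in> schwartz"
  shows "rapid (\<lambda>z. weyl_form a f (tf_shift z g))"
  unfolding rapid_def
proof (intro conjI allI)
  have [measurable]: "f \<in> borel_measurable borel" "g \<in> borel_measurable borel" "a \<in> borel_measurable borel"
    using f g symbol_family_measurable[OF a] by (auto intro: schwartz_measurable)
  show "(\<lambda>z. weyl_form a f (tf_shift z g)) \<in> borel_measurable borel"
    by measurable
  show "\<exists>C. \<forall>z. cmod (weyl_form a f (tf_shift z g)) \<le> C * wt (- s) z" for s
    using weyl_form_decay[OF a f g] by metis
qed

text \<open>Resolves the definite description in \<open>weyl\<close>. Existence: the synthesis of
  the coefficients of the form has the right pairings. Uniqueness: testing against shifts determines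
  all coefficients, and these determine a Schwartz function.\<close>

lemma weyl_eq_synth:
  fixes f :: "'a::euclidean_space \<Rightarrow> complex"
  assumes a: "symbol_family K (\<lambda>_ :: unit. a)" and p: "\<phi> \<in> schwartz" "\<phi> \<noteq> (\<lambda>_. 0)" and f: "f \<in> schwartz"
  shows "weyl a f = (\<lambda>y. of_real (rc \<phi>) * synth \<phi> (\<lambda>z. weyl_form a f (tf_shift z \<phi>)) y)"
  unfolding weyl_def
proof (rule the_equality, intro conjI ballI)
  let ?h = "\<lambda>y. of_real (rc \<phi>) * synth \<phi> (\<lambda>z. weyl_form a f (tf_shift z \<phi>)) y"
  note R = rapid_weyl_form[OF a f p(1)]
  show h: "?h \<in> schwartz"
    by (intro schwartz_cmult schwartz_synth p R)
  obtain A where A: "\<And>v. cmod (a v) \<le> A * wt K v" using symbol_family_bound[OF a] by metis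
  have hg: "L2_inner ?h g = weyl_form a f g" if g: "g \<in> schwartz" for g
  proof -
    have "L2_inner ?h g = of_real (rc \<phi>) * (LINT z|lborel. weyl_form a f (tf_shift z \<phi>) * cnj (L2_inner g (tf_shift z \<phi>)))"
      unfolding L2_inner_cmult_left L2_inner_synth[OF p(1) rapid_integrable[OF R] rapid_integrable[OF schwartz_rapid[OF g]]] L2_inner_commute[of "tf_shift _ \<phi>" g] ..
    also have "\<dots> = weyl_form a f g"
      unfolding weyl_form_expansion_right[OF p f g symbol_family_measurable[OF a] A] by (simp add: mult.commute)
    finally show ?thesis .
  qed
  then show "L2_inner ?h g = weyl_distr (L2_inner a) f g" if "g \<in> schwartz" for g
    using that by (simp add: weyl_form_def)
  fix h assume h': "h \<in> schwartz \<and> (\<forall>g\<in>schwartz. L2_inner h g = weyl_distr (L2_inner a) f g)"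
  then have "(\<lambda>z. L2_inner h (tf_shift z \<phi>)) = (\<lambda>z. weyl_form a f (tf_shift z \<phi>))"
    using schwartz_tf_shift[OF p(1)] by (auto simp: weyl_form_def)
  moreover have "h = (\<lambda>y. of_real (rc \<phi>) * synth \<phi> (\<lambda>z. L2_inner h (tf_shift z \<phi>)) y)"
    using h' by (intro reproducing[OF p]) auto
  ultimately show "h = ?h" by simp
qed

text \<open>With \<open>f\<close> a shift \<open>tf_shift w \<phi>\<close>, this exhibits the
  transform of the Weyl operator applied to \<open>u\<close> as an integral operator on
  \<open>stft \<phi> u\<close>.\<close>

lemma tempered_weyl:
  fixes u :: "('a::euclidean_space \<Rightarrow> complex) \<Rightarrow> complex"
  assumes u: "tempered_distribution u" and a: "symbol_family K (\<lambda>_ :: unit. a)"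
    and p: "\<phi> \<in> schwartz" "\<phi> \<noteq> (\<lambda>_. 0)" and f: "f \<in> schwartz"
  shows "u (weyl a f) = of_real (rc \<phi>) * (LINT z|lborel. cnj (weyl_form a f (tf_shift z \<phi>)) * stft \<phi> u z)"
proof -
  note R = rapid_weyl_form[OF a f p(1)]
  have "u (weyl a f) = cnj (of_real (rc \<phi>)) * u (synth \<phi> (\<lambda>z. weyl_form a f (tf_shift z \<phi>)))"
    unfolding weyl_eq_synth[OF a p f] by (intro tempered_cmult[OF u] schwartz_synth p R)
  then show ?thesis unfolding tempered_synth[OF u p(1) R] by simp
qed

text \<open>The value at a constant symbol is Fourier inversion in the second phase space variable.\<close>

lemma weyl_form_const:
  fixes f g :: "'a::euclidean_space \<Rightarrow> complex"
  assumes f: "f \<in> schwartz" and g: "g \<in> schwartz"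
  shows "weyl_form (\<lambda>_. c) f g = c * L2_inner f g"
proof -
  let ?c = "complex_of_real ((2 * pi) ^ DIM('a))"
  have "(LINT v|lborel. wigner g f v) = (LINT x|lborel. LINT \<xi>|lborel. wigner g f (x, \<xi>))"
    by (rule integral_phase_space[OF rapid_integrable[OF wigner_rapid[OF g f]]])
  also have "\<dots> = (LINT x|lborel. ?c * (g x * cnj (f x)))"
  proof (intro Bochner_Integration.integral_cong refl)
    fix x
    let ?F = "\<lambda>\<tau>. g (x + \<tau> /\<^sub>R 2) * cnj (f (x - \<tau> /\<^sub>R 2))"
    obtain A where A: "A \<ge> 0" "\<And>x. cmod (f x) \<le> A" using schwartz_bounded[OF f] by blast
    obtain B where B: "B \<ge> 0" "\<And>x. cmod (g x) \<le> B" using schwartz_bounded[OF g] by blast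
    have "(LINT \<xi>|lborel. LINT \<tau>|lborel. ?F \<tau> * exp (- \<i> * of_real (\<tau> \<bullet> \<xi>))) = ?c * ?F 0"
    proof (rule fourier_inversion_0)
      show "continuous_on UNIV ?F"
        by (intro continuous_intros continuous_on_compose2[OF continuous_on_smooth[OF schwartz_smooth[OF f]]]
            continuous_on_compose2[OF continuous_on_smooth[OF schwartz_smooth[OF g]]]) auto
      show "integrable lborel ?F"
        using wigner_integrable[OF g f, of x 0] by simp
      show "cmod (?F \<tau>) \<le> B * A" for \<tau>
        unfolding norm_mult complex_mod_cnj using A B by (intro mult_mono) auto
      show "integrable lborel (\<lambda>\<xi>. LINT \<tau>|lborel. ?F \<tau> * exp (- \<i> * of_real (\<tau> \<bullet> \<xi>)))"
      proof -
        let ?s = "2 * real DIM('a)"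
        obtain C where C: "C \<ge> 0" "\<And>v. cmod (wigner g f v) \<le> C * wt (- ?s) v"
          using rapid_bound[OF wigner_rapid[OF g f]] by blast
        have [measurable]: "f \<in> borel_measurable borel" "g \<in> borel_measurable borel"
          using f g by (auto intro: schwartz_measurable)
        have "integrable lborel (\<lambda>\<xi>. wigner g f (x, \<xi>))"
        proof (rule integrable_wt_bound[of _ C ?s])
          show "(\<lambda>\<xi>. wigner g f (x, \<xi>)) \<in> borel_measurable borel"
            unfolding wigner_apply fst_conv snd_conv by measurable
          fix \<xi>
          have "cmod (wigner g f (x, \<xi>)) \<le> C * wt (- ?s) (x, \<xi>)" by (rule C)
          also have "\<dots> \<le> C * wt (- ?s) \<xi>"
            using C(1) bracket_snd_le[of "(x, \<xi>)"] by (intro mult_left_mono powr_mono2') auto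
          finally show "cmod (wigner g f (x, \<xi>)) \<le> C * wt (- ?s) \<xi>" .
        qed simp
        then show ?thesis by (simp add: wigner_apply)
      qed
    qed
    then show "(LINT \<xi>|lborel. wigner g f (x, \<xi>)) = ?c * (g x * cnj (f x))"
      by (simp add: wigner_apply)
  qed
  also have "\<dots> = ?c * L2_inner g f" by (simp add: L2_inner_def)
  finally have "(LINT v|lborel. wigner g f v) = ?c * L2_inner g f" .
  then have "(LINT v|lborel. cnj (wigner g f v)) = ?c * L2_inner f g"
    by (simp add: L2_inner_commute[of f g])
  then have "weyl_form (\<lambda>_. c) f g = (of_real ((2 * pi) powr - real DIM('a)) * ?c) * (c * L2_inner f g)"
    unfolding weyl_form_eq by simp
  also have "of_real ((2 * pi) powr - real DIM('a)) * ?c = complex_of_real ((2 * pi) powr - real DIM('a) * (2 * pi) powr real DIM('a))"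
  proof -
    have "(2 * pi) ^ DIM('a) = (2 * pi) powr real DIM('a)" by (simp add: powr_realpow)
    then show ?thesis by (simp only: of_real_mult)
  qed
  also have "(2 * pi) powr - real DIM('a) * (2 * pi) powr real DIM('a) = 1"
    unfolding powr_add[symmetric] by simp
  finally show ?thesis by simp
qed

section \<open>Shubin symbols and their kernels\<close>

lemma shubin_bound:
  assumes "a \<in> shubin m" "set bs \<subseteq> Basis"
  obtains C where "C \<ge> 0" "\<And>z. cmod (partial_derivs bs a z) \<le> C * wt (m - real (length bs)) z"
proof -
  obtain C where C: "C > 0" "\<forall>z. cmod (partial_derivs bs a z) \<le> C * wt (m - real (length bs)) z"
    using assms unfolding shubin_def by blast
  show ?thesis by (rule that[of C]) (use C in auto)
qed

lemma shubin_smooth: "a \<in> shubin m \<Longrightarrow> smooth a"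
  by (simp add: shubin_def)

lemma shubin_symbol:
  fixes a :: "'a::euclidean_space \<times> 'a \<Rightarrow> complex"
  assumes "a \<in> shubin m"
  shows "symbol_family m (\<lambda>_. a)"
  unfolding symbol_family_def
proof (intro conjI allI impI)
  show "smooth a" using assms by (rule shubin_smooth)
  fix bs :: "('a \<times> 'a) list" assume bs: "set bs \<subseteq> Basis"
  obtain C where C: "C \<ge> 0" "\<And>z. cmod (partial_derivs bs a z) \<le> C * wt (m - real (length bs)) z"
    using shubin_bound[OF assms bs] by blast
  have "cmod (partial_derivs bs a v) \<le> C * wt m v" for v
    by (rule order_trans[OF C(2)]) (intro mult_left_mono wt_mono C(1), simp)
  then show "\<exists>C\<ge>0. \<forall>q v. cmod (partial_derivs bs a v) \<le> C * wt m v" using C(1) by blast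
qed

lemma partial_derivs_cnj:
  assumes "smooth a" "set bs \<subseteq> Basis"
  shows "partial_derivs bs (\<lambda>z. cnj (a z)) = (\<lambda>z. cnj (partial_derivs bs a z))"
  using assms(2)
proof (induction bs)
  case (Cons b bs)
  then have "smooth (partial_derivs bs a)" by (intro smooth_partial_derivs assms) auto
  then have "((\<lambda>z. cnj (partial_derivs bs a z)) has_derivative (\<lambda>h. cnj (frechet_derivative (partial_derivs bs a) (at x) h))) (at x)" for x
    by (intro bounded_linear.has_derivative[OF bounded_linear_cnj] smooth_has_derivative)
  from dpart_eq[OF this] show ?case using Cons by simp
qed simp

lemma smooth_cnj:
  assumes "smooth a"
  shows "smooth (\<lambda>z. cnj (a z))"
  unfolding smooth_def
proof (intro allI impI)
  fix bs :: "'a list" assume bs: "set bs \<subseteq> Basis"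
  have "(\<lambda>z. cnj (partial_derivs bs a z)) differentiable (at x)" for x
    unfolding differentiable_def
    using bounded_linear.has_derivative[OF bounded_linear_cnj smooth_has_derivative[OF smooth_partial_derivs[OF assms bs]]] by blast
  then show "partial_derivs bs (\<lambda>z. cnj (a z)) differentiable_on UNIV"
    by (simp add: partial_derivs_cnj[OF assms bs] differentiable_on_def)
qed

lemma shubin_cnj:
  assumes "a \<in> shubin m"
  shows "(\<lambda>z. cnj (a z)) \<in> shubin m"
  using assms unfolding shubin_def by (auto simp: partial_derivs_cnj smooth_cnj)

lemma partial_derivs_translate:
  assumes "smooth a" "set bs \<subseteq> Basis"
  shows "partial_derivs bs (\<lambda>z. a (z + w)) = (\<lambda>z. partial_derivs bs a (z + w))"
  using assms(2)
proof (induction bs)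
  case (Cons b bs)
  then have s: "smooth (partial_derivs bs a)" by (intro smooth_partial_derivs assms) auto
  have "((\<lambda>z. z + w) has_derivative (\<lambda>h. h)) (at x)" for x by (auto intro!: derivative_eq_intros)
  from has_derivative_compose[OF this smooth_has_derivative[OF s]]
  have "((\<lambda>z. partial_derivs bs a (z + w)) has_derivative (\<lambda>h. frechet_derivative (partial_derivs bs a) (at (x + w)) h)) (at x)" for x .
  from dpart_eq[OF this] show ?case using Cons by simp
qed simp

lemma smooth_translate:
  assumes "smooth a"
  shows "smooth (\<lambda>z. a (z + w))"
  unfolding smooth_def
proof (intro allI impI)
  fix bs :: "'a list" assume bs: "set bs \<subseteq> Basis"
  have "((\<lambda>z. z + w) has_derivative (\<lambda>h. h)) (at x)" for x by (auto intro!: derivative_eq_intros)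
  from has_derivative_compose[OF this smooth_has_derivative[OF smooth_partial_derivs[OF assms bs]]]
  have "(\<lambda>z. partial_derivs bs a (z + w)) differentiable (at x)" for x
    unfolding differentiable_def by blast
  then show "partial_derivs bs (\<lambda>z. a (z + w)) differentiable_on UNIV"
    by (simp add: partial_derivs_translate[OF assms bs] differentiable_on_def)
qed

lemma smooth_const: "smooth (\<lambda>_. c)"
  by (rule smooth_coinduct[of _ "range (\<lambda>c _. c)"]) auto

lemma partial_derivs_const: "bs \<noteq> [] \<Longrightarrow> partial_derivs bs (\<lambda>_. c) = (\<lambda>_. 0)"
proof (induction bs)
  case (Cons b bs)
  then show ?case by (cases bs) auto
qed simp

text \<open>Recentred at \<open>w\<close> and normalized by \<open>wt (1 - m) w\<close>, the
  deviation of the symbol from its value at \<open>w\<close> satisfies bounds that no longer involve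
  \<open>w\<close>. Derivatives gain an order directly. The value itself is a mean value estimate
  along the segment from \<open>w\<close> to \<open>v + w\<close>, whose length accounts for the
  summand 1 in the order.\<close>

lemma shubin_difference:
  fixes a :: "'a::euclidean_space \<times> 'a \<Rightarrow> complex"
  assumes a: "a \<in> shubin m"
  shows "symbol_family (\<bar>m - 1\<bar> + 1) (\<lambda>w v. of_real (wt (1 - m) w) * (a (v + w) - a w))"
    (is "symbol_family ?K ?b")
  unfolding symbol_family_def
proof (intro conjI allI impI)
  note sm = shubin_smooth[OF a]
  have sd: "smooth (\<lambda>v. a (v + w) - a w)" for w
    using smooth_add[OF smooth_translate[OF sm, of w] smooth_const[of "- a w"]] by simp
  show "smooth (?b w)" for w by (rule smooth_cmult[OF sd])
  fix bs :: "('a \<times> 'a) list" assume bs: "set bs \<subseteq> Basis"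
  have shift: "wt (1 - m) w * wt (m - 1) (v + w) \<le> 2 powr \<bar>m - 1\<bar> * wt \<bar>m - 1\<bar> v" for v w :: "'a \<times> 'a"
  proof -
    have "wt (1 - m) w * wt (m - 1) (v + w) \<le> wt (1 - m) w * (2 powr \<bar>m - 1\<bar> * wt (m - 1) w * wt \<bar>m - 1\<bar> v)"
      using wt_add_le[of w v "m - 1"] by (intro mult_left_mono) (auto simp: add.commute)
    also have "\<dots> = (wt (1 - m) w * wt (m - 1) w) * (2 powr \<bar>m - 1\<bar> * wt \<bar>m - 1\<bar> v)"
      by (simp only: mult_ac)
    also have "wt (1 - m) w * wt (m - 1) w = 1" by (simp flip: powr_add)
    finally show ?thesis by simp
  qed
  \<comment> \<open>Derivatives of positive order do not see the constant \<open>a w\<close>; the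
    empty list is the case that needs the mean value inequality.\<close>
  show "\<exists>C\<ge>0. \<forall>w v. cmod (partial_derivs bs (?b w) v) \<le> C * wt ?K v"
  proof (cases "bs = []")
    case False
    then have len: "1 \<le> real (length bs)" by (cases bs) auto
    obtain C where C: "C \<ge> 0" "\<And>z. cmod (partial_derivs bs a z) \<le> C * wt (m - real (length bs)) z"
      using shubin_bound[OF a bs] by blast
    have "cmod (partial_derivs bs (?b w) v) \<le> (C * 2 powr \<bar>m - 1\<bar>) * wt ?K v" for w v
    proof -
      have "partial_derivs bs (?b w) = (\<lambda>v. of_real (wt (1 - m) w) * partial_derivs bs a (v + w))"
        using partial_derivs_add[OF smooth_translate[OF sm, of w] smooth_const[of "- a w"] bs]
          partial_derivs_const[OF False] partial_derivs_translate[OF sm bs, of w]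
        by (simp add: partial_derivs_cmult[OF sd bs])
      then have "cmod (partial_derivs bs (?b w) v) = wt (1 - m) w * cmod (partial_derivs bs a (v + w))"
        by (simp add: norm_mult)
      also have "\<dots> \<le> wt (1 - m) w * (C * wt (m - 1) (v + w))"
        using C len by (intro mult_left_mono order_trans[OF C(2)] wt_mono) auto
      also have "\<dots> = C * (wt (1 - m) w * wt (m - 1) (v + w))" by (simp only: mult_ac)
      also have "\<dots> \<le> C * (2 powr \<bar>m - 1\<bar> * wt \<bar>m - 1\<bar> v)"
        using C by (intro mult_left_mono shift)
      also have "\<dots> \<le> C * (2 powr \<bar>m - 1\<bar> * wt ?K v)"
        using C by (intro mult_left_mono wt_mono) auto
      finally show ?thesis by (simp only: mult_ac)
    qed
    moreover have "0 \<le> C * 2 powr \<bar>m - 1\<bar>" using C by simp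
    ultimately show ?thesis by blast
  next
    case True
    have "\<forall>e\<in>Basis. \<exists>C\<ge>0. \<forall>z. cmod (dpart e a z) \<le> C * wt (m - 1) z"
    proof
      fix e :: "'a \<times> 'a" assume "e \<in> Basis"
      then have "set [e] \<subseteq> Basis" by simp
      from shubin_bound[OF a this] obtain C where "C \<ge> 0" "\<And>z. cmod (partial_derivs [e] a z) \<le> C * wt (m - real (length [e])) z" by blast
      then show "\<exists>C\<ge>0. \<forall>z. cmod (dpart e a z) \<le> C * wt (m - 1) z" by auto
    qed
    then obtain C where C: "\<And>e. e \<in> Basis \<Longrightarrow> C e \<ge> 0" "\<And>e z. e \<in> Basis \<Longrightarrow> cmod (dpart e a z) \<le> C e * wt (m - 1) z" by metis
    define D where "D = (\<Sum>e\<in>Basis. C e)"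
    have D: "D \<ge> 0" unfolding D_def by (intro sum_nonneg C)
    have fd: "cmod (frechet_derivative a (at z) h) \<le> D * wt (m - 1) z * norm h" for z h
    proof -
      have "(\<Sum>e\<in>Basis. cmod (dpart e a z)) \<le> D * wt (m - 1) z"
        unfolding D_def sum_distrib_right by (intro sum_mono C)
      then show ?thesis
        using cmod_frechet_derivative_le[OF smoothD[OF sm], of z h] by (meson mult_right_mono norm_ge_zero order_trans)
    qed
    have "cmod (?b w v) \<le> (D * 2 powr \<bar>m - 1\<bar>) * wt ?K v" for w v
    proof -
      let ?B = "D * (wt (m - 1) w * (2 powr \<bar>m - 1\<bar> * wt \<bar>m - 1\<bar> v))"
      have "cmod (a (v + w) - a w) \<le> ?B * norm ((v + w) - w)"
      proof (rule differentiable_bound[where S = "closed_segment w (v + w)"])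
        show "(a has_derivative frechet_derivative a (at x)) (at x within closed_segment w (v + w))" for x
          using smooth_has_derivative[OF sm] has_derivative_at_withinI by blast
        show "onorm (frechet_derivative a (at x)) \<le> ?B" if "x \<in> closed_segment w (v + w)" for x
        proof (rule onorm_le)
          fix h
          obtain t where t: "0 \<le> t" "t \<le> 1" "x = (1 - t) *\<^sub>R w + t *\<^sub>R (v + w)"
            using \<open>x \<in> _\<close> unfolding closed_segment_def by blast
          then have x: "x = w + t *\<^sub>R v" by (simp add: algebra_simps)
          have "wt (m - 1) x \<le> 2 powr \<bar>m - 1\<bar> * wt (m - 1) w * wt \<bar>m - 1\<bar> (t *\<^sub>R v)"
            unfolding x by (rule wt_add_le)
          also have "\<dots> \<le> 2 powr \<bar>m - 1\<bar> * wt (m - 1) w * wt \<bar>m - 1\<bar> v"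
            using t by (intro mult_left_mono powr_mono2 bracket_mono) (auto simp: mult_left_le_one_le)
          finally have "wt (m - 1) x \<le> wt (m - 1) w * (2 powr \<bar>m - 1\<bar> * wt \<bar>m - 1\<bar> v)" by (simp only: mult_ac)
          then have "D * wt (m - 1) x \<le> ?B" using D by (rule mult_left_mono)
          then show "norm (frechet_derivative a (at x) h) \<le> ?B * norm h"
            using fd[of x h] by (meson mult_right_mono norm_ge_zero order_trans)
        qed
      qed auto
      then have "cmod (?b w v) \<le> wt (1 - m) w * (?B * norm v)"
        unfolding norm_mult norm_of_real by (simp add: mult_left_mono)
      also have "\<dots> = (D * 2 powr \<bar>m - 1\<bar>) * (wt (1 - m) w * wt (m - 1) w) * (norm v * wt \<bar>m - 1\<bar> v)"
        by (simp only: mult_ac)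
      also have "wt (1 - m) w * wt (m - 1) w = 1" by (simp flip: powr_add)
      also have "(D * 2 powr \<bar>m - 1\<bar>) * 1 * (norm v * wt \<bar>m - 1\<bar> v) \<le> (D * 2 powr \<bar>m - 1\<bar>) * 1 * wt ?K v"
        using D norm_mult_wt_le[of v "\<bar>m - 1\<bar>"] by (intro mult_left_mono) auto
      finally show ?thesis by simp
    qed
    moreover have "0 \<le> D * 2 powr \<bar>m - 1\<bar>" using D by simp
    ultimately show ?thesis unfolding True partial_derivs.simps by blast
  qed
qed

text \<open>Normalization by \<open>wt (- m) w\<close> makes all translates of one symbol a single
  family, so one constant serves for every base point.\<close>

lemma shubin_translates:
  fixes a :: "'a::euclidean_space \<times> 'a \<Rightarrow> complex"
  assumes a: "a \<in> shubin m"
  shows "symbol_family \<bar>m\<bar> (\<lambda>w v. of_real (wt (- m) w) * a (v + w))" (is "symbol_family ?K ?b")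
  unfolding symbol_family_def
proof (intro conjI allI impI)
  note sm = shubin_smooth[OF a]
  show "smooth (?b w)" for w by (intro smooth_cmult smooth_translate sm)
  fix bs :: "('a \<times> 'a) list" assume bs: "set bs \<subseteq> Basis"
  obtain C where C: "C \<ge> 0" "\<And>z. cmod (partial_derivs bs a z) \<le> C * wt (m - real (length bs)) z"
    using shubin_bound[OF a bs] by blast
  have "cmod (partial_derivs bs (?b w) v) \<le> (C * 2 powr \<bar>m\<bar>) * wt ?K v" for w v
  proof -
    have "cmod (partial_derivs bs (?b w) v) = wt (- m) w * cmod (partial_derivs bs a (v + w))"
      by (simp add: partial_derivs_cmult[OF smooth_translate[OF sm] bs] partial_derivs_translate[OF sm bs] norm_mult)
    also have "\<dots> \<le> wt (- m) w * (C * wt m (v + w))"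
      using C by (intro mult_left_mono order_trans[OF C(2)] wt_mono) auto
    also have "\<dots> \<le> wt (- m) w * (C * (2 powr \<bar>m\<bar> * wt m w * wt \<bar>m\<bar> v))"
      using wt_add_le[of w v m] C by (intro mult_left_mono) (auto simp: add.commute)
    also have "\<dots> = (C * 2 powr \<bar>m\<bar>) * wt \<bar>m\<bar> v * (wt (- m) w * wt m w)"
      by (simp only: mult_ac)
    also have "wt (- m) w * wt m w = 1" by (simp flip: powr_add)
    finally show ?thesis by simp
  qed
  moreover have "0 \<le> C * 2 powr \<bar>m\<bar>" using C by simp
  ultimately show "\<exists>C\<ge>0. \<forall>w v. cmod (partial_derivs bs (?b w) v) \<le> C * wt ?K v" by blast
qed

lemma weyl_form_cmult_symbol: "weyl_form (\<lambda>v. c * a v) f g = c * weyl_form a f g"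
  unfolding weyl_form_eq by (simp add: mult.assoc mult.left_commute)

text \<open>Covariance moves the base point to the origin and the symbol into the family of its
  normalized translates.\<close>

lemma weyl_form_kernel_decay:
  fixes f g :: "'a::euclidean_space \<Rightarrow> complex"
  assumes a: "a \<in> shubin m" and f: "f \<in> schwartz" and g: "g \<in> schwartz"
  obtains C where "C \<ge> 0" "\<And>w z. cmod (weyl_form a (tf_shift w f) (tf_shift z g)) \<le> C * wt m w * wt (- s) (z - w)"
proof -
  obtain C where C: "C \<ge> 0" "\<And>w z. cmod (weyl_form (\<lambda>v. of_real (wt (- m) w) * a (v + w)) f (tf_shift z g)) \<le> C * wt (- s) z"
    using weyl_form_decay[OF shubin_translates[OF a] f g, of s] by blast
  have "cmod (weyl_form a (tf_shift w f) (tf_shift z g)) \<le> C * wt m w * wt (- s) (z - w)" for w z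
  proof -
    let ?B = "cmod (weyl_form a (tf_shift w f) (tf_shift z g))"
    have "wt (- m) w * ?B \<le> C * wt (- s) (z - w)"
      using C(2)[of w "z - w"] unfolding weyl_form_covariance weyl_form_cmult_symbol by (simp add: norm_mult)
    then show ?thesis by (simp add: powr_minus field_simps)
  qed
  then show ?thesis using that C(1) by blast
qed

lemma weyl_form_diff_symbol:
  fixes f g :: "'a::euclidean_space \<Rightarrow> complex"
  assumes f: "f \<in> schwartz" and g: "g \<in> schwartz" and a: "a \<in> borel_measurable borel" "\<And>v. cmod (a v) \<le> A * wt K v"
  shows "weyl_form (\<lambda>v. a v - c) f g = weyl_form a f g - c * L2_inner f g"
proof -
  have "integrable lborel (\<lambda>v. c * cnj (wigner g f v))"
    by (rule weyl_form_integrable[OF f g, where A = "cmod c" and K = 0]) auto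
  then have "weyl_form (\<lambda>v. a v - c) f g = weyl_form a f g - weyl_form (\<lambda>_. c) f g"
    unfolding weyl_form_eq left_diff_distrib using weyl_form_integrable[OF f g a]
    by (simp add: right_diff_distrib)
  then show ?thesis unfolding weyl_form_const[OF f g] .
qed

text \<open>The constant symbol \<open>a w\<close> has the form \<open>a w\<close> times the inner
  product, so the difference is the Weyl form of the symbol minus its value at \<open>w\<close>, and
  covariance recentres it.\<close>

lemma weyl_form_difference_decay:
  fixes f g :: "'a::euclidean_space \<Rightarrow> complex"
  assumes a: "a \<in> shubin m" and f: "f \<in> schwartz" and g: "g \<in> schwartz"
  obtains C where "C \<ge> 0"
    "\<And>w z. cmod (weyl_form a (tf_shift w f) (tf_shift z g) - a w * L2_inner (tf_shift w f) (tf_shift z g))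
      \<le> C * wt (m - 1) w * wt (- s) (z - w)"
proof -
  obtain C where C: "C \<ge> 0"
    "\<And>w z. cmod (weyl_form (\<lambda>v. of_real (wt (1 - m) w) * (a (v + w) - a w)) f (tf_shift z g)) \<le> C * wt (- s) z"
    using weyl_form_decay[OF shubin_difference[OF a] f g, of s] by blast
  obtain A where A: "\<And>v. cmod (a v) \<le> A * wt m v"
    using symbol_family_bound[OF shubin_symbol[OF a]] by metis
  note am = measurable_smooth[OF shubin_smooth[OF a]]
  have "cmod (weyl_form a (tf_shift w f) (tf_shift z g) - a w * L2_inner (tf_shift w f) (tf_shift z g))
      \<le> C * wt (m - 1) w * wt (- s) (z - w)" for w z
  proof -
    let ?B = "cmod (weyl_form a (tf_shift w f) (tf_shift z g) - a w * L2_inner (tf_shift w f) (tf_shift z g))"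
    have "?B = cmod (weyl_form (\<lambda>v. a v - a w) (tf_shift w f) (tf_shift z g))"
      unfolding weyl_form_diff_symbol[OF schwartz_tf_shift[OF f] schwartz_tf_shift[OF g] am A] ..
    also have "\<dots> = cmod (weyl_form (\<lambda>v. a (v + w) - a w) f (tf_shift (z - w) g))"
      by (rule weyl_form_covariance)
    finally have "wt (1 - m) w * ?B \<le> C * wt (- s) (z - w)"
      using C(2)[of w "z - w"] unfolding weyl_form_cmult_symbol by (simp add: norm_mult)
    then have le: "wt (m - 1) w * (wt (1 - m) w * ?B) \<le> wt (m - 1) w * (C * wt (- s) (z - w))"
      by (rule mult_left_mono) simp
    have "wt (m - 1) w * wt (1 - m) w = 1" by (simp flip: powr_add)
    then have "?B = wt (m - 1) w * (wt (1 - m) w * ?B)" by (simp only: mult.assoc[symmetric] mult_1_left)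
    also note le
    finally show ?thesis by (simp only: mult_ac)
  qed
  then show ?thesis using that C(1) by blast
qed

subsection \<open>Cones\<close>

text \<open>The gap between two concentric balls scales with the ray parameter: for
  \<open>w = t x\<close> in the smaller cone and \<open>z\<close> outside the larger one,
  \<open>norm (z - w)\<close> is at least \<open>t r\<close>, while \<open>norm w\<close> is at most
  \<open>t\<close> times a constant. Hence \<open>z - w\<close> controls \<open>w\<close>, and with
  it \<open>z\<close>.\<close>

lemma cone_shrink:
  fixes \<Gamma> :: "'b::euclidean_space set"
  assumes G: "open_cone \<Gamma>" and z0: "z0 \<in> \<Gamma>"
  shows "\<exists>\<Gamma>' c. open_cone \<Gamma>' \<and> z0 \<in> \<Gamma>' \<and> c > 0 \<and>
    (\<forall>w\<in>\<Gamma>'. \<forall>z. z \<notin> \<Gamma> \<longrightarrow> bracket w \<le> c * bracket (z - w) \<and> bracket z \<le> c * bracket (z - w)) \<and> \<Gamma>' \<subseteq> \<Gamma>"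
proof -
  obtain e where e: "e > 0" "ball z0 e \<subseteq> \<Gamma>"
    using G z0 unfolding open_cone_def by (meson openE)
  define r where "r = e / 2"
  have r: "r > 0" using e by (simp add: r_def)
  define \<Gamma>' where "\<Gamma>' = (\<Union>t\<in>{0<..}. (\<lambda>w. t *\<^sub>R w) ` ball z0 r)"
  \<comment> \<open>The largest possible ratio of \<open>norm w = t * norm x\<close> to the gap
    \<open>t * r\<close>. Passing to \<open>norm z\<close> adds 1, and passing from norms to
    brackets adds another 1.\<close>
  define k where "k = (norm z0 + r) / r"
  have k: "k > 0" using r unfolding k_def by (intro divide_pos_pos add_nonneg_pos) auto
  have sub: "\<Gamma>' \<subseteq> \<Gamma>"
  proof
    fix x assume "x \<in> \<Gamma>'"
    then obtain t w where tw: "t > 0" "w \<in> ball z0 r" "x = t *\<^sub>R w" by (auto simp: \<Gamma>'_def)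
    then have "w \<in> ball z0 e" using e by (simp add: r_def)
    then show "x \<in> \<Gamma>" using e tw G by (auto simp: open_cone_def)
  qed
  have "open_cone \<Gamma>'"
    unfolding open_cone_def
  proof (intro conjI ballI allI impI)
    show "open \<Gamma>'" unfolding \<Gamma>'_def by (intro open_UN ballI open_scaling) auto
    show "0 \<notin> \<Gamma>'" using sub G by (auto simp: open_cone_def)
    fix z and t :: real assume z: "z \<in> \<Gamma>'" and t: "t > 0"
    obtain s w where "s > 0" "w \<in> ball z0 r" "z = s *\<^sub>R w"
      using z by (auto simp: \<Gamma>'_def)
    then have "t * s > 0" "t *\<^sub>R z = (t * s) *\<^sub>R w" using t by auto
    with \<open>w \<in> ball z0 r\<close> show "t *\<^sub>R z \<in> \<Gamma>'"
      unfolding \<Gamma>'_def by blast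
  qed
  moreover have "z0 \<in> \<Gamma>'"
    unfolding \<Gamma>'_def using r by (intro UN_I[of 1] image_eqI[of _ _ z0]) auto
  moreover have "bracket w \<le> (2 + k) * bracket (z - w) \<and> bracket z \<le> (2 + k) * bracket (z - w)"
    if w: "w \<in> \<Gamma>'" and z: "z \<notin> \<Gamma>" for w z
  proof -
    obtain t x where t: "t > 0" and x: "x \<in> ball z0 r" and wt: "w = t *\<^sub>R x"
      using w by (auto simp: \<Gamma>'_def)
    have "(1 / t) *\<^sub>R z \<notin> \<Gamma>"
    proof
      assume "(1 / t) *\<^sub>R z \<in> \<Gamma>"
      then have "t *\<^sub>R ((1 / t) *\<^sub>R z) \<in> \<Gamma>" using G t by (simp only: open_cone_def)
      then show False using z t by simp
    qed
    then have "(1 / t) *\<^sub>R z \<notin> ball z0 e" using e by blast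
    then have "e \<le> norm ((1 / t) *\<^sub>R z - z0)" by (simp add: dist_norm norm_minus_commute)
    moreover have "norm (x - z0) < e / 2" using x by (simp add: r_def dist_norm norm_minus_commute)
    moreover have "norm ((1 / t) *\<^sub>R z - z0) \<le> norm ((1 / t) *\<^sub>R z - x) + norm (x - z0)"
      using norm_triangle_ineq[of "(1 / t) *\<^sub>R z - x" "x - z0"] by simp
    ultimately have "r \<le> norm ((1 / t) *\<^sub>R z - x)" by (simp add: r_def)
    then have "t * r \<le> t * norm ((1 / t) *\<^sub>R z - x)" using t by (intro mult_left_mono) auto
    also have "\<dots> = norm (t *\<^sub>R ((1 / t) *\<^sub>R z - x))" using t by simp
    also have "\<dots> = norm (z - w)" using t by (simp add: wt scaleR_diff_right)
    finally have tr: "t * r \<le> norm (z - w)" .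
    have "norm x \<le> norm z0 + r"
      using x norm_triangle_ineq2[of x z0] by (simp add: dist_norm norm_minus_commute)
    then have "norm w \<le> t * (norm z0 + r)" using t by (simp add: wt mult_left_mono)
    also have "\<dots> = k * (t * r)" using r by (simp add: k_def)
    also have "\<dots> \<le> k * norm (z - w)" using tr k by (intro mult_left_mono) auto
    finally have nw: "norm w \<le> k * norm (z - w)" .
    have "norm z \<le> norm (z - w) + norm w" using norm_triangle_ineq[of "z - w" w] by simp
    then have nz: "norm z \<le> (1 + k) * norm (z - w)" using nw by (simp add: distrib_right)
    have b1: "1 \<le> bracket (z - w)" and bn: "norm (z - w) \<le> bracket (z - w)"
      by (rule bracket_ge_1, rule norm_le_bracket)
    have "k * norm (z - w) \<le> k * bracket (z - w)" using bn k by (intro mult_left_mono) auto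
    then show ?thesis
      using bracket_le_one_plus_norm[of w] bracket_le_one_plus_norm[of z] nw nz b1 bn
      by (auto simp: distrib_right)
  qed
  moreover have "2 + k > 0" using k by simp
  ultimately show ?thesis using sub
    by (intro exI[of _ \<Gamma>'] exI[of _ "2 + k"] conjI) auto
qed

text \<open>Inside \<Gamma> the decay at \<open>z\<close> is moved to \<open>w\<close> by Peetre's
  inequality. Outside, nothing is known beyond growth, but there powers of the bracket of
  \<open>z - w\<close> pay both for this growth and for the claimed decay in \<open>w\<close>. The
  set \<open>Z\<close> is all of phase space or a lattice.\<close>

lemma rapid_off_cone:
  fixes V :: "'b::euclidean_space \<Rightarrow> complex"
  assumes c: "c > 0" and cone: "\<And>w z. w \<in> \<Gamma>' \<Longrightarrow> z \<notin> \<Gamma> \<Longrightarrow> bracket w \<le> c * bracket (z - w) \<and> bracket z \<le> c * bracket (z - w)"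
    and P: "P \<ge> 0" and G: "G \<ge> 0" and growth: "\<And>z. z \<in> Z \<Longrightarrow> cmod (V z) \<le> G * wt P z"
    and N: "N \<ge> 0" and bdd: "bdd_above ((\<lambda>z. wt N z * cmod (V z)) ` (Z \<inter> \<Gamma>))"
  shows "\<exists>C\<ge>0. \<forall>w\<in>\<Gamma>'. \<forall>z\<in>Z. cmod (V z) \<le> C * wt (- N) w * wt (N + P) (z - w)"
proof -
  obtain M0 where M0: "\<And>z. z \<in> Z \<Longrightarrow> z \<in> \<Gamma> \<Longrightarrow> wt N z * cmod (V z) \<le> M0"
    using bdd unfolding bdd_above_def by blast
  define M where "M = max M0 0"
  have M: "M \<ge> 0" "\<And>z. z \<in> Z \<Longrightarrow> z \<in> \<Gamma> \<Longrightarrow> wt N z * cmod (V z) \<le> M"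
    using M0 by (auto simp: M_def le_max_iff_disj)
  define C where "C = M * 2 powr N + G * c powr (N + P)"
  have "cmod (V z) \<le> C * wt (- N) w * wt (N + P) (z - w)" if w: "w \<in> \<Gamma>'" and z: "z \<in> Z" for w z
  proof (cases "z \<in> \<Gamma>")
    case True
    have "cmod (V z) \<le> M * wt (- N) z"
      using M(2)[OF z True] by (simp add: powr_minus field_simps)
    also have "\<dots> \<le> M * (2 powr \<bar>- N\<bar> * wt (- N) w * wt \<bar>- N\<bar> (z - w))"
      using M by (intro mult_left_mono wt_diff_le)
    also have "\<dots> = (M * 2 powr N) * wt (- N) w * wt N (z - w)" using N by simp
    also have "\<dots> \<le> C * wt (- N) w * wt (N + P) (z - w)"
      unfolding C_def using M G P by (intro mult_mono wt_mono) auto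
    finally show ?thesis .
  next
    case False
    note cn = cone[OF w False]
    have "wt P z \<le> (c * bracket (z - w)) powr P"
      using cn P by (intro powr_mono2) auto
    then have zP: "wt P z \<le> c powr P * wt P (z - w)" using c by (simp add: powr_mult)
    have "wt N w \<le> (c * bracket (z - w)) powr N"
      using cn N by (intro powr_mono2) auto
    then have "wt N w \<le> c powr N * wt N (z - w)" using c by (simp add: powr_mult)
    then have "wt (- N) w * wt N w \<le> wt (- N) w * (c powr N * wt N (z - w))"
      by (rule mult_left_mono) simp
    moreover have "wt (- N) w * wt N w = 1" by (simp flip: powr_add)
    \<comment> \<open>This factor of at least 1 is inserted to manufacture the decay in
      \<open>w\<close>.\<close>
    ultimately have one: "1 \<le> wt (- N) w * (c powr N * wt N (z - w))" by simp
    have "cmod (V z) \<le> G * wt P z" by (rule growth[OF z])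
    also have "\<dots> \<le> G * (c powr P * wt P (z - w))" using G zP by (intro mult_left_mono) auto
    also have "\<dots> = G * (c powr P * wt P (z - w)) * 1" by simp
    also have "\<dots> \<le> G * (c powr P * wt P (z - w)) * (wt (- N) w * (c powr N * wt N (z - w)))"
      using G c by (intro mult_left_mono one) auto
    also have "\<dots> = (G * (c powr N * c powr P)) * wt (- N) w * (wt N (z - w) * wt P (z - w))"
      by (simp only: mult_ac)
    also have "\<dots> = (G * c powr (N + P)) * wt (- N) w * wt (N + P) (z - w)"
      by (simp add: powr_add)
    also have "\<dots> \<le> C * wt (- N) w * wt (N + P) (z - w)"
      unfolding C_def using M G by (intro mult_right_mono) auto
    finally show ?thesis .
  qed
  moreover have "C \<ge> 0" unfolding C_def using M G c by simp
  ultimately show ?thesis by blast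
qed

lemma bdd_above_decayI:
  assumes "\<And>w. w \<in> S \<Longrightarrow> cmod (V w) \<le> C * wt (- N) w"
  shows "bdd_above ((\<lambda>w. wt N w * cmod (V w)) ` S)"
proof (rule bdd_aboveI2)
  fix w assume "w \<in> S"
  from assms[OF this] show "wt N w * cmod (V w) \<le> C" by (simp add: powr_minus field_simps)
qed

lemma cmod_integral_wt_le:
  fixes F :: "'b::euclidean_space \<Rightarrow> complex"
  assumes b: "\<And>z. cmod (F z) \<le> B * wt (- s) (z - w)" and s: "2 * real DIM('b) \<le> s"
  shows "cmod (LINT z|lborel. F z) \<le> B * (LINT z::'b|lborel. wt (- s) z)"
proof (cases "integrable lborel F")
  case True
  have "cmod (LINT z|lborel. F z) \<le> (LINT z|lborel. B * wt (- s) (z - w))"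
    using integrable_wt_shift(1)[OF s, of w] by (intro Bochner_Integration.integral_norm_bound_integral[OF True _ b]) simp
  also have "\<dots> = B * (LINT z::'b|lborel. wt (- s) z)"
    using integrable_wt_shift(2)[OF s, of w] by simp
  finally show ?thesis .
next
  case False
  \<comment> \<open>Without integrability the integral is 0 by convention, so only the sign of the
    bound matters.\<close>
  have "0 \<le> B" using order_trans[OF norm_ge_zero b[of w]] by (simp add: zero_le_mult_iff)
  then show ?thesis using False by (simp add: not_integrable_integral_eq)
qed

text \<open>The transform with the new window is the old one integrated against the Gram kernel of
  the two windows. The rapid decay of this kernel off the diagonal absorbs the weights that
  \<open>rapid_off_cone\<close> leaves in \<open>z - w\<close>.\<close>

lemma stft_decay_change_window:
  fixes u :: "('a::euclidean_space \<Rightarrow> complex) \<Rightarrow> complex"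
  assumes u: "tempered_distribution u" and p: "\<phi> \<in> schwartz" "\<phi> \<noteq> (\<lambda>_. 0)" and q: "\<psi> \<in> schwartz"
    and c: "c > 0" and cone: "\<And>w z. w \<in> \<Gamma>' \<Longrightarrow> z \<notin> \<Gamma> \<Longrightarrow> bracket w \<le> c * bracket (z - w) \<and> bracket z \<le> c * bracket (z - w)"
    and decay: "\<forall>N\<ge>0. bdd_above ((\<lambda>z. wt N z * cmod (stft \<phi> u z)) ` \<Gamma>)" and N: "N \<ge> 0"
  shows "bdd_above ((\<lambda>z. wt N z * cmod (stft \<psi> u z)) ` \<Gamma>')"
proof -
  obtain G P where G: "G > 0" "P \<ge> 0" "\<And>z. cmod (stft \<phi> u z) \<le> G * wt P z"
    using stft_growth_lipschitz[OF u p(1)] by metis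
  have "\<exists>C\<ge>0. \<forall>w\<in>\<Gamma>'. \<forall>z\<in>UNIV. cmod (stft \<phi> u z) \<le> C * wt (- N) w * wt (N + P) (z - w)"
    using G decay N by (intro rapid_off_cone[OF c cone, where G = G]) auto
  then obtain C where C: "C \<ge> 0" "\<And>w z. w \<in> \<Gamma>' \<Longrightarrow> cmod (stft \<phi> u z) \<le> C * wt (- N) w * wt (N + P) (z - w)" by blast
  define d where "d = 2 * real DIM('a \<times> 'a)"
  obtain D where D: "D \<ge> 0" "\<And>z w. cmod (L2_inner (tf_shift w \<psi>) (tf_shift z \<phi>)) \<le> D * wt (- (d + (N + P))) (z - w)"
    using stft_decay2[OF p(1) q] by blast
  let ?I = "LINT z::'a\<times>'a|lborel. wt (- d) z"
  have "cmod (stft \<psi> u w) \<le> (rc \<phi> * (D * C * ?I)) * wt (- N) w" if w: "w \<in> \<Gamma>'" for w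
  proof -
    have "cmod (cnj (L2_inner (tf_shift w \<psi>) (tf_shift z \<phi>)) * stft \<phi> u z) \<le> (D * C * wt (- N) w) * wt (- d) (z - w)" for z
    proof -
      have "cmod (cnj (L2_inner (tf_shift w \<psi>) (tf_shift z \<phi>)) * stft \<phi> u z)
          \<le> (D * wt (- (d + (N + P))) (z - w)) * (C * wt (- N) w * wt (N + P) (z - w))"
        unfolding norm_mult complex_mod_cnj using C D w by (intro mult_mono) auto
      also have "\<dots> = (D * C * wt (- N) w) * (wt (- (d + (N + P))) (z - w) * wt (N + P) (z - w))"
        by (simp only: mult_ac)
      also have "\<dots> = (D * C * wt (- N) w) * wt (- d) (z - w)" by (simp flip: powr_add)
      finally show ?thesis .
    qed
    then have "cmod (LINT z|lborel. cnj (L2_inner (tf_shift w \<psi>) (tf_shift z \<phi>)) * stft \<phi> u z) \<le> (D * C * wt (- N) w) * ?I"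
      by (rule cmod_integral_wt_le) (simp add: d_def)
    then have "rc \<phi> * cmod (LINT z|lborel. cnj (L2_inner (tf_shift w \<psi>) (tf_shift z \<phi>)) * stft \<phi> u z) \<le> rc \<phi> * ((D * C * wt (- N) w) * ?I)"
      using rc_pos[OF p] by (intro mult_left_mono) auto
    moreover have "cmod (stft \<psi> u w) = rc \<phi> * cmod (LINT z|lborel. cnj (L2_inner (tf_shift w \<psi>) (tf_shift z \<phi>)) * stft \<phi> u z)"
      using tempered_reproducing[OF u p schwartz_tf_shift[OF q], of w] rc_pos[OF p]
      by (simp add: stft_def[of \<psi>] norm_mult)
    ultimately show ?thesis by (simp only: mult_ac)
  qed
  then show ?thesis by (rule bdd_above_decayI)
qed

subsection \<open>A smooth conic cutoff\<close>

text \<open>For \<open>k = 0\<close> this is the classical flat function exp (- 1 / t). The powers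
  of 1 / t are included because differentiation produces them, so that the family is closed up to
  linear combinations.\<close>

definition exp_cutoff :: "nat \<Rightarrow> real \<Rightarrow> real" where
  "exp_cutoff k t = (if t > 0 then (1 / t) ^ k * exp (- (1 / t)) else 0)"

lemma power_le_fact_exp:
  assumes "0 \<le> (x::real)"
  shows "x ^ n \<le> fact n * exp x"
proof -
  have "(\<Sum>k\<in>{n}. x ^ k /\<^sub>R fact k) \<le> (\<Sum>k. x ^ k /\<^sub>R fact k)"
    using assms by (intro sum_le_suminf summable_exp_generic) auto
  then have "x ^ n / fact n \<le> exp x" by (simp add: exp_def field_simps)
  then show ?thesis by (simp add: field_simps)
qed

lemma exp_cutoff_nonneg: "0 \<le> exp_cutoff k t"
  by (simp add: exp_cutoff_def)

text \<open>One term of the exponential series of 1 / t dominates the power. With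
  \<open>n = 0\<close> this is boundedness, and with \<open>n = 2\<close> it makes the difference
  quotient at 0 tend to 0.\<close>

lemma exp_cutoff_le: "exp_cutoff k t \<le> fact (k + n) * \<bar>t\<bar> ^ n"
proof (cases "t > 0")
  case True
  have "(1 / t) ^ (k + n) \<le> fact (k + n) * exp (1 / t)"
    using True by (intro power_le_fact_exp) auto
  then have "(1 / t) ^ (k + n) * exp (- (1 / t)) \<le> fact (k + n) * exp (1 / t) * exp (- (1 / t))"
    by (rule mult_right_mono) simp
  also have "\<dots> = fact (k + n)" by (simp add: mult.assoc flip: exp_add)
  finally have "((1 / t) ^ (k + n) * exp (- (1 / t))) * t ^ n \<le> fact (k + n) * t ^ n"
    using True by (intro mult_right_mono) auto
  moreover have "((1 / t) ^ (k + n) * exp (- (1 / t))) * t ^ n = (1 / t) ^ k * exp (- (1 / t)) * ((1 / t) * t) ^ n"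
    by (simp only: power_add power_mult_distrib mult_ac)
  ultimately show ?thesis using True by (simp add: exp_cutoff_def)
next
  case False
  then show ?thesis by (simp add: exp_cutoff_def)
qed

lemma exp_cutoff_deriv:
  "(exp_cutoff k has_real_derivative (- real k * exp_cutoff (k + 1) t + exp_cutoff (k + 2) t)) (at t)"
proof -
  consider "t > 0" | "t < 0" | "t = 0" by linarith
  then show ?thesis
  proof cases
    case 1
    have d1: "((\<lambda>t. 1 / t) has_real_derivative - ((1 / t)\<^sup>2)) (at t)"
      using 1 by (auto intro!: derivative_eq_intros simp: power2_eq_square field_simps)
    have eq: "real k * (- ((1 / t)\<^sup>2) * (1 / t) ^ (k - Suc 0)) * exp (- (1 / t))
        + exp (- (1 / t)) * - (- ((1 / t)\<^sup>2)) * (1 / t) ^ k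
      = - real k * exp_cutoff (k + 1) t + exp_cutoff (k + 2) t"
    proof -
      have "real k * (- (s\<^sup>2) * s ^ (k - Suc 0)) * E + E * - (- (s\<^sup>2)) * s ^ k
        = - real k * (s ^ (k + 1) * E) + s ^ (k + 2) * E" for s E :: real
        by (cases k) (simp_all add: power2_eq_square algebra_simps)
      then show ?thesis using 1 unfolding exp_cutoff_def by presburger
    qed
    have "((\<lambda>t. (1 / t) ^ k * exp (- (1 / t))) has_real_derivative
       (- real k * exp_cutoff (k + 1) t + exp_cutoff (k + 2) t)) (at t)"
      using DERIV_mult[OF DERIV_power[OF d1, of k] DERIV_fun_exp[OF DERIV_minus[OF d1]]]
      unfolding eq .
    then show ?thesis
      by (rule has_field_derivative_transform_within_open[of _ _ _ "{0<..}"]) (use 1 in \<open>auto simp: exp_cutoff_def\<close>)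
  next
    case 2
    have "((\<lambda>t. 0) has_real_derivative (- real k * exp_cutoff (k + 1) t + exp_cutoff (k + 2) t)) (at t)"
      using 2 by (auto simp: exp_cutoff_def)
    then show ?thesis
      by (rule has_field_derivative_transform_within_open[of _ _ _ "{..<0}"]) (use 2 in \<open>auto simp: exp_cutoff_def\<close>)
  next
    case 3
    have "((\<lambda>h. (exp_cutoff k (0 + h) - exp_cutoff k 0) / h) \<longlongrightarrow> 0) (at 0)"
    proof (rule Lim_null_comparison)
      have "norm ((exp_cutoff k (0 + h) - exp_cutoff k 0) / h) \<le> fact (k + 2) * \<bar>h\<bar>" if "h \<noteq> 0" for h
      proof -
        have "exp_cutoff k h \<le> (fact (k + 2) * \<bar>h\<bar>) * \<bar>h\<bar>"
          using exp_cutoff_le[of k h 2] unfolding power2_eq_square mult.assoc .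
        then have "exp_cutoff k h / \<bar>h\<bar> \<le> fact (k + 2) * \<bar>h\<bar>"
          by (subst pos_divide_le_eq) (use that in auto)
        moreover have "norm ((exp_cutoff k (0 + h) - exp_cutoff k 0) / h) = exp_cutoff k h / \<bar>h\<bar>"
          using exp_cutoff_nonneg[of k h] by (simp add: exp_cutoff_def[of _ 0])
        ultimately show ?thesis by (simp only:)
      qed
      then show "\<forall>\<^sub>F h in at 0. norm ((exp_cutoff k (0 + h) - exp_cutoff k 0) / h) \<le> fact (k + 2) * \<bar>h\<bar>"
        by (simp add: eventually_at_filter)
      show "((\<lambda>h::real. fact (k + 2) * \<bar>h\<bar>) \<longlongrightarrow> 0) (at 0)"
        by (auto intro!: tendsto_eq_intros)
    qed
    then show ?thesis using 3 by (simp add: DERIV_def exp_cutoff_def)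
  qed
qed

lemma bracket_has_derivative:
  "(bracket has_derivative (\<lambda>h. (z \<bullet> h) / bracket z)) (at (z::'b::euclidean_space))"
proof -
  define G where "G = (\<lambda>z::'b. 1 + z \<bullet> z)"
  have pos: "0 < G z" by (simp add: add_pos_nonneg G_def)
  have 1: "(G has_derivative (\<lambda>h. 2 * (z \<bullet> h))) (at z)"
    unfolding G_def by (auto intro!: derivative_eq_intros simp: inner_commute)
  have "((\<lambda>z. sqrt (G z)) has_derivative (\<lambda>h. 2 * (z \<bullet> h) * (inverse (sqrt (G z)) / 2))) (at z)"
    by (rule DERIV_compose_FDERIV[where g = G, OF DERIV_real_sqrt[OF pos] 1])
  moreover have "(\<lambda>h. 2 * (z \<bullet> h) * (inverse (sqrt (G z)) / 2)) = (\<lambda>h. (z \<bullet> h) / sqrt (G z))"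
    by (simp add: fun_eq_iff inverse_eq_divide)
  moreover have "sqrt (G z) = bracket z" for z
    by (simp add: bracket_def G_def power2_norm_eq_inner)
  ultimately show ?thesis by (simp only:)
qed

text \<open>An algebra of symbols, closed under derivatives, that contains the cutoff.\<close>

inductive cone_symbol :: "'b::euclidean_space \<Rightarrow> real \<Rightarrow> ('b \<Rightarrow> real) \<Rightarrow> real \<Rightarrow> bool" for e :: 'b and \<delta> :: real where
  const: "cone_symbol e \<delta> (\<lambda>_. c) 0"
| inv: "cone_symbol e \<delta> (\<lambda>z. 1 / bracket z) (- 1)"
| dir: "cone_symbol e \<delta> (\<lambda>z. (z \<bullet> h) / bracket z) 0"
| cut: "cone_symbol e \<delta> (\<lambda>z. exp_cutoff k ((z \<bullet> e) / bracket z - \<delta>)) 0"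
| add: "cone_symbol e \<delta> f m \<Longrightarrow> cone_symbol e \<delta> g m \<Longrightarrow> cone_symbol e \<delta> (\<lambda>z. f z + g z) m"
| mult: "cone_symbol e \<delta> f m \<Longrightarrow> cone_symbol e \<delta> g n \<Longrightarrow> cone_symbol e \<delta> (\<lambda>z. f z * g z) (m + n)"

lemma cone_symbol_bound:
  "cone_symbol e \<delta> f m \<Longrightarrow> \<exists>C\<ge>0. \<forall>z. \<bar>f z\<bar> \<le> C * wt m z"
proof (induction rule: cone_symbol.induct)
  case (const c)
  then show ?case by (intro exI[of _ "\<bar>c\<bar>"]) auto
next
  case inv
  then show ?case by (intro exI[of _ 1]) (auto simp: powr_minus divide_inverse)
next
  case (dir h)
  have "\<bar>(z \<bullet> h) / bracket z\<bar> \<le> norm h" for z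
  proof -
    have "\<bar>z \<bullet> h\<bar> \<le> bracket z * norm h"
      by (rule order_trans[OF Cauchy_Schwarz_ineq2 mult_right_mono[OF norm_le_bracket]]) simp
    then show ?thesis by (simp add: field_simps)
  qed
  then show ?case by (intro exI[of _ "norm h"]) auto
next
  case (cut k)
  then show ?case
    using exp_cutoff_le[of k _ 0] exp_cutoff_nonneg[of k] by (intro exI[of _ "fact k"]) auto
next
  case (add f m g)
  then obtain A B where A: "A \<ge> 0" "\<And>z. \<bar>f z\<bar> \<le> A * wt m z" and B: "B \<ge> 0" "\<And>z. \<bar>g z\<bar> \<le> B * wt m z" by blast
  have "\<bar>f z + g z\<bar> \<le> (A + B) * wt m z" for z
    using A(2)[of z] B(2)[of z] by (simp add: distrib_right)
  then show ?case using A B by (intro exI[of _ "A + B"]) auto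
next
  case (mult f m g n)
  then obtain A B where A: "A \<ge> 0" "\<And>z. \<bar>f z\<bar> \<le> A * wt m z" and B: "B \<ge> 0" "\<And>z. \<bar>g z\<bar> \<le> B * wt n z" by blast
  have "\<bar>f z * g z\<bar> \<le> (A * B) * wt (m + n) z" for z
    using mult_mono[OF A(2)[of z] B(2)[of z]] A B by (simp add: abs_mult powr_add mult_ac)
  then show ?case using A B by (intro exI[of _ "A * B"]) auto
qed

lemma cone_symbol_zero: "cone_symbol e \<delta> (\<lambda>_. 0) (- 1)"
  using cone_symbol.mult[OF cone_symbol.const[of e \<delta> 0] cone_symbol.inv[of e \<delta>]] by simp

lemma cone_symbol_dir_deriv:
  "((\<lambda>z. (z \<bullet> h) / bracket z) has_derivative
      (\<lambda>k. (k \<bullet> h) * (1 / bracket z) + (- 1) * ((z \<bullet> h) / bracket z * ((z \<bullet> k) / bracket z * (1 / bracket z))))) (at (z::'b::euclidean_space))"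
proof -
  have "((\<lambda>z. z \<bullet> h) has_derivative (\<lambda>k. k \<bullet> h)) (at z)" by (auto intro!: derivative_eq_intros)
  from has_derivative_divide[OF this bracket_has_derivative[of z] bracket_neq_0]
  show ?thesis by (rule has_derivative_eq_rhs) (simp add: fun_eq_iff field_simps)
qed

text \<open>The generators are functions of \<open>z\<close> divided by its bracket, and every
  derivative of this quotient carries a factor \<open>1 / bracket z\<close>; this is the gain of one
  order. Using the bracket instead of the norm keeps everything smooth at the origin.\<close>

lemma cone_symbol_deriv:
  "cone_symbol e \<delta> f m \<Longrightarrow> \<exists>f'. (\<forall>z. (f has_derivative f' z) (at z)) \<and> (\<forall>b. cone_symbol e \<delta> (\<lambda>z. f' z b) (m - 1))"
proof (induction rule: cone_symbol.induct)
  case (const c)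
  show ?case using cone_symbol_zero by (intro exI[of _ "\<lambda>_ _. 0"]) auto
next
  case inv
  let ?f' = "\<lambda>z b. (- 1) * ((z \<bullet> b) / bracket z * (1 / bracket z * (1 / bracket z)))"
  have "((\<lambda>z. 1 / bracket z) has_derivative ?f' z) (at z)" for z :: 'a
    using has_derivative_divide[OF has_derivative_const[of 1] bracket_has_derivative[of z] bracket_neq_0]
    by (rule has_derivative_eq_rhs) (simp add: fun_eq_iff field_simps)
  moreover have "cone_symbol e \<delta> (\<lambda>z. ?f' z b) (0 + (0 + (- 1 + - 1)))" for b
    by (intro cone_symbol.intros)
  ultimately show ?case by (intro exI[of _ ?f']) auto
next
  case (dir h)
  let ?f' = "\<lambda>z k. (k \<bullet> h) * (1 / bracket z) + (- 1) * ((z \<bullet> h) / bracket z * ((z \<bullet> k) / bracket z * (1 / bracket z)))"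
  have "cone_symbol e \<delta> (\<lambda>z. (b \<bullet> h) * (1 / bracket z)) (- 1)" for b
    using cone_symbol.mult[OF cone_symbol.const[of e \<delta> "b \<bullet> h"] cone_symbol.inv[of e \<delta>]] by simp
  moreover have "cone_symbol e \<delta> (\<lambda>z. (- 1) * ((z \<bullet> h) / bracket z * ((z \<bullet> b) / bracket z * (1 / bracket z)))) (0 + (0 + (0 + (- 1))))" for b
    by (intro cone_symbol.intros)
  ultimately have "cone_symbol e \<delta> (\<lambda>z. ?f' z b) (0 - 1)" for b
    by (intro cone_symbol.add) auto
  then show ?case using cone_symbol_dir_deriv by (intro exI[of _ ?f']) blast
next
  case (cut k)
  let ?t = "\<lambda>z. (z \<bullet> e) / bracket z - \<delta>"
  let ?t' = "\<lambda>z k. (k \<bullet> e) * (1 / bracket z) + (- 1) * ((z \<bullet> e) / bracket z * ((z \<bullet> k) / bracket z * (1 / bracket z)))"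
  let ?f' = "\<lambda>z b. (- real k * exp_cutoff (k + 1) (?t z) + exp_cutoff (k + 2) (?t z)) * ?t' z b"
  have "((\<lambda>z. exp_cutoff k (?t z)) has_derivative ?f' z) (at z)" for z
  proof -
    have "(?t has_derivative ?t' z) (at z)"
      using has_derivative_diff[OF cone_symbol_dir_deriv has_derivative_const[of \<delta>]] by simp
    from has_derivative_compose[OF this exp_cutoff_deriv[unfolded has_field_derivative_def]]
    show ?thesis .
  qed
  moreover have "cone_symbol e \<delta> (\<lambda>z. ?f' z b) (0 - 1)" for b
  proof -
    have "cone_symbol e \<delta> (\<lambda>z. (b \<bullet> e) * (1 / bracket z)) (- 1)"
      using cone_symbol.mult[OF cone_symbol.const[of e \<delta> "b \<bullet> e"] cone_symbol.inv[of e \<delta>]] by simp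
    moreover have "cone_symbol e \<delta> (\<lambda>z. (- 1) * ((z \<bullet> e) / bracket z * ((z \<bullet> b) / bracket z * (1 / bracket z)))) (0 + (0 + (0 + (- 1))))"
      by (intro cone_symbol.intros)
    ultimately have t: "cone_symbol e \<delta> (\<lambda>z. ?t' z b) (- 1)"
      by (intro cone_symbol.add) auto
    have "cone_symbol e \<delta> (\<lambda>z. - real k * exp_cutoff (k + 1) (?t z)) (0 + 0)"
      by (intro cone_symbol.mult cone_symbol.const cone_symbol.cut)
    then have "cone_symbol e \<delta> (\<lambda>z. - real k * exp_cutoff (k + 1) (?t z) + exp_cutoff (k + 2) (?t z)) 0"
      by (intro cone_symbol.add cone_symbol.cut) simp
    from cone_symbol.mult[OF this t] show ?thesis by simp
  qed
  ultimately show ?case by (intro exI[of _ ?f']) blast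
next
  case (add f m g)
  then obtain f' g' where f': "\<And>z. (f has_derivative f' z) (at z)" "\<And>b. cone_symbol e \<delta> (\<lambda>z. f' z b) (m - 1)"
    and g': "\<And>z. (g has_derivative g' z) (at z)" "\<And>b. cone_symbol e \<delta> (\<lambda>z. g' z b) (m - 1)" by blast
  then show ?case
    by (intro exI[of _ "\<lambda>z b. f' z b + g' z b"] conjI allI has_derivative_add cone_symbol.add) auto
next
  case (mult f m g n)
  then obtain f' g' where f': "\<And>z. (f has_derivative f' z) (at z)" "\<And>b. cone_symbol e \<delta> (\<lambda>z. f' z b) (m - 1)"
    and g': "\<And>z. (g has_derivative g' z) (at z)" "\<And>b. cone_symbol e \<delta> (\<lambda>z. g' z b) (n - 1)" by blast
  have "cone_symbol e \<delta> (\<lambda>z. f z * g' z b) (m + n - 1)" for b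
    using cone_symbol.mult[OF mult.hyps(1) g'(2)[of b]] by (simp add: add_diff_eq)
  moreover have "cone_symbol e \<delta> (\<lambda>z. f' z b * g z) (m + n - 1)" for b
    using cone_symbol.mult[OF f'(2)[of b] mult.hyps(2)] by (simp add: algebra_simps)
  ultimately have "cone_symbol e \<delta> (\<lambda>z. f z * g' z b + f' z b * g z) (m + n - 1)" for b
    by (rule cone_symbol.add)
  then show ?case using has_derivative_mult[OF f'(1) g'(1)]
    by (intro exI[of _ "\<lambda>z b. f z * g' z b + f' z b * g z"]) blast
qed

lemma cone_symbol_partial_derivs:
  assumes "cone_symbol e \<delta> f m"
  shows "\<exists>g. cone_symbol e \<delta> g (m - real (length bs)) \<and> partial_derivs bs (\<lambda>z. complex_of_real (f z)) = (\<lambda>z. of_real (g z))"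
proof (induction bs)
  case Nil
  then show ?case using assms by auto
next
  case (Cons b bs)
  then obtain g where g: "cone_symbol e \<delta> g (m - real (length bs))"
    "partial_derivs bs (\<lambda>z. complex_of_real (f z)) = (\<lambda>z. of_real (g z))" by blast
  obtain g' where g': "\<And>z. (g has_derivative g' z) (at z)" "\<And>b. cone_symbol e \<delta> (\<lambda>z. g' z b) (m - real (length bs) - 1)"
    using cone_symbol_deriv[OF g(1)] by blast
  have "((\<lambda>z. complex_of_real (g z)) has_derivative (\<lambda>h. of_real (g' z h))) (at z)" for z
    by (rule bounded_linear.has_derivative[OF bounded_linear_of_real g'(1)])
  from dpart_eq[OF this]
  have "partial_derivs (b # bs) (\<lambda>z. complex_of_real (f z)) = (\<lambda>z. of_real (g' z b))"
    by (simp add: g(2))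
  moreover have "cone_symbol e \<delta> (\<lambda>z. g' z b) (m - real (length (b # bs)))"
    using g'(2)[of b] by (simp add: algebra_simps)
  ultimately show ?case by blast
qed

lemma cone_symbol_shubin:
  fixes e :: "'a::euclidean_space \<times> 'a"
  assumes "cone_symbol e \<delta> f m"
  shows "(\<lambda>z. complex_of_real (f z)) \<in> shubin m"
  unfolding shubin_def smooth_def
proof (intro CollectI conjI allI impI)
  fix bs :: "('a \<times> 'a) list"
  obtain g where g: "cone_symbol e \<delta> g (m - real (length bs))"
    "partial_derivs bs (\<lambda>z. complex_of_real (f z)) = (\<lambda>z. of_real (g z))"
    using cone_symbol_partial_derivs[OF assms] by blast
  obtain g' where g': "\<And>z. (g has_derivative g' z) (at z)"
    using cone_symbol_deriv[OF g(1)] by blast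
  have "((\<lambda>z. complex_of_real (g z)) has_derivative (\<lambda>h. of_real (g' z h))) (at z)" for z
    by (rule bounded_linear.has_derivative[OF bounded_linear_of_real g'])
  then show "partial_derivs bs (\<lambda>z. complex_of_real (f z)) differentiable_on UNIV"
    unfolding g(2) differentiable_on_def differentiable_def by auto
  obtain C where C: "C \<ge> 0" "\<And>z. \<bar>g z\<bar> \<le> C * wt (m - real (length bs)) z"
    using cone_symbol_bound[OF g(1)] by blast
  have "cmod (partial_derivs bs (\<lambda>z. complex_of_real (f z)) z) \<le> (C + 1) * wt (m - real (length bs)) z" for z
    unfolding g(2) using C(2)[of z] by (simp add: distrib_right add_increasing2)
  then show "\<exists>C>0. \<forall>z. cmod (partial_derivs bs (\<lambda>z. complex_of_real (f z)) z) \<le> C * wt (m - real (length bs)) z"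
    using C(1) by (intro exI[of _ "C + 1"]) auto
qed

text \<open>The cutoff is positive where the inner product with the axis \<open>e\<close> exceeds
  \<delta> times the bracket. Since the bracket dominates the norm and \<delta> is nonnegative, this
  set lies in a circular cone. Far out, norm and bracket are comparable, so the cutoff is bounded
  below on a narrower cone.\<close>

lemma cone_cutoff_exists:
  fixes \<Gamma> :: "('a::euclidean_space \<times> 'a) set"
  assumes G: "open_cone \<Gamma>" and z0: "z0 \<in> \<Gamma>"
  shows "\<exists>a\<in>shubin 0. (\<forall>z. a z \<noteq> 0 \<longrightarrow> z \<in> \<Gamma>) \<and> noncharacteristic 0 a z0"
proof -
  have z0n: "z0 \<noteq> 0" using assms by (auto simp: open_cone_def)
  define e where "e = z0 /\<^sub>R norm z0"
  have e: "norm e = 1" using z0n by (simp add: e_def)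
  have eG: "e \<in> \<Gamma>" using assms z0n unfolding e_def open_cone_def by simp
  obtain r where r: "r > 0" "ball e r \<subseteq> \<Gamma>"
    using G eG unfolding open_cone_def by (meson openE)
  \<comment> \<open>For unit vectors,
    \<open>(norm (y - e))\<^sup>2 = 2 - 2 * (y \<bullet> e)\<close>, so an inner product above
    \<open>1 - r\<^sup>2 / 2\<close> puts \<open>y\<close> into the ball. The maximum with 0 keeps
    \<delta> nonnegative.\<close>
  define \<delta> where "\<delta> = max 0 (1 - r\<^sup>2 / 2)"
  have \<delta>: "0 \<le> \<delta>" "\<delta> < 1" "1 - r\<^sup>2 / 2 \<le> \<delta>" using r by (auto simp: \<delta>_def)
  have inG: "z \<in> \<Gamma>" if "\<delta> * norm z < z \<bullet> e" for z
  proof -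
    have zn: "z \<noteq> 0" using that by auto
    define y where "y = z /\<^sub>R norm z"
    have y: "norm y = 1" using zn by (simp add: y_def)
    have "\<delta> < y \<bullet> e" using that zn by (simp add: y_def field_simps)
    have "(norm (y - e))\<^sup>2 = 2 - 2 * (y \<bullet> e)"
    proof -
      have "(norm (y - e))\<^sup>2 = (norm y)\<^sup>2 - 2 * (y \<bullet> e) + (norm e)\<^sup>2"
        by (simp add: power2_norm_eq_inner inner_diff_left inner_diff_right inner_commute)
      then show ?thesis using y e by simp
    qed
    also have "\<dots> < r\<^sup>2" using \<open>\<delta> < y \<bullet> e\<close> \<delta> by linarith
    finally have "norm (y - e) < r"
      by (rule power2_less_imp_less) (use r in simp)
    then have "y \<in> ball e r" by (simp add: dist_norm norm_minus_commute)
    then have "y \<in> \<Gamma>" using r by blast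
    moreover have "norm z > 0" using zn by simp
    ultimately have "norm z *\<^sub>R y \<in> \<Gamma>" using G unfolding open_cone_def by blast
    then show ?thesis using zn by (simp add: y_def)
  qed
  define a where "a = (\<lambda>z. complex_of_real (exp_cutoff 0 ((z \<bullet> e) / bracket z - \<delta>)))"
  have "a \<in> shubin 0" unfolding a_def
    by (rule cone_symbol_shubin[OF cone_symbol.cut[of e \<delta> 0]])
  moreover have "z \<in> \<Gamma>" if "a z \<noteq> 0" for z
  proof -
    have "(z \<bullet> e) / bracket z - \<delta> > 0"
      using that by (auto simp: a_def exp_cutoff_def split: if_splits)
    then have "\<delta> * bracket z < z \<bullet> e" by (simp add: field_simps)
    moreover have "\<delta> * norm z \<le> \<delta> * bracket z" using \<delta> by (intro mult_left_mono norm_le_bracket)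
    ultimately show ?thesis by (intro inG) linarith
  qed
  moreover have "noncharacteristic 0 a z0"
  proof -
    \<comment> \<open>An aperture strictly between \<delta> and 1. Half of the gap, called \<eta>,
      is kept as the lower bound for the argument of the cutoff; the other half pays for replacing
      the norm by the bracket once \<open>norm z\<close> is at least 1 / \<eta>.\<close>
    define \<gamma> where "\<gamma> = (1 + \<delta>) / 2"
    have \<gamma>: "\<delta> < \<gamma>" "\<gamma> < 1" "0 < \<gamma>" using \<delta> by (auto simp: \<gamma>_def)
    define \<eta> where "\<eta> = (\<gamma> - \<delta>) / 2"
    have \<eta>: "\<eta> > 0" using \<gamma> by (simp add: \<eta>_def)
    let ?G = "{z. \<gamma> * norm z < z \<bullet> e}"
    show ?thesis
      unfolding noncharacteristic_def
    proof (rule exI[of _ "1 / \<eta>"], rule conjI, use \<eta> in simp, rule exI[of _ "exp (- (1 / \<eta>))"], rule conjI, simp,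
        rule exI[of _ ?G], intro conjI ballI impI)
      show "open_cone ?G"
        unfolding open_cone_def
      proof (intro conjI ballI allI impI)
        show "open ?G" by (intro open_Collect_less continuous_intros)
        fix z and t :: real assume "z \<in> ?G" "t > 0"
        then show "t *\<^sub>R z \<in> ?G" by (simp add: mult.left_commute)
      qed simp
      show "z0 \<in> ?G"
      proof -
        have "z0 \<bullet> e = norm z0" using z0n by (simp add: e_def dot_square_norm power2_eq_square)
        then show ?thesis using \<gamma> z0n by simp
      qed
      fix z assume z: "z \<in> ?G" "1 / \<eta> \<le> norm z"
      have nz: "norm z > 0" using z(2) \<eta> by (meson divide_pos_pos less_le_trans zero_less_one)
      have "\<gamma> * norm z - \<eta> * bracket z \<ge> \<delta> * bracket z"
      proof -
        have "1 \<le> \<eta> * norm z" using z(2) \<eta> by (simp add: field_simps)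
        moreover have "\<gamma> * bracket z \<le> \<gamma> * (1 + norm z)" using \<gamma> by (intro mult_left_mono bracket_le_one_plus_norm) auto
        moreover have "\<eta> * norm z \<le> \<eta> * bracket z" using \<eta> by (intro mult_left_mono norm_le_bracket) auto
        moreover have "\<gamma> * bracket z - \<delta> * bracket z = 2 * (\<eta> * bracket z)" by (simp add: \<eta>_def field_simps)
        ultimately show ?thesis using \<gamma> by (simp add: distrib_left) 
      qed
      then have "(\<delta> + \<eta>) * bracket z \<le> z \<bullet> e" using z(1) by (simp add: distrib_right)
      then have t: "\<eta> \<le> (z \<bullet> e) / bracket z - \<delta>" by (simp add: field_simps)
      then have "exp (- (1 / \<eta>)) \<le> exp (- (1 / ((z \<bullet> e) / bracket z - \<delta>)))"
        using \<eta> by (simp add: frac_le)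
      then show "cmod (a z) \<ge> exp (- (1 / \<eta>)) * wt 0 z"
        using t \<eta> by (simp add: a_def exp_cutoff_def)
    qed
  qed
  ultimately show ?thesis by blast
qed

subsection \<open>The global wave front set and the short-time Fourier transform\<close>

text \<open>The transform \<open>H\<close> of the cutoff operator applied to \<open>u\<close> is
  estimated on all of phase space. The bounds \<open>near\<close> and \<open>kernel\<close> each
  control one direction of the integrand, and \<open>far\<close> interpolates between them; then the
  synthesis of \<open>H\<close> is the Schwartz function sought.\<close>

lemma WF_subset_WF':
  fixes u :: "('a::euclidean_space \<Rightarrow> complex) \<Rightarrow> complex"
  assumes u: "tempered_distribution u" and p: "\<phi> \<in> schwartz" "\<phi> \<noteq> (\<lambda>_. 0)"
  shows "WF u \<subseteq> WF' \<phi> u"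
proof
  fix z0 assume z0: "z0 \<in> WF u"
  show "z0 \<in> WF' \<phi> u"
  proof (rule ccontr)
    assume "z0 \<notin> WF' \<phi> u"
    moreover have "z0 \<noteq> 0" using z0 by (simp add: WF_def)
    ultimately obtain \<Gamma> where \<Gamma>: "open_cone \<Gamma>" "z0 \<in> \<Gamma>"
      and decay: "\<forall>N\<ge>0. bdd_above ((\<lambda>z. wt N z * cmod (stft \<phi> u z)) ` \<Gamma>)"
      by (auto simp: WF'_def)
    obtain \<Gamma>' c where \<Gamma>': "open_cone \<Gamma>'" "z0 \<in> \<Gamma>'" and c: "c > 0"
      and cone: "\<And>w z. w \<in> \<Gamma>' \<Longrightarrow> z \<notin> \<Gamma> \<Longrightarrow> bracket w \<le> c * bracket (z - w) \<and> bracket z \<le> c * bracket (z - w)"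
      using cone_shrink[OF \<Gamma>] by metis
    obtain a where a: "a \<in> shubin 0" and supp: "\<And>z. a z \<noteq> 0 \<Longrightarrow> z \<in> \<Gamma>'" and nc: "noncharacteristic 0 a z0"
      using cone_cutoff_exists[OF \<Gamma>'] by blast
    let ?V = "stft \<phi> u"
    obtain G P where G: "G > 0" "P \<ge> 0" "\<And>z. cmod (?V z) \<le> G * wt P z"
      using stft_growth_lipschitz[OF u p(1)] by metis
    define b where "b = (\<lambda>z. cnj (a z))"
    have b: "b \<in> shubin 0" unfolding b_def by (rule shubin_cnj[OF a])
    have suppb: "z \<in> \<Gamma>'" if "b z \<noteq> 0" for z using supp that by (simp add: b_def)
    note bs = shubin_symbol[OF b]
    note bm = measurable_smooth[OF shubin_smooth[OF b]]
    obtain Cb where Cb: "Cb \<ge> 0" "\<And>v. cmod (b v) \<le> Cb * wt 0 v"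
      using symbol_family_bound[OF bs] by metis
    define B where "B = (\<lambda>w z. weyl_form b (tf_shift w \<phi>) (tf_shift z \<phi>))"
    define d where "d = 2 * real DIM('a \<times> 'a)"
    have d: "d \<ge> 0" by (simp add: d_def)
    define I where "I = (LINT z::'a\<times>'a|lborel. wt (- d) z)"
    have I: "I \<ge> 0" unfolding I_def by simp
    have pm [measurable]: "\<phi> \<in> borel_measurable borel" by (rule schwartz_measurable[OF p(1)])
    have Vm [measurable]: "?V \<in> borel_measurable borel" by (rule measurable_stft_distr[OF u p(1)])
    note [measurable] = bm
    have Bm: "(\<lambda>(w, z). B w z) \<in> borel_measurable (borel \<Otimes>\<^sub>M borel)" unfolding B_def by measurable
    \<comment> \<open>Uses the support of the symbol: where \<open>b v\<close> does not vanish,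
      \<open>v\<close> lies in the smaller cone, and \<open>rapid_off_cone\<close> bounds the
      transform at \<open>z\<close> by a decaying weight at \<open>v\<close>. Since \<open>v\<close>
      is close to the midpoint, the weight can be moved on to \<open>w\<close>, at the price of
      growth in \<open>z - w\<close>.\<close>
    have near: "\<exists>C\<ge>0. \<forall>w z. cmod (B w z) * cmod (?V z) \<le> C * (wt (- N) w * wt (2 * N + P) (z - w))" if N: "N \<ge> 0" for N
    proof -
      have "\<exists>C\<ge>0. \<forall>w\<in>\<Gamma>'. \<forall>z\<in>UNIV. cmod (?V z) \<le> C * wt (- N) w * wt (N + P) (z - w)"
        using G decay N by (intro rapid_off_cone[OF c cone, where G = G]) auto
      then obtain C where C: "C \<ge> 0" "\<And>w z. w \<in> \<Gamma>' \<Longrightarrow> cmod (?V z) \<le> C * wt (- N) w * wt (N + P) (z - w)" by blast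
      \<comment> \<open>Wigner decay sufficient for one integrable factor and the two weights in
        \<open>v\<close> minus the midpoint that Peetre's inequality creates.\<close>
      define s where "s = d + (N + (N + P))"
      have s: "s \<ge> 0" using N G d by (simp add: s_def)
      obtain D where D: "D \<ge> 0" "\<And>z w v. cmod (wigner (tf_shift z \<phi>) (tf_shift w \<phi>) v) \<le> D * wt (- s) (v - (z + w) /\<^sub>R 2)"
        using wigner_decay[OF p(1) p(1) s] by blast
      define k where "k = (2::real) powr N * 2 powr N * 2 powr (N + P)"
      let ?w = "(2 * pi) powr - real DIM('a)"
      have "cmod (B w z) * cmod (?V z) \<le> (?w * (Cb * C * k * D * I)) * (wt (- N) w * wt (2 * N + P) (z - w))" for w z
      proof -
        let ?p = "(z + w) /\<^sub>R 2"
        have half: "wt r ((1 / 2) *\<^sub>R (z - w)) \<le> wt r (z - w)" if "r \<ge> 0" for r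
          using that by (intro powr_mono2 bracket_mono) auto
        \<comment> \<open>The modulus of the transform at \<open>z\<close> is kept under the
          integral over \<open>v\<close>, because its estimate depends on \<open>v\<close> lying in
          the support of \<open>b\<close>.\<close>
        have pt: "cmod (b v * cnj (wigner (tf_shift z \<phi>) (tf_shift w \<phi>) v) * of_real (cmod (?V z)))
            \<le> (Cb * C * k * D * (wt (- N) w * wt (2 * N + P) (z - w))) * wt (- d) (v - ?p)" for v
        proof (cases "b v = 0")
          case True
          then show ?thesis using Cb C D by (simp add: k_def)
        next
          case False
          \<comment> \<open>The offset of \<open>v\<close> from either point splits into its offset
            from the midpoint and half of \<open>z - w\<close>.\<close>
          have e1: "v - w = (v - ?p) + (1 / 2) *\<^sub>R (z - w)"
            by (simp add: algebra_simps flip: scaleR_add_left)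
          have e2: "z - v = - (v - ?p) + (1 / 2) *\<^sub>R (z - w)"
            by (simp add: algebra_simps flip: scaleR_add_left)
          have "wt N (v - w) \<le> 2 powr \<bar>N\<bar> * wt N (v - ?p) * wt \<bar>N\<bar> ((1 / 2) *\<^sub>R (z - w))"
            unfolding e1 by (rule wt_add_le)
          also have "\<dots> \<le> 2 powr N * wt N (v - ?p) * wt N (z - w)"
            using N half[OF N] by (intro mult_mono) auto
          finally have vw: "wt N (v - w) \<le> 2 powr N * wt N (v - ?p) * wt N (z - w)" .
          have NP: "N + P \<ge> 0" using N G by simp
          have "wt (N + P) (z - v) \<le> 2 powr \<bar>N + P\<bar> * wt (N + P) (- (v - ?p)) * wt \<bar>N + P\<bar> ((1 / 2) *\<^sub>R (z - w))"
            unfolding e2 by (rule wt_add_le)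
          also have "\<dots> \<le> 2 powr (N + P) * wt (N + P) (v - ?p) * wt (N + P) (z - w)"
            unfolding bracket_minus using NP half[OF NP] by (intro mult_mono) auto
          finally have zv: "wt (N + P) (z - v) \<le> 2 powr (N + P) * wt (N + P) (v - ?p) * wt (N + P) (z - w)" .
          have "wt (- N) v \<le> 2 powr \<bar>- N\<bar> * wt (- N) w * wt \<bar>- N\<bar> (v - w)" by (rule wt_diff_le)
          also have "\<dots> \<le> 2 powr N * wt (- N) w * (2 powr N * wt N (v - ?p) * wt N (z - w))"
            using N vw by (intro mult_mono) auto
          finally have vN: "wt (- N) v \<le> 2 powr N * wt (- N) w * (2 powr N * wt N (v - ?p) * wt N (z - w))" .
          have "cmod (?V z) \<le> C * wt (- N) v * wt (N + P) (z - v)" by (rule C(2)[OF suppb[OF False]])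
          also have "\<dots> \<le> C * (2 powr N * wt (- N) w * (2 powr N * wt N (v - ?p) * wt N (z - w)))
              * (2 powr (N + P) * wt (N + P) (v - ?p) * wt (N + P) (z - w))"
            using C(1) vN zv by (intro mult_mono) auto
          finally have Vz: "cmod (?V z) \<le> C * (2 powr N * wt (- N) w * (2 powr N * wt N (v - ?p) * wt N (z - w)))
              * (2 powr (N + P) * wt (N + P) (v - ?p) * wt (N + P) (z - w))" .
          have "cmod (b v * cnj (wigner (tf_shift z \<phi>) (tf_shift w \<phi>) v) * of_real (cmod (?V z)))
              = cmod (b v) * cmod (wigner (tf_shift z \<phi>) (tf_shift w \<phi>) v) * cmod (?V z)" by (simp add: norm_mult)
          also have "\<dots> \<le> Cb * (D * wt (- s) (v - ?p)) * (C * (2 powr N * wt (- N) w * (2 powr N * wt N (v - ?p) * wt N (z - w)))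
              * (2 powr (N + P) * wt (N + P) (v - ?p) * wt (N + P) (z - w)))"
            using Cb C D Vz by (intro mult_mono) auto
          also have "\<dots> = Cb * C * k * D * (wt (- N) w * (wt N (z - w) * wt (N + P) (z - w)))
              * (wt (- s) (v - ?p) * (wt N (v - ?p) * wt (N + P) (v - ?p)))"
            unfolding k_def by (simp only: mult_ac)
          also have "wt N (z - w) * wt (N + P) (z - w) = wt (2 * N + P) (z - w)"
            by (simp flip: powr_add)
          also have "wt (- s) (v - ?p) * (wt N (v - ?p) * wt (N + P) (v - ?p)) = wt (- d) (v - ?p)"
            unfolding powr_add[symmetric] by (simp add: s_def)
          finally show ?thesis .
        qed
        have "cmod (LINT v|lborel. b v * cnj (wigner (tf_shift z \<phi>) (tf_shift w \<phi>) v) * of_real (cmod (?V z)))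
            \<le> (Cb * C * k * D * (wt (- N) w * wt (2 * N + P) (z - w))) * I"
          unfolding I_def by (rule cmod_integral_wt_le[OF pt]) (simp add: d_def)
        then have "?w * (cmod (LINT v|lborel. b v * cnj (wigner (tf_shift z \<phi>) (tf_shift w \<phi>) v)) * cmod (?V z))
            \<le> ?w * ((Cb * C * k * D * (wt (- N) w * wt (2 * N + P) (z - w))) * I)"
          by (intro mult_left_mono) (auto simp: norm_mult)
        then show ?thesis
          unfolding B_def weyl_form_eq norm_mult by (simp add: mult_ac)
      qed
      moreover have "?w * (Cb * C * k * D * I) \<ge> 0" using Cb C D I by (simp add: k_def)
      ultimately show ?thesis by blast
    qed
    have kernel: "\<exists>C\<ge>0. \<forall>w z. cmod (B w z) \<le> C * wt (- M) (z - w)" for M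
    proof -
      obtain C where C: "C \<ge> 0" "\<And>w z. cmod (weyl_form b (tf_shift w \<phi>) (tf_shift z \<phi>)) \<le> C * wt 0 w * wt (- M) (z - w)"
        using weyl_form_kernel_decay[OF b p(1) p(1)] by blast
      then show ?thesis unfolding B_def by auto
    qed
    \<comment> \<open>The square of the product is bounded once by \<open>near\<close> and once by
      \<open>kernel\<close> together with the growth of the transform, and the root is
      taken.\<close>
    have far: "\<exists>C\<ge>0. \<forall>w z. cmod (B w z) * cmod (?V z) \<le> C * (wt (- N) w * wt (- d) (z - w))" if N: "N \<ge> 0" for N
    proof -
      \<comment> \<open>Taking the root halves the exponents and the growth costs \<open>P\<close>,
        hence \<open>2 * N + P\<close>. The choice of \<open>M\<close> leaves exactly twice
        \<open>- d\<close> for \<open>z - w\<close>, so that the root is integrable in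
        \<open>z\<close>.\<close>
      define N' where "N' = 2 * N + P"
      define M where "M = (2 * N' + P) + P + 2 * d"
      have N': "N' \<ge> 0" using N G by (simp add: N'_def)
      obtain C1 where C1: "C1 \<ge> 0" "\<And>w z. cmod (B w z) * cmod (?V z) \<le> C1 * (wt (- N') w * wt (2 * N' + P) (z - w))"
        using near[OF N'] by blast
      obtain C2 where C2: "C2 \<ge> 0" "\<And>w z. cmod (B w z) \<le> C2 * wt (- M) (z - w)"
        using kernel by blast
      define C where "C = C1 * C2 * G * 2 powr P"
      have C: "C \<ge> 0" using C1 C2 G by (simp add: C_def)
      have "cmod (B w z) * cmod (?V z) \<le> sqrt C * (wt (- N) w * wt (- d) (z - w))" for w z
      proof (rule power2_le_imp_le)
        have "wt P z \<le> 2 powr \<bar>P\<bar> * wt P w * wt \<bar>P\<bar> (z - w)" by (rule wt_diff_le)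
        then have Vz: "cmod (?V z) \<le> G * (2 powr P * wt P w * wt P (z - w))"
          using G by (intro order_trans[OF G(3)] mult_left_mono) auto
        have "(cmod (B w z) * cmod (?V z))\<^sup>2 = (cmod (B w z) * cmod (?V z)) * (cmod (B w z) * cmod (?V z))"
          by (simp add: power2_eq_square)
        also have "\<dots> \<le> (C1 * (wt (- N') w * wt (2 * N' + P) (z - w))) * ((C2 * wt (- M) (z - w)) * (G * (2 powr P * wt P w * wt P (z - w))))"
        proof (rule mult_mono)
          show "cmod (B w z) * cmod (?V z) \<le> C1 * (wt (- N') w * wt (2 * N' + P) (z - w))" by (rule C1(2))
          show "cmod (B w z) * cmod (?V z) \<le> (C2 * wt (- M) (z - w)) * (G * (2 powr P * wt P w * wt P (z - w)))"
            using C2 Vz by (intro mult_mono) auto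
        qed (use C1 in auto)
        also have "\<dots> = C * ((wt (- N') w * wt P w) * (wt (2 * N' + P) (z - w) * (wt (- M) (z - w) * wt P (z - w))))"
          unfolding C_def by (simp only: mult_ac)
        also have "wt (- N') w * wt P w = wt (- N) w * wt (- N) w"
          unfolding powr_add[symmetric] by (simp add: N'_def)
        also have "wt (2 * N' + P) (z - w) * (wt (- M) (z - w) * wt P (z - w)) = wt (- d) (z - w) * wt (- d) (z - w)"
          unfolding powr_add[symmetric] by (simp add: M_def)
        finally show "(cmod (B w z) * cmod (?V z))\<^sup>2 \<le> (sqrt C * (wt (- N) w * wt (- d) (z - w)))\<^sup>2"
        proof -
          have sq: "(sqrt C * x)\<^sup>2 = C * (x * x)" for x
            unfolding power_mult_distrib using C by (simp add: power2_eq_square)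
          then show ?thesis if "(cmod (B w z) * cmod (?V z))\<^sup>2
              \<le> C * ((wt (- N) w * wt (- N) w) * (wt (- d) (z - w) * wt (- d) (z - w)))"
            using that unfolding sq by (simp only: mult_ac)
        qed
      qed (use C in simp)
      then show ?thesis using C by (intro exI[of _ "sqrt C"]) auto
    qed
    define H where "H = (\<lambda>w. weyl_ext a u (tf_shift w \<phi>))"
    have ext: "weyl_ext a u g = of_real (rc \<phi>) * (LINT z|lborel. cnj (weyl_form b g (tf_shift z \<phi>)) * ?V z)" if "g \<in> schwartz" for g
      unfolding weyl_ext_def b_def[symmetric] by (rule tempered_weyl[OF u bs p that])
    have Heq: "H w = of_real (rc \<phi>) * (LINT z|lborel. cnj (B w z) * ?V z)" for w
      unfolding H_def B_def by (rule ext[OF schwartz_tf_shift[OF p(1)]])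
    have rapH: "rapid H"
      unfolding rapid_def
    proof (intro conjI allI)
      show "H \<in> borel_measurable borel"
        unfolding Heq using Bm by measurable
      fix N :: real
      obtain C where C: "C \<ge> 0" "\<And>w z. cmod (B w z) * cmod (?V z) \<le> C * (wt (- \<bar>N\<bar>) w * wt (- d) (z - w))"
        using far[of "\<bar>N\<bar>"] by auto
      have "cmod (H w) \<le> (rc \<phi> * (C * I)) * wt (- N) w" for w
      proof -
        have "cmod (cnj (B w z) * ?V z) \<le> (C * wt (- \<bar>N\<bar>) w) * wt (- d) (z - w)" for z
          using C(2)[of w z] by (simp add: norm_mult mult.assoc)
        then have "cmod (LINT z|lborel. cnj (B w z) * ?V z) \<le> (C * wt (- \<bar>N\<bar>) w) * I"
          unfolding I_def by (rule cmod_integral_wt_le) (simp add: d_def)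
        also have "\<dots> \<le> (C * wt (- N) w) * I"
          using C I by (intro mult_right_mono mult_left_mono wt_mono) auto
        finally have "rc \<phi> * cmod (LINT z|lborel. cnj (B w z) * ?V z) \<le> rc \<phi> * ((C * wt (- N) w) * I)"
          using rc_pos[OF p] by (intro mult_left_mono) auto
        then show ?thesis unfolding Heq norm_mult using rc_pos[OF p] by (simp add: mult_ac)
      qed
      then show "\<exists>C. \<forall>w. cmod (H w) \<le> C * wt (- N) w" by blast
    qed
    \<comment> \<open>Expanding \<open>g\<close> in shifts and exchanging the integrals identifies
      the distribution with the synthesis of its own transform \<open>H\<close>. For the exchange
      the plain kernel decay suffices, since the coefficients of \<open>g\<close> decay
      rapidly.\<close>
    have "weyl_ext a u g = L2_inner (\<lambda>y. of_real (rc \<phi>) * synth \<phi> H y) g" if g: "g \<in> schwartz" for g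
    proof -
      let ?L = "\<lambda>w. L2_inner g (tf_shift w \<phi>)"
      have gm [measurable]: "g \<in> borel_measurable borel" by (rule schwartz_measurable[OF g])
      note [measurable] = Bm
      have "weyl_ext a u g = of_real (rc \<phi>) * (LINT z|lborel. of_real (rc \<phi>) * (LINT w|lborel. cnj (?L w) * cnj (B w z) * ?V z))"
      proof -
        have "cnj (weyl_form b g (tf_shift z \<phi>)) * ?V z = of_real (rc \<phi>) * (LINT w|lborel. cnj (?L w) * cnj (B w z) * ?V z)" for z
        proof -
          have "weyl_form b g (tf_shift z \<phi>) = of_real (rc \<phi>) * (LINT w|lborel. ?L w * B w z)"
            unfolding B_def using Cb(2) by (intro weyl_form_expansion_left[OF p g schwartz_tf_shift[OF p(1)] bm])
          then have "cnj (weyl_form b g (tf_shift z \<phi>)) = of_real (rc \<phi>) * (LINT w|lborel. cnj (?L w) * cnj (B w z))"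
            by (simp flip: Bochner_Integration.integral_cnj)
          then show ?thesis unfolding integral_mult_left_zero by (simp only: mult.assoc)
        qed
        then show ?thesis unfolding ext[OF g] by presburger
      qed
      also have "\<dots> = of_real (rc \<phi>) * (of_real (rc \<phi>) * (LINT z|lborel. LINT w|lborel. cnj (?L w) * cnj (B w z) * ?V z))"
        by simp
      also have "(LINT z|lborel. LINT w|lborel. cnj (?L w) * cnj (B w z) * ?V z)
          = (LINT w|lborel. LINT z|lborel. cnj (?L w) * cnj (B w z) * ?V z)"
      proof -
        define M where "M = P + d"
        have M: "M \<ge> 0" using G d by (simp add: M_def)
        obtain C where C: "C \<ge> 0" "\<And>w z. cmod (B w z) \<le> C * wt (- M) (z - w)" using kernel by blast
        obtain D where D: "D \<ge> 0" "\<And>w. cmod (?L w) \<le> D * wt (- (M + d)) w"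
          using stft_decay[OF p(1) g] by blast
        show ?thesis
        proof (rule fubini_dominated(2)[where u = "\<lambda>z. C * 2 powr M * G * wt (- d) z" and v = "\<lambda>w. D * wt (- d) w"])
          show "(\<lambda>(z, w). cnj (?L w) * cnj (B w z) * ?V z) \<in> borel_measurable (lborel \<Otimes>\<^sub>M lborel)"
            by measurable
          show "integrable lborel (\<lambda>z::'a \<times> 'a. C * 2 powr M * G * wt (- d) z)" "integrable lborel (\<lambda>w::'a \<times> 'a. D * wt (- d) w)"
            using integrable_wt[where 'a = "'a \<times> 'a" and s = d] by (simp_all add: d_def)
          show "cmod (cnj (?L w) * cnj (B w z) * ?V z) \<le> (C * 2 powr M * G * wt (- d) z) * (D * wt (- d) w)" for z w
          proof -
            have "cmod (B w z) \<le> C * (2 powr \<bar>- M\<bar> * wt (- M) z * wt \<bar>- M\<bar> (- w))"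
              using wt_add_le[of z "- w" "- M"] C by (intro order_trans[OF C(2)] mult_left_mono) auto
            then have Bz: "cmod (B w z) \<le> C * (2 powr M * wt (- M) z * wt M w)" using M by simp
            have "cmod (cnj (?L w) * cnj (B w z) * ?V z) \<le> (D * wt (- (M + d)) w) * (C * (2 powr M * wt (- M) z * wt M w)) * (G * wt P z)"
              unfolding norm_mult complex_mod_cnj using C D G Bz by (intro mult_mono) auto
            also have "\<dots> = (C * 2 powr M * G * (wt (- M) z * wt P z)) * (D * (wt (- (M + d)) w * wt M w))"
              by (simp only: mult_ac)
            also have "wt (- M) z * wt P z = wt (- d) z" unfolding powr_add[symmetric] by (simp add: M_def)
            also have "wt (- (M + d)) w * wt M w = wt (- d) w" unfolding powr_add[symmetric] by simp
            finally show ?thesis .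
          qed
        qed
      qed
      also have "of_real (rc \<phi>) * (of_real (rc \<phi>) * (LINT w|lborel. LINT z|lborel. cnj (?L w) * cnj (B w z) * ?V z))
          = of_real (rc \<phi>) * (LINT w|lborel. H w * cnj (?L w))"
      proof -
        have "of_real (rc \<phi>) * (LINT z|lborel. cnj (?L w) * cnj (B w z) * ?V z) = H w * cnj (?L w)" for w
          unfolding Heq by (simp add: mult.assoc)
        then have "of_real (rc \<phi>) * (LINT w|lborel. LINT z|lborel. cnj (?L w) * cnj (B w z) * ?V z) = (LINT w|lborel. H w * cnj (?L w))"
          by (subst integral_mult_right_zero[symmetric]) presburger
        then show ?thesis by (simp only:)
      qed
      also have "\<dots> = L2_inner (\<lambda>y. of_real (rc \<phi>) * synth \<phi> H y) g"
        unfolding L2_inner_cmult_left L2_inner_synth[OF p(1) rapid_integrable[OF rapH] rapid_integrable[OF schwartz_rapid[OF g]]] L2_inner_commute[of "tf_shift _ \<phi>" g] ..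
      finally show ?thesis .
    qed
    then have "is_schwartz (weyl_ext a u)"
      unfolding is_schwartz_def using schwartz_cmult[OF schwartz_synth[OF p(1) rapH]] by blast
    then have "z0 \<in> char_set 0 a" using z0 a by (auto simp: WF_def)
    then show False using nc by (simp add: char_set_def)
  qed
qed

text \<open>Ellipticity gives information inside the cone, whereas the remainder integrates over all
  of phase space; this is why the supremum of the weighted transform is taken globally around a
  fixed \<open>w0\<close> and estimated region by region.\<close>

lemma WF'_subset_WF:
  fixes u :: "('a::euclidean_space \<Rightarrow> complex) \<Rightarrow> complex"
  assumes u: "tempered_distribution u" and p: "\<phi> \<in> schwartz" "\<phi> \<noteq> (\<lambda>_. 0)"
  shows "WF' \<phi> u \<subseteq> WF u"
proof
  fix z0 assume z0: "z0 \<in> WF' \<phi> u"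
  show "z0 \<in> WF u"
  proof (rule ccontr)
    assume "z0 \<notin> WF u"
    moreover have "z0 \<noteq> 0" using z0 by (simp add: WF'_def)
    ultimately obtain m a where a: "a \<in> shubin m" and sch: "is_schwartz (weyl_ext a u)" and "noncharacteristic m a z0"
      by (auto simp: WF_def char_set_def)
    then obtain A \<epsilon> \<Gamma> where A: "A > 0" and \<epsilon>: "\<epsilon> > 0" and \<Gamma>: "open_cone \<Gamma>" "z0 \<in> \<Gamma>"
      and ell: "\<And>z. z \<in> \<Gamma> \<Longrightarrow> A \<le> norm z \<Longrightarrow> \<epsilon> * wt m z \<le> cmod (a z)"
      unfolding noncharacteristic_def by blast
    obtain \<Gamma>' c where \<Gamma>': "open_cone \<Gamma>'" "z0 \<in> \<Gamma>'" and c: "c > 0"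
      and cone: "\<And>w z. w \<in> \<Gamma>' \<Longrightarrow> z \<notin> \<Gamma> \<Longrightarrow> bracket w \<le> c * bracket (z - w) \<and> bracket z \<le> c * bracket (z - w)"
      using cone_shrink[OF \<Gamma>] by metis
    let ?V = "stft \<phi> u"
    obtain G P where G: "G > 0" "P \<ge> 0" "\<And>z. cmod (?V z) \<le> G * wt P z"
      using stft_growth_lipschitz[OF u p(1)] by metis
    obtain h where h: "h \<in> schwartz" and hV: "\<And>g. g \<in> schwartz \<Longrightarrow> weyl_ext a u g = L2_inner h g"
      using sch by (auto simp: is_schwartz_def)
    define b where "b = (\<lambda>z. cnj (a z))"
    have b: "b \<in> shubin m" unfolding b_def by (rule shubin_cnj[OF a])
    define d where "d = 2 * real DIM('a \<times> 'a)"
    define I where "I = (LINT z::'a\<times>'a|lborel. wt (- d) z)"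
    have I: "I \<ge> 0" unfolding I_def by simp
    have rc: "rc \<phi> > 0" by (rule rc_pos[OF p])
    \<comment> \<open>The kernel of the operator minus multiplication by the symbol on phase space;
      its order in \<open>w\<close> is \<open>m - 1\<close>.\<close>
    define K where "K = (\<lambda>w z. weyl_form b (tf_shift w \<phi>) (tf_shift z \<phi>) - b w * L2_inner (tf_shift w \<phi>) (tf_shift z \<phi>))"
    \<comment> \<open>The pairing with the Schwartz function \<open>h\<close> is the full kernel
      applied to the transform, and the reproducing formula identifies the contribution of
      \<open>b w\<close> times the Gram kernel with \<open>a w * ?V w\<close>.\<close>
    have key: "a w * ?V w = L2_inner h (tf_shift w \<phi>) - of_real (rc \<phi>) * (LINT z|lborel. cnj (K w z) * ?V z)" for w
    proof -
      let ?B = "\<lambda>z. weyl_form b (tf_shift w \<phi>) (tf_shift z \<phi>)" and ?L = "\<lambda>z. L2_inner (tf_shift w \<phi>) (tf_shift z \<phi>)"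
      have tw: "tf_shift w \<phi> \<in> schwartz" by (rule schwartz_tf_shift[OF p(1)])
      have iB: "integrable lborel (\<lambda>z. cnj (?B z) * ?V z)"
        by (rule integrable_rapid_stft[OF u p(1) rapid_weyl_form[OF shubin_symbol[OF b] tw p(1)]])
      have iL: "integrable lborel (\<lambda>z. cnj (?L z) * ?V z)"
        by (rule integrable_rapid_stft[OF u p(1) rapid_stft[OF p(1) tw]])
      have "L2_inner h (tf_shift w \<phi>) = of_real (rc \<phi>) * (LINT z|lborel. cnj (?B z) * ?V z)"
        using hV[OF tw] tempered_weyl[OF u shubin_symbol[OF b] p tw] by (simp add: weyl_ext_def b_def)
      moreover have "a w * ?V w = of_real (rc \<phi>) * (LINT z|lborel. a w * (cnj (?L z) * ?V z))"
        unfolding integral_mult_right_zero using tempered_reproducing[OF u p tw] by (simp add: stft_def)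
      moreover have "(LINT z|lborel. cnj (K w z) * ?V z) = (LINT z|lborel. cnj (?B z) * ?V z) - (LINT z|lborel. a w * (cnj (?L z) * ?V z))"
      proof -
        have "cnj (K w z) * ?V z = cnj (?B z) * ?V z - a w * (cnj (?L z) * ?V z)" for z
          by (simp add: K_def b_def algebra_simps)
        then have "(LINT z|lborel. cnj (K w z) * ?V z) = (LINT z|lborel. cnj (?B z) * ?V z - a w * (cnj (?L z) * ?V z))" by presburger
        also have "\<dots> = (LINT z|lborel. cnj (?B z) * ?V z) - (LINT z|lborel. a w * (cnj (?L z) * ?V z))"
          using iB iL by (intro Bochner_Integration.integral_diff integrable_mult_right)
        finally show ?thesis .
      qed
      ultimately show ?thesis by (simp add: right_diff_distrib)
    qed
    have dec: "bdd_above ((\<lambda>w. wt N w * cmod (?V w)) ` \<Gamma>')" if N: "N \<ge> 0" for N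
    proof -
      \<comment> \<open>The part \<open>P\<close> makes the weighted supremum finite, and the part
        \<open>N\<close> is the decay that remains off the cone.\<close>
      define L where "L = N + P"
      have L: "L \<ge> 0" "L \<ge> P" using N G by (auto simp: L_def)
      obtain Ck where Ck: "Ck \<ge> 0" "\<And>w z. cmod (K w z) \<le> Ck * wt (m - 1) w * wt (- (L + d)) (z - w)"
        using weyl_form_difference_decay[OF b p(1) p(1)] unfolding K_def by blast
      \<comment> \<open>Dividing by the symbol costs \<open>wt (- m) w\<close>, after which exactly
        the order \<open>- L\<close> remains.\<close>
      obtain Ch where Ch: "Ch \<ge> 0" "\<And>w. cmod (L2_inner h (tf_shift w \<phi>)) \<le> Ch * wt (- (L - m)) w"
        using stft_decay[OF p(1) h] by blast
      define C1 where "C1 = rc \<phi> * (Ck * 2 powr L * I) / \<epsilon>"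
      have C1: "C1 \<ge> 0" using rc Ck I \<epsilon> by (simp add: C1_def)
      \<comment> \<open>Beyond this radius the ellipticity estimate is valid and
        \<open>C1 * wt (- 1) w\<close> is at most 1/2.\<close>
      define R where "R = max A (2 * C1 + 1)"
      have R: "R \<ge> A" "R \<ge> 2 * C1" "R > 0" using A C1 by (auto simp: R_def)
      define C2 where "C2 = Ch / \<epsilon> * 2 powr L"
      define C3 where "C3 = G * c powr P * c powr (L - P)"
      define C4 where "C4 = G * 2 powr L * (1 + R) powr (P + L)"
      have C234: "C2 \<ge> 0" "C3 \<ge> 0" "C4 \<ge> 0" using Ch \<epsilon> G c by (auto simp: C2_def C3_def C4_def)
      have "cmod (?V w0) \<le> (2 * (C2 + C3 + C4)) * wt (- N) w0" if w0: "w0 \<in> \<Gamma>'" for w0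
      proof -
        let ?f = "\<lambda>z. wt (- L) (z - w0) * cmod (?V z)"
        have bddf: "bdd_above (range ?f)"
        proof (rule bdd_aboveI2)
          fix z :: "'a \<times> 'a"
          have "wt P z \<le> 2 powr \<bar>P\<bar> * wt P w0 * wt \<bar>P\<bar> (z - w0)" by (rule wt_diff_le)
          then have "?f z \<le> wt (- L) (z - w0) * (G * (2 powr P * wt P w0 * wt P (z - w0)))"
            using G by (intro mult_left_mono order_trans[OF G(3)]) auto
          also have "\<dots> = G * (2 powr P * wt P w0) * (wt (- L) (z - w0) * wt P (z - w0))" by (simp only: mult_ac)
          also have "\<dots> \<le> G * (2 powr P * wt P w0) * 1"
            unfolding powr_add[symmetric] using G L by (intro mult_left_mono wt_le_1) auto
          finally show "?f z \<le> G * (2 powr P * wt P w0)" by simp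
        qed
        define F where "F = (SUP z. ?f z)"
        have F: "?f z \<le> F" for z unfolding F_def by (rule cSUP_upper[OF _ bddf]) simp
        have F0: "F \<ge> 0" using F[of 0] by (rule order_trans[rotated]) simp
        have Vle: "cmod (?V z) \<le> F * wt L (z - w0)" for z
          using F[of z] by (simp add: powr_minus field_simps)
        \<comment> \<open>A point \<open>w\<close> is either far from the origin or far from it
          relative to \<open>w0\<close>: decay in \<open>w\<close> combined with the weight around
          \<open>w0\<close> becomes decay in \<open>w0\<close>.\<close>
        have lw: "wt (- L) w * wt (- L) (w - w0) \<le> 2 powr L * wt (- L) w0" for w
        proof -
          have "wt (- L) (w - w0) \<le> 2 powr \<bar>- L\<bar> * wt (- L) (- w0) * wt \<bar>- L\<bar> w"
            using wt_add_le[of "- w0" w "- L"] by simp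
          then have "wt (- L) w * wt (- L) (w - w0) \<le> wt (- L) w * (2 powr L * wt (- L) w0 * wt L w)"
            using L by (intro mult_left_mono) auto
          also have "\<dots> = 2 powr L * wt (- L) w0 * (wt (- L) w * wt L w)" by (simp only: mult_ac)
          also have "wt (- L) w * wt L w = 1" by (simp flip: powr_add)
          finally show ?thesis by simp
        qed
        have mono: "wt (- L) w0 \<le> wt (- N) w0" using G by (intro wt_mono) (simp add: L_def)
        have "?f w \<le> (C2 + C3 + C4) * wt (- N) w0 + F / 2" for w
        proof -
          \<comment> \<open>Ellipticity settles the far part of the cone up to half the supremum,
            cone separation settles the complement, and on the bounded part plain growth together
            with \<open>lw\<close> is enough.\<close>
          consider "w \<in> \<Gamma>" "R \<le> norm w" | "w \<notin> \<Gamma>" | "norm w < R" by linarith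
          then show ?thesis
          proof cases
            case 1
            have int: "cmod (LINT z|lborel. cnj (K w z) * ?V z) \<le> (Ck * wt (m - 1) w * (F * (2 powr L * wt L (w - w0)))) * I"
              unfolding I_def
            proof (rule cmod_integral_wt_le)
              show "cmod (cnj (K w z) * ?V z) \<le> (Ck * wt (m - 1) w * (F * (2 powr L * wt L (w - w0)))) * wt (- d) (z - w)" for z
              proof -
                have "wt L (z - w0) \<le> 2 powr \<bar>L\<bar> * wt L (w - w0) * wt \<bar>L\<bar> (z - w)"
                  using wt_add_le[of "w - w0" "z - w" L] by simp
                then have Vz: "cmod (?V z) \<le> F * (2 powr L * wt L (w - w0) * wt L (z - w))"
                  using F0 L by (intro order_trans[OF Vle] mult_left_mono) auto
                have "cmod (cnj (K w z) * ?V z) \<le> (Ck * wt (m - 1) w * wt (- (L + d)) (z - w)) * (F * (2 powr L * wt L (w - w0) * wt L (z - w)))"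
                  unfolding norm_mult complex_mod_cnj using Ck by (intro mult_mono Vz Ck(2)) auto
                also have "\<dots> = (Ck * wt (m - 1) w * (F * (2 powr L * wt L (w - w0)))) * (wt (- (L + d)) (z - w) * wt L (z - w))"
                  by (simp only: mult_ac)
                also have "wt (- (L + d)) (z - w) * wt L (z - w) = wt (- d) (z - w)"
                  unfolding powr_add[symmetric] by simp
                finally show ?thesis .
              qed
            qed (simp add: d_def)
            have "\<epsilon> * wt m w * cmod (?V w) \<le> cmod (a w) * cmod (?V w)"
              using 1 R by (intro mult_right_mono ell) auto
            also have "\<dots> = cmod (a w * ?V w)" by (simp add: norm_mult)
            also have "\<dots> \<le> cmod (L2_inner h (tf_shift w \<phi>)) + cmod (of_real (rc \<phi>) * (LINT z|lborel. cnj (K w z) * ?V z))"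
              unfolding key by (rule norm_triangle_ineq4)
            also have "\<dots> \<le> Ch * wt (- (L - m)) w + rc \<phi> * ((Ck * wt (m - 1) w * (F * (2 powr L * wt L (w - w0)))) * I)"
              unfolding norm_mult norm_of_real using rc by (intro add_mono Ch(2) mult_mono int) auto
            also have "\<dots> = \<epsilon> * (Ch / \<epsilon> * wt (- (L - m)) w + C1 * wt (m - 1) w * (F * wt L (w - w0)))"
              using \<epsilon> by (simp add: C1_def field_simps)
            finally have "\<epsilon> * (wt m w * cmod (?V w)) \<le> \<epsilon> * (Ch / \<epsilon> * wt (- (L - m)) w + C1 * wt (m - 1) w * (F * wt L (w - w0)))"
              by (simp only: mult.assoc)
            then have "wt m w * cmod (?V w) \<le> Ch / \<epsilon> * wt (- (L - m)) w + C1 * wt (m - 1) w * (F * wt L (w - w0))"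
              using \<epsilon> by (simp only: mult_le_cancel_left_pos)
            then have "wt (- m) w * wt (- L) (w - w0) * (wt m w * cmod (?V w))
                \<le> wt (- m) w * wt (- L) (w - w0) * (Ch / \<epsilon> * wt (- (L - m)) w + C1 * wt (m - 1) w * (F * wt L (w - w0)))"
              by (rule mult_left_mono) simp
            also have "\<dots> = Ch / \<epsilon> * ((wt (- m) w * wt (- (L - m)) w) * wt (- L) (w - w0))
                + C1 * (wt (- m) w * wt (m - 1) w) * (F * (wt (- L) (w - w0) * wt L (w - w0)))"
              by (simp only: distrib_left mult_ac)
            also have "wt (- m) w * wt (- (L - m)) w = wt (- L) w" unfolding powr_add[symmetric] by simp
            also have "wt (- m) w * wt (m - 1) w = wt (- 1) w" unfolding powr_add[symmetric] by simp
            also have "wt (- L) (w - w0) * wt L (w - w0) = 1" by (simp flip: powr_add)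
            also have "wt (- m) w * wt (- L) (w - w0) * (wt m w * cmod (?V w)) = (wt (- m) w * wt m w) * ?f w"
              by (simp only: mult_ac)
            also have "wt (- m) w * wt m w = 1" by (simp flip: powr_add)
            finally have "?f w \<le> Ch / \<epsilon> * (wt (- L) w * wt (- L) (w - w0)) + C1 * wt (- 1) w * F" by simp
            moreover have "Ch / \<epsilon> * (wt (- L) w * wt (- L) (w - w0)) \<le> C2 * wt (- L) w0"
              using mult_left_mono[OF lw[of w], of "Ch / \<epsilon>"] Ch \<epsilon> by (simp add: C2_def mult.assoc)
            moreover have "C1 * wt (- 1) w * F \<le> F / 2"
            proof -
              have "2 * C1 \<le> bracket w" using 1 R norm_le_bracket[of w] by linarith
              then have "C1 * wt (- 1) w \<le> 1 / 2" by (simp add: powr_minus field_simps)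
              then show ?thesis using F0 mult_right_mono[of "C1 * wt (- 1) w" "1 / 2" F] by simp
            qed
            moreover have "C2 * wt (- L) w0 \<le> C2 * wt (- N) w0" using C234 mono by (intro mult_left_mono) auto
            moreover have "0 \<le> C3 * wt (- N) w0" "0 \<le> C4 * wt (- N) w0" using C234 by auto
            ultimately show ?thesis unfolding distrib_right by linarith
          next
            case 2
            note cn = cone[OF w0 2]
            have "wt P w \<le> (c * bracket (w - w0)) powr P" using cn G by (intro powr_mono2) auto
            then have wP: "wt P w \<le> c powr P * wt P (w - w0)" using c by (simp add: powr_mult)
            have "wt N w0 \<le> (c * bracket (w - w0)) powr N" using cn N by (intro powr_mono2) auto
            then have "wt N w0 \<le> c powr N * wt N (w - w0)" using c by (simp add: powr_mult)
            then have wN: "wt (- N) (w - w0) \<le> c powr N * wt (- N) w0" by (simp add: powr_minus field_simps)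
            have "?f w \<le> wt (- L) (w - w0) * (G * (c powr P * wt P (w - w0)))"
              using G wP by (intro mult_left_mono order_trans[OF G(3)]) auto
            also have "\<dots> = G * c powr P * (wt (- L) (w - w0) * wt P (w - w0))" by (simp only: mult_ac)
            also have "wt (- L) (w - w0) * wt P (w - w0) = wt (- N) (w - w0)"
              unfolding powr_add[symmetric] by (simp add: L_def)
            also have "G * c powr P * wt (- N) (w - w0) \<le> G * c powr P * (c powr N * wt (- N) w0)"
              using G c wN by (intro mult_left_mono) auto
            also have "\<dots> = C3 * wt (- N) w0" by (simp add: C3_def L_def)
            finally have "?f w \<le> C3 * wt (- N) w0" .
            moreover have "0 \<le> C2 * wt (- N) w0" "0 \<le> C4 * wt (- N) w0" using C234 by auto
            ultimately show ?thesis using F0 unfolding distrib_right by linarith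
          next
            case 3
            have "bracket w \<le> 1 + R" using 3 bracket_le_one_plus_norm[of w] by linarith
            then have bw: "wt (P + L) w \<le> (1 + R) powr (P + L)" using G L by (intro powr_mono2) auto
            have "?f w \<le> wt (- L) (w - w0) * (G * wt P w)" using G by (intro mult_left_mono) auto
            also have "\<dots> = G * (wt (- L) w * wt (- L) (w - w0)) * wt (P + L) w"
            proof -
              have "wt (- L) w * wt (P + L) w = wt P w" unfolding powr_add[symmetric] by simp
              then show ?thesis by (metis mult.assoc mult.commute mult.left_commute)
            qed
            also have "\<dots> \<le> G * (2 powr L * wt (- L) w0) * (1 + R) powr (P + L)"
              using G by (intro mult_mono[OF mult_left_mono[OF lw] bw]) auto
            also have "\<dots> = C4 * wt (- L) w0" by (simp add: C4_def)
            also have "\<dots> \<le> C4 * wt (- N) w0" using C234 mono by (intro mult_left_mono) auto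
            finally have "?f w \<le> C4 * wt (- N) w0" .
            moreover have "0 \<le> C2 * wt (- N) w0" "0 \<le> C3 * wt (- N) w0" using C234 by auto
            ultimately show ?thesis using F0 unfolding distrib_right by linarith
          qed
        qed
        \<comment> \<open>\<open>F\<close> is finite, so the half on the right can be absorbed. At
          \<open>w = w0\<close> the weight is 1, which returns the value of the transform.\<close>
        then have "F \<le> (C2 + C3 + C4) * wt (- N) w0 + F / 2"
          unfolding F_def[symmetric] by (subst F_def) (rule cSUP_least, auto)
        then have "F \<le> 2 * ((C2 + C3 + C4) * wt (- N) w0)" by linarith
        moreover have "cmod (?V w0) \<le> F" using F[of w0] by (simp add: bracket_def)
        ultimately show ?thesis unfolding mult.assoc by linarith
      qed
      then show ?thesis by (rule bdd_above_decayI)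
    qed
    then show False using z0 \<Gamma>' by (auto simp: WF'_def)
  qed
qed

section \<open>Sums over separated sets\<close>

lemma tf_lattice_separated:
  assumes "\<alpha> > 0" "\<beta> > 0" and l: "l \<in> tf_lattice \<alpha> \<beta>" and m: "m \<in> tf_lattice \<alpha> \<beta>" and "l \<noteq> m"
  shows "min \<alpha> \<beta> \<le> dist l (m :: 'a::euclidean_space \<times> 'a)"
proof -
  have *: "\<gamma> \<le> norm (\<gamma> *\<^sub>R j - \<gamma> *\<^sub>R j')"
    if "\<gamma> > 0" "j \<noteq> j'" and ints: "\<And>b. b \<in> Basis \<Longrightarrow> j \<bullet> b \<in> \<int> \<and> j' \<bullet> b \<in> \<int>" for \<gamma> and j j' :: 'a
  proof -
    obtain b where b: "b \<in> Basis" "j \<bullet> b \<noteq> j' \<bullet> b" using \<open>j \<noteq> j'\<close> by (auto simp: euclidean_eq_iff[of j])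
    have "1 \<le> \<bar>j \<bullet> b - j' \<bullet> b\<bar>" using b ints[of b] by (intro Ints_nonzero_abs_ge1) auto
    then have "\<gamma> * 1 \<le> \<gamma> * \<bar>(j - j') \<bullet> b\<bar>"
      using \<open>\<gamma> > 0\<close> by (intro mult_left_mono) (auto simp: inner_diff_left)
    also have "\<dots> \<le> \<gamma> * norm (j - j')" using \<open>\<gamma> > 0\<close> b Basis_le_norm[of b "j - j'"] by simp
    also have "\<dots> = norm (\<gamma> *\<^sub>R j - \<gamma> *\<^sub>R j')" using \<open>\<gamma> > 0\<close> by (simp flip: scaleR_diff_right)
    finally show ?thesis by simp
  qed
  obtain j k where jk: "l = (\<alpha> *\<^sub>R j, \<beta> *\<^sub>R k)" "\<And>b. b \<in> Basis \<Longrightarrow> j \<bullet> b \<in> \<int> \<and> k \<bullet> b \<in> \<int>"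
    using l by (auto simp: tf_lattice_def)
  obtain j' k' where jk': "m = (\<alpha> *\<^sub>R j', \<beta> *\<^sub>R k')" "\<And>b. b \<in> Basis \<Longrightarrow> j' \<bullet> b \<in> \<int> \<and> k' \<bullet> b \<in> \<int>"
    using m by (auto simp: tf_lattice_def)
  consider "j \<noteq> j'" | "k \<noteq> k'" using jk jk' \<open>l \<noteq> m\<close> by auto
  then show ?thesis
  proof cases
    case 1
    have "min \<alpha> \<beta> \<le> dist (fst l) (fst m)"
      using *[OF \<open>\<alpha> > 0\<close> 1] jk jk' by (simp add: dist_norm min.coboundedI1)
    then show ?thesis using dist_fst_le[of l m] by linarith
  next
    case 2
    have "min \<alpha> \<beta> \<le> dist (snd l) (snd m)"
      using *[OF \<open>\<beta> > 0\<close> 2] jk jk' by (simp add: dist_norm min.coboundedI2)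
    then show ?thesis using dist_snd_le[of l m] by linarith
  qed
qed

text \<open>A packing argument: the balls of radius \<open>r / 2\<close> around the points are
  disjoint and have equal volume, and the weight changes by a bounded factor on each, so the sum is
  comparable to an integral. Translation invariance makes the bound independent of
  \<open>w\<close>.\<close>

lemma separated_sum_wt_le:
  fixes \<Lambda> :: "'b::euclidean_space set"
  assumes r: "r > 0" and sep: "\<And>l m. l \<in> \<Lambda> \<Longrightarrow> m \<in> \<Lambda> \<Longrightarrow> l \<noteq> m \<Longrightarrow> r \<le> dist l m"
    and s: "2 * real DIM('b) \<le> s"
  obtains S where "S \<ge> 0" "\<And>F w. finite F \<Longrightarrow> F \<subseteq> \<Lambda> \<Longrightarrow> (\<Sum>l\<in>F. wt (- s) (l - w)) \<le> S"
proof -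
  define \<mu> where "\<mu> = measure lborel (ball (0 :: 'b) (r / 2))"
  have \<mu>: "\<mu> > 0" "measure lborel (ball l (r / 2)) = \<mu>" for l :: 'b
    using r by (simp_all add: \<mu>_def content_ball)
  \<comment> \<open>The Peetre factor for moving the weight by a distance of at most
    \<open>r\<close>.\<close>
  define K where "K = 2 powr s * (1 + r) powr s"
  define J where "J = (LINT z::'b|lborel. wt (- s) z)"
  have s0: "s \<ge> 0" using s by (rule order_trans[rotated]) simp
  have J: "J \<ge> 0" unfolding J_def by simp
  have "(\<Sum>l\<in>F. wt (- s) (l - w)) \<le> K * J / \<mu>" if F: "finite F" "F \<subseteq> \<Lambda>" for F and w :: 'b
  proof -
    let ?i = "\<lambda>l x. indicator (ball l (r / 2)) x :: real"
    have ib: "integrable lborel (?i l)" for l :: 'b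
      by (intro integrable_real_indicator emeasure_lborel_ball_finite) simp
    have one: "(\<Sum>l\<in>F. ?i l x) \<le> 1" for x
    proof -
      have "card {l \<in> F. x \<in> ball l (r / 2)} \<le> 1"
      proof (rule card_le_Suc0_iff_eq[THEN iffD2, simplified One_nat_def[symmetric]])
        show "\<forall>l\<in>{l \<in> F. x \<in> ball l (r / 2)}. \<forall>m\<in>{l \<in> F. x \<in> ball l (r / 2)}. l = m"
        proof (intro ballI, rule ccontr)
          fix l m assume lm: "l \<in> {l \<in> F. x \<in> ball l (r / 2)}" "m \<in> {l \<in> F. x \<in> ball l (r / 2)}" "l \<noteq> m"
          then have "r \<le> dist l m" using F by (intro sep) auto
          then show False using lm dist_triangle2[of l m x] by (simp add: dist_commute) 
        qed
      qed (use F in simp)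
      moreover have "(\<Sum>l\<in>F. ?i l x) = card {l \<in> F. x \<in> ball l (r / 2)}"
        using F by (simp add: indicator_def sum.If_cases Int_def)
      ultimately show ?thesis by simp
    qed
    have "\<mu> * wt (- s) (l - w) \<le> (LINT x|lborel. ?i l x * (K * wt (- s) (x - w)))" for l
    proof -
      have "\<mu> * wt (- s) (l - w) = (LINT x|lborel. ?i l x * wt (- s) (l - w))"
        using \<mu>(2)[of l] by simp
      also have "\<dots> \<le> (LINT x|lborel. ?i l x * (K * wt (- s) (x - w)))"
      proof (rule integral_mono)
        show "integrable lborel (\<lambda>x. ?i l x * wt (- s) (l - w))" using ib by simp
        show "integrable lborel (\<lambda>x. ?i l x * (K * wt (- s) (x - w)))"
          using integrable_wt_shift(1)[OF s, of w]
          by (intro integrable_real_mult_indicator[where f = "\<lambda>x. K * wt (- s) (x - w)", simplified mult.commute]) auto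
        show "?i l x * wt (- s) (l - w) \<le> ?i l x * (K * wt (- s) (x - w))" for x
        proof (cases "x \<in> ball l (r / 2)")
          case True
          then have "norm (l - x) \<le> r" using r by (simp add: dist_norm)
          then have "bracket (l - x) \<le> 1 + r" using bracket_le_one_plus_norm[of "l - x"] by linarith
          then have "wt s (l - x) \<le> (1 + r) powr s" using s0 by (intro powr_mono2) auto
          then have "2 powr s * wt (- s) (x - w) * wt s (l - x) \<le> 2 powr s * wt (- s) (x - w) * (1 + r) powr s"
            by (intro mult_left_mono) auto
          moreover have "wt (- s) (l - w) \<le> 2 powr s * wt (- s) (x - w) * wt s (l - x)"
            using wt_diff_le[of "l - w" "- s" "x - w"] s0 by simp
          ultimately have "wt (- s) (l - w) \<le> 2 powr s * wt (- s) (x - w) * (1 + r) powr s" by linarith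
          then show ?thesis using True by (simp add: K_def mult_ac)
        qed simp
      qed
      finally show ?thesis .
    qed
    then have "(\<Sum>l\<in>F. \<mu> * wt (- s) (l - w)) \<le> (\<Sum>l\<in>F. LINT x|lborel. ?i l x * (K * wt (- s) (x - w)))"
      by (intro sum_mono)
    also have "\<dots> = (LINT x|lborel. (\<Sum>l\<in>F. ?i l x * (K * wt (- s) (x - w))))"
      using integrable_wt_shift(1)[OF s, of w]
      by (intro Bochner_Integration.integral_sum[symmetric]
          integrable_real_mult_indicator[where f = "\<lambda>x. K * wt (- s) (x - w)", simplified mult.commute]) auto
    also have "\<dots> \<le> (LINT x|lborel. K * wt (- s) (x - w))"
    proof (rule integral_mono)
      show "integrable lborel (\<lambda>x. \<Sum>l\<in>F. ?i l x * (K * wt (- s) (x - w)))"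
        using integrable_wt_shift(1)[OF s, of w]
        by (intro Bochner_Integration.integrable_sum
          integrable_real_mult_indicator[where f = "\<lambda>x. K * wt (- s) (x - w)", simplified mult.commute]) auto
      show "integrable lborel (\<lambda>x. K * wt (- s) (x - w))" using integrable_wt_shift(1)[OF s, of w] by simp
      show "(\<Sum>l\<in>F. ?i l x * (K * wt (- s) (x - w))) \<le> K * wt (- s) (x - w)" for x
        unfolding sum_distrib_right[symmetric]
        using mult_right_mono[OF one[of x], of "K * wt (- s) (x - w)"] by (simp add: K_def)
    qed
    also have "\<dots> = K * J" unfolding J_def using integrable_wt_shift(2)[OF s, of w] by simp
    finally have "\<mu> * (\<Sum>l\<in>F. wt (- s) (l - w)) \<le> K * J" by (simp add: sum_distrib_left)
    then show ?thesis using \<mu>(1) by (simp add: field_simps)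
  qed
  moreover have "K * J / \<mu> \<ge> 0" using \<mu>(1) J by (simp add: K_def)
  ultimately show ?thesis using that by blast
qed

section \<open>Slowly varying damping weights\<close>

lemma abs_power_diff_1_le:
  fixes t :: real
  assumes "\<bar>t\<bar> \<le> M" "1 \<le> M"
  shows "\<bar>1 - t ^ n\<bar> \<le> n * \<bar>1 - t\<bar> * M ^ n"
proof (induction n)
  case (Suc n)
  have "1 - t ^ Suc n = (1 - t) + t * (1 - t ^ n)" by (simp add: algebra_simps)
  then have "\<bar>1 - t ^ Suc n\<bar> \<le> \<bar>1 - t\<bar> + \<bar>t\<bar> * \<bar>1 - t ^ n\<bar>"
    using abs_triangle_ineq[of "1 - t" "t * (1 - t ^ n)"] by (simp add: abs_mult)
  also have "\<dots> \<le> \<bar>1 - t\<bar> * M ^ Suc n + M * (n * \<bar>1 - t\<bar> * M ^ n)"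
    using assms Suc mult_left_mono[OF one_le_power[OF assms(2), of "Suc n"], of "\<bar>1 - t\<bar>"]
    by (intro add_mono mult_mono) auto
  finally show ?case by (simp add: algebra_simps)
qed simp

text \<open>A weight of order \<open>- n\<close> around \<open>w\<close> whose relative variation is
  governed by the length scale \<open>R\<close>. It is comparable to
  \<open>wt (- real n) (z - w)\<close> with constants depending on \<open>n\<close> and
  \<open>R\<close> but not on \<open>w\<close>.\<close>

definition scaled_wt :: "nat \<Rightarrow> real \<Rightarrow> 'b::real_normed_vector \<Rightarrow> 'b \<Rightarrow> real" where
  "scaled_wt n R w z = inverse (1 + norm (z - w) / R) ^ n"

lemma scaled_wt_nonneg [simp]: "R \<ge> 1 \<Longrightarrow> 0 \<le> scaled_wt n R w z"
  by (simp add: scaled_wt_def)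

lemma measurable_scaled_wt [measurable]:
  "scaled_wt n R w \<in> borel_measurable borel" for w :: "'b::euclidean_space"
  unfolding scaled_wt_def by measurable

lemma scaled_wt_le:
  assumes R: "R \<ge> 1"
  shows "scaled_wt n R w z \<le> R ^ n * wt (- real n) (z - w)"
proof -
  have "bracket (z - w) \<le> R * (1 + norm (z - w) / R)"
    using R bracket_le_one_plus_norm[of "z - w"] by (simp add: distrib_left)
  then have "inverse (1 + norm (z - w) / R) \<le> R / bracket (z - w)"
    using R by (simp add: field_simps add_pos_nonneg)
  then have "scaled_wt n R w z \<le> (R / bracket (z - w)) ^ n"
    unfolding scaled_wt_def using R by (intro power_mono) auto
  then show ?thesis by (simp add: powr_minus powr_realpow divide_inverse power_mult_distrib power_inverse)
qed

lemma scaled_wt_ge: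
  assumes R: "R \<ge> 1"
  shows "1 \<le> 2 ^ n * wt (real n) (z - w) * scaled_wt n R w z"
proof -
  have "norm (z - w) / R \<le> norm (z - w)" using R by (simp add: divide_le_eq mult_le_cancel_left1)
  then have "1 + norm (z - w) / R \<le> 2 * bracket (z - w)"
    using norm_le_bracket[of "z - w"] bracket_ge_1[of "z - w"] by linarith
  then have "(1 + norm (z - w) / R) ^ n \<le> (2 * bracket (z - w)) ^ n" using R by (intro power_mono) auto
  then have "(1 + norm (z - w) / R) ^ n * scaled_wt n R w z \<le> (2 * bracket (z - w)) ^ n * scaled_wt n R w z"
    using R by (intro mult_right_mono) auto
  moreover have "1 + norm (z - w) / R > 0" using R by (simp add: add_pos_nonneg)
  then have "(1 + norm (z - w) / R) ^ n * scaled_wt n R w z = 1"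
    unfolding scaled_wt_def power_mult_distrib[symmetric] by simp
  ultimately show ?thesis unfolding wt_nat power_mult_distrib by linarith
qed

text \<open>Large \<open>R\<close> makes the weight vary slowly, uniformly in its centre \<open>w\<close>.\<close>

lemma scaled_wt_diff_le:
  assumes R: "R \<ge> 1"
  shows "\<bar>scaled_wt n R w z - scaled_wt n R w v\<bar> \<le> real n * 2 ^ n / R * wt (real n + 1) (z - v) * scaled_wt n R w z"
proof -
  define A where "A = 1 + norm (z - w) / R"
  define B where "B = 1 + norm (v - w) / R"
  define \<delta> where "\<delta> = norm (z - v) / R"
  have AB: "A \<ge> 1" "B \<ge> 1" "\<delta> \<ge> 0" using R by (simp_all add: A_def B_def \<delta>_def)
  have "\<bar>norm (z - w) - norm (v - w)\<bar> \<le> norm (z - v)" using norm_triangle_ineq3[of "z - w" "v - w"] by simp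
  then have "\<bar>norm (v - w) - norm (z - w)\<bar> / R \<le> \<delta>"
    unfolding \<delta>_def abs_minus_commute[of "norm (v - w)"] using R by (intro divide_right_mono) auto
  moreover have "B - A = (norm (v - w) - norm (z - w)) / R" by (simp add: A_def B_def diff_divide_distrib)
  ultimately have d: "\<bar>B - A\<bar> \<le> \<delta>" using R by (simp add: abs_divide)
  have "1 - A / B = (B - A) / B" using AB by (simp add: diff_divide_distrib)
  then have "\<bar>1 - A / B\<bar> = \<bar>B - A\<bar> / B" using AB by (simp add: abs_divide)
  also have "\<dots> \<le> \<bar>B - A\<bar>" using AB by (simp add: divide_le_eq mult_le_cancel_left1)
  finally have t: "\<bar>1 - A / B\<bar> \<le> \<delta>" using d by linarith
  have "\<delta> \<le> norm (z - v)" using R by (simp add: \<delta>_def divide_le_eq mult_le_cancel_left1)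
  then have m: "1 + \<delta> \<le> 2 * bracket (z - v)"
    using norm_le_bracket[of "z - v"] bracket_ge_1[of "z - v"] by linarith
  have "\<bar>1 - (A / B) ^ n\<bar> \<le> n * \<bar>1 - A / B\<bar> * (1 + \<delta>) ^ n"
    by (rule abs_power_diff_1_le) (use t AB in linarith)+
  \<comment> \<open>Only the linear factor keeps 1 / \<open>R\<close>; in the power the scale is
    merely estimated by \<open>R \<ge> 1\<close>.\<close>
  also have "\<dots> \<le> real n * (bracket (z - v) / R) * (2 * bracket (z - v)) ^ n"
  proof (intro mult_mono power_mono m order_trans[OF t])
    show "\<delta> \<le> bracket (z - v) / R" unfolding \<delta>_def using R norm_le_bracket[of "z - v"] by (intro divide_right_mono) auto
  qed (use AB R in auto)
  also have "\<dots> = real n * 2 ^ n / R * wt (real n + 1) (z - v)"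
    using powr_realpow[of "bracket (z - v)" "Suc n"] by (simp add: power_mult_distrib add.commute)
  finally have main: "\<bar>1 - (A / B) ^ n\<bar> \<le> real n * 2 ^ n / R * wt (real n + 1) (z - v)" .
  \<comment> \<open>With bases \<open>A\<close> and \<open>B\<close> the difference of the inverse
    powers is the first weight times \<open>1 - (A / B) ^ n\<close>, which makes the estimate
    relative to the weight itself.\<close>
  have "scaled_wt n R w z - scaled_wt n R w v = scaled_wt n R w z * (1 - (A / B) ^ n)"
  proof -
    have "inverse x - inverse y = inverse x * (1 - x / y)" if "x > 0" "y > 0" for x y :: real
      using that by (simp add: field_simps)
    from this[of "A ^ n" "B ^ n"] show ?thesis
      using AB unfolding scaled_wt_def A_def[symmetric] B_def[symmetric] power_divide power_inverse by simp
  qed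
  then have "\<bar>scaled_wt n R w z - scaled_wt n R w v\<bar> = \<bar>1 - (A / B) ^ n\<bar> * scaled_wt n R w z"
    using R by (simp add: abs_mult mult.commute)
  also have "\<dots> \<le> (real n * 2 ^ n / R * wt (real n + 1) (z - v)) * scaled_wt n R w z"
    by (intro mult_right_mono main) (use R in simp)
  finally show ?thesis .
qed

section \<open>Convolution with a decaying weight\<close>

text \<open>Convolution with the even function \<open>wt (- s)\<close>. It is the form in which the
  commutator errors of the damping appear.\<close>

definition wt_conv :: "real \<Rightarrow> ('b::euclidean_space \<Rightarrow> real) \<Rightarrow> 'b \<Rightarrow> real" where
  "wt_conv s G w = (LINT z|lborel. G z * wt (- s) (z - w))"

lemma integrable_mult_wt:
  assumes "integrable lborel G" "0 \<le> s"
  shows "integrable lborel (\<lambda>z. G z * wt (- s) (z - w))"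
proof (rule Bochner_Integration.integrable_bound[OF assms(1)])
  have [measurable]: "G \<in> borel_measurable borel" using borel_measurable_integrable[OF assms(1)] by simp
  show "(\<lambda>z. G z * wt (- s) (z - w)) \<in> borel_measurable lborel" by measurable
  have "\<bar>G z\<bar> * wt (- s) (z - w) \<le> \<bar>G z\<bar> * 1" for z
    using assms wt_le_1[of "- s" "z - w"] by (intro mult_left_mono) auto
  then show "AE z in lborel. norm (G z * wt (- s) (z - w)) \<le> norm (G z)"
    by (simp add: abs_mult)
qed

lemma wt_conv_le_integral:
  assumes "integrable lborel G" "\<And>z. 0 \<le> G z" "0 \<le> s"
  shows "wt_conv s G w \<le> (LINT z|lborel. G z)"
  unfolding wt_conv_def
proof (rule integral_mono[OF integrable_mult_wt[OF assms(1,3)] assms(1)])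
  show "G z * wt (- s) (z - w) \<le> G z" for z
    using mult_left_mono[OF wt_le_1[of "- s" "z - w"] assms(2)[of z]] assms(3) by simp
qed

lemma wt_conv_nonneg: "(\<And>z. 0 \<le> G z) \<Longrightarrow> 0 \<le> wt_conv s G w"
  unfolding wt_conv_def by simp

lemma integral_wt_pos:
  assumes s: "2 * real DIM('b) \<le> s"
  shows "(LINT z::'b::euclidean_space|lborel. wt (- s) z) > 0"
proof -
  have "(LINT z::'b|lborel. wt (- s) z) \<noteq> 0"
  proof
    assume "(LINT z::'b|lborel. wt (- s) z) = 0"
    then have "AE z::'b in lborel. wt (- s) z = 0"
      by (subst (asm) integral_nonneg_eq_0_iff_AE[OF integrable_wt[OF s]]) auto
    then have "AE z::'b in lborel. False" by simp
    then show False by (simp add: eventually_False ae_filter_eq_bot_iff)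
  qed
  moreover have "(LINT z::'b|lborel. wt (- s) z) \<ge> 0" by simp
  ultimately show ?thesis by linarith
qed

text \<open>The Cauchy-Schwarz inequality for the weight as a measure of total mass
  \<open>J\<close>, obtained from the nonnegative variance of \<open>G\<close>.\<close>

lemma wt_conv_power2_le:
  fixes G :: "'b::euclidean_space \<Rightarrow> real"
  assumes G: "integrable lborel G" and G2: "integrable lborel (\<lambda>z. (G z)\<^sup>2)"
    and s: "2 * real DIM('b) \<le> s"
  shows "(wt_conv s G w)\<^sup>2 \<le> (LINT z::'b|lborel. wt (- s) z) * wt_conv s (\<lambda>z. (G z)\<^sup>2) w"
proof -
  define J where "J = (LINT z::'b|lborel. wt (- s) z)"
  have J: "J > 0" unfolding J_def by (rule integral_wt_pos[OF s])
  have s0: "s \<ge> 0" using s by (rule order_trans[rotated]) simp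
  \<comment> \<open>The mean of \<open>G\<close> with respect to the weight, where the quadratic
    polynomial in \<open>t\<close> is smallest.\<close>
  define t where "t = wt_conv s G w / J"
  have "0 \<le> (LINT z|lborel. (G z - t)\<^sup>2 * wt (- s) (z - w))" by simp
  also have "\<dots> = (LINT z|lborel. (G z)\<^sup>2 * wt (- s) (z - w) - 2 * t * (G z * wt (- s) (z - w)) + t\<^sup>2 * wt (- s) (z - w))"
    by (simp add: power2_eq_square algebra_simps)
  also have "\<dots> = wt_conv s (\<lambda>z. (G z)\<^sup>2) w - 2 * t * wt_conv s G w + t\<^sup>2 * J"
    unfolding wt_conv_def J_def
    using integrable_mult_wt[OF G s0, of w] integrable_mult_wt[OF G2 s0, of w] integrable_wt_shift[OF s, of w]
    by simp
  also have "\<dots> = wt_conv s (\<lambda>z. (G z)\<^sup>2) w - (wt_conv s G w)\<^sup>2 / J"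
    using J by (simp add: t_def power2_eq_square field_simps)
  finally have "(wt_conv s G w)\<^sup>2 / J \<le> wt_conv s (\<lambda>z. (G z)\<^sup>2) w" by simp
  then show ?thesis using J by (simp add: J_def[symmetric] field_simps)
qed

lemma integral_wt_conv:
  fixes G :: "'b::euclidean_space \<Rightarrow> real"
  assumes [measurable]: "G \<in> borel_measurable borel" and G: "\<And>z. \<bar>G z\<bar> \<le> C * wt (- (2 * s)) z"
    and s: "2 * real DIM('b) \<le> s"
  shows "integrable lborel (wt_conv s G)"
    and "(LINT w|lborel. wt_conv s G w) = (LINT z::'b|lborel. wt (- s) z) * (LINT z|lborel. G z)"
proof -
  have s0: "s \<ge> 0" using s by (rule order_trans[rotated]) simp
  \<comment> \<open>Cast to complex numbers, the type for which the exchange of integrals was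
    stated. The decay of order \<open>2 * s\<close> of \<open>G\<close> pays for splitting the
    kernel into a product of two integrable functions.\<close>
  define f where "f = (\<lambda>w z. complex_of_real (G z * wt (- s) (z - w)))"
  have m: "case_prod f \<in> borel_measurable (lborel \<Otimes>\<^sub>M lborel)" unfolding f_def by measurable
  have iu: "integrable lborel (\<lambda>w::'b. 2 powr s * wt (- s) w)" and iv: "integrable lborel (\<lambda>z::'b. C * wt (- s) z)"
    using integrable_wt[OF s] by simp_all
  have b: "cmod (f w z) \<le> (2 powr s * wt (- s) w) * (C * wt (- s) z)" for w z
  proof -
    have "wt (- s) (w - z) \<le> 2 powr s * wt (- s) w * wt s z"
      using wt_add_le[of w "- z" "- s"] s0 by simp
    then have "\<bar>G z\<bar> * wt (- s) (z - w) \<le> (C * wt (- (2 * s)) z) * (2 powr s * wt (- s) w * wt s z)"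
      unfolding bracket_diff_commute[of z w] using order_trans[OF abs_ge_zero G[of z]]
      by (intro mult_mono G) auto
    also have "\<dots> = (2 powr s * wt (- s) w) * (C * (wt (- (2 * s)) z * wt s z))" by (simp only: mult_ac)
    also have "wt (- (2 * s)) z * wt s z = wt (- s) z" by (simp flip: powr_add)
    finally show ?thesis unfolding f_def norm_of_real abs_mult by simp
  qed
  have fw: "(LINT z|lborel. f w z) = complex_of_real (wt_conv s G w)" for w
    unfolding f_def wt_conv_def by (rule integral_complex_of_real)
  have fz: "(LINT w|lborel. f w z) = complex_of_real (G z * (LINT z::'b|lborel. wt (- s) z))" for z
    unfolding f_def integral_complex_of_real bracket_diff_commute[of z]
    using integrable_wt_shift[OF s, of z] by simp
  note F = fubini_dominated[OF m iu iv b]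
  have "integrable lborel (\<lambda>w. complex_of_real (wt_conv s G w))"
    using lborel_pair.integrable_fst'[OF F(1)] by (simp add: fw)
  then show "integrable lborel (wt_conv s G)" by (simp only: complex_of_real_integrable_eq)
  show "(LINT w|lborel. wt_conv s G w) = (LINT z::'b|lborel. wt (- s) z) * (LINT z|lborel. G z)"
    using F(2) unfolding fw fz integral_complex_of_real of_real_eq_iff by (simp add: mult.commute)
qed

text \<open>Schur's test for a symmetric kernel: the product \<open>G w * G z\<close> is at most the
  mean of the two squares, and each square integrates against the kernel to the same value.\<close>

lemma integral_mult_wt_conv_le:
  fixes G :: "'b::euclidean_space \<Rightarrow> real"
  assumes [measurable]: "G \<in> borel_measurable borel" and G0: "\<And>z. 0 \<le> G z"
    and G: "\<And>z. G z \<le> C * wt (- (2 * s)) z" and s: "2 * real DIM('b) \<le> s"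
  shows "integrable lborel (\<lambda>w. G w * wt_conv s G w)"
    and "(LINT w|lborel. G w * wt_conv s G w) \<le> (LINT z::'b|lborel. wt (- s) z) * (LINT z|lborel. (G z)\<^sup>2)"
proof -
  define J where "J = (LINT z::'b|lborel. wt (- s) z)"
  have s0: "s \<ge> 0" using s by (rule order_trans[rotated]) simp
  have C: "C \<ge> 0" using order_trans[OF G0 G, of 0] by (simp add: zero_le_mult_iff not_less)
  have Gi: "integrable lborel G"
    using integrable_wt_bound[of G C "2 * s"] G G0 s s0 by simp
  have G2: "(G z)\<^sup>2 \<le> C\<^sup>2 * wt (- (2 * s)) z" for z
  proof -
    have "G z \<le> C" using G[of z] mult_left_mono[OF wt_le_1[of "- (2 * s)" z] C] s0 by simp
    then have "G z * G z \<le> C * (C * wt (- (2 * s)) z)" using G G0 C by (intro mult_mono) auto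
    then show ?thesis by (simp add: power2_eq_square mult.assoc)
  qed
  have G2i: "integrable lborel (\<lambda>z. (G z)\<^sup>2)"
    using integrable_wt_bound[of "\<lambda>z. (G z)\<^sup>2" "C\<^sup>2" "2 * s"] G2 s s0 by simp
  note conv = integral_wt_conv[OF _ _ s]
  have c1: "integrable lborel (wt_conv s G)" by (rule conv(1)[where C = C]) (use G G0 in auto)
  have m [measurable]: "wt_conv s G \<in> borel_measurable borel" using borel_measurable_integrable[OF c1] by simp
  have c2: "integrable lborel (wt_conv s (\<lambda>z. (G z)\<^sup>2))"
    and e2: "(LINT w|lborel. wt_conv s (\<lambda>z. (G z)\<^sup>2) w) = J * (LINT z|lborel. (G z)\<^sup>2)"
    unfolding J_def using conv[where C = "C\<^sup>2" and G = "\<lambda>z. (G z)\<^sup>2"] G2 by auto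
  show i: "integrable lborel (\<lambda>w. G w * wt_conv s G w)"
  proof (rule Bochner_Integration.integrable_bound)
    show "integrable lborel (\<lambda>w. G w * (LINT z|lborel. G z))" using Gi by simp
    show "AE w in lborel. norm (G w * wt_conv s G w) \<le> norm (G w * (LINT z|lborel. G z))"
      using G0 wt_conv_nonneg[of G s, OF G0] wt_conv_le_integral[OF Gi G0 s0]
      by (intro AE_I2) (simp add: abs_mult mult_left_mono)
  qed measurable
  have "G w * wt_conv s G w \<le> (J * (G w)\<^sup>2 + wt_conv s (\<lambda>z. (G z)\<^sup>2) w) / 2" for w
  proof -
    have "G w * wt_conv s G w = (LINT z|lborel. G w * (G z * wt (- s) (z - w)))" by (simp add: wt_conv_def)
    also have "\<dots> \<le> (LINT z|lborel. ((G w)\<^sup>2 * wt (- s) (z - w) + (G z)\<^sup>2 * wt (- s) (z - w)) / 2)"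
    proof (rule integral_mono)
      show "integrable lborel (\<lambda>z. G w * (G z * wt (- s) (z - w)))"
        using integrable_mult_wt[OF Gi s0] by simp
      show "integrable lborel (\<lambda>z. ((G w)\<^sup>2 * wt (- s) (z - w) + (G z)\<^sup>2 * wt (- s) (z - w)) / 2)"
        using integrable_mult_wt[OF G2i s0, of w] integrable_wt_shift(1)[OF s, of w] by simp
      show "G w * (G z * wt (- s) (z - w)) \<le> ((G w)\<^sup>2 * wt (- s) (z - w) + (G z)\<^sup>2 * wt (- s) (z - w)) / 2" for z
      proof -
        have "0 \<le> (G w - G z)\<^sup>2" by simp
        then have "G w * G z \<le> ((G w)\<^sup>2 + (G z)\<^sup>2) / 2" by (simp add: power2_eq_square algebra_simps)
        then have "(G w * G z) * wt (- s) (z - w) \<le> ((G w)\<^sup>2 + (G z)\<^sup>2) / 2 * wt (- s) (z - w)"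
          by (rule mult_right_mono) simp
        then show ?thesis by (simp add: algebra_simps)
      qed
    qed
    also have "\<dots> = ((G w)\<^sup>2 * J + wt_conv s (\<lambda>z. (G z)\<^sup>2) w) / 2"
      unfolding J_def wt_conv_def
      using integrable_mult_wt[OF G2i s0, of w] integrable_wt_shift[OF s, of w] by simp
    finally show ?thesis by (simp add: mult.commute)
  qed
  then have "(LINT w|lborel. G w * wt_conv s G w)
      \<le> (LINT w|lborel. (J * (G w)\<^sup>2 + wt_conv s (\<lambda>z. (G z)\<^sup>2) w) / 2)"
    using i G2i c2 by (intro integral_mono) auto
  also have "\<dots> = J * (LINT z|lborel. (G z)\<^sup>2)" using G2i c2 e2 by simp
  finally show "(LINT w|lborel. G w * wt_conv s G w) \<le> (LINT z::'b|lborel. wt (- s) z) * (LINT z|lborel. (G z)\<^sup>2)"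
    unfolding J_def .
qed

lemma sum_wt_conv_le:
  assumes G: "integrable lborel G" "\<And>z. 0 \<le> G z" and s: "0 \<le> s"
    and F: "finite F" and S: "\<And>w. (\<Sum>l\<in>F. wt (- s) (l - w)) \<le> S"
  shows "(\<Sum>l\<in>F. wt_conv s G l) \<le> S * (LINT z|lborel. G z)"
proof -
  have "(\<Sum>l\<in>F. wt_conv s G l) = (LINT z|lborel. (\<Sum>l\<in>F. G z * wt (- s) (z - l)))"
    unfolding wt_conv_def using integrable_mult_wt[OF G(1) s] by (intro Bochner_Integration.integral_sum[symmetric]) auto
  also have "\<dots> \<le> (LINT z|lborel. G z * S)"
  proof (rule integral_mono)
    show "integrable lborel (\<lambda>z. \<Sum>l\<in>F. G z * wt (- s) (z - l))"
      using integrable_mult_wt[OF G(1) s] by (intro Bochner_Integration.integrable_sum) auto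
    show "integrable lborel (\<lambda>z. G z * S)" using G by simp
    show "(\<Sum>l\<in>F. G z * wt (- s) (z - l)) \<le> G z * S" for z
      unfolding sum_distrib_left[symmetric] bracket_diff_commute[of z]
      using S G by (intro mult_left_mono) auto
  qed
  finally show ?thesis by (simp add: mult.commute)
qed

section \<open>The frame inequality for damped transforms\<close>

text \<open>The damped transform decays only to a finite order, so its synthesis need not be a
  Schwartz function; this is the finite decay that makes it integrable and square
  integrable.\<close>

lemma synth_decay:
  fixes H :: "'a::euclidean_space \<times> 'a \<Rightarrow> complex"
  assumes p: "\<phi> \<in> schwartz" and q: "q \<ge> 0" and s: "2 * real DIM('a \<times> 'a) \<le> s"
    and H: "\<And>z. cmod (H z) \<le> C * wt (- (q + s)) z"
  obtains B where "\<And>y. cmod (synth \<phi> H y) \<le> B * wt (- q) y"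
proof -
  obtain D where D: "D \<ge> 0" "\<And>x. cmod (\<phi> x) \<le> D * wt (- q) x" using schwartz_bound0[OF p] by blast
  have C: "C \<ge> 0" using order_trans[OF norm_ge_zero H[of 0]] by (simp add: zero_le_mult_iff not_less)
  have "cmod (synth \<phi> H y) \<le> (C * D * 2 powr q * wt (- q) y) * (LINT z::'a\<times>'a|lborel. wt (- s) z)" for y
    unfolding synth_def
  proof (rule cmod_integral_wt_le[where w = 0, OF _ s])
    fix z :: "'a \<times> 'a"
    have "wt (- q) (y - fst z) \<le> 2 powr q * wt (- q) y * wt q (fst z)"
      using wt_add_le[of y "- fst z" "- q"] q by simp
    moreover have "wt q (fst z) \<le> wt q z"
      using q bracket_mono[OF norm_fst_le[of "fst z" "snd z"]] by (intro powr_mono2) auto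
    then have "2 powr q * wt (- q) y * wt q (fst z) \<le> 2 powr q * wt (- q) y * wt q z"
      by (intro mult_left_mono) auto
    ultimately have "wt (- q) (y - fst z) \<le> 2 powr q * wt (- q) y * wt q z" by linarith
    then have "cmod (tf_shift z \<phi> y) \<le> D * (2 powr q * wt (- q) y * wt q z)"
      using D order_trans[OF D(2) mult_left_mono] by simp
    then have "cmod (H z * tf_shift z \<phi> y) \<le> (C * wt (- (q + s)) z) * (D * (2 powr q * wt (- q) y * wt q z))"
      unfolding norm_mult using C by (intro mult_mono H) auto
    also have "\<dots> = (C * D * 2 powr q * wt (- q) y) * (wt (- (q + s)) z * wt q z)" by (simp only: mult_ac)
    also have "wt (- (q + s)) z * wt q z = wt (- s) (z - 0)" by (simp flip: powr_add)
    finally show "cmod (H z * tf_shift z \<phi> y) \<le> (C * D * 2 powr q * wt (- q) y) * wt (- s) (z - 0)" .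
  qed
  then show ?thesis using that[of "C * D * 2 powr q * (LINT z::'a\<times>'a|lborel. wt (- s) z)"]
    by (simp add: mult_ac)
qed

text \<open>Analysis of \<open>synth \<psi> H\<close> returns \<open>H\<close> up to an error
  controlled by \<epsilon>. Hence the norm of the synthesis is at least almost that of
  \<open>H\<close>, while its frame sum consists of the lattice values of \<open>H\<close> and a
  sampled error. The frame inequality compares the two and leaves an estimate of \<open>X\<close> in
  which all errors carry \<epsilon>.\<close>

lemma frame_lower_bound_perturbed:
  fixes \<psi> :: "'a::euclidean_space \<Rightarrow> complex" and H :: "'a \<times> 'a \<Rightarrow> complex"
  assumes p: "\<psi> \<in> schwartz" and s: "s = 2 * real DIM('a \<times> 'a)"
    and [measurable]: "H \<in> borel_measurable borel" and H: "\<And>z. cmod (H z) \<le> C * wt (- (2 * s)) z"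
    and c: "c > 0" and A: "A > 0" and \<epsilon>: "\<epsilon> \<ge> 0" and S: "S \<ge> 0" and Y: "Y \<ge> 0"
    and frame: "\<And>f. f \<in> borel_measurable lborel \<Longrightarrow> integrable lborel (\<lambda>x. (cmod (f x))\<^sup>2) \<Longrightarrow>
        (\<lambda>l. (cmod (L2_inner f (tf_shift l \<psi>)))\<^sup>2) summable_on \<Lambda> \<and>
        A * (LINT x|lborel. (cmod (f x))\<^sup>2) \<le> (\<Sum>\<^sub>\<infinity>l\<in>\<Lambda>. (cmod (L2_inner f (tf_shift l \<psi>)))\<^sup>2)"
    and D: "\<And>w. cmod (of_real c * L2_inner (synth \<psi> H) (tf_shift w \<psi>) - H w) \<le> \<epsilon> * wt_conv s (\<lambda>z. cmod (H z)) w"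
    and sum: "\<And>F w. finite F \<Longrightarrow> F \<subseteq> \<Lambda> \<Longrightarrow> (\<Sum>l\<in>F. wt (- s) (l - w)) \<le> S"
    and lat: "\<And>l. l \<in> \<Lambda> \<Longrightarrow> (cmod (H l))\<^sup>2 \<le> Y * wt (- s) (l - w0)"
    and J: "J = (LINT z::'a\<times>'a|lborel. wt (- s) z)" and X: "X = (LINT z|lborel. (cmod (H z))\<^sup>2)"
  shows "A * c * ((1 - \<epsilon> * J) * X) \<le> 2 * (Y * S) + 2 * (\<epsilon>\<^sup>2 * (J * (S * X)))"
proof -
  have s1: "2 * real DIM('a \<times> 'a) \<le> s" and s0: "s \<ge> 0" by (simp_all add: s)
  have [measurable]: "\<psi> \<in> borel_measurable borel" by (rule schwartz_measurable[OF p])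
  define f where "f = synth \<psi> H"
  define T where "T = (\<lambda>w. of_real c * L2_inner f (tf_shift w \<psi>))"
  define E where "E = wt_conv s (\<lambda>z. cmod (H z))"
  define E2 where "E2 = wt_conv s (\<lambda>z. (cmod (H z))\<^sup>2)"
  have C: "C \<ge> 0" using order_trans[OF norm_ge_zero H[of 0]] by (simp add: zero_le_mult_iff not_less)
  have J0: "J \<ge> 0" unfolding J by simp
  have [measurable]: "f \<in> borel_measurable borel" unfolding f_def synth_def by measurable
  then have Tm [measurable]: "T \<in> borel_measurable borel" unfolding T_def by measurable
  have Hi: "integrable lborel H" using integrable_wt_bound[of H C "2 * s"] H s by simp
  have H2: "(cmod (H z))\<^sup>2 \<le> C\<^sup>2 * wt (- (2 * s)) z" for z
  proof -
    have "cmod (H z) \<le> C" using H[of z] mult_left_mono[OF wt_le_1[of "- (2 * s)" z] C] s0 by simp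
    then have "cmod (H z) * cmod (H z) \<le> C * (C * wt (- (2 * s)) z)" using H C by (intro mult_mono) auto
    then show ?thesis by (simp add: power2_eq_square mult.assoc)
  qed
  have H2i: "integrable lborel (\<lambda>z. (cmod (H z))\<^sup>2)"
    using integrable_wt_bound[of "\<lambda>z. (cmod (H z))\<^sup>2" "C\<^sup>2" "2 * s"] H2 s by simp
  have E: "E w \<ge> 0" "(E w)\<^sup>2 \<le> J * E2 w" for w
    unfolding E_def E2_def J using Hi H2i s1 by (auto intro!: wt_conv_nonneg wt_conv_power2_le)
  have HE: "integrable lborel (\<lambda>w. cmod (H w) * E w)" "(LINT w|lborel. cmod (H w) * E w) \<le> J * X"
    unfolding E_def J X by (rule integral_mult_wt_conv_le[OF _ _ H s1]; simp)+
  have D': "cmod (T w - H w) \<le> \<epsilon> * E w" for w unfolding T_def f_def E_def by (rule D)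
  obtain B where B: "\<And>y. cmod (f y) \<le> B * wt (- (2 * real DIM('a))) y"
  proof (rule synth_decay[OF p _ s1])
    show "cmod (H z) \<le> C * wt (- (2 * real DIM('a) + s)) z" for z
      by (rule order_trans[OF H mult_left_mono[OF wt_mono C]]) (simp add: s)
  qed (use that f_def in auto)
  have fi: "integrable lborel f" by (rule integrable_wt_bound[OF _ B]) auto
  have B0: "B \<ge> 0" using order_trans[OF norm_ge_zero B[of 0]] by (simp add: zero_le_mult_iff not_less)
  have f2: "integrable lborel (\<lambda>y. (cmod (f y))\<^sup>2)"
  proof (rule integrable_wt_bound[where s = "2 * real DIM('a)" and C = "B\<^sup>2"])
    fix y
    have "cmod (f y) \<le> B" using B[of y] mult_left_mono[OF wt_le_1[of "- (2 * real DIM('a))" y] B0] by simp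
    then have "cmod (f y) * cmod (f y) \<le> B * (B * wt (- (2 * real DIM('a))) y)" using B B0 by (intro mult_mono) auto
    then show "norm ((cmod (f y))\<^sup>2) \<le> B\<^sup>2 * wt (- (2 * real DIM('a))) y" by (simp add: power2_eq_square mult.assoc)
  qed auto
  have lower: "(1 - \<epsilon> * J) * X \<le> c * (LINT y|lborel. (cmod (f y))\<^sup>2)"
  proof -
    \<comment> \<open>By adjointness the squared norm of the synthesis is the pairing of
      \<open>H\<close> with its own analysis \<open>T\<close>, and \<open>T\<close> is close to
      \<open>H\<close>.\<close>
    have "complex_of_real (c * (LINT y|lborel. (cmod (f y))\<^sup>2)) = of_real c * L2_inner f f"
      unfolding L2_inner_def complex_norm_square[symmetric] integral_complex_of_real by simp
    also have "L2_inner f f = (LINT z|lborel. H z * L2_inner (tf_shift z \<psi>) f)"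
      using L2_inner_synth[OF p Hi fi] by (simp add: f_def)
    also have "of_real c * \<dots> = (LINT z|lborel. H z * cnj (T z))"
      unfolding T_def L2_inner_commute[of f] by (simp add: mult.left_commute flip: integral_mult_right_zero)
    finally have eq: "c * (LINT y|lborel. (cmod (f y))\<^sup>2) = Re (LINT z|lborel. H z * cnj (T z))"
      by (metis Re_complex_of_real)
    have i: "integrable lborel (\<lambda>z. H z * cnj (T z))"
    proof (rule Bochner_Integration.integrable_bound)
      show "integrable lborel (\<lambda>z. (cmod (H z))\<^sup>2 + \<epsilon> * (cmod (H z) * E z))" using H2i HE(1) by simp
      show "AE z in lborel. cmod (H z * cnj (T z)) \<le> norm ((cmod (H z))\<^sup>2 + \<epsilon> * (cmod (H z) * E z))"
      proof (rule AE_I2)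
        fix z
        have "cmod (T z) \<le> cmod (H z) + \<epsilon> * E z" using D'[of z] norm_triangle_ineq2[of "T z" "H z"] by linarith
        then have "cmod (H z) * cmod (T z) \<le> cmod (H z) * (cmod (H z) + \<epsilon> * E z)" by (intro mult_left_mono) auto
        also have "\<dots> = (cmod (H z))\<^sup>2 + \<epsilon> * (cmod (H z) * E z)" by (simp add: power2_eq_square algebra_simps)
        finally show "cmod (H z * cnj (T z)) \<le> norm ((cmod (H z))\<^sup>2 + \<epsilon> * (cmod (H z) * E z))"
          by (simp add: norm_mult)
      qed
    qed measurable
    have "(1 - \<epsilon> * J) * X \<le> X - \<epsilon> * (LINT w|lborel. cmod (H w) * E w)"
      using mult_left_mono[OF HE(2) \<epsilon>] by (simp add: algebra_simps)
    also have "\<dots> = (LINT z|lborel. (cmod (H z))\<^sup>2 - \<epsilon> * (cmod (H z) * E z))"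
      unfolding X using H2i HE(1) by simp
    also have "\<dots> \<le> (LINT z|lborel. Re (H z * cnj (T z)))"
    proof (rule integral_mono)
      show "integrable lborel (\<lambda>z. (cmod (H z))\<^sup>2 - \<epsilon> * (cmod (H z) * E z))" using H2i HE(1) by simp
      show "integrable lborel (\<lambda>z. Re (H z * cnj (T z)))" by (rule integrable_Re[OF i])
      fix z
      have "H z * cnj (T z) = of_real ((cmod (H z))\<^sup>2) + H z * cnj (T z - H z)"
        unfolding complex_norm_square by (simp add: algebra_simps)
      then have "Re (H z * cnj (T z)) = (cmod (H z))\<^sup>2 + Re (H z * cnj (T z - H z))" by simp
      moreover have "\<bar>Re (H z * cnj (T z - H z))\<bar> \<le> cmod (H z) * cmod (T z - H z)"
        using abs_Re_le_cmod[of "H z * cnj (T z - H z)"] by (simp only: norm_mult complex_mod_cnj)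
      moreover have "cmod (H z) * cmod (T z - H z) \<le> cmod (H z) * (\<epsilon> * E z)" by (intro mult_left_mono D') auto
      ultimately show "(cmod (H z))\<^sup>2 - \<epsilon> * (cmod (H z) * E z) \<le> Re (H z * cnj (T z))"
        by (simp only: mult.left_commute[of \<epsilon>])
    qed
    also have "\<dots> = Re (LINT z|lborel. H z * cnj (T z))" using i by (rule integral_Re)
    finally show ?thesis unfolding eq .
  qed
  define I where "I = (\<Sum>\<^sub>\<infinity>l\<in>\<Lambda>. (cmod (L2_inner f (tf_shift l \<psi>)))\<^sup>2)"
  define Z where "Z = 2 * (Y * S) + 2 * (\<epsilon>\<^sup>2 * (J * (S * X)))"
  have fr: "(\<lambda>l. (cmod (L2_inner f (tf_shift l \<psi>)))\<^sup>2) summable_on \<Lambda>" "A * (LINT x|lborel. (cmod (f x))\<^sup>2) \<le> I"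
    using frame[OF _ f2] by (simp_all add: I_def)
  \<comment> \<open>The infinite frame sum is controlled through its finite partial sums, for which
    the separation of the points bounds both the lattice values and the sampled convolution
    \<open>E2\<close>.\<close>
  have "I \<le> Z / c\<^sup>2"
    unfolding I_def
  proof (rule infsum_le_finite_sums[OF fr(1)])
    fix F assume F: "finite F" "F \<subseteq> \<Lambda>"
    have "c\<^sup>2 * (\<Sum>l\<in>F. (cmod (L2_inner f (tf_shift l \<psi>)))\<^sup>2) = (\<Sum>l\<in>F. (cmod (T l))\<^sup>2)"
      by (simp add: T_def sum_distrib_left norm_mult power_mult_distrib)
    also have "\<dots> \<le> (\<Sum>l\<in>F. 2 * (Y * wt (- s) (l - w0)) + 2 * (\<epsilon>\<^sup>2 * (J * E2 l)))"
    proof (rule sum_mono)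
      fix l assume "l \<in> F"
      then have l: "(cmod (H l))\<^sup>2 \<le> Y * wt (- s) (l - w0)" using F lat by blast
      have "cmod (T l) \<le> cmod (H l) + \<epsilon> * E l" using D'[of l] norm_triangle_ineq2[of "T l" "H l"] by linarith
      then have "(cmod (T l))\<^sup>2 \<le> (cmod (H l) + \<epsilon> * E l)\<^sup>2" by (intro power_mono) auto
      also have "\<dots> \<le> 2 * (cmod (H l))\<^sup>2 + 2 * (\<epsilon> * E l)\<^sup>2"
        using zero_le_power2[of "cmod (H l) - \<epsilon> * E l"] by (simp add: power2_eq_square algebra_simps)
      also have "\<dots> \<le> 2 * (Y * wt (- s) (l - w0)) + 2 * (\<epsilon>\<^sup>2 * (J * E2 l))"
        unfolding power_mult_distrib using l E(2)[of l] by (intro add_mono mult_left_mono) auto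
      finally show "(cmod (T l))\<^sup>2 \<le> 2 * (Y * wt (- s) (l - w0)) + 2 * (\<epsilon>\<^sup>2 * (J * E2 l))" .
    qed
    also have "\<dots> = 2 * (Y * (\<Sum>l\<in>F. wt (- s) (l - w0))) + 2 * (\<epsilon>\<^sup>2 * (J * (\<Sum>l\<in>F. E2 l)))"
      by (simp only: sum.distrib sum_distrib_left)
    also have "\<dots> \<le> Z"
      unfolding Z_def E2_def X using sum[OF F] Y J0 sum_wt_conv_le[OF H2i _ s0 F(1) sum[OF F]]
      by (intro add_mono mult_left_mono) auto
    finally show "(\<Sum>l\<in>F. (cmod (L2_inner f (tf_shift l \<psi>)))\<^sup>2) \<le> Z / c\<^sup>2"
      using c by (simp add: field_simps)
  qed
  then have "c\<^sup>2 * (A * (LINT x|lborel. (cmod (f x))\<^sup>2)) \<le> c\<^sup>2 * (Z / c\<^sup>2)"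
    using fr(2) by (intro mult_left_mono) auto
  moreover have "c\<^sup>2 * (Z / c\<^sup>2) = Z" using c by simp
  moreover have "A * c * ((1 - \<epsilon> * J) * X) \<le> A * c * (c * (LINT y|lborel. (cmod (f y))\<^sup>2))"
    using A c lower by (intro mult_left_mono) auto
  moreover have "A * c * (c * (LINT y|lborel. (cmod (f y))\<^sup>2)) = c\<^sup>2 * (A * (LINT x|lborel. (cmod (f x))\<^sup>2))"
    by (simp add: power2_eq_square)
  ultimately show ?thesis unfolding Z_def by linarith
qed

text \<open>The frame inequality is applied to the synthesis of the STFT damped away from \<open>w\<close>; since
  the damping varies slowly, localization almost commutes with analysis and synthesis.\<close>

lemma stft_le_of_lattice:
  fixes u :: "('a::euclidean_space \<Rightarrow> complex) \<Rightarrow> complex"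
  assumes u: "tempered_distribution u" and p: "\<psi> \<in> schwartz" "\<psi> \<noteq> (\<lambda>_. 0)"
    and r: "r > 0" and sep: "\<And>l m. l \<in> \<Lambda> \<Longrightarrow> m \<in> \<Lambda> \<Longrightarrow> l \<noteq> m \<Longrightarrow> r \<le> dist l m"
    and frame: "gabor_frame \<psi> \<Lambda>"
    and P: "P \<ge> 0" and growth: "\<And>z. cmod (stft \<psi> u z) \<le> G * wt P z" and t: "P \<le> t"
  obtains C where "C \<ge> 0"
    "\<And>w Q. Q \<ge> 0 \<Longrightarrow> (\<And>l. l \<in> \<Lambda> \<Longrightarrow> cmod (stft \<psi> u l) \<le> Q * wt t (l - w)) \<Longrightarrow> cmod (stft \<psi> u w) \<le> C * Q"
proof -
  let ?V = "stft \<psi> u"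
  define s where "s = 2 * real DIM('a \<times> 'a)"
  have s1: "2 * real DIM('a \<times> 'a) \<le> s" and s0: "s \<ge> 0" by (simp_all add: s_def)
  have [measurable]: "\<psi> \<in> borel_measurable borel" "?V \<in> borel_measurable borel"
    by (rule schwartz_measurable[OF p(1)], rule measurable_stft_distr[OF u p(1)])
  have G: "G \<ge> 0" using order_trans[OF norm_ge_zero growth[of 0]] by (simp add: zero_le_mult_iff not_less)
  \<comment> \<open>Damping of this order leaves decay \<open>2 * s\<close> of the damped transform,
    since \<open>t\<close> is at least the growth \<open>P\<close>, and leaves more than the decay
    needed to sum its lattice values.\<close>
  define n where "n = nat \<lceil>t + 2 * s\<rceil>"
  have n: "t + 2 * s \<le> real n" unfolding n_def by linarith
  \<comment> \<open>The commutator costs \<open>real n + 1\<close> powers in \<open>z - w\<close>;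
    what remains of the Gram kernel is the convolution weight of order \<open>- s\<close>.\<close>
  define M where "M = real n + 1 + s"
  obtain K where K: "K \<ge> 0" "\<And>z w. cmod (L2_inner (tf_shift w \<psi>) (tf_shift z \<psi>)) \<le> K * wt (- M) (z - w)"
    using stft_decay2[OF p(1) p(1)] by blast
  have K': "cmod (L2_inner (tf_shift z \<psi>) (tf_shift w \<psi>)) \<le> K * wt (- M) (z - w)" for z w
    unfolding L2_inner_commute[of "tf_shift z \<psi>"] complex_mod_cnj by (rule K(2))
  define c where "c = rc \<psi>"
  have c: "c > 0" unfolding c_def by (rule rc_pos[OF p])
  obtain S where S: "S \<ge> 0" "\<And>F w. finite F \<Longrightarrow> F \<subseteq> \<Lambda> \<Longrightarrow> (\<Sum>l\<in>F. wt (- s) (l - w)) \<le> S"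
    using separated_sum_wt_le[OF r sep s1] by blast
  obtain A where A: "A > 0" and fr: "\<And>f. f \<in> borel_measurable lborel \<Longrightarrow> integrable lborel (\<lambda>x. (cmod (f x))\<^sup>2) \<Longrightarrow>
        (\<lambda>l. (cmod (L2_inner f (tf_shift l \<psi>)))\<^sup>2) summable_on \<Lambda> \<and>
        A * (LINT x|lborel. (cmod (f x))\<^sup>2) \<le> (\<Sum>\<^sub>\<infinity>l\<in>\<Lambda>. (cmod (L2_inner f (tf_shift l \<psi>)))\<^sup>2)"
    using frame unfolding gabor_frame_def by blast
  define J where "J = (LINT z::'a\<times>'a|lborel. wt (- s) z)"
  have J: "J \<ge> 0" unfolding J_def by simp
  \<comment> \<open>The commutator constant before division by \<open>R\<close>.\<close>
  define \<kappa> where "\<kappa> = real n * 2 ^ n * c * K"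
  have \<kappa>: "\<kappa> \<ge> 0" using c K by (simp add: \<kappa>_def)
  \<comment> \<open>One summand per requirement: at least 1, \<epsilon> times \<open>J\<close> at
    most 1/2, and the sampled error at most \<open>A * c / 4\<close>. In the last one
    \<open>R\<close> may be replaced by its square because it is at least 1.\<close>
  define R where "R = 1 + 2 * \<kappa> * J + 8 * \<kappa>\<^sup>2 * J * S / (A * c)"
  have Rb: "R \<ge> 1" "2 * \<kappa> * J \<le> R" "8 * \<kappa>\<^sup>2 * J * S / (A * c) \<le> R"
    unfolding R_def using \<kappa> J S A c by simp_all
  define \<epsilon> where "\<epsilon> = \<kappa> / R"
  have \<epsilon>: "\<epsilon> \<ge> 0" using \<kappa> Rb by (simp add: \<epsilon>_def)
  have \<epsilon>1: "\<epsilon> * J \<le> 1 / 2" using Rb(1,2) by (simp add: \<epsilon>_def field_simps)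
  have \<epsilon>2: "2 * (\<epsilon>\<^sup>2 * J * S) \<le> A * c / 4"
  proof -
    have "8 * (\<kappa>\<^sup>2 * J * S) \<le> R * (A * c)"
      using Rb(3) A c by (simp add: divide_le_eq mult_ac)
    also have "\<dots> \<le> R * R * (A * c)" using Rb(1) A c by (intro mult_right_mono) auto
    finally have "8 * (\<kappa>\<^sup>2 * J * S) / (R * R) \<le> A * c"
      using Rb(1) by (simp add: divide_le_eq mult_ac)
    then show ?thesis by (simp add: \<epsilon>_def power2_eq_square)
  qed
  define C where "C = c * K * 2 ^ n * sqrt (J * (8 * S / (A * c))) * R ^ n"
  have C: "C \<ge> 0" using c K J S A Rb by (simp add: C_def)
  show ?thesis
  proof (rule that[OF C])
    fix w0 Q assume Q: "Q \<ge> 0" and lat: "\<And>l. l \<in> \<Lambda> \<Longrightarrow> cmod (?V l) \<le> Q * wt t (l - w0)"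
    define a where "a = scaled_wt n R w0"
    have a: "a z \<ge> 0" "a z \<le> R ^ n * wt (- real n) (z - w0)" "1 \<le> 2 ^ n * wt (real n) (z - w0) * a z" for z
      unfolding a_def using scaled_wt_le[OF Rb(1)] scaled_wt_ge[OF Rb(1)] Rb(1) by auto
    have am [measurable]: "a \<in> borel_measurable borel" unfolding a_def by (rule measurable_scaled_wt)
    define H where "H = (\<lambda>z. of_real (a z) * ?V z)"
    have Hm [measurable]: "H \<in> borel_measurable borel" unfolding H_def by measurable
    have Hn: "cmod (H z) = a z * cmod (?V z)" for z using a(1)[of z] by (simp add: H_def norm_mult)
    define e where "e = P + 2 * s"
    have e: "e \<ge> 0" using P s0 by (simp add: e_def)
    \<comment> \<open>This bound depends on \<open>w0\<close>. It secures integrability and the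
      decay required by the frame estimate, while the final constant \<open>C\<close> is independent
      of \<open>w0\<close>.\<close>
    define D where "D = R ^ n * G * 2 powr e * wt e w0"
    have Hd: "cmod (H z) \<le> D * wt (- (2 * s)) z" for z
    proof -
      have "wt (- real n) (z - w0) \<le> wt (- e) (z - w0)" using n t by (intro wt_mono) (simp add: e_def)
      also have "\<dots> \<le> 2 powr e * wt (- e) z * wt e w0"
        using wt_add_le[of z "- w0" "- e"] e by simp
      finally have "a z \<le> R ^ n * (2 powr e * wt (- e) z * wt e w0)"
        using Rb(1) by (intro order_trans[OF a(2)] mult_left_mono) auto
      then have "a z * cmod (?V z) \<le> R ^ n * (2 powr e * wt (- e) z * wt e w0) * (G * wt P z)"
        using a(1) Rb(1) by (intro mult_mono growth) auto
      also have "\<dots> = D * (wt (- e) z * wt P z)" unfolding D_def by (simp only: mult_ac)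
      also have "wt (- e) z * wt P z = wt (- (2 * s)) z" unfolding powr_add[symmetric] by (simp add: e_def)
      finally show ?thesis unfolding Hn .
    qed
    have D0: "D \<ge> 0" using Rb(1) G by (simp add: D_def)
    have Hi: "integrable lborel H" using integrable_wt_bound[of H D "2 * s"] Hd s_def by simp
    have nHi: "integrable lborel (\<lambda>z. cmod (H z))" using Hi by simp
    define E where "E = wt_conv s (\<lambda>z. cmod (H z))"
    have Vi: "integrable lborel (\<lambda>z. L2_inner (tf_shift z \<psi>) (tf_shift w \<psi>) * ?V z)" for w
      using integrable_rapid_stft[OF u p(1) rapid_stft[OF p(1) schwartz_tf_shift[OF p(1), of w]]]
      unfolding L2_inner_commute[of "tf_shift _ \<psi>" "tf_shift w \<psi>", symmetric] .
    have Vw: "?V w = of_real c * (LINT z|lborel. L2_inner (tf_shift z \<psi>) (tf_shift w \<psi>) * ?V z)" for w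
      using tempered_reproducing[OF u p schwartz_tf_shift[OF p(1), of w]]
      unfolding L2_inner_commute[of "tf_shift _ \<psi>" "tf_shift w \<psi>", symmetric] c_def
      by (simp add: stft_def)
    \<comment> \<open>Without the damping, analysis after synthesis would reproduce the transform
      exactly. What remains is the kernel multiplied by \<open>a z - a w\<close>, which is small
      relative to \<open>a z\<close>.\<close>
    have diff: "cmod (of_real c * L2_inner (synth \<psi> H) (tf_shift w \<psi>) - H w) \<le> \<epsilon> * E w" for w
    proof -
      let ?k = "\<lambda>z. L2_inner (tf_shift z \<psi>) (tf_shift w \<psi>)"
      have gi: "integrable lborel (tf_shift w \<psi>)"
        by (rule rapid_integrable[OF schwartz_rapid[OF schwartz_tf_shift[OF p(1)]]])
      have hi: "integrable lborel (\<lambda>z. H z * ?k z)"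
      proof (rule Bochner_Integration.integrable_bound)
        show "integrable lborel (\<lambda>z. K * cmod (H z))" using nHi by simp
        show "(\<lambda>z. H z * ?k z) \<in> borel_measurable lborel"
          unfolding L2_inner_commute[of "tf_shift _ \<psi>" "tf_shift w \<psi>"] by measurable
        have "cmod (?k z) \<le> K * 1" for z
          by (rule order_trans[OF K' mult_left_mono[OF wt_le_1 K(1)]]) (use s0 in \<open>simp add: M_def\<close>)
        then have "cmod (H z * ?k z) \<le> norm (K * cmod (H z))" for z
          unfolding norm_mult using K(1) mult_left_mono[of "cmod (?k z)" K "cmod (H z)"] by (simp add: mult.commute)
        then show "AE z in lborel. norm (H z * ?k z) \<le> norm (K * cmod (H z))" by simp
      qed
      have "of_real c * L2_inner (synth \<psi> H) (tf_shift w \<psi>) - H w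
          = of_real c * ((LINT z|lborel. H z * ?k z) - of_real (a w) * (LINT z|lborel. ?k z * ?V z))"
        unfolding L2_inner_synth[OF p(1) Hi gi] right_diff_distrib
        by (subst (2) H_def, subst Vw) (simp add: mult_ac)
      also have "(LINT z|lborel. H z * ?k z) - of_real (a w) * (LINT z|lborel. ?k z * ?V z)
          = (LINT z|lborel. H z * ?k z - of_real (a w) * (?k z * ?V z))"
        using hi Vi[of w] by simp
      finally have eq: "cmod (of_real c * L2_inner (synth \<psi> H) (tf_shift w \<psi>) - H w)
          = c * cmod (LINT z|lborel. H z * ?k z - of_real (a w) * (?k z * ?V z))"
        using c by (simp add: norm_mult)
      have "cmod (LINT z|lborel. H z * ?k z - of_real (a w) * (?k z * ?V z))
          \<le> (LINT z|lborel. (real n * 2 ^ n / R * K) * (cmod (H z) * wt (- s) (z - w)))"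
      proof (rule Bochner_Integration.integral_norm_bound_integral)
        show "integrable lborel (\<lambda>z. H z * ?k z - of_real (a w) * (?k z * ?V z))" using hi Vi[of w] by simp
        show "integrable lborel (\<lambda>z. (real n * 2 ^ n / R * K) * (cmod (H z) * wt (- s) (z - w)))"
          using integrable_mult_wt[OF nHi s0, of w] by simp
        fix z
        have "H z * ?k z - of_real (a w) * (?k z * ?V z) = of_real (a z - a w) * (?V z * ?k z)"
          by (simp add: H_def algebra_simps)
        then have "cmod (H z * ?k z - of_real (a w) * (?k z * ?V z)) = \<bar>a z - a w\<bar> * (cmod (?V z) * cmod (?k z))"
          by (simp only: norm_mult norm_of_real)
        also have "\<dots> \<le> (real n * 2 ^ n / R * wt (real n + 1) (z - w) * a z) * (cmod (?V z) * (K * wt (- M) (z - w)))"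
          using K' K(1) Rb(1) a(1)[of z] unfolding a_def
          by (intro mult_mono[OF scaled_wt_diff_le[OF Rb(1)] mult_left_mono[OF K']]) auto
        also have "\<dots> = (real n * 2 ^ n / R * K) * (cmod (H z) * (wt (real n + 1) (z - w) * wt (- M) (z - w)))"
          unfolding Hn by (simp only: mult_ac)
        also have "wt (real n + 1) (z - w) * wt (- M) (z - w) = wt (- s) (z - w)"
          unfolding powr_add[symmetric] by (simp add: M_def)
        finally show "cmod (H z * ?k z - of_real (a w) * (?k z * ?V z))
            \<le> (real n * 2 ^ n / R * K) * (cmod (H z) * wt (- s) (z - w))" .
      qed
      also have "\<dots> = (real n * 2 ^ n / R * K) * E w" unfolding E_def wt_conv_def by simp
      finally have "c * cmod (LINT z|lborel. H z * ?k z - of_real (a w) * (?k z * ?V z)) \<le> c * ((real n * 2 ^ n / R * K) * E w)"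
        using c by (intro mult_left_mono) auto
      also have "\<dots> = \<epsilon> * E w" by (simp add: \<epsilon>_def \<kappa>_def)
      finally show ?thesis unfolding eq .
    qed
    define X where "X = (LINT z|lborel. (cmod (H z))\<^sup>2)"
    have X0: "X \<ge> 0" unfolding X_def by simp
    have Hlat: "(cmod (H l))\<^sup>2 \<le> (R ^ n * Q)\<^sup>2 * wt (- s) (l - w0)" if "l \<in> \<Lambda>" for l
    proof -
      have "cmod (H l) \<le> (R ^ n * wt (- real n) (l - w0)) * (Q * wt t (l - w0))"
        unfolding Hn using a lat[OF that] Rb(1) by (intro mult_mono) auto
      also have "\<dots> = (R ^ n * Q) * (wt (- real n) (l - w0) * wt t (l - w0))" by (simp only: mult_ac)
      also have "wt (- real n) (l - w0) * wt t (l - w0) = wt (t - real n) (l - w0)"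
        unfolding powr_add[symmetric] by simp
      also have "R ^ n * Q * wt (t - real n) (l - w0) \<le> R ^ n * Q * wt (- s) (l - w0)"
        using Rb(1) Q n s0 by (intro mult_left_mono wt_mono) auto
      finally have "(cmod (H l))\<^sup>2 \<le> (R ^ n * Q * wt (- s) (l - w0))\<^sup>2" by (intro power_mono) auto
      also have "\<dots> = (R ^ n * Q)\<^sup>2 * (wt (- s) (l - w0) * wt (- s) (l - w0))"
        by (simp add: power2_eq_square mult_ac)
      also have "\<dots> \<le> (R ^ n * Q)\<^sup>2 * (wt (- s) (l - w0) * 1)"
        using s0 by (intro mult_left_mono wt_le_1) auto
      finally show ?thesis by simp
    qed
    \<comment> \<open>On the left at least \<open>A * c / 2\<close> times \<open>X\<close> remains,
      and the error on the right is at most \<open>A * c / 4\<close> times \<open>X\<close>. Since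
      \<open>X\<close> is a finite number, the lattice term bounds it.\<close>
    have "A * c * ((1 - \<epsilon> * J) * X) \<le> 2 * ((R ^ n * Q)\<^sup>2 * S) + 2 * (\<epsilon>\<^sup>2 * (J * (S * X)))"
      using frame_lower_bound_perturbed[OF p(1) s_def Hm Hd c A \<epsilon> S(1) zero_le_power2 fr diff[unfolded E_def] S(2) Hlat J_def X_def]
      by blast
    moreover have "A * c / 2 * X \<le> A * c * ((1 - \<epsilon> * J) * X)"
    proof -
      have "1 / 2 * X \<le> (1 - \<epsilon> * J) * X" using \<epsilon>1 X0 by (intro mult_right_mono) auto
      then have "A * c * (1 / 2 * X) \<le> A * c * ((1 - \<epsilon> * J) * X)" using A c by (intro mult_left_mono) auto
      then show ?thesis by simp
    qed
    moreover have "2 * (\<epsilon>\<^sup>2 * (J * (S * X))) \<le> A * c / 4 * X"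
      using mult_right_mono[OF \<epsilon>2 X0] by (simp add: mult.assoc)
    ultimately have "A * c / 4 * X \<le> 2 * ((R ^ n * Q)\<^sup>2 * S)" by (simp add: field_simps)
    then have X: "X \<le> 8 * S / (A * c) * (R ^ n * Q)\<^sup>2" using A c by (simp add: field_simps)
    have H2i: "integrable lborel (\<lambda>z. (cmod (H z))\<^sup>2)"
    proof (rule Bochner_Integration.integrable_bound)
      show "integrable lborel (\<lambda>z. D * cmod (H z))" using nHi by simp
      have "cmod (H z) \<le> D" for z
        using Hd[of z] mult_left_mono[OF wt_le_1[of "- (2 * s)" z] D0] s0 by simp
      then show "AE z in lborel. norm ((cmod (H z))\<^sup>2) \<le> norm (D * cmod (H z))"
        using D0 by (simp add: power2_eq_square mult_right_mono)
    qed measurable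
    \<comment> \<open>From a square integral back to a point: Cauchy-Schwarz bounds the convolution
      at \<open>w0\<close>, and the reproducing formula below bounds the transform at
      \<open>w0\<close> by that convolution.\<close>
    have "(E w0)\<^sup>2 \<le> J * wt_conv s (\<lambda>z. (cmod (H z))\<^sup>2) w0"
      unfolding E_def J_def by (rule wt_conv_power2_le[OF nHi H2i s1])
    also have "\<dots> \<le> J * X"
      unfolding X_def by (intro mult_left_mono wt_conv_le_integral H2i s0 J) auto
    also have "\<dots> \<le> J * (8 * S / (A * c) * (R ^ n * Q)\<^sup>2)" by (intro mult_left_mono X J)
    also have "\<dots> = (J * (8 * S / (A * c))) * (R ^ n * Q)\<^sup>2" by simp
    finally have "E w0 \<le> sqrt ((J * (8 * S / (A * c))) * (R ^ n * Q)\<^sup>2)" by (rule real_le_rsqrt)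
    also have "\<dots> = sqrt (J * (8 * S / (A * c))) * (R ^ n * Q)"
      unfolding real_sqrt_mult using Rb(1) Q by simp
    finally have E: "E w0 \<le> sqrt (J * (8 * S / (A * c))) * (R ^ n * Q)" .
    \<comment> \<open>Undoing the damping costs \<open>real n\<close> powers of the bracket of
      \<open>z - w0\<close>, which the Gram kernel pays.\<close>
    have "cmod (LINT z|lborel. L2_inner (tf_shift z \<psi>) (tf_shift w0 \<psi>) * ?V z)
        \<le> (LINT z|lborel. (K * 2 ^ n) * (cmod (H z) * wt (- s) (z - w0)))"
    proof (rule Bochner_Integration.integral_norm_bound_integral[OF Vi])
      show "integrable lborel (\<lambda>z. (K * 2 ^ n) * (cmod (H z) * wt (- s) (z - w0)))"
        using integrable_mult_wt[OF nHi s0, of w0] by simp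
      fix z
      have "cmod (L2_inner (tf_shift z \<psi>) (tf_shift w0 \<psi>) * ?V z) \<le> (K * wt (- M) (z - w0)) * cmod (?V z)"
        unfolding norm_mult by (intro mult_right_mono K') auto
      also have "\<dots> \<le> (K * wt (- M) (z - w0)) * (2 ^ n * wt (real n) (z - w0) * a z * cmod (?V z))"
        using mult_right_mono[OF a(3)[of z], of "cmod (?V z)"] K(1) by (intro mult_left_mono) auto
      also have "\<dots> = (K * 2 ^ n) * (cmod (H z) * (wt (- M) (z - w0) * wt (real n) (z - w0)))"
        unfolding Hn by (simp only: mult_ac)
      also have "wt (- M) (z - w0) * wt (real n) (z - w0) = wt (- 1 - s) (z - w0)"
        unfolding powr_add[symmetric] by (simp add: M_def)
      also have "(K * 2 ^ n) * (cmod (H z) * wt (- 1 - s) (z - w0)) \<le> (K * 2 ^ n) * (cmod (H z) * wt (- s) (z - w0))"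
        using K(1) by (intro mult_left_mono wt_mono) auto
      finally show "cmod (L2_inner (tf_shift z \<psi>) (tf_shift w0 \<psi>) * ?V z) \<le> (K * 2 ^ n) * (cmod (H z) * wt (- s) (z - w0))" .
    qed
    also have "\<dots> = (K * 2 ^ n) * E w0" unfolding E_def wt_conv_def by simp
    also have "\<dots> \<le> (K * 2 ^ n) * (sqrt (J * (8 * S / (A * c))) * (R ^ n * Q))"
      using K(1) E by (intro mult_left_mono) auto
    finally have "c * cmod (LINT z|lborel. L2_inner (tf_shift z \<psi>) (tf_shift w0 \<psi>) * ?V z)
        \<le> c * ((K * 2 ^ n) * (sqrt (J * (8 * S / (A * c))) * (R ^ n * Q)))"
      using c by (intro mult_left_mono) auto
    also have "\<dots> = C * Q" unfolding C_def by (simp only: mult_ac)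
    also have "c * cmod (LINT z|lborel. L2_inner (tf_shift z \<psi>) (tf_shift w0 \<psi>) * ?V z) = cmod (?V w0)"
      using c by (subst Vw) (simp add: norm_mult)
    finally show "cmod (?V w0) \<le> C * Q" .
  qed
qed

section \<open>The Gabor wave front set\<close>

text \<open>Decay passes from the lattice to all points with the window \<psi> of the frame, and
  only then to the window \<phi>. Each passage uses up one shrinking of the cone.\<close>

lemma WF'_subset_WF_G:
  fixes u :: "('a::euclidean_space \<Rightarrow> complex) \<Rightarrow> complex"
  assumes u: "tempered_distribution u" and p: "\<phi> \<in> schwartz" and q: "\<psi> \<in> schwartz" "\<psi> \<noteq> (\<lambda>_. 0)"
    and r: "r > 0" and sep: "\<And>l m. l \<in> \<Lambda> \<Longrightarrow> m \<in> \<Lambda> \<Longrightarrow> l \<noteq> m \<Longrightarrow> r \<le> dist l m"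
    and frame: "gabor_frame \<psi> \<Lambda>"
  shows "WF' \<phi> u \<subseteq> WF_G \<psi> \<Lambda> u"
proof
  fix z0 assume z0: "z0 \<in> WF' \<phi> u"
  show "z0 \<in> WF_G \<psi> \<Lambda> u"
  proof (rule ccontr)
    assume "z0 \<notin> WF_G \<psi> \<Lambda> u"
    moreover have "z0 \<noteq> 0" using z0 by (simp add: WF'_def)
    ultimately obtain \<Gamma> where \<Gamma>: "open_cone \<Gamma>" "z0 \<in> \<Gamma>"
      and decay: "\<forall>N\<ge>0. bdd_above ((\<lambda>l. wt N l * cmod (stft \<psi> u l)) ` (\<Lambda> \<inter> \<Gamma>))"
      by (auto simp: WF_G_def)
    obtain \<Gamma>' c where \<Gamma>': "open_cone \<Gamma>'" "z0 \<in> \<Gamma>'" and c: "c > 0"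
      and cone: "\<And>w z. w \<in> \<Gamma>' \<Longrightarrow> z \<notin> \<Gamma> \<Longrightarrow> bracket w \<le> c * bracket (z - w) \<and> bracket z \<le> c * bracket (z - w)"
      using cone_shrink[OF \<Gamma>] by metis
    obtain \<Gamma>'' c' where \<Gamma>'': "open_cone \<Gamma>''" "z0 \<in> \<Gamma>''" and c': "c' > 0"
      and cone': "\<And>w z. w \<in> \<Gamma>'' \<Longrightarrow> z \<notin> \<Gamma>' \<Longrightarrow> bracket w \<le> c' * bracket (z - w) \<and> bracket z \<le> c' * bracket (z - w)"
      using cone_shrink[OF \<Gamma>'] by metis
    obtain G P where G: "G > 0" "P \<ge> 0" "\<And>z. cmod (stft \<psi> u z) \<le> G * wt P z"
      using stft_growth_lipschitz[OF u q(1)] by metis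
    have "bdd_above ((\<lambda>z. wt N z * cmod (stft \<psi> u z)) ` \<Gamma>')" if N: "N \<ge> 0" for N
    proof -
      obtain D where D: "D \<ge> 0" "\<And>w l. w \<in> \<Gamma>' \<Longrightarrow> l \<in> \<Lambda> \<Longrightarrow> cmod (stft \<psi> u l) \<le> D * wt (- N) w * wt (N + P) (l - w)"
        using rapid_off_cone[OF c cone G(2) less_imp_le[OF G(1)] G(3) N decay[rule_format, OF N]] by metis
      obtain C where C: "C \<ge> 0"
        "\<And>w Q. Q \<ge> 0 \<Longrightarrow> (\<And>l. l \<in> \<Lambda> \<Longrightarrow> cmod (stft \<psi> u l) \<le> Q * wt (N + P) (l - w)) \<Longrightarrow> cmod (stft \<psi> u w) \<le> C * Q"
        by (rule stft_le_of_lattice[OF u q r sep frame G(2,3), of "N + P"]) (use N in auto)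
      show ?thesis
      proof (rule bdd_above_decayI)
        \<comment> \<open>For a fixed \<open>w\<close>, \<open>D * wt (- N) w\<close> is the number
          \<open>Q\<close> of the lattice estimate; as \<open>C\<close> does not depend on the
          centre, the decay in \<open>w\<close> survives.\<close>
        show "cmod (stft \<psi> u w) \<le> (C * D) * wt (- N) w" if "w \<in> \<Gamma>'" for w
          using C(2)[of "D * wt (- N) w" w] D that by (simp add: mult.assoc)
      qed
    qed
    then have decay': "\<forall>N\<ge>0. bdd_above ((\<lambda>z. wt N z * cmod (stft \<psi> u z)) ` \<Gamma>')" by simp
    have "bdd_above ((\<lambda>z. wt N z * cmod (stft \<phi> u z)) ` \<Gamma>'')" if "N \<ge> 0" for N
      by (rule stft_decay_change_window[OF u q p c' _ decay' that]) (rule cone')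
    then show False using z0 \<Gamma>'' by (auto simp: WF'_def)
  qed
qed

text \<open>Decay on a cone restricts to the points of \<Lambda> in it; the smaller cone is the
  price of changing the window from \<phi> to \<psi>.\<close>

lemma WF_G_subset_WF':
  fixes u :: "('a::euclidean_space \<Rightarrow> complex) \<Rightarrow> complex"
  assumes u: "tempered_distribution u" and p: "\<phi> \<in> schwartz" "\<phi> \<noteq> (\<lambda>_. 0)" and q: "\<psi> \<in> schwartz"
  shows "WF_G \<psi> \<Lambda> u \<subseteq> WF' \<phi> u"
proof
  fix z0 assume z0: "z0 \<in> WF_G \<psi> \<Lambda> u"
  show "z0 \<in> WF' \<phi> u"
  proof (rule ccontr)
    assume "z0 \<notin> WF' \<phi> u"
    moreover have "z0 \<noteq> 0" using z0 by (simp add: WF_G_def)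
    ultimately obtain \<Gamma> where \<Gamma>: "open_cone \<Gamma>" "z0 \<in> \<Gamma>"
      and decay: "\<forall>N\<ge>0. bdd_above ((\<lambda>z. wt N z * cmod (stft \<phi> u z)) ` \<Gamma>)"
      by (auto simp: WF'_def)
    obtain \<Gamma>' c where \<Gamma>': "open_cone \<Gamma>'" "z0 \<in> \<Gamma>'" and c: "c > 0"
      and cone: "\<And>w z. w \<in> \<Gamma>' \<Longrightarrow> z \<notin> \<Gamma> \<Longrightarrow> bracket w \<le> c * bracket (z - w) \<and> bracket z \<le> c * bracket (z - w)"
      using cone_shrink[OF \<Gamma>] by metis
    have "bdd_above ((\<lambda>z. wt N z * cmod (stft \<psi> u z)) ` (\<Lambda> \<inter> \<Gamma>'))" if "N \<ge> 0" for N
    proof (rule bdd_above_mono)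
      show "bdd_above ((\<lambda>z. wt N z * cmod (stft \<psi> u z)) ` \<Gamma>')"
        by (rule stft_decay_change_window[OF u p q c _ decay that]) (rule cone)
    qed auto
    then show False using z0 \<Gamma>' by (auto simp: WF_G_def)
  qed
qed

text \<open>The window \<phi> and the frame generated by \<psi> are chosen independently. Since
  \<open>WF u\<close> involves neither, the equalities contain the independence of both other sets
  from these choices.\<close>

theorem corollary4p3:
  fixes u :: "(real ^ 'd \<Rightarrow> complex) \<Rightarrow> complex"
    and \<phi> \<psi> :: "real ^ 'd \<Rightarrow> complex"
    and \<alpha> \<beta> :: real
  assumes "tempered_distribution u"
    and "\<phi> \<in> schwartz" and "\<phi> \<noteq> (\<lambda>_. 0)"
    and "\<psi> \<in> schwartz" and "\<psi> \<noteq> (\<lambda>_. 0)"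
    and "\<alpha> > 0" and "\<beta> > 0"
    and "gabor_frame \<psi> (tf_lattice \<alpha> \<beta>)"
  shows "WF u = WF' \<phi> u \<and> WF' \<phi> u = WF_G \<psi> (tf_lattice \<alpha> \<beta>) u"
proof (intro conjI subset_antisym)
  show "WF u \<subseteq> WF' \<phi> u" "WF' \<phi> u \<subseteq> WF u"
    using assms(1-3) by (rule WF_subset_WF' WF'_subset_WF)+
  show "WF' \<phi> u \<subseteq> WF_G \<psi> (tf_lattice \<alpha> \<beta>) u"
    by (rule WF'_subset_WF_G[OF assms(1,2,4,5) _ tf_lattice_separated[OF assms(6,7)] assms(8)]) (use assms in auto)
  show "WF_G \<psi> (tf_lattice \<alpha> \<beta>) u \<subseteq> WF' \<phi> u"
    by (rule WF_G_subset_WF'[OF assms(1-4)])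
qed

end
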